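(* Let $N\ge2$, $L\geq2$ be integers, $t\in\mathbb C$ a primitive $2(N+L)$-th root of $1$, and $\epsilon\in\{1,-1\}$. Any braiding of the $\mathcal V_{NL}$-face algebra $\mathfrak S(A_{N-1};t)_\epsilon$ is either of the form $\mathcal R^+_\zeta$ or of the form $(\mathcal R^-_\zeta)_{21}$, where $\zeta$ denotes a solution of $\zeta^N=\epsilon^{N-1}t$.
   Context: **Face algebras and braidings.** Let $\mathcal V$ be a finite nonempty set. A $\mathcal V$-face algebra over $\mathbb K=\mathbb C$ is an algebra $\mathfrak H$ with a coalgebra structure $(\Delta,\varepsilon)$ and elements $e_i,\mathring e_i$ ($i\in\mathcal V$) such that for all $a,b\in\mathfrak H$, $i,j\in\mathcal V$: $\Delta(ab)=\Delta(a)\Delta(b)$; $e_ie_j=\delta_{ij}e_i$, $\mathring e_i\mathring e_j=\delta_{ij}\mathring e_i$, $e_i\mathring e_j=\mathring e_je_i$; $\sum_k e_k=1=\sum_k\mathring e_k$; $\Delta(\mathring e_ie_j)=\sum_k\mathring e_ie_k\otimes\mathring e_ke_j$; $\varepsilon(\mathring e_ie_j)=\delta_{ij}$; $\varepsilon(ab)=\sum_k\varepsilon(ae_k)\varepsilon(\mathring e_kb)$. Write $\Delta(a)=\sum a_{(1)}\otimes a_{(2)}$; $\mathfrak H^*$ and $(\mathfrak H\otimes\mathfrak H)^*$ are algebras under convolution. For $X\in\mathfrak H^*$ put $m^*(X)(a,b)=X(ab)$, $(m^{op})^*(X)(a,b)=X(ba)$. A braiding is $\mathcal R^+\in(\mathfrak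 H\otimes\mathfrak H)^*$ for which there is a (unique) $\mathcal R^-$ with $\mathcal R^-\mathcal R^+=m^*(\varepsilon)$, $\mathcal R^+\mathcal R^-=(m^{op})^*(\varepsilon)$, $\mathcal R^\pm\mathcal R^\mp\mathcal R^\pm=\mathcal R^\pm$, and such that $\mathcal R^+m^*(X)\mathcal R^-=(m^{op})^*(X)$ for all $X$, $\mathcal R^+(ab,c)=\sum\mathcal R^+(a,c_{(1)})\mathcal R^+(b,c_{(2)})$, $\mathcal R^+(a,bc)=\sum\mathcal R^+(a_{(1)},c)\mathcal R^+(a_{(2)},b)$. $(\mathcal R^-)_{21}(a,b)=\mathcal R^-(b,a)$. **The algebra $\mathfrak A(w)$.** Let $\mathcal G$ be a finite oriented graph with vertex set $\mathcal V$, $\mathcal G^m$ its set of paths of length $m$ ($\mathcal G^0=\mathcal V$), $\mathcal G^m_{ij}$ those from $i$ to $j$, $\mathfrak s(\mathbf p),\mathfrak r(\mathbf p)$ the start and end of $\mathbf p$. A face is a quadruple of edges $(\mathbf r\,\frac{\mathbf p}{\mathbf q}\,\mathbf s)$ ($\mathbf r$ left, $\mathbf p$ top, $\mathbf q$ bottom, $\mathbf s$ right) such that $\mathbf p\cdot\mathbf s$ and $\mathbf r\cdot\mathbf q$ are paths with the same start and the same end. A face model assigns a scalar $w[\mathbf r\,\frac{\mathbf p}{\mathbf q}\,\mathbf s]$ to each face (and $0$ to other quadruples); identify $w$ with the operator on $\mathbb K\mathcal G^2$, $w(\mathbf p,\mathbf q)=\sum_{(\mathbf r,\mathbf s)\in\mathcal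 G^2}w[\mathbf r\,\frac{\mathbf p}{\mathbf s}\,\mathbf q](\mathbf r,\mathbf s)$. It is star-triangular if $w$ is invertible and satisfies $w_1w_2w_1=w_2w_1w_2$ on $\mathbb K\mathcal G^3$ ($w_1,w_2$ act on the first, resp. last, two edges). Let $\mathfrak H(\mathcal G)$ have basis $e\binom{\mathbf p}{\mathbf q}$ ($\mathbf p,\mathbf q\in\mathcal G^m$, $m\ge0$), with $e\binom{\mathbf p}{\mathbf q}e\binom{\mathbf r}{\mathbf s}=\delta_{\mathfrak r(\mathbf p)\mathfrak s(\mathbf r)}\delta_{\mathfrak r(\mathbf q)\mathfrak s(\mathbf s)}e\binom{\mathbf p\cdot\mathbf r}{\mathbf q\cdot\mathbf s}$, $\Delta(e\binom{\mathbf p}{\mathbf q})=\sum_{\mathbf t\in\mathcal G^m}e\binom{\mathbf p}{\mathbf t}\otimes e\binom{\mathbf t}{\mathbf q}$, $\varepsilon(e\binom{\mathbf p}{\mathbf q})=\delta_{\mathbf p\mathbf q}$, $\mathring e_i=\sum_je\binom ij$, $e_j=\sum_ie\binom ij$. $\mathfrak A(w)$ is its quotient by the relations $\sum_{(\mathbf c,\mathbf d)\in\mathcal G^2}w[\mathbf a\,\frac{\mathbf c}{\mathbf b}\,\mathbf d]\,e\binom{\mathbf c\cdot\mathbf d}{\mathbf p\cdot\mathbf q}=\sum_{(\mathbf r,\mathbf s)\in\mathcal G^2}w[\mathbf r\,\frac{\mathbf p}{\mathbf s}\,\mathbf q]\,e\binom{\mathbf a\cdot\mathbf b}{\mathbf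 r\cdot\mathbf s}$, $(\mathbf p,\mathbf q),(\mathbf a,\mathbf b)\in\mathcal G^2$. For star-triangular $w$ it has a unique (canonical) braiding with $\mathcal R^+(e\binom{\mathbf p}{\mathbf q},e\binom{\mathbf r}{\mathbf s})=w[\mathbf r\,\frac{\mathbf q}{\mathbf p}\,\mathbf s]$ for edges $\mathbf p,\mathbf q,\mathbf r,\mathbf s$. **$SU(N)_L$-SOS model.** $\mathcal V=\mathcal V_{NL}=\{\lambda\in\mathbb Z^N\mid L\ge\lambda_1\ge\dots\ge\lambda_N=0\}$, and $(\lambda_1+1,\dots,\lambda_N+1)$ is identified with $\lambda$. Let $\hat i=(\delta_{1i},\dots,\delta_{Ni})$. Paths of length $m$ are the sequences $(\lambda\,|\,i_1,\dots,i_m)=(\lambda,\lambda+\hat i_1,\dots,\lambda+\hat i_1+\cdots+\hat i_m)$ all of whose entries lie in $\mathcal V$; this defines $\mathcal G=\mathcal G_{N,L}$. For $\mathbf p=(\lambda\,|\,i,j)$ ($\lambda\in\mathcal V$) put $\mathbf p^\dagger=(\lambda\,|\,j,i)$, $d(\mathbf p)=\lambda_i-\lambda_j+j-i$, and $[n]=(t^n-t^{-n})/(t-t^{-1})$. For a nonzero parameter $\zeta$, the star-triangular face model $w_{N,t,\epsilon}=w_{N,t,\epsilon,\zeta}$ is defined as follows, where $w\begin{bmatrix}\lambda&\mu\\ \mu'&\kappa\end{bmatrix}$ is the weight of the face with top edge $\lambda\to\mu$, left edge $\lambda\to\mu'$, right edge $\mu\to\kappa$, bottom edge $\mu'\to\kappa$: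 for $\mathbf p=(\lambda\,|\,i,j)\in\mathcal G^2$ with $i\neq j$, $$w\begin{bmatrix}\lambda&\lambda+\hat i\\ \lambda+\hat i&\lambda+\hat i+\hat j\end{bmatrix}=-\zeta^{-1}t^{-d(\mathbf p)}\frac1{[d(\mathbf p)]},\qquad w\begin{bmatrix}\lambda&\lambda+\hat i\\ \lambda+\hat j&\lambda+\hat i+\hat j\end{bmatrix}=\zeta^{-1}\epsilon\frac{[d(\mathbf p)-1]}{[d(\mathbf p)]}$$ (the latter only when $\mathbf p^\dagger\in\mathcal G^2$; otherwise there is no such face), and $w\begin{bmatrix}\lambda&\lambda+\hat k\\ \lambda+\hat k&\lambda+2\hat k\end{bmatrix}=\zeta^{-1}t$ for $(\lambda\,|\,k,k)\in\mathcal G^2$. The face algebra $\mathfrak A(w_{N,t,\epsilon})$ does not depend on $\zeta$. **SOS algebra.** $\mathfrak S(A_{N-1};t)_\epsilon=\mathfrak A(w_{N,t,\epsilon})/(\det-1)$, where $\det=\sum_{\lambda,\mu\in\mathcal V}\det\binom\lambda\mu$, $\det\binom\lambda\mu=\frac{D(\mu)}{D(\lambda)}\sum_{\mathbf p\in\mathcal G^N_{\lambda\lambda}}(-\epsilon)^{\mathcal L(\mathbf p)+\mathcal L(\mathbf q)}e\binom{\mathbf p}{\mathbf q}$ with $\mathbf q\in\mathcal G^N_{\mu\mu}$ arbitrary (the result does not depend on $\mathbf q$), $\mathcal L(\lambda\,|\,i_1,\dots,i_N)=\mathrm{Card}\{(k,l)\mid1\le k<l\le N,\ i_k<i_l\}$,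 $D(\lambda)=\prod_{1\le i<j\le N}\frac{[d(\lambda\,|\,i,j)]}{[d(0\,|\,i,j)]}$. The canonical braiding of $\mathfrak A(w_{N,t,\epsilon,\zeta})$ induces a braiding $\mathcal R^+_\zeta$ of $\mathfrak S(A_{N-1};t)_\epsilon$ if and only if $\zeta^N=\epsilon^{N-1}t$. *)

theory Defs
  imports
    Complex_Main
    "HOL-Library.Poly_Mapping"
    "HOL-Algebra.QuotRing"
    "HOL-Algebra.Module"
    "Graph_Theory.Arc_Walk"
begin

section \<open>Face algebras and their braidings\<close>

definition complex_ring :: "complex ring" where
  "complex_ring = \<lparr>carrier = UNIV, mult = (*), one = 1, zero = 0, add = (+)\<rparr>"

definition linear_form :: "(complex, 'a, 'm) module_scheme \<Rightarrow> ('a \<Rightarrow> complex) \<Rightarrow> bool" where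
  "linear_form M X \<longleftrightarrow>
     (\<forall>x\<in>carrier M. \<forall>y\<in>carrier M. X (x \<oplus>\<^bsub>M\<^esub> y) = X x + X y) \<and>
     (\<forall>c. \<forall>x\<in>carrier M. X (c \<odot>\<^bsub>M\<^esub> x) = c * X x)"

definition bilinear_form :: "(complex, 'a, 'm) module_scheme \<Rightarrow> ('a \<Rightarrow> 'a \<Rightarrow> complex) \<Rightarrow> bool" where
  "bilinear_form M B \<longleftrightarrow>
     (\<forall>y\<in>carrier M. linear_form M (\<lambda>x. B x y)) \<and> (\<forall>x\<in>carrier M. linear_form M (B x))"

definition trilinear_form ::
  "(complex, 'a, 'm) module_scheme \<Rightarrow> ('a \<Rightarrow> 'a \<Rightarrow> 'a \<Rightarrow> complex) \<Rightarrow> bool" where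
  "trilinear_form M T \<longleftrightarrow>
     (\<forall>y\<in>carrier M. \<forall>z\<in>carrier M. linear_form M (\<lambda>x. T x y z)) \<and>
     (\<forall>x\<in>carrier M. \<forall>z\<in>carrier M. linear_form M (\<lambda>y. T x y z)) \<and>
     (\<forall>x\<in>carrier M. \<forall>y\<in>carrier M. linear_form M (T x y))"

text \<open>The tensor square of a complex vector space \<open>M\<close> is realised as the span of the evaluations
  \<open>x \<otimes> y : B \<mapsto> B x y\<close> in the dual of the space of bilinear forms on \<open>M\<close>.  Hence
  \<open>\<tau> B\<close> is the value on \<open>\<tau>\<close> of the linear map \<open>M \<otimes> M \<rightarrow> \<complex>\<close> corresponding to the
  bilinear form \<open>B\<close>.  If \<open>\<Delta> a = \<Sum> a\<^sub>1 \<otimes> a\<^sub>2\<close>, then \<open>\<Delta> a (\<lambda>x y. B x y)\<close> reads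
  \<open>\<Sum> B(a\<^sub>1, a\<^sub>2)\<close>.\<close>

type_synonym 'a tensor = "('a \<Rightarrow> 'a \<Rightarrow> complex) \<Rightarrow> complex"

definition pure_tensor :: "(complex, 'a, 'm) module_scheme \<Rightarrow> 'a \<Rightarrow> 'a \<Rightarrow> 'a tensor" where
  "pure_tensor M x y = (\<lambda>B. if bilinear_form M B then B x y else 0)"

definition tensor_square :: "(complex, 'a, 'm) module_scheme \<Rightarrow> 'a tensor set" where
  "tensor_square M =
     {\<lambda>B. \<Sum>(x, y)\<leftarrow>xs. pure_tensor M x y B | xs. set xs \<subseteq> carrier M \<times> carrier M}"

text \<open>\<open>face_idem A i\<close> is \<open>e\<^sub>i\<close>, and \<open>face_idem_ring A i\<close> is the ringed
  (i.e. with a small circle on top) \<open>e\<^sub>i\<close>.\<close>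

record ('a, 'v) face_alg = "(complex, 'a) module" +
  comult :: "'a \<Rightarrow> 'a tensor"
  counit :: "'a \<Rightarrow> complex"
  face_idem :: "'v \<Rightarrow> 'a"
  face_idem_ring :: "'v \<Rightarrow> 'a"

text \<open>Identities in \<open>A \<otimes> A\<close> (\<open>A \<otimes> A \<otimes> A\<close>) between nested coproducts are tested
  against all bilinear (trilinear) forms, and \<open>(\<epsilon> \<otimes> id) \<Delta> a = a\<close> against all linear forms.\<close>

locale face_algebra = ring A + Module.module complex_ring A
  for V :: "'v set" and A :: "('a, 'v) face_alg" (structure) +
  assumes finite_V: "finite V" and nonempty_V: "V \<noteq> {}"
    and smult_mult_l:
      "\<lbrakk>a \<in> carrier A; b \<in> carrier A\<rbrakk> \<Longrightarrow> (c \<odot>\<^bsub>A\<^esub> a) \<otimes>\<^bsub>A\<^esub> b = c \<odot>\<^bsub>A\<^esub> (a \<otimes>\<^bsub>A\<^esub> b)"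
    and smult_mult_r:
      "\<lbrakk>a \<in> carrier A; b \<in> carrier A\<rbrakk> \<Longrightarrow> a \<otimes>\<^bsub>A\<^esub> (c \<odot>\<^bsub>A\<^esub> b) = c \<odot>\<^bsub>A\<^esub> (a \<otimes>\<^bsub>A\<^esub> b)"
    and comult_closed: "a \<in> carrier A \<Longrightarrow> comult A a \<in> tensor_square A"
    and comult_add:
      "\<lbrakk>a \<in> carrier A; b \<in> carrier A\<rbrakk> \<Longrightarrow>
        comult A (a \<oplus>\<^bsub>A\<^esub> b) = (\<lambda>B. comult A a B + comult A b B)"
    and comult_smult: "a \<in> carrier A \<Longrightarrow> comult A (c \<odot>\<^bsub>A\<^esub> a) = (\<lambda>B. c * comult A a B)"
    and counit_linear: "linear_form A (counit A)"
    and coassoc: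
      "\<lbrakk>a \<in> carrier A; trilinear_form A T\<rbrakk> \<Longrightarrow>
        comult A a (\<lambda>x y. comult A x (\<lambda>x1 x2. T x1 x2 y)) =
        comult A a (\<lambda>x y. comult A y (\<lambda>y1 y2. T x y1 y2))"
    and counit_l:
      "\<lbrakk>a \<in> carrier A; linear_form A X\<rbrakk> \<Longrightarrow> comult A a (\<lambda>x y. counit A x * X y) = X a"
    and counit_r:
      "\<lbrakk>a \<in> carrier A; linear_form A X\<rbrakk> \<Longrightarrow> comult A a (\<lambda>x y. X x * counit A y) = X a"
    and comult_mult:
      "\<lbrakk>a \<in> carrier A; b \<in> carrier A; bilinear_form A B\<rbrakk> \<Longrightarrow>
        comult A (a \<otimes>\<^bsub>A\<^esub> b) B =
        comult A a (\<lambda>a1 a2. comult A b (\<lambda>b1 b2. B (a1 \<otimes>\<^bsub>A\<^esub> b1) (a2 \<otimes>\<^bsub>A\<^esub> b2)))"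
    and idem_closed: "i \<in> V \<Longrightarrow> face_idem A i \<in> carrier A"
    and idem_ring_closed: "i \<in> V \<Longrightarrow> face_idem_ring A i \<in> carrier A"
    and idem_mult:
      "\<lbrakk>i \<in> V; j \<in> V\<rbrakk> \<Longrightarrow>
        face_idem A i \<otimes>\<^bsub>A\<^esub> face_idem A j = (if i = j then face_idem A i else \<zero>\<^bsub>A\<^esub>)"
    and idem_ring_mult:
      "\<lbrakk>i \<in> V; j \<in> V\<rbrakk> \<Longrightarrow>
        face_idem_ring A i \<otimes>\<^bsub>A\<^esub> face_idem_ring A j = (if i = j then face_idem_ring A i else \<zero>\<^bsub>A\<^esub>)"
    and idem_commute:
      "\<lbrakk>i \<in> V; j \<in> V\<rbrakk> \<Longrightarrow>
        face_idem A i \<otimes>\<^bsub>A\<^esub> face_idem_ring A j = face_idem_ring A j \<otimes>\<^bsub>A\<^esub> face_idem A i"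
    and idem_sum: "(\<Oplus>\<^bsub>A\<^esub>k\<in>V. face_idem A k) = \<one>\<^bsub>A\<^esub>"
    and idem_ring_sum: "(\<Oplus>\<^bsub>A\<^esub>k\<in>V. face_idem_ring A k) = \<one>\<^bsub>A\<^esub>"
    and comult_idem:
      "\<lbrakk>i \<in> V; j \<in> V\<rbrakk> \<Longrightarrow>
        comult A (face_idem_ring A i \<otimes>\<^bsub>A\<^esub> face_idem A j) =
        (\<lambda>B. \<Sum>k\<in>V. pure_tensor A (face_idem_ring A i \<otimes>\<^bsub>A\<^esub> face_idem A k)
                                 (face_idem_ring A k \<otimes>\<^bsub>A\<^esub> face_idem A j) B)"
    and counit_idem:
      "\<lbrakk>i \<in> V; j \<in> V\<rbrakk> \<Longrightarrow>
        counit A (face_idem_ring A i \<otimes>\<^bsub>A\<^esub> face_idem A j) = (if i = j then 1 else 0)"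
    and counit_mult:
      "\<lbrakk>a \<in> carrier A; b \<in> carrier A\<rbrakk> \<Longrightarrow>
        counit A (a \<otimes>\<^bsub>A\<^esub> b) =
        (\<Sum>k\<in>V. counit A (a \<otimes>\<^bsub>A\<^esub> face_idem A k) * counit A (face_idem_ring A k \<otimes>\<^bsub>A\<^esub> b))"
begin

text \<open>Elements of \<open>(A \<otimes> A)\<^sup>*\<close> are bilinear forms; only their values on the carrier matter.\<close>

definition form_eq :: "('a \<Rightarrow> 'a \<Rightarrow> complex) \<Rightarrow> ('a \<Rightarrow> 'a \<Rightarrow> complex) \<Rightarrow> bool" where
  "form_eq X Y \<longleftrightarrow> (\<forall>a\<in>carrier A. \<forall>b\<in>carrier A. X a b = Y a b)"

definition conv :: "('a \<Rightarrow> 'a \<Rightarrow> complex) \<Rightarrow> ('a \<Rightarrow> 'a \<Rightarrow> complex) \<Rightarrow> 'a \<Rightarrow> 'a \<Rightarrow> complex" where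
  "conv X Y a b = comult A a (\<lambda>a1 a2. comult A b (\<lambda>b1 b2. X a1 b1 * Y a2 b2))"

definition m_star :: "('a \<Rightarrow> complex) \<Rightarrow> 'a \<Rightarrow> 'a \<Rightarrow> complex" where
  "m_star X a b = X (a \<otimes>\<^bsub>A\<^esub> b)"

definition mop_star :: "('a \<Rightarrow> complex) \<Rightarrow> 'a \<Rightarrow> 'a \<Rightarrow> complex" where
  "mop_star X a b = X (b \<otimes>\<^bsub>A\<^esub> a)"

definition braiding_pair :: "('a \<Rightarrow> 'a \<Rightarrow> complex) \<Rightarrow> ('a \<Rightarrow> 'a \<Rightarrow> complex) \<Rightarrow> bool" where
  "braiding_pair Rp Rm \<longleftrightarrow>
     bilinear_form A Rp \<and> bilinear_form A Rm \<and>
     form_eq (conv Rm Rp) (m_star (counit A)) \<and>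
     form_eq (conv Rp Rm) (mop_star (counit A)) \<and>
     form_eq (conv (conv Rp Rm) Rp) Rp \<and>
     form_eq (conv (conv Rm Rp) Rm) Rm \<and>
     (\<forall>X. linear_form A X \<longrightarrow> form_eq (conv (conv Rp (m_star X)) Rm) (mop_star X)) \<and>
     (\<forall>a\<in>carrier A. \<forall>b\<in>carrier A. \<forall>c\<in>carrier A.
        Rp (a \<otimes>\<^bsub>A\<^esub> b) c = comult A c (\<lambda>c1 c2. Rp a c1 * Rp b c2)) \<and>
     (\<forall>a\<in>carrier A. \<forall>b\<in>carrier A. \<forall>c\<in>carrier A.
        Rp a (b \<otimes>\<^bsub>A\<^esub> c) = comult A a (\<lambda>a1 a2. Rp a1 c * Rp a2 b))"

definition braiding :: "('a \<Rightarrow> 'a \<Rightarrow> complex) \<Rightarrow> bool" where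
  "braiding Rp \<longleftrightarrow> (\<exists>Rm. braiding_pair Rp Rm)"

end

text \<open>The quotient by an ideal \<open>I\<close> which is also a coideal: all structure maps are transported along
  the projection \<open>a \<mapsto> I + a\<close>, the counit and coproduct via a choice of representative.\<close>

definition quotient_face_alg :: "('a, 'v) face_alg \<Rightarrow> 'a set \<Rightarrow> ('a set, 'v) face_alg" where
  "quotient_face_alg A I =
     (let Q = ring.extend (A Quot I)
                (module.fields (\<lambda>c X. \<Union>x\<in>X. I +>\<^bsub>A\<^esub> (c \<odot>\<^bsub>A\<^esub> x)))
      in module.extend Q
           (face_alg.fields
              (\<lambda>X B. if bilinear_form Q B
                     then comult A (SOME x. x \<in> X) (\<lambda>x y. B (I +>\<^bsub>A\<^esub> x) (I +>\<^bsub>A\<^esub> y)) else 0)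
              (\<lambda>X. counit A (SOME x. x \<in> X))
              (\<lambda>i. I +>\<^bsub>A\<^esub> face_idem A i)
              (\<lambda>i. I +>\<^bsub>A\<^esub> face_idem_ring A i)))"


section \<open>The algebras \<open>\<HH>(G)\<close> and \<open>\<AA>(w)\<close> of a finite oriented graph\<close>

text \<open>A path is its start vertex together with its list of arcs.\<close>

type_synonym ('v, 'e) path = "'v \<times> 'e list"

definition paths :: "('v, 'e) pre_digraph \<Rightarrow> nat \<Rightarrow> ('v, 'e) path set" where
  "paths G m = {(u, es). (\<exists>v. pre_digraph.awalk G u es v) \<and> length es = m}"

definition path_end :: "('v, 'e) pre_digraph \<Rightarrow> ('v, 'e) path \<Rightarrow> 'v" where
  "path_end G p = pre_digraph.awlast G (fst p) (snd p)"

definition path_concat :: "('v, 'e) path \<Rightarrow> ('v, 'e) path \<Rightarrow> ('v, 'e) path" where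
  "path_concat p q = (fst p, snd p @ snd q)"

definition edge_path :: "('v, 'e) pre_digraph \<Rightarrow> 'e \<Rightarrow> ('v, 'e) path" where
  "edge_path G a = (tail G a, [a])"

definition edge_pair_path :: "('v, 'e) pre_digraph \<Rightarrow> 'e \<Rightarrow> 'e \<Rightarrow> ('v, 'e) path" where
  "edge_pair_path G a b = (tail G a, [a, b])"

text \<open>\<open>\<HH>(G)\<close> consists of the finitely supported functions on pairs of paths of equal length.\<close>

type_synonym ('v, 'e) path_comb = "(('v, 'e) path \<times> ('v, 'e) path) \<Rightarrow>\<^sub>0 complex"

definition e_basis :: "('v, 'e) path \<Rightarrow> ('v, 'e) path \<Rightarrow> ('v, 'e) path_comb" where
  "e_basis p q = Poly_Mapping.single (p, q) 1"

definition comb_scale :: "complex \<Rightarrow> ('v, 'e) path_comb \<Rightarrow> ('v, 'e) path_comb" where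
  "comb_scale c = Poly_Mapping.map ((*) c)"

definition e_basis_mult ::
  "('v, 'e) pre_digraph \<Rightarrow> ('v, 'e) path \<times> ('v, 'e) path \<Rightarrow> ('v, 'e) path \<times> ('v, 'e) path
    \<Rightarrow> ('v, 'e) path_comb" where
  "e_basis_mult G = (\<lambda>(p, q) (r, s).
     if path_end G p = fst r \<and> path_end G q = fst s
     then e_basis (path_concat p r) (path_concat q s) else 0)"

definition path_module :: "('v, 'e) pre_digraph \<Rightarrow> (complex, ('v, 'e) path_comb) module" where
  "path_module G =
     \<lparr>carrier = {f. Poly_Mapping.keys f \<subseteq> (\<Union>m. paths G m \<times> paths G m)},
      mult = (\<lambda>f g. \<Sum>x\<in>Poly_Mapping.keys f. \<Sum>y\<in>Poly_Mapping.keys g.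
                comb_scale (Poly_Mapping.lookup f x * Poly_Mapping.lookup g y) (e_basis_mult G x y)),
      one = (\<Sum>i\<in>verts G. \<Sum>j\<in>verts G. e_basis (i, []) (j, [])),
      zero = 0,
      add = (+),
      smult = comb_scale\<rparr>"

definition path_face_alg :: "('v, 'e) pre_digraph \<Rightarrow> (('v, 'e) path_comb, 'v) face_alg" where
  "path_face_alg G = module.extend (path_module G)
     (face_alg.fields
        (\<lambda>f B. \<Sum>(p, q)\<in>Poly_Mapping.keys f. Poly_Mapping.lookup f (p, q) *
           (\<Sum>r\<in>paths G (length (snd p)). pure_tensor (path_module G) (e_basis p r) (e_basis r q) B))
        (\<lambda>f. \<Sum>(p, q)\<in>Poly_Mapping.keys f. Poly_Mapping.lookup f (p, q) * (if p = q then 1 else 0))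
        (\<lambda>j. \<Sum>i\<in>verts G. e_basis (i, []) (j, []))
        (\<lambda>i. \<Sum>j\<in>verts G. e_basis (i, []) (j, [])))"

text \<open>For a face model \<open>w\<close>, the weight of the face with left, top, bottom, right edge
  \<open>r, p, q, s\<close> is written \<open>w r p q s\<close>.\<close>

type_synonym 'e face_weight = "'e \<Rightarrow> 'e \<Rightarrow> 'e \<Rightarrow> 'e \<Rightarrow> complex"

definition is_face :: "('v, 'e) pre_digraph \<Rightarrow> 'e \<Rightarrow> 'e \<Rightarrow> 'e \<Rightarrow> 'e \<Rightarrow> bool" where
  "is_face G r p q s \<longleftrightarrow> {r, p, q, s} \<subseteq> arcs G \<and>
     head G p = tail G s \<and> head G r = tail G q \<and> tail G p = tail G r \<and> head G s = head G q"

definition composable_pairs :: "('v, 'e) pre_digraph \<Rightarrow> ('e \<times> 'e) set" where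
  "composable_pairs G = {(a, b). a \<in> arcs G \<and> b \<in> arcs G \<and> head G a = tail G b}"

definition face_relations :: "('v, 'e) pre_digraph \<Rightarrow> 'e face_weight \<Rightarrow> ('v, 'e) path_comb set" where
  "face_relations G w =
     {(\<Sum>(c, d)\<in>composable_pairs G.
         comb_scale (w a c b d) (e_basis (edge_pair_path G c d) (edge_pair_path G p q))) -
      (\<Sum>(r, s)\<in>composable_pairs G.
         comb_scale (w r p s q) (e_basis (edge_pair_path G a b) (edge_pair_path G r s)))
      | a b p q. (p, q) \<in> composable_pairs G \<and> (a, b) \<in> composable_pairs G}"

definition face_ideal :: "('v, 'e) pre_digraph \<Rightarrow> 'e face_weight \<Rightarrow> ('v, 'e) path_comb set" where
  "face_ideal G w = Idl\<^bsub>path_face_alg G\<^esub> (face_relations G w)"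

definition weight_face_alg ::
  "('v, 'e) pre_digraph \<Rightarrow> 'e face_weight \<Rightarrow> (('v, 'e) path_comb set, 'v) face_alg" where
  "weight_face_alg G w = quotient_face_alg (path_face_alg G) (face_ideal G w)"

definition weight_proj ::
  "('v, 'e) pre_digraph \<Rightarrow> 'e face_weight \<Rightarrow> ('v, 'e) path_comb \<Rightarrow> ('v, 'e) path_comb set" where
  "weight_proj G w f = face_ideal G w +>\<^bsub>path_face_alg G\<^esub> f"

definition canonical_braiding ::
  "('v, 'e) pre_digraph \<Rightarrow> 'e face_weight
    \<Rightarrow> (('v, 'e) path_comb set \<Rightarrow> ('v, 'e) path_comb set \<Rightarrow> complex) \<Rightarrow> bool" where
  "canonical_braiding G w C \<longleftrightarrow>
     face_algebra.braiding (weight_face_alg G w) C \<and>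
     (\<forall>p\<in>arcs G. \<forall>q\<in>arcs G. \<forall>r\<in>arcs G. \<forall>s\<in>arcs G.
        C (weight_proj G w (e_basis (edge_path G p) (edge_path G q)))
          (weight_proj G w (e_basis (edge_path G r) (edge_path G s))) = w r q p s)"


section \<open>The \<open>SU(N)\<^sub>L\<close>-SOS model\<close>

text \<open>Weights are functions supported on \<open>{1..N}\<close>; modulo \<open>(1, \<dots>, 1)\<close> every integer vector
  has a unique representative with vanishing \<open>N\<close>-th entry.\<close>

type_synonym weight = "nat \<Rightarrow> int"

definition sos_verts :: "nat \<Rightarrow> nat \<Rightarrow> weight set" where
  "sos_verts N L =
     {l. (\<forall>k. k \<notin> {1..N} \<longrightarrow> l k = 0) \<and> int L \<ge> l 1 \<and> (\<forall>k\<in>{1..<N}. l k \<ge> l (k + 1)) \<and> l N = 0}"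

definition normalise :: "nat \<Rightarrow> weight \<Rightarrow> weight" where
  "normalise N l = (\<lambda>k. if k \<in> {1..N} then l k - l N else 0)"

text \<open>The arc \<open>(\<lambda>, i)\<close> is the edge from \<open>\<lambda>\<close> to \<open>\<lambda>\<close> plus the \<open>i\<close>-th unit vector; since
  \<open>N \<ge> 2\<close>, the target determines \<open>i\<close>, so there is at most one edge between two vertices.\<close>

type_synonym sos_arc = "weight \<times> nat"

definition sos_step :: "nat \<Rightarrow> weight \<Rightarrow> nat \<Rightarrow> weight" where
  "sos_step N l i = normalise N (l(i := l i + 1))"

definition sos_graph :: "nat \<Rightarrow> nat \<Rightarrow> (weight, sos_arc) pre_digraph" where
  "sos_graph N L =
     \<lparr>verts = sos_verts N L,
      arcs = {(l, i). l \<in> sos_verts N L \<and> i \<in> {1..N} \<and> sos_step N l i \<in> sos_verts N L},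
      tail = fst,
      head = (\<lambda>(l, i). sos_step N l i)\<rparr>"

definition sos_d :: "weight \<Rightarrow> nat \<Rightarrow> nat \<Rightarrow> int" where
  "sos_d l i j = l i - l j + int j - int i"

definition q_int :: "complex \<Rightarrow> int \<Rightarrow> complex" where
  "q_int t n = (t powi n - t powi (- n)) / (t - inverse t)"

text \<open>A face of \<open>sos_graph N L\<close> with top \<open>(\<lambda>, i)\<close> and right edge labelled \<open>j\<close> has left edge
  \<open>(\<lambda>, i)\<close> or \<open>(\<lambda>, j)\<close>.\<close>

definition sos_weight :: "nat \<Rightarrow> nat \<Rightarrow> complex \<Rightarrow> complex \<Rightarrow> complex \<Rightarrow> sos_arc face_weight" where
  "sos_weight N L t \<epsilon> \<zeta> r p q s =
     (if is_face (sos_graph N L) r p q s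
      then let l = fst p; i = snd p; j = snd s; d = sos_d l i j in
        if i = j then inverse \<zeta> * t
        else if snd r = i then - inverse \<zeta> * t powi (- d) * (1 / q_int t d)
        else inverse \<zeta> * \<epsilon> * (q_int t (d - 1) / q_int t d)
      else 0)"

definition closed_sos_paths :: "nat \<Rightarrow> nat \<Rightarrow> weight \<Rightarrow> (weight, sos_arc) path set" where
  "closed_sos_paths N L l =
     {p \<in> paths (sos_graph N L) N. fst p = l \<and> path_end (sos_graph N L) p = l}"

definition sos_length :: "(weight, sos_arc) path \<Rightarrow> nat" where
  "sos_length p = (let is = map snd (snd p) in
     card {(k, l). k < l \<and> l < length is \<and> is ! k < is ! l})"

definition sos_D :: "nat \<Rightarrow> complex \<Rightarrow> weight \<Rightarrow> complex" where
  "sos_D N t l = (\<Prod>(i, j)\<in>{(i, j). 1 \<le> i \<and> i < j \<and> j \<le> N}.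
     q_int t (sos_d l i j) / q_int t (sos_d (\<lambda>_. 0) i j))"

text \<open>The quantum determinant, as a representative in \<open>\<HH>(G)\<close>; its class in \<open>\<AA>(w)\<close> does not depend
  on the choice of \<open>q\<close>.\<close>

definition sos_det_comp ::
  "nat \<Rightarrow> nat \<Rightarrow> complex \<Rightarrow> complex \<Rightarrow> weight \<Rightarrow> weight \<Rightarrow> (weight, sos_arc) path_comb" where
  "sos_det_comp N L t \<epsilon> l m =
     (let q = (SOME q. q \<in> closed_sos_paths N L m) in
      comb_scale (sos_D N t m / sos_D N t l)
        (\<Sum>p\<in>closed_sos_paths N L l.
           comb_scale ((- \<epsilon>) ^ (sos_length p + sos_length q)) (e_basis p q)))"

definition sos_det ::
  "nat \<Rightarrow> nat \<Rightarrow> complex \<Rightarrow> complex \<Rightarrow> (weight, sos_arc) path_comb" where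
  "sos_det N L t \<epsilon> = (\<Sum>l\<in>sos_verts N L. \<Sum>m\<in>sos_verts N L. sos_det_comp N L t \<epsilon> l m)"

text \<open>\<open>\<AA>(w)\<close> is unchanged when \<open>w\<close> is rescaled, so it is formed with \<open>\<zeta> = 1\<close>.\<close>

definition sos_weight_alg ::
  "nat \<Rightarrow> nat \<Rightarrow> complex \<Rightarrow> complex \<Rightarrow> ((weight, sos_arc) path_comb set, weight) face_alg" where
  "sos_weight_alg N L t \<epsilon> = weight_face_alg (sos_graph N L) (sos_weight N L t \<epsilon> 1)"

definition sos_ideal ::
  "nat \<Rightarrow> nat \<Rightarrow> complex \<Rightarrow> complex \<Rightarrow> (weight, sos_arc) path_comb set set" where
  "sos_ideal N L t \<epsilon> =
     Idl\<^bsub>sos_weight_alg N L t \<epsilon>\<^esub>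
       {weight_proj (sos_graph N L) (sos_weight N L t \<epsilon> 1) (sos_det N L t \<epsilon>)
          \<ominus>\<^bsub>sos_weight_alg N L t \<epsilon>\<^esub> \<one>\<^bsub>sos_weight_alg N L t \<epsilon>\<^esub>}"

definition sos_algebra ::
  "nat \<Rightarrow> nat \<Rightarrow> complex \<Rightarrow> complex \<Rightarrow> ((weight, sos_arc) path_comb set set, weight) face_alg" where
  "sos_algebra N L t \<epsilon> = quotient_face_alg (sos_weight_alg N L t \<epsilon>) (sos_ideal N L t \<epsilon>)"

text \<open>\<open>sos_braiding_pair N L t \<epsilon> \<zeta> Rp Rm\<close>: \<open>Rp\<close> is the braiding \<open>R\<^sup>+\<^sub>\<zeta>\<close> induced by the canonical
  braiding of \<open>\<AA>(w)\<close> for the weights with parameter \<open>\<zeta>\<close>, and \<open>Rm\<close> is its inverse \<open>R\<^sup>-\<^sub>\<zeta>\<close>.\<close>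

definition sos_braiding_pair ::
  "nat \<Rightarrow> nat \<Rightarrow> complex \<Rightarrow> complex \<Rightarrow> complex
    \<Rightarrow> ((weight, sos_arc) path_comb set set \<Rightarrow> (weight, sos_arc) path_comb set set \<Rightarrow> complex)
    \<Rightarrow> ((weight, sos_arc) path_comb set set \<Rightarrow> (weight, sos_arc) path_comb set set \<Rightarrow> complex)
    \<Rightarrow> bool" where
  "sos_braiding_pair N L t \<epsilon> \<zeta> Rp Rm \<longleftrightarrow>
     face_algebra.braiding_pair (sos_algebra N L t \<epsilon>) Rp Rm \<and>
     (\<exists>C. canonical_braiding (sos_graph N L) (sos_weight N L t \<epsilon> \<zeta>) C \<and>
        (let A = sos_weight_alg N L t \<epsilon>; I = sos_ideal N L t \<epsilon> in
         \<forall>a\<in>carrier A. \<forall>b\<in>carrier A. Rp (I +>\<^bsub>A\<^esub> a) (I +>\<^bsub>A\<^esub> b) = C a b))"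

end

theory Submission imports Defs
begin

text \<open>Let \<open>S\<close> be the SOS algebra.  The proof has a general and a special part.

  In the general part a braiding is described by its matrix entries \<open>R(e(p/q), e(r/s))\<close> on paths
  (\<open>braiding_pair_iff\<close>).  The hexagon identities make \<open>R(-, e(r/s))\<close>, for edges \<open>r, s\<close>, the transfer
  matrix of the values on edges (\<open>rmatrix_transfer\<close>), and the intertwining relation need only be
  checked for edges (\<open>commutes_generators\<close>).  So everything is determined by one face weight \<open>X\<close>,
  the edge weight of \<open>R\<close>.

  In the special part \<open>X\<close> is compared with the operator \<open>w\<close> of the SOS model, which satisfies the
  Hecke relation \<open>w\<^sup>2 = 1 + (t - 1/t) w\<close> (for \<open>\<zeta> = 1\<close>) and the Yang-Baxter equation.  By the latter
  the transfer matrices of \<open>w\<^sub>\<zeta>\<close> respect the face relations.  On the quantum determinant such a transfer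
  matrix is the scalar \<open>\<zeta>\<^sup>-\<^sup>N t \<epsilon>\<^sup>N\<^sup>-\<^sup>1\<close> (\<open>transfer_det\<close>), so for \<open>\<zeta>\<^sup>N = \<epsilon>\<^sup>N\<^sup>-\<^sup>1 t\<close> its entries are functionals on \<open>S\<close>
  (\<open>S_functional\<close>).  Applying them to the intertwining relation of \<open>R\<close> gives
  \<open>X\<^sub>2 w\<^sub>1 w\<^sub>2 = w\<^sub>1 w\<^sub>2 X\<^sub>1\<close> (\<open>braiding_relation\<close>).  At the origin the paths of length two span blocks of dimension one, with
  the two eigenvalues of \<open>w\<close>, so there \<open>X = \<alpha> + \<beta> w\<close>; the relation carries this form along edges, and
  every vertex can be reached from the origin.  Finally \<open>R\<close> vanishes on the face relations, which
  amounts to \<open>\<alpha> (\<alpha> + \<beta> (t - 1/t)) (w\<^sub>1 - w\<^sub>2) = 0\<close> (\<open>edge_operator\<close>).  Hence \<open>X\<close> is a multiple of \<open>w\<close> or of its inverse.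

  If \<open>X = w\<^sub>\<zeta>\<close>, the value on the determinant forces \<open>\<zeta>\<^sup>N = \<epsilon>\<^sup>N\<^sup>-\<^sup>1 t\<close>, and the pullback of \<open>R\<close> to \<open>\<AA>(w)\<close> is the
  canonical braiding (\<open>canonical_case\<close>).  Otherwise the same applies to the flipped inverse of \<open>R\<close>, which is a braiding
  as well (\<open>rmatrix_pair_swap\<close>, \<open>commutes_swap\<close>).  No braiding has to be constructed.\<close>

section \<open>Linear and bilinear forms\<close>

lemma linear_form_add:
 "linear_form M X ==> x : carrier M ==> y : carrier M ==> X (x \<oplus>\<^bsub>M\<^esub> y) = X x + X y"
 by (simp add: linear_form_def)

lemma linear_form_smult:
 "linear_form M X ==> x : carrier M ==> X (c \<odot>\<^bsub>M\<^esub> x) = c * X x"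
 by (simp add: linear_form_def)

lemma linear_form_lincomb:
 "linear_form M X ==> linear_form M Y ==> linear_form M (%x. c * X x + d * Y x)"
 by (simp add: linear_form_def algebra_simps)

lemma linear_form_times: "linear_form M X ==> linear_form M (%x. c * X x)"
 by (simp add: linear_form_def algebra_simps)

lemma linear_form_times_right: "linear_form M X ==> linear_form M (%x. X x * c)"
 by (simp add: linear_form_def algebra_simps)

lemma linear_form_sum:
 "(!!i. i : S ==> linear_form M (X i)) ==> linear_form M (%x. SUM i:S. X i x)"
 by (simp add: linear_form_def sum.distrib sum_distrib_left)

lemma linear_form_sum_list:
 "(!!i. i : set S ==> linear_form M (X i)) ==> linear_form M (%x. \<Sum>i\<leftarrow>S. X i x)"
proof (induction S)
 case Nil
 then show ?case by (simp add: linear_form_def)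
next
 case (Cons a S)
 then have "linear_form M (%x. 1 * X a x + 1 * (\<Sum>i\<leftarrow>S. X i x))"
 by (intro linear_form_lincomb) auto
 then show ?case by simp
qed

lemma bilinear_form_left: "bilinear_form M B ==> y : carrier M ==> linear_form M (%x. B x y)"
 by (simp add: bilinear_form_def)

lemma bilinear_form_right: "bilinear_form M B ==> x : carrier M ==> linear_form M (B x)"
 by (simp add: bilinear_form_def)

lemma bilinear_form_prod:
 "linear_form M X ==> linear_form M Y ==> bilinear_form M (%x y. X x * Y y)"
 by (simp add: bilinear_form_def linear_form_times linear_form_times_right)

lemma bilinear_form_swap: "bilinear_form M B ==> bilinear_form M (%x y. B y x)"
 by (simp add: bilinear_form_def)

lemma bilinear_form_sum_list:
 "(!!i. i : set S ==> bilinear_form M (B i)) ==> bilinear_form M (%x y. \<Sum>i\<leftarrow>S. B i x y)"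
 by (auto simp: bilinear_form_def intro!: linear_form_sum_list)

lemma trilinear_formD:
 assumes "trilinear_form M T"
 shows "z : carrier M ==> bilinear_form M (%x y. T x y z)"
 and "x : carrier M ==> bilinear_form M (T x)"
 using assms by (auto simp: trilinear_form_def bilinear_form_def)

lemma cring_complex_ring: "cring complex_ring"
proof (rule cringI)
 show "abelian_group complex_ring"
 proof (rule abelian_groupI)
 fix x assume "x : carrier complex_ring"
 show "EX y:carrier complex_ring. y \<oplus>\<^bsub>complex_ring\<^esub> x = \<zero>\<^bsub>complex_ring\<^esub>"
  by (rule bexI[of _ "- x"]) (auto simp: complex_ring_def)
 qed (auto simp: complex_ring_def)
 show "comm_monoid complex_ring"
 by (rule comm_monoidI) (auto simp: complex_ring_def)
qed (auto simp: complex_ring_def algebra_simps)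


section \<open>Coproducts as finite sums\<close>

context face_algebra
begin

lemma A_ring: "ring A"
 by unfold_locales

lemma A_semiring: "semiring A"
 by unfold_locales

lemma A_abelian_group: "abelian_group A"
 by unfold_locales

lemmas A_l_neg = abelian_group.l_neg[OF A_abelian_group]
 and A_a_ac = abelian_monoid.a_ac[OF abelian_group.axioms(1)[OF A_abelian_group]]
 and A_m_assoc = Group.monoid.m_assoc[OF ring.axioms(2)[OF A_ring]]

lemmas A_l_distr = semiring.l_distr[OF A_semiring] and A_r_distr = semiring.r_distr[OF A_semiring]

lemma smult_in: "x : carrier A ==> c \<odot>\<^bsub>A\<^esub> x : carrier A"
 using smult_closed[of c x] by (simp add: complex_ring_def)

lemma smult_plus: "x : carrier A ==> y : carrier A ==> c \<odot>\<^bsub>A\<^esub> (x \<oplus>\<^bsub>A\<^esub> y) = c \<odot>\<^bsub>A\<^esub> x \<oplus>\<^bsub>A\<^esub> c \<odot>\<^bsub>A\<^esub> y"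
 using smult_r_distr[of c x y] by (simp add: complex_ring_def)

lemma linear_form_cong:
 assumes "!!x. x : carrier A ==> X x = Y x"
 shows "linear_form A X = linear_form A Y"
 using assms smult_in by (simp add: linear_form_def)

lemma bilinear_form_cong:
 assumes "!!x y. x : carrier A ==> y : carrier A ==> B x y = B' x y"
 shows "bilinear_form A B = bilinear_form A B'"
proof -
 have "linear_form A (%x. B x y) = linear_form A (%x. B' x y)" if "y : carrier A" for y
 using assms that by (intro linear_form_cong) auto
 moreover have "linear_form A (B x) = linear_form A (B' x)" if "x : carrier A" for x
 using assms that by (intro linear_form_cong) auto
 ultimately show ?thesis by (auto simp: bilinear_form_def)
qed

lemma comult_repr:
 assumes "a : carrier A"
 obtains xs where "set xs \<subseteq> carrier A \<times> carrier A"
 and "!!B. bilinear_form A B ==> comult A a B = (\<Sum>(x, y)\<leftarrow>xs. B x y)"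
 and "!!B. ~ bilinear_form A B ==> comult A a B = 0"
proof -
 obtain xs where xs: "comult A a = (%B. \<Sum>(x, y)\<leftarrow>xs. pure_tensor A x y B)"
  "set xs \<subseteq> carrier A \<times> carrier A"
 using comult_closed[OF assms] by (auto simp: tensor_square_def)
 show ?thesis
 by (rule that[of xs]) (use xs in \<open>simp_all add: pure_tensor_def case_prod_unfold\<close>)
qed

lemma comult_cong:
 assumes a: "a : carrier A" and eq: "!!x y. x : carrier A ==> y : carrier A ==> B x y = B' x y"
 shows "comult A a B = comult A a B'"
proof -
 obtain xs where xs: "set xs \<subseteq> carrier A \<times> carrier A"
 "!!B. bilinear_form A B ==> comult A a B = (\<Sum>(x, y)\<leftarrow>xs. B x y)"
 "!!B. ~ bilinear_form A B ==> comult A a B = 0"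
 using comult_repr[OF a] by metis
 have "bilinear_form A B = bilinear_form A B'"
 using eq by (rule bilinear_form_cong)
 moreover have "(\<Sum>(x, y)\<leftarrow>xs. B x y) = (\<Sum>(x, y)\<leftarrow>xs. B' x y)"
 using xs(1) eq by (intro arg_cong[where f = sum_list] map_cong) auto
 ultimately show ?thesis using xs(2,3) by (cases "bilinear_form A B") auto
qed

lemma linear_form_comult: "bilinear_form A B ==> linear_form A (%a. comult A a B)"
 by (simp add: linear_form_def comult_add comult_smult)

lemma linear_form_comult_param:
 assumes a: "a : carrier A"
 and lin: "!!x y. x : carrier A ==> y : carrier A ==> linear_form M (%z. B z x y)"
 and bil: "!!z. z : carrier M ==> bilinear_form A (B z)"
 and closed: "!!z w. z : carrier M ==> w : carrier M ==> z \<oplus>\<^bsub>M\<^esub> w : carrier M"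
  "!!c z. z : carrier M ==> c \<odot>\<^bsub>M\<^esub> z : carrier M"
 shows "linear_form M (%z. comult A a (B z))"
proof -
 obtain xs where xs: "set xs \<subseteq> carrier A \<times> carrier A"
 "!!B. bilinear_form A B ==> comult A a B = (\<Sum>(x, y)\<leftarrow>xs. B x y)"
 using comult_repr[OF a] by metis
 have L: "linear_form M (%z. \<Sum>(x, y)\<leftarrow>xs. B z x y)"
 unfolding case_prod_unfold using xs(1) lin by (intro linear_form_sum_list) auto
 have eq: "comult A a (B z) = (\<Sum>(x, y)\<leftarrow>xs. B z x y)" if "z : carrier M" for z
 using xs(2)[OF bil[OF that]] .
 show ?thesis
 using L closed unfolding linear_form_def by (simp add: eq)
qed

lemma bilinear_form_conv_inner:
 assumes b: "b : carrier A" and X: "bilinear_form A X" and Y: "bilinear_form A Y"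
 shows "bilinear_form A (%a1 a2. comult A b (%b1 b2. X a1 b1 * Y a2 b2))"
proof -
 have bl: "bilinear_form A (%b1 b2. X a1 b1 * Y a2 b2)" if "a1 : carrier A" "a2 : carrier A" for a1 a2
 by (intro bilinear_form_prod bilinear_form_right[OF X] bilinear_form_right[OF Y] that)
 have "linear_form A (%a1. comult A b (%b1 b2. X a1 b1 * Y a2 b2))" if "a2 : carrier A" for a2
 by (rule linear_form_comult_param[OF b linear_form_times_right[OF bilinear_form_left[OF X]] bl[OF _ that]])
  (simp_all add: smult_in)
 moreover have "linear_form A (%a2. comult A b (%b1 b2. X a1 b1 * Y a2 b2))" if "a1 : carrier A" for a1
 by (rule linear_form_comult_param[OF b linear_form_times[OF bilinear_form_left[OF Y]] bl[OF that]])
  (simp_all add: smult_in)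
 ultimately show ?thesis by (simp add: bilinear_form_def)
qed

lemma bilinear_form_conv:
 assumes X: "bilinear_form A X" and Y: "bilinear_form A Y"
 shows "bilinear_form A (conv X Y)"
proof -
 have "linear_form A (%a. conv X Y a b)" if "b : carrier A" for b
 unfolding conv_def by (rule linear_form_comult[OF bilinear_form_conv_inner[OF that X Y]])
 moreover have "linear_form A (conv X Y a)" if a: "a : carrier A" for a
 unfolding conv_def
 proof (rule linear_form_comult_param[OF a])
 fix x y assume "x : carrier A" "y : carrier A"
 then show "linear_form A (%z. comult A z (%b1 b2. X x b1 * Y y b2))"
  by (intro linear_form_comult bilinear_form_prod bilinear_form_right[OF X] bilinear_form_right[OF Y])
 next
 fix z assume "z : carrier A"
 then show "bilinear_form A (%a1 a2. comult A z (%b1 b2. X a1 b1 * Y a2 b2))"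
  by (rule bilinear_form_conv_inner[OF _ X Y])
 qed (auto intro: smult_in)
 ultimately show ?thesis by (auto simp: bilinear_form_def)
qed

lemma linear_form_mult_left:
 "linear_form A X ==> y : carrier A ==> linear_form A (%x. X (x \<otimes>\<^bsub>A\<^esub> y))"
 by (auto simp: linear_form_def A_l_distr smult_mult_l smult_in)

lemma linear_form_mult_right:
 "linear_form A X ==> y : carrier A ==> linear_form A (%x. X (y \<otimes>\<^bsub>A\<^esub> x))"
 by (auto simp: linear_form_def A_r_distr smult_mult_r smult_in)

lemma bilinear_form_m_star: "linear_form A X ==> bilinear_form A (m_star X)"
 unfolding bilinear_form_def m_star_def[abs_def]
 by (auto intro: linear_form_mult_left linear_form_mult_right)

lemma bilinear_form_mop_star: "linear_form A X ==> bilinear_form A (mop_star X)"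
 unfolding bilinear_form_def mop_star_def[abs_def]
 by (auto intro: linear_form_mult_left linear_form_mult_right)

lemma bilinear_form_mult:
 assumes "bilinear_form A B" "u : carrier A" "v : carrier A"
 shows "bilinear_form A (%x y. B (x \<otimes>\<^bsub>A\<^esub> u) (y \<otimes>\<^bsub>A\<^esub> v))"
 and "bilinear_form A (%x y. B (u \<otimes>\<^bsub>A\<^esub> x) (v \<otimes>\<^bsub>A\<^esub> y))"
 using linear_form_mult_left[OF bilinear_form_left[OF assms(1)]]
 linear_form_mult_left[OF bilinear_form_right[OF assms(1)]]
 linear_form_mult_right[OF bilinear_form_left[OF assms(1)]]
 linear_form_mult_right[OF bilinear_form_right[OF assms(1)]] assms(2,3)
 unfolding bilinear_form_def by simp_all

end


section \<open>Quotients by biideals\<close>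

definition biideal :: "('a, 'v) face_alg => 'a set => bool" where
 "biideal A I \<longleftrightarrow> ideal I A & (ALL x:I. counit A x = 0) \<and>
  (ALL x:I. ALL B. bilinear_form A B --> (ALL z:I. ALL y:carrier A. B z y = 0 & B y z = 0) -->
  comult A x B = 0)"

locale biideal_quotient = face_algebra V A for V and A (structure) +
 fixes I
 assumes biideal: "biideal A I"
begin

abbreviation "Q \<equiv> quotient_face_alg A I"
abbreviation pr where "pr a \<equiv> I +>\<^bsub>A\<^esub> a"

lemma I_ideal: "ideal I A"
 using biideal by (simp add: biideal_def)

sublocale I: ideal I A
 by (rule I_ideal)

lemma Q_carrier: "carrier Q = pr ` carrier A"
 by (auto simp: quotient_face_alg_def Let_def module.defs ring.defs face_alg.defs FactRing_def
  A_RCOSETS_def' a_r_coset_def)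

lemma Q_ops:
 "mult Q = rcoset_mult A I" "one Q = pr \<one>\<^bsub>A\<^esub>" "zero Q = I" "add Q = set_add A"
 by (simp_all add: quotient_face_alg_def Let_def module.defs ring.defs face_alg.defs FactRing_def)

lemma pr_eq_iff: "a : carrier A ==> b : carrier A ==> pr a = pr b \<longleftrightarrow> a \<ominus>\<^bsub>A\<^esub> b : I"
 using ring.quotient_eq_iff_same_a_r_cos[OF A_ring I_ideal] by blast

lemma pr_mult: "a : carrier A ==> b : carrier A ==> pr a \<otimes>\<^bsub>Q\<^esub> pr b = pr (a \<otimes>\<^bsub>A\<^esub> b)"
 by (simp add: Q_ops I.rcoset_mult_add)

lemma pr_add: "a : carrier A ==> b : carrier A ==> pr a \<oplus>\<^bsub>Q\<^esub> pr b = pr (a \<oplus>\<^bsub>A\<^esub> b)"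
 by (simp add: Q_ops I.a_rcos_sum)

lemma pr_zero: "pr \<zero>\<^bsub>A\<^esub> = \<zero>\<^bsub>Q\<^esub>"
 by (simp add: Q_ops I.a_subset a_coset_add_zero)

lemma pr_self: "a : carrier A ==> a : pr a"
 by (rule I.a_rcos_self)

lemma mem_pr:
 assumes "x : pr a" "a : carrier A"
 shows "x : carrier A" "pr x = pr a" "x \<ominus>\<^bsub>A\<^esub> a : I"
proof -
 show x: "x : carrier A"
 using assms I.a_elemrcos_carrier by blast
 show "pr x = pr a"
 using abelian_subgroup.a_repr_independence'[OF I.abelian_subgroup_axioms assms] by simp
 then show "x \<ominus>\<^bsub>A\<^esub> a : I" using pr_eq_iff x assms(2) by blast
qed

lemma I_smult: assumes "x : I" shows "c \<odot>\<^bsub>A\<^esub> x : I"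
proof -
 have "c \<odot>\<^bsub>A\<^esub> x = (c \<odot>\<^bsub>A\<^esub> \<one>\<^bsub>A\<^esub>) \<otimes>\<^bsub>A\<^esub> x"
 using assms I.Icarr smult_mult_l by simp
 then show ?thesis using I.I_l_closed[OF assms] smult_in by simp
qed

lemma smult_diff: "x : carrier A ==> y : carrier A ==> c \<odot>\<^bsub>A\<^esub> x \<ominus>\<^bsub>A\<^esub> c \<odot>\<^bsub>A\<^esub> y = c \<odot>\<^bsub>A\<^esub> (x \<ominus>\<^bsub>A\<^esub> y)"
 by (simp add: a_minus_def smult_plus smult_r_minus complex_ring_def)

lemma pr_smult: assumes "a : carrier A" shows "c \<odot>\<^bsub>Q\<^esub> pr a = pr (c \<odot>\<^bsub>A\<^esub> a)"
proof -
 have "c \<odot>\<^bsub>Q\<^esub> pr a = (\<Union>x\<in>pr a. pr (c \<odot>\<^bsub>A\<^esub> x))"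
 by (simp add: quotient_face_alg_def Let_def module.defs ring.defs face_alg.defs)
 also have "... = (\<Union>x\<in>pr a. pr (c \<odot>\<^bsub>A\<^esub> a))"
 proof (intro SUP_cong refl)
 fix x assume x: "x : pr a"
 show "pr (c \<odot>\<^bsub>A\<^esub> x) = pr (c \<odot>\<^bsub>A\<^esub> a)"
  using mem_pr[OF x assms] assms by (subst pr_eq_iff) (auto simp: smult_diff smult_in I_smult)
 qed
 also have "... = pr (c \<odot>\<^bsub>A\<^esub> a)" using pr_self[OF assms] by auto
 finally show ?thesis .
qed

lemma linear_form_pr: "linear_form Q X \<longleftrightarrow> linear_form A (%a. X (pr a))"
 by (auto simp: linear_form_def Q_carrier pr_add pr_smult smult_in)

lemma bilinear_form_pr: "bilinear_form Q B \<longleftrightarrow> bilinear_form A (%a b. B (pr a) (pr b))"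
 by (auto simp: bilinear_form_def Q_carrier linear_form_pr)

lemma linear_form_zero: "linear_form A X ==> X \<zero>\<^bsub>A\<^esub> = 0"
 using linear_form_smult[of A X "\<zero>\<^bsub>A\<^esub>" 0] by (simp add: smult_r_null complex_ring_def)

lemma linear_form_diff:
 assumes "linear_form A X" "a : carrier A" "b : carrier A"
 shows "X (a \<ominus>\<^bsub>A\<^esub> b) = X a - X b"
proof -
 have "X (a \<ominus>\<^bsub>A\<^esub> b \<oplus>\<^bsub>A\<^esub> b) = X (a \<ominus>\<^bsub>A\<^esub> b) + X b"
 using assms by (intro linear_form_add) auto
 moreover have "a \<ominus>\<^bsub>A\<^esub> b \<oplus>\<^bsub>A\<^esub> b = a"
 using assms by (simp add: a_minus_def A_a_ac(1) A_l_neg)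
 ultimately show ?thesis by simp
qed

lemma pr_I: "z : I ==> pr z = pr \<zero>\<^bsub>A\<^esub>"
 using I.Icarr pr_eq_iff[of z "\<zero>\<^bsub>A\<^esub>"] by (simp add: a_minus_def)

lemma pr_bilinear_vanish:
 assumes "bilinear_form Q B" "z : I" "y : carrier A"
 shows "B (pr z) (pr y) = 0" "B (pr y) (pr z) = 0"
proof -
 have b: "bilinear_form A (%a b. B (pr a) (pr b))" using assms(1) by (simp add: bilinear_form_pr)
 show "B (pr z) (pr y) = 0"
 using linear_form_zero[OF bilinear_form_left[OF b assms(3)]] pr_I[OF assms(2)] by simp
 show "B (pr y) (pr z) = 0"
 using linear_form_zero[OF bilinear_form_right[OF b assms(3)]] pr_I[OF assms(2)] by simp
qed

lemma pr_counit: assumes "a : carrier A" shows "counit Q (pr a) = counit A a"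
proof -
 have "(SOME x. x : pr a) : pr a" by (rule someI[of _ a]) (rule pr_self[OF assms])
 then have s: "(SOME x. x : pr a) : carrier A" "(SOME x. x : pr a) \<ominus>\<^bsub>A\<^esub> a : I"
 using mem_pr[OF _ assms] by auto
 then have "counit A ((SOME x. x : pr a) \<ominus>\<^bsub>A\<^esub> a) = 0" using biideal by (auto simp: biideal_def)
 then have "counit A (SOME x. x : pr a) = counit A a"
 using linear_form_diff[OF counit_linear s(1) assms] by simp
 then show ?thesis
 by (simp add: quotient_face_alg_def Let_def module.defs ring.defs face_alg.defs)
qed

lemma pr_comult_raw:
 assumes "a : carrier A"
 shows "comult Q (pr a) B = (if bilinear_form Q B then comult A a (%x y. B (pr x) (pr y)) else 0)"
proof -
 let ?Q = "ring.extend (A Quot I) (module.fields (%c X. \<Union>x\<in>X. I +>\<^bsub>A\<^esub> (c \<odot>\<^bsub>A\<^esub> x)))"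
 let ?s = "SOME x. x : pr a"
 have "?s : pr a" by (rule someI[of _ a]) (rule pr_self[OF assms])
 then have s: "?s : carrier A" "?s \<ominus>\<^bsub>A\<^esub> a : I" using mem_pr[OF _ assms] by auto
 have bq: "bilinear_form ?Q B = bilinear_form Q B"
 by (simp add: quotient_face_alg_def Let_def module.defs ring.defs face_alg.defs bilinear_form_def linear_form_def)
 have "comult A ?s (%x y. B (pr x) (pr y)) = comult A a (%x y. B (pr x) (pr y))"
 if B: "bilinear_form Q B"
 proof -
 have b: "bilinear_form A (%a b. B (pr a) (pr b))" using B by (simp add: bilinear_form_pr)
 have "comult A (?s \<ominus>\<^bsub>A\<^esub> a) (%x y. B (pr x) (pr y)) = 0"
  using biideal s(2) b pr_bilinear_vanish[OF B] by (auto simp: biideal_def)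
 then show ?thesis using linear_form_diff[OF linear_form_comult[OF b] s(1) assms] by simp
 qed
 moreover have "comult Q (pr a) B =
  (if bilinear_form ?Q B then comult A ?s (%x y. B (pr x) (pr y)) else 0)"
 by (simp add: quotient_face_alg_def Let_def module.defs ring.defs face_alg.defs)
 ultimately show ?thesis using bq by simp
qed

lemma pr_comult:
 "a : carrier A ==> bilinear_form Q B ==> comult Q (pr a) B = comult A a (%x y. B (pr x) (pr y))"
 by (simp add: pr_comult_raw)

lemma pr_idem: "face_idem Q i = pr (face_idem A i)" "face_idem_ring Q i = pr (face_idem_ring A i)"
 by (simp_all add: quotient_face_alg_def Let_def module.defs ring.defs face_alg.defs)

lemma Q_ring: "ring Q"
proof (rule ringI)
 show "abelian_group Q"
 proof (rule abelian_groupI)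
 fix x assume "x : carrier Q"
 then obtain a where a: "a : carrier A" "x = pr a" by (auto simp: Q_carrier)
 then have "pr (\<ominus>\<^bsub>A\<^esub> a) \<oplus>\<^bsub>Q\<^esub> x = \<zero>\<^bsub>Q\<^esub>" by (simp add: pr_add A_l_neg pr_zero)
 then show "EX y:carrier Q. y \<oplus>\<^bsub>Q\<^esub> x = \<zero>\<^bsub>Q\<^esub>" using a by (auto simp: Q_carrier)
 next
 show "\<zero>\<^bsub>Q\<^esub> : carrier Q" unfolding pr_zero[symmetric] by (simp add: Q_carrier)
 next
 fix x assume "x : carrier Q"
 then show "\<zero>\<^bsub>Q\<^esub> \<oplus>\<^bsub>Q\<^esub> x = x" unfolding pr_zero[symmetric] by (auto simp: Q_carrier pr_add)
 qed (auto simp: Q_carrier pr_add A_a_ac)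
 show "Group.monoid Q"
 proof (rule Group.monoidI)
 show "\<one>\<^bsub>Q\<^esub> : carrier Q" by (simp add: Q_carrier Q_ops)
 fix x assume "x : carrier Q"
 then show "\<one>\<^bsub>Q\<^esub> \<otimes>\<^bsub>Q\<^esub> x = x" "x \<otimes>\<^bsub>Q\<^esub> \<one>\<^bsub>Q\<^esub> = x"
  by (auto simp: Q_carrier Q_ops(2) pr_mult)
 qed (auto simp: Q_carrier pr_mult A_m_assoc)
qed (auto simp: Q_carrier pr_mult pr_add A_l_distr A_r_distr)

lemma Q_module: "Module.module complex_ring Q"
proof (rule moduleI)
 show "cring complex_ring" by (rule cring_complex_ring)
 show "abelian_group Q" using Q_ring by (simp add: ring_def)
 have one: "!!x. x : carrier A ==> 1 \<odot>\<^bsub>A\<^esub> x = x"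
 using smult_one by (simp add: complex_ring_def)
 have assoc: "!!a b x. x : carrier A ==> (a * b) \<odot>\<^bsub>A\<^esub> x = a \<odot>\<^bsub>A\<^esub> (b \<odot>\<^bsub>A\<^esub> x)"
 using smult_assoc1 by (simp add: complex_ring_def)
 have dist: "!!a b x. x : carrier A ==> (a + b) \<odot>\<^bsub>A\<^esub> x = a \<odot>\<^bsub>A\<^esub> x \<oplus>\<^bsub>A\<^esub> b \<odot>\<^bsub>A\<^esub> x"
 using smult_l_distr by (simp add: complex_ring_def)
 show "!!a x. a : carrier complex_ring ==> x : carrier Q ==> a \<odot>\<^bsub>Q\<^esub> x : carrier Q"
 by (auto simp: Q_carrier pr_smult smult_in)
 show "!!a b x. x : carrier Q ==> (a \<oplus>\<^bsub>complex_ring\<^esub> b) \<odot>\<^bsub>Q\<^esub> x = a \<odot>\<^bsub>Q\<^esub> x \<oplus>\<^bsub>Q\<^esub> b \<odot>\<^bsub>Q\<^esub> x"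
 by (auto simp: Q_carrier pr_smult pr_add smult_in dist complex_ring_def)
 show "!!a x y. x : carrier Q ==> y : carrier Q ==> a \<odot>\<^bsub>Q\<^esub> (x \<oplus>\<^bsub>Q\<^esub> y) = a \<odot>\<^bsub>Q\<^esub> x \<oplus>\<^bsub>Q\<^esub> a \<odot>\<^bsub>Q\<^esub> y"
 by (auto simp: Q_carrier pr_smult pr_add smult_in smult_plus)
 show "!!a b x. x : carrier Q ==> (a \<otimes>\<^bsub>complex_ring\<^esub> b) \<odot>\<^bsub>Q\<^esub> x = a \<odot>\<^bsub>Q\<^esub> (b \<odot>\<^bsub>Q\<^esub> x)"
 by (auto simp: Q_carrier pr_smult smult_in assoc complex_ring_def)
 show "!!x. x : carrier Q ==> \<one>\<^bsub>complex_ring\<^esub> \<odot>\<^bsub>Q\<^esub> x = x"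
 by (auto simp: Q_carrier pr_smult one complex_ring_def)
qed

lemma Q_comult_coassoc:
 assumes a: "a : carrier A" and T: "trilinear_form Q T"
 shows "comult Q (pr a) (%x y. comult Q x (%x1 x2. T x1 x2 y)) =
   comult Q (pr a) (%x y. comult Q y (%y1 y2. T x y1 y2))"
proof -
 let ?T = "%x y z. T (pr x) (pr y) (pr z)"
 have TA: "trilinear_form A ?T"
 using T by (auto simp: trilinear_form_def Q_carrier linear_form_pr)
 have tl: "bilinear_form Q (%x1 x2. T x1 x2 (pr y))" "bilinear_form Q (T (pr y))"
 if "y : carrier A" for y
 using trilinear_formD[OF T] that by (auto simp: Q_carrier)
 have e1: "comult Q (pr x) (%x1 x2. T x1 x2 (pr y)) = comult A x (%x1 x2. ?T x1 x2 y)"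
 and e2: "comult Q (pr x) (T (pr y)) = comult A x (?T y)"
 if "x : carrier A" "y : carrier A" for x y
 using that tl by (simp_all add: pr_comult)
 have lin: "linear_form A (%z. ?T z x y)" "linear_form A (%z. ?T x z y)" "linear_form A (%z. ?T x y z)"
 if "x : carrier A" "y : carrier A" for x y
 using TA that by (auto simp: trilinear_form_def)
 have bA: "bilinear_form A (%x y. comult A x (%x1 x2. ?T x1 x2 y))"
 unfolding bilinear_form_def
 proof (intro conjI ballI)
 fix y assume y: "y : carrier A"
 show "linear_form A (%x. comult A x (%x1 x2. ?T x1 x2 y))"
  by (rule linear_form_comult[OF trilinear_formD(1)[OF TA y]])
 show "linear_form A (%z. comult A y (%x1 x2. ?T x1 x2 z))"
  by (rule linear_form_comult_param[OF y lin(3) trilinear_formD(1)[OF TA]]) (simp_all add: smult_in)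
 qed
 have bA': "bilinear_form A (%x y. comult A y (?T x))"
 unfolding bilinear_form_def
 proof (intro conjI ballI)
 fix y assume y: "y : carrier A"
 show "linear_form A (%x. comult A x (?T y))"
  by (rule linear_form_comult[OF trilinear_formD(2)[OF TA y]])
 show "linear_form A (%z. comult A y (?T z))"
  by (rule linear_form_comult_param[OF y lin(1) trilinear_formD(2)[OF TA]]) (simp_all add: smult_in)
 qed
 have bQ: "bilinear_form Q (%x y. comult Q x (%x1 x2. T x1 x2 y))"
 unfolding bilinear_form_pr using bA
 by (rule iffD1[OF bilinear_form_cong, rotated]) (simp add: e1)
 have bQ': "bilinear_form Q (%x y. comult Q y (T x))"
 unfolding bilinear_form_pr using bA'
 by (rule iffD1[OF bilinear_form_cong, rotated]) (simp add: e2)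
 have "comult Q (pr a) (%x y. comult Q x (%x1 x2. T x1 x2 y)) =
  comult A a (%x y. comult Q (pr x) (%x1 x2. T x1 x2 (pr y)))"
 by (rule pr_comult[OF a bQ])
 also have "... = comult A a (%x y. comult A x (%x1 x2. ?T x1 x2 y))"
 by (rule comult_cong[OF a]) (simp add: e1)
 also have "... = comult A a (%x y. comult A y (?T x))"
 by (rule coassoc[OF a TA])
 also have "... = comult A a (%x y. comult Q (pr y) (T (pr x)))"
 by (rule comult_cong[OF a]) (simp add: e2)
 also have "... = comult Q (pr a) (%x y. comult Q y (T x))"
 by (rule pr_comult[OF a bQ', symmetric])
 finally show ?thesis .
qed

lemma Q_comult_mult:
 assumes a: "a : carrier A" and b: "b : carrier A" and B: "bilinear_form Q B"
 shows "comult Q (pr a \<otimes>\<^bsub>Q\<^esub> pr b) B =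
 comult Q (pr a) (%a1 a2. comult Q (pr b) (%b1 b2. B (a1 \<otimes>\<^bsub>Q\<^esub> b1) (a2 \<otimes>\<^bsub>Q\<^esub> b2)))"
proof -
 let ?B = "%x y. B (pr x) (pr y)"
 let ?f = "%a1 a2. comult A b (%b1 b2. ?B (a1 \<otimes>\<^bsub>A\<^esub> b1) (a2 \<otimes>\<^bsub>A\<^esub> b2))"
 have BA: "bilinear_form A ?B" using B by (simp add: bilinear_form_pr)
 have inner: "comult Q (pr b) (%b1 b2. B (pr a1 \<otimes>\<^bsub>Q\<^esub> b1) (pr a2 \<otimes>\<^bsub>Q\<^esub> b2)) = ?f a1 a2"
 if a12: "a1 : carrier A" "a2 : carrier A" for a1 a2
 proof -
 have "bilinear_form A (%b1 b2. B (pr a1 \<otimes>\<^bsub>Q\<^esub> pr b1) (pr a2 \<otimes>\<^bsub>Q\<^esub> pr b2))"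
  using bilinear_form_mult(2)[OF BA a12]
  by (rule iffD1[OF bilinear_form_cong, rotated]) (simp add: pr_mult a12)
 then show ?thesis
  by (subst pr_comult[OF b]) (auto simp: bilinear_form_pr pr_mult a12 intro!: comult_cong[OF b])
 qed
 have "linear_form A (%a1. ?f a1 a2)" if a2: "a2 : carrier A" for a2
 proof (rule linear_form_comult_param[OF b])
 fix x y assume "x : carrier A" "y : carrier A"
 then show "linear_form A (%a1. ?B (a1 \<otimes>\<^bsub>A\<^esub> x) (a2 \<otimes>\<^bsub>A\<^esub> y))"
  using linear_form_mult_left[OF bilinear_form_left[OF BA, of "a2 \<otimes>\<^bsub>A\<^esub> y"]] a2 by simp
 qed (use a2 bilinear_form_mult(2)[OF BA] in \<open>simp_all add: smult_in\<close>)
 moreover have "linear_form A (?f a1)" if a1: "a1 : carrier A" for a1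
 proof (rule linear_form_comult_param[OF b])
 fix x y assume "x : carrier A" "y : carrier A"
 then show "linear_form A (%a2. ?B (a1 \<otimes>\<^bsub>A\<^esub> x) (a2 \<otimes>\<^bsub>A\<^esub> y))"
  using linear_form_mult_left[OF bilinear_form_right[OF BA, of "a1 \<otimes>\<^bsub>A\<^esub> x"]] a1 by simp
 qed (use a1 bilinear_form_mult(2)[OF BA] in \<open>simp_all add: smult_in\<close>)
 ultimately have fA: "bilinear_form A ?f" by (simp add: bilinear_form_def)
 have fQ: "bilinear_form Q (%a1 a2. comult Q (pr b) (%b1 b2. B (a1 \<otimes>\<^bsub>Q\<^esub> b1) (a2 \<otimes>\<^bsub>Q\<^esub> b2)))"
 unfolding bilinear_form_pr using fA
 by (rule iffD1[OF bilinear_form_cong, rotated]) (simp add: inner)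
 have "comult Q (pr a \<otimes>\<^bsub>Q\<^esub> pr b) B = comult A a ?f"
 using a b B BA by (simp add: pr_mult pr_comult comult_mult)
 also have "... = comult A a (%a1 a2. comult Q (pr b) (%b1 b2. B (pr a1 \<otimes>\<^bsub>Q\<^esub> b1) (pr a2 \<otimes>\<^bsub>Q\<^esub> b2)))"
 by (rule comult_cong[OF a]) (simp add: inner)
 also have "... = comult Q (pr a) (%a1 a2. comult Q (pr b) (%b1 b2. B (a1 \<otimes>\<^bsub>Q\<^esub> b1) (a2 \<otimes>\<^bsub>Q\<^esub> b2)))"
 by (rule pr_comult[OF a fQ, symmetric])
 finally show ?thesis .
qed

lemma pr_finsum:
 assumes "finite S" "!!k. k : S ==> f k : carrier A"
 shows "(\<Oplus>\<^bsub>Q\<^esub>k\<in>S. pr (f k)) = pr (\<Oplus>\<^bsub>A\<^esub>k\<in>S. f k)"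
proof -
 interpret R: ring Q by (rule Q_ring)
 show ?thesis using assms
 proof (induction S rule: finite_induct)
 case empty
 then show ?case by (simp add: pr_zero)
 next
 case (insert x F)
 then show ?case by (simp add: pr_add Q_carrier)
 qed
qed

text \<open>Every axiom is inherited: a form on the quotient is a form on \<open>A\<close> which vanishes on \<open>I\<close>, so identities
  that are tested against forms can be checked on representatives.\<close>

theorem Q_face_algebra: "face_algebra V Q"
proof -
 interpret RQ: ring Q by (rule Q_ring)
 interpret MQ: Module.module complex_ring Q by (rule Q_module)
 have prc: "pr a : carrier Q" if "a : carrier A" for a using that by (simp add: Q_carrier)
 show ?thesis
 proof unfold_locales
 show "finite V" by (rule finite_V)
 show "V ~= {}" by (rule nonempty_V)
 show "linear_form Q (counit Q)"
  unfolding linear_form_pr using counit_linear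
  by (rule iffD1[OF linear_form_cong, rotated]) (simp add: pr_counit)
 next
 fix a b c assume "a : carrier Q" "b : carrier Q"
 then show "c \<odot>\<^bsub>Q\<^esub> a \<otimes>\<^bsub>Q\<^esub> b = c \<odot>\<^bsub>Q\<^esub> (a \<otimes>\<^bsub>Q\<^esub> b)"
  "a \<otimes>\<^bsub>Q\<^esub> (c \<odot>\<^bsub>Q\<^esub> b) = c \<odot>\<^bsub>Q\<^esub> (a \<otimes>\<^bsub>Q\<^esub> b)"
  by (auto simp: Q_carrier pr_mult pr_smult smult_in smult_mult_l smult_mult_r)
 next
 fix x assume "x : carrier Q"
 then obtain a where a: "a : carrier A" "x = pr a" by (auto simp: Q_carrier)
 obtain xs where xs: "set xs \<subseteq> carrier A \<times> carrier A"
  "!!B. bilinear_form A B ==> comult A a B = (\<Sum>(x, y)\<leftarrow>xs. B x y)"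
  using comult_repr[OF a(1)] by metis
 let ?ys = "map (%(x, y). (pr x, pr y)) xs"
 have "comult Q x = (%B. \<Sum>(x, y)\<leftarrow>?ys. pure_tensor Q x y B)"
 proof
  fix B
  show "comult Q x B = (\<Sum>(x, y)\<leftarrow>?ys. pure_tensor Q x y B)"
  using xs(2)[of "%x y. B (pr x) (pr y)"] a
  by (simp add: pr_comult_raw pure_tensor_def bilinear_form_pr comp_def case_prod_unfold)
 qed
 moreover have "set ?ys \<subseteq> carrier Q \<times> carrier Q" using xs(1) by (auto simp: Q_carrier)
 ultimately show "comult Q x : tensor_square Q" unfolding tensor_square_def by blast
 fix c
 show "comult Q (c \<odot>\<^bsub>Q\<^esub> x) = (%B. c * comult Q x B)"
  using a by (auto simp: pr_smult smult_in pr_comult_raw comult_smult)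
 next
 fix x y assume "x : carrier Q" "y : carrier Q"
 then show "comult Q (x \<oplus>\<^bsub>Q\<^esub> y) = (%B. comult Q x B + comult Q y B)"
  by (auto simp: Q_carrier pr_add pr_comult_raw comult_add)
 next
 fix x T assume "x : carrier Q" "trilinear_form Q T"
 then show "comult Q x (%x y. comult Q x (%x1 x2. T x1 x2 y)) =
   comult Q x (%x y. comult Q y (%y1 y2. T x y1 y2))"
  using Q_comult_coassoc by (auto simp: Q_carrier)
 next
 fix x X assume "x : carrier Q" and X: "linear_form Q X"
 then obtain a where a: "a : carrier A" "x = pr a" by (auto simp: Q_carrier)
 have XA: "linear_form A (%a. X (pr a))" using X by (simp add: linear_form_pr)
 have cQ: "linear_form Q (counit Q)"
  unfolding linear_form_pr using counit_linear
  by (rule iffD1[OF linear_form_cong, rotated]) (simp add: pr_counit)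
 show "comult Q x (%x y. counit Q x * X y) = X x"
  using a X cQ counit_l[OF a(1) XA]
  comult_cong[OF a(1), of "%x y. counit Q (pr x) * X (pr y)" "%x y. counit A x * X (pr y)"]
  by (simp add: pr_comult bilinear_form_prod pr_counit)
 show "comult Q x (%x y. X x * counit Q y) = X x"
  using a X cQ counit_r[OF a(1) XA]
  comult_cong[OF a(1), of "%x y. X (pr x) * counit Q (pr y)" "%x y. X (pr x) * counit A y"]
  by (simp add: pr_comult bilinear_form_prod pr_counit)
 next
 fix x y B assume "x : carrier Q" "y : carrier Q" "bilinear_form Q B"
 then show "comult Q (x \<otimes>\<^bsub>Q\<^esub> y) B =
  comult Q x (%a1 a2. comult Q y (%b1 b2. B (a1 \<otimes>\<^bsub>Q\<^esub> b1) (a2 \<otimes>\<^bsub>Q\<^esub> b2)))"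
  using Q_comult_mult by (auto simp: Q_carrier)
 next
 fix i assume "i : V"
 then show "face_idem Q i : carrier Q" "face_idem_ring Q i : carrier Q"
  by (auto simp: pr_idem Q_carrier idem_closed idem_ring_closed)
 next
 fix i j assume ij: "i : V" "j : V"
 note cl = ij[THEN idem_closed] ij[THEN idem_ring_closed]
 show "face_idem Q i \<otimes>\<^bsub>Q\<^esub> face_idem Q j = (if i = j then face_idem Q i else \<zero>\<^bsub>Q\<^esub>)"
  using ij cl by (simp add: pr_idem pr_mult idem_mult pr_zero)
 show "face_idem_ring Q i \<otimes>\<^bsub>Q\<^esub> face_idem_ring Q j = (if i = j then face_idem_ring Q i else \<zero>\<^bsub>Q\<^esub>)"
  using ij cl by (simp add: pr_idem pr_mult idem_ring_mult pr_zero)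
 show "face_idem Q i \<otimes>\<^bsub>Q\<^esub> face_idem_ring Q j = face_idem_ring Q j \<otimes>\<^bsub>Q\<^esub> face_idem Q i"
  using ij cl by (simp add: pr_idem pr_mult idem_commute)
 show "counit Q (face_idem_ring Q i \<otimes>\<^bsub>Q\<^esub> face_idem Q j) = (if i = j then 1 else 0)"
  using ij cl by (simp add: pr_idem pr_mult pr_counit counit_idem)
 have pt: "pure_tensor Q (pr u) (pr v) B = (if bilinear_form Q B then pure_tensor A u v (%x y. B (pr x) (pr y)) else 0)"
  for u v B by (simp add: pure_tensor_def bilinear_form_pr)
 show "comult Q (face_idem_ring Q i \<otimes>\<^bsub>Q\<^esub> face_idem Q j) =
  (%B. SUM k:V. pure_tensor Q (face_idem_ring Q i \<otimes>\<^bsub>Q\<^esub> face_idem Q k)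
   (face_idem_ring Q k \<otimes>\<^bsub>Q\<^esub> face_idem Q j) B)"
  using ij cl
  by (auto simp: pr_idem pr_mult pr_comult_raw comult_idem pt idem_closed idem_ring_closed
   intro!: ext sum.cong)
 next
 show "(\<Oplus>\<^bsub>Q\<^esub>k\<in>V. face_idem Q k) = \<one>\<^bsub>Q\<^esub>"
  unfolding pr_idem by (subst pr_finsum) (auto simp: finite_V idem_closed idem_sum Q_ops)
 show "(\<Oplus>\<^bsub>Q\<^esub>k\<in>V. face_idem_ring Q k) = \<one>\<^bsub>Q\<^esub>"
  unfolding pr_idem by (subst pr_finsum) (auto simp: finite_V idem_ring_closed idem_ring_sum Q_ops)
 next
 fix x y assume "x : carrier Q" "y : carrier Q"
 then obtain a b where ab: "a : carrier A" "x = pr a" "b : carrier A" "y = pr b"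
  by (auto simp: Q_carrier)
 have "counit Q (x \<otimes>\<^bsub>Q\<^esub> y) = counit A (a \<otimes>\<^bsub>A\<^esub> b)"
  using ab by (simp add: pr_mult pr_counit)
 also have "... = (SUM k:V. counit A (a \<otimes>\<^bsub>A\<^esub> face_idem A k) * counit A (face_idem_ring A k \<otimes>\<^bsub>A\<^esub> b))"
  using ab by (intro counit_mult)
 also have "... = (SUM k:V. counit Q (x \<otimes>\<^bsub>Q\<^esub> face_idem Q k) * counit Q (face_idem_ring Q k \<otimes>\<^bsub>Q\<^esub> y))"
  using ab by (intro sum.cong) (simp_all add: pr_idem pr_mult pr_counit idem_closed idem_ring_closed)
 finally show "counit Q (x \<otimes>\<^bsub>Q\<^esub> y) =
  (SUM k:V. counit Q (x \<otimes>\<^bsub>Q\<^esub> face_idem Q k) * counit Q (face_idem_ring Q k \<otimes>\<^bsub>Q\<^esub> y))" .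
 qed
qed

text \<open>This is how functionals on the quotients arise: by checking that they vanish on the ideal.\<close>

lemma form_descends:
 assumes F: "linear_form A F" and zero: "!!x. x : I ==> F x = 0"
 obtains F' where "linear_form Q F'" "!!a. a : carrier A ==> F' (pr a) = F a"
proof -
 let ?F = "%X. F (SOME x. x : X)"
 have eq: "?F (pr a) = F a" if a: "a : carrier A" for a
 proof -
 have "(SOME x. x : pr a) : pr a" by (rule someI[of _ a]) (rule pr_self[OF a])
 then have "(SOME x. x : pr a) : carrier A" "(SOME x. x : pr a) \<ominus>\<^bsub>A\<^esub> a : I"
  using mem_pr[OF _ a] by auto
 then show ?thesis using linear_form_diff[OF F _ a] zero by force
 qed
 have "linear_form Q ?F"
 unfolding linear_form_pr using F
 by (rule iffD1[OF linear_form_cong, rotated]) (simp add: eq)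
 then show ?thesis using eq that by blast
qed

end

context face_algebra
begin

lemma idealI_closed:
 assumes "K \<subseteq> carrier A" "\<zero>\<^bsub>A\<^esub> : K" "!!x y. x : K ==> y : K ==> x \<oplus>\<^bsub>A\<^esub> y : K"
 and l: "!!x a. x : K ==> a : carrier A ==> a \<otimes>\<^bsub>A\<^esub> x : K"
 and r: "!!x a. x : K ==> a : carrier A ==> x \<otimes>\<^bsub>A\<^esub> a : K"
 shows "ideal K A"
proof (rule idealI[OF A_ring])
 show "subgroup K (add_monoid A)"
 proof (unfold_locales)
 fix x assume x: "x : K"
 have "(\<ominus>\<^bsub>A\<^esub> \<one>\<^bsub>A\<^esub>) \<otimes>\<^bsub>A\<^esub> x = \<ominus>\<^bsub>A\<^esub> x"
  using x assms(1) by (simp add: ring.l_minus[OF A_ring] subset_iff)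
 then have "\<ominus>\<^bsub>A\<^esub> x : K" using l[OF x] by (metis abelian_group.a_inv_closed[OF A_abelian_group] Group.monoid.one_closed[OF ring.axioms(2)[OF A_ring]])
 then show "inv\<^bsub>add_monoid A\<^esub> x : K" by (simp add: a_inv_def)
 qed (use assms in auto)
qed (use l r in auto)

lemma comult_zero_form: "a : carrier A ==> comult A a (%x y. 0) = 0"
proof -
 assume a: "a : carrier A"
 have "bilinear_form A (%x y. 0)" by (simp add: bilinear_form_def linear_form_def)
 then show ?thesis using comult_repr[OF a] by (metis (mono_tags, lifting) case_prod_unfold map_eq_conv sum_list_0)
qed

text \<open>It suffices to check the coideal conditions on generators: \<open>\<Delta>\<close> is multiplicative, and by
  the last axiom of a face algebra the counit of a product \<open>a g b\<close> is determined by the values on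
  the corner elements between the idempotents of \<open>a\<close> and of \<open>b\<close>.\<close>

lemma biideal_genideal:
 assumes S: "S \<subseteq> carrier A"
 and counit: "!!g k l. g : S ==> k : V ==> l : V ==>
  counit A (face_idem_ring A k \<otimes>\<^bsub>A\<^esub> (g \<otimes>\<^bsub>A\<^esub> face_idem A l)) = 0"
 and comult: "!!g B. g : S ==> bilinear_form A B ==>
  (!!z y. z : Idl\<^bsub>A\<^esub> S ==> y : carrier A ==> B z y = 0 & B y z = 0) ==> comult A g B = 0"
 shows "biideal A (Idl\<^bsub>A\<^esub> S)"
proof -
 let ?I = "Idl\<^bsub>A\<^esub> S"
 have I: "ideal ?I A" by (rule ring.genideal_ideal[OF A_ring S])
 interpret I: ideal ?I A by (rule I)
 have lin0: "X \<zero>\<^bsub>A\<^esub> = 0" if "linear_form A X" for X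
 using linear_form_smult[OF that, of "\<zero>\<^bsub>A\<^esub>" 0] by (simp add: smult_r_null complex_ring_def)
 let ?K1 = "{x : carrier A. ALL a:carrier A. ALL b:carrier A. counit A (a \<otimes>\<^bsub>A\<^esub> (x \<otimes>\<^bsub>A\<^esub> b)) = 0}"
 have "ideal ?K1 A"
 proof (rule idealI_closed)
 show "\<zero>\<^bsub>A\<^esub> : ?K1" using lin0[OF counit_linear] by simp
 fix x y assume "x : ?K1" "y : ?K1"
 then show "x \<oplus>\<^bsub>A\<^esub> y : ?K1"
  using linear_form_add[OF counit_linear] by (simp add: A_l_distr A_r_distr)
 next
 fix x a assume "x : ?K1" "a : carrier A"
 then show "a \<otimes>\<^bsub>A\<^esub> x : ?K1" "x \<otimes>\<^bsub>A\<^esub> a : ?K1"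
  by (auto simp: A_m_assoc[symmetric]) (simp add: A_m_assoc)
 qed auto
 moreover have "S \<subseteq> ?K1"
 proof
 fix g assume g: "g : S"
 then have gc: "g : carrier A" using S by auto
 have "counit A (a \<otimes>\<^bsub>A\<^esub> (g \<otimes>\<^bsub>A\<^esub> b)) = 0" if ab: "a : carrier A" "b : carrier A" for a b
 proof -
  have "counit A (face_idem_ring A k \<otimes>\<^bsub>A\<^esub> (g \<otimes>\<^bsub>A\<^esub> b)) = 0" if k: "k : V" for k
  proof -
  have "counit A (face_idem_ring A k \<otimes>\<^bsub>A\<^esub> (g \<otimes>\<^bsub>A\<^esub> b)) =
   counit A (face_idem_ring A k \<otimes>\<^bsub>A\<^esub> g \<otimes>\<^bsub>A\<^esub> b)"
   using k ab gc by (simp add: A_m_assoc idem_ring_closed)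
  also have "... = (SUM l:V. counit A (face_idem_ring A k \<otimes>\<^bsub>A\<^esub> g \<otimes>\<^bsub>A\<^esub> face_idem A l) *
   counit A (face_idem_ring A l \<otimes>\<^bsub>A\<^esub> b))"
   using k ab gc by (intro counit_mult) (auto simp: idem_ring_closed)
  also have "... = 0"
   using counit[OF g k] k gc by (intro sum.neutral) (simp add: A_m_assoc idem_ring_closed idem_closed)
  finally show ?thesis .
  qed
  then show ?thesis
  using ab gc by (subst counit_mult) (auto intro!: sum.neutral)
 qed
 then show "g : ?K1" using gc by simp
 qed
 ultimately have sub1: "?I \<subseteq> ?K1" by (rule ring.genideal_minimal[OF A_ring])
 define van where "van B \<longleftrightarrow> bilinear_form A B & (ALL z:?I. ALL y:carrier A. B z y = 0 & B y z = 0)" for B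
 let ?K2 = "{x : carrier A. ALL B. van B --> comult A x B = 0}"
 have van_mult: "van (%x1 x2. B (a1 \<otimes>\<^bsub>A\<^esub> x1) (a2 \<otimes>\<^bsub>A\<^esub> x2))" "van (%x1 x2. B (x1 \<otimes>\<^bsub>A\<^esub> a1) (x2 \<otimes>\<^bsub>A\<^esub> a2))"
 if "van B" "a1 : carrier A" "a2 : carrier A" for B a1 a2
 using that bilinear_form_mult I.I_l_closed I.I_r_closed unfolding van_def by auto
 have "ideal ?K2 A"
 proof (rule idealI_closed)
 show "\<zero>\<^bsub>A\<^esub> : ?K2" using lin0[OF linear_form_comult] by (simp add: van_def)
 fix x y assume "x : ?K2" "y : ?K2"
 then show "x \<oplus>\<^bsub>A\<^esub> y : ?K2" by (simp add: comult_add)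
 next
 fix x a assume x: "x : ?K2" and a: "a : carrier A"
 have "comult A (a \<otimes>\<^bsub>A\<^esub> x) B = 0" if B: "van B" for B
 proof -
  have "comult A (a \<otimes>\<^bsub>A\<^esub> x) B = comult A a (%a1 a2. comult A x (%b1 b2. B (a1 \<otimes>\<^bsub>A\<^esub> b1) (a2 \<otimes>\<^bsub>A\<^esub> b2)))"
  using x a B by (intro comult_mult) (auto simp: van_def)
  also have "... = comult A a (%a1 a2. 0)"
  using x van_mult(1)[OF B] by (intro comult_cong[OF a]) auto
  finally show ?thesis using comult_zero_form[OF a] by simp
 qed
 then show "a \<otimes>\<^bsub>A\<^esub> x : ?K2" using x a by simp
 have "comult A (x \<otimes>\<^bsub>A\<^esub> a) B = 0" if B: "van B" for B
 proof -
  obtain xs where xs: "set xs \<subseteq> carrier A \<times> carrier A"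
  "!!B. bilinear_form A B ==> comult A a B = (\<Sum>(x, y)\<leftarrow>xs. B x y)"
  using comult_repr[OF a] by metis
  let ?B = "%x1 x2. \<Sum>(u, v)\<leftarrow>xs. B (x1 \<otimes>\<^bsub>A\<^esub> u) (x2 \<otimes>\<^bsub>A\<^esub> v)"
  have vB: "van ?B"
  unfolding van_def case_prod_unfold
  proof (intro conjI ballI)
  show "bilinear_form A (%x1 x2. \<Sum>p\<leftarrow>xs. B (x1 \<otimes>\<^bsub>A\<^esub> fst p) (x2 \<otimes>\<^bsub>A\<^esub> snd p))"
   using van_mult(2)[OF B] xs(1) unfolding van_def by (intro bilinear_form_sum_list) auto
  fix z y assume zy: "z : ?I" "y : carrier A"
  have z: "B (z \<otimes>\<^bsub>A\<^esub> fst p) (y \<otimes>\<^bsub>A\<^esub> snd p) = 0 & B (y \<otimes>\<^bsub>A\<^esub> fst p) (z \<otimes>\<^bsub>A\<^esub> snd p) = 0"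
   if "p : set xs" for p
   using van_mult(2)[OF B] xs(1) that zy unfolding van_def by auto
  have "map (%p. B (z \<otimes>\<^bsub>A\<^esub> fst p) (y \<otimes>\<^bsub>A\<^esub> snd p)) xs = map (%p. 0) xs"
   "map (%p. B (y \<otimes>\<^bsub>A\<^esub> fst p) (z \<otimes>\<^bsub>A\<^esub> snd p)) xs = map (%p. 0) xs"
   using z by auto
  then show "(\<Sum>p\<leftarrow>xs. B (z \<otimes>\<^bsub>A\<^esub> fst p) (y \<otimes>\<^bsub>A\<^esub> snd p)) = 0"
   "(\<Sum>p\<leftarrow>xs. B (y \<otimes>\<^bsub>A\<^esub> fst p) (z \<otimes>\<^bsub>A\<^esub> snd p)) = 0"
   by (simp_all only: sum_list_0)
  qed
  have "comult A (x \<otimes>\<^bsub>A\<^esub> a) B = comult A x (%a1 a2. comult A a (%b1 b2. B (a1 \<otimes>\<^bsub>A\<^esub> b1) (a2 \<otimes>\<^bsub>A\<^esub> b2)))"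
  using x a B by (intro comult_mult) (auto simp: van_def)
  also have "... = comult A x ?B"
  using van_mult(1)[OF B] x unfolding van_def by (intro comult_cong xs(2)) auto
  finally show ?thesis using x vB by simp
 qed
 then show "x \<otimes>\<^bsub>A\<^esub> a : ?K2" using x a by simp
 qed auto
 moreover have "S \<subseteq> ?K2" using comult S by (auto simp: van_def)
 ultimately have sub2: "?I \<subseteq> ?K2" by (rule ring.genideal_minimal[OF A_ring])
 have "counit A x = 0" if x: "x : ?I" for x
 proof -
 have "counit A (\<one>\<^bsub>A\<^esub> \<otimes>\<^bsub>A\<^esub> (x \<otimes>\<^bsub>A\<^esub> \<one>\<^bsub>A\<^esub>)) = 0"
  using subsetD[OF sub1 x] Group.monoid.one_closed[OF ring.axioms(2)[OF A_ring]] by blast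
 then show ?thesis using I.Icarr[OF x] by simp
 qed
 then show ?thesis using I sub2 unfolding biideal_def van_def by blast
qed

end

section \<open>Paths\<close>

context pre_digraph
begin

lemma path_end_Nil [simp]: "path_end G (u, []) = u"
 by (simp add: path_end_def)

lemma path_end_Cons: "path_end G (u, e # es) = path_end G (head G e, es)"
 by (cases es) (simp_all add: path_end_def)

lemma fst_path_concat [simp]: "fst (path_concat p r) = fst p"
 by (simp add: path_concat_def)

lemma path_end_append: "path_end G (u, es @ fs) = path_end G (path_end G (u, es), fs)"
 by (induction es arbitrary: u) (simp_all add: path_end_Cons)

lemma path_end_concat: "path_end G p = fst r ==> path_end G (path_concat p r) = path_end G r"
 by (cases p; cases r) (simp add: path_concat_def path_end_append)

lemma path_concat_assoc: "path_concat (path_concat p q) r = path_concat p (path_concat q r)"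
 by (simp add: path_concat_def)

end

context wf_digraph
begin

lemma path_Nil_iff: "(u, es) : paths G 0 \<longleftrightarrow> u : verts G & es = []"
 by (auto simp: paths_def awalk_def)

lemma path_Cons_iff:
 "(u, e # es) : paths G (Suc m) \<longleftrightarrow> e : arcs G & tail G e = u & (head G e, es) : paths G m"
 by (auto simp: paths_def awalk_Cons_iff)

lemma path_length: "p : paths G m ==> length (snd p) = m"
 by (auto simp: paths_def)

lemma path_start: "p : paths G m ==> fst p : verts G"
 by (auto simp: paths_def awalk_def)

lemma path_end_vert: "p : paths G m ==> path_end G p : verts G"
proof (induction m arbitrary: p)
 case 0
 then show ?case by (cases p) (simp add: path_Nil_iff)
next
 case (Suc m)
 obtain u e es where p: "p = (u, e # es)"
 using path_length[OF Suc.prems] by (cases p; cases "snd p") auto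
 then show ?case using Suc by (simp add: path_Cons_iff path_end_Cons)
qed

lemma path_append_iff:
 "(u, es @ fs) : paths G (m + n) & length es = m \<longleftrightarrow>
 (u, es) : paths G m & (path_end G (u, es), fs) : paths G n"
proof (induction m arbitrary: u es)
 case 0
 then show ?case using path_start[of "(u, fs)" n] by (auto simp: path_Nil_iff)
next
 case (Suc m)
 show ?case
 proof (cases es)
 case Nil
 then show ?thesis by (auto dest: path_length)
 next
 case (Cons e es')
 then show ?thesis using Suc.IH[of "head G e" es']
  by (auto simp: path_Cons_iff path_end_Cons)
 qed
qed

lemma path_concat_in:
 "p : paths G m ==> r : paths G n ==> path_end G p = fst r ==> path_concat p r : paths G (m + n)"
 using path_append_iff[of "fst p" "snd p" "snd r" m n] by (simp add: path_concat_def)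

lemma path_concat_inject:
 assumes "p : paths G m" "q : paths G m" "path_end G p = fst r" "path_end G q = fst s"
 and "path_concat p r = path_concat q s"
 shows "p = q & r = s"
proof -
 have "length (snd p) = length (snd q)" using assms(1,2) by (simp add: path_length)
 then have "fst p = fst q" "snd p = snd q" "snd r = snd s"
 using assms(5) by (auto simp: path_concat_def)
 then show ?thesis using assms(3,4) by (metis prod.collapse)
qed

lemma path_split:
 assumes "x : paths G (m + n)"
 obtains p r where "p : paths G m" "r : paths G n" "path_end G p = fst r" "x = path_concat p r"
proof -
 have len: "length (snd x) = m + n" by (rule path_length[OF assms])
 let ?p = "(fst x, take m (snd x))" and ?r = "(path_end G (fst x, take m (snd x)), drop m (snd x))"
 have "?p : paths G m & ?r : paths G n"
 using path_append_iff[of "fst x" "take m (snd x)" "drop m (snd x)" m n] assms len by simp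
 then show ?thesis by (intro that[of ?p ?r]) (simp_all add: path_concat_def)
qed

lemma sum_paths_concat:
 fixes f :: "_ => 'c :: comm_monoid_add"
 shows "(SUM x:paths G (m + n). f x) =
 (SUM (p, r):{(p, r). p : paths G m & r : paths G n & path_end G p = fst r}. f (path_concat p r))"
proof (rule sum.reindex_cong[where l = "%(p, r). path_concat p r"])
 show "inj_on (%(p, r). path_concat p r) {(p, r). p : paths G m & r : paths G n & path_end G p = fst r}"
 proof (rule inj_onI)
 fix x y assume "x : {(p, r). p : paths G m & r : paths G n & path_end G p = fst r}"
  "y : {(p, r). p : paths G m & r : paths G n & path_end G p = fst r}"
  "(case x of (p, r) => path_concat p r) = (case y of (p, r) => path_concat p r)"
 then show "x = y"
  using path_concat_inject[of "fst x" m "fst y" "snd x" "snd y"]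
  by (simp add: case_prod_unfold prod_eq_iff[of x y])
 qed
 show "paths G (m + n) = (%(p, r). path_concat p r) ` {(p, r). p : paths G m & r : paths G n & path_end G p = fst r}"
 (is "_ = _ ` ?S")
 proof (intro equalityI subsetI)
 fix x assume "x : paths G (m + n)"
 then obtain p r where "p : paths G m" "r : paths G n" "path_end G p = fst r" "x = path_concat p r"
  by (rule path_split)
 then show "x : (%(p, r). path_concat p r) ` ?S" by (intro image_eqI[of _ _ "(p, r)"]) auto
 qed (auto simp: path_concat_in)
qed auto

end

context fin_digraph
begin

lemma finite_paths [simp]: "finite (paths G m)"
proof -
 have "set es \<subseteq> arcs G" if "(u, es) : paths G m" for u es
 using that by (auto simp: paths_def awalk_def)
 then have "paths G m \<subseteq> verts G \<times> {es. set es \<subseteq> arcs G & length es = m}"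
 using path_start path_length by fastforce
 then show ?thesis
 by (rule finite_subset) (intro finite_cartesian_product finite_lists_length_eq, auto)
qed

lemma sum_paths_concat_if:
 fixes f :: "_ => 'c :: comm_monoid_add"
 shows "(SUM x:paths G (m + n). f x) =
 (SUM p:paths G m. SUM r:paths G n. if path_end G p = fst r then f (path_concat p r) else 0)"
proof -
 have "(SUM x:paths G (m + n). f x) =
  (SUM (p, r):paths G m \<times> paths G n. if path_end G p = fst r then f (path_concat p r) else 0)"
 unfolding sum_paths_concat
 by (rule sum.mono_neutral_cong_left) (auto split: if_splits)
 then show ?thesis by (simp add: sum.cartesian_product)
qed

end


section \<open>The face algebra of paths\<close>

lemma lookup_comb_scale [simp]: "Poly_Mapping.lookup (comb_scale c f) x = c * Poly_Mapping.lookup f x"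
 by (simp add: comb_scale_def map.rep_eq when_def)

lemma comb_scale_simps:
 "comb_scale c (f + g) = comb_scale c f + comb_scale c g"
 "comb_scale (c + d) f = comb_scale c f + comb_scale d f"
 "comb_scale c (comb_scale d f) = comb_scale (c * d) f"
 "comb_scale 1 f = f" "comb_scale 0 f = 0" "comb_scale c 0 = 0"
 by (auto intro!: poly_mapping_eqI simp: lookup_add algebra_simps)

lemma comb_scale_sum: "comb_scale c (SUM i:S. f i) = (SUM i:S. comb_scale c (f i))"
 by (induction S rule: infinite_finite_induct) (simp_all add: comb_scale_simps)

lemma keys_comb_scale: "Poly_Mapping.keys (comb_scale c f) \<subseteq> Poly_Mapping.keys f"
 by (auto simp: in_keys_iff)

lemma path_comb_expand:
 "f = (SUM x:Poly_Mapping.keys f. comb_scale (Poly_Mapping.lookup f x) (e_basis (fst x) (snd x)))"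
proof (rule poly_mapping_eqI)
 fix k
 show "Poly_Mapping.lookup f k = Poly_Mapping.lookup
  (SUM x:Poly_Mapping.keys f. comb_scale (Poly_Mapping.lookup f x) (e_basis (fst x) (snd x))) k"
 by (simp add: lookup_sum e_basis_def lookup_single when_def in_keys_iff sum.delta
  if_distrib[of "(*) _"] cong: if_cong)
qed

text \<open>Sums over the keys are linear extensions from the basis; enlarging the index set to a common
  finite superset makes additivity visible.\<close>

lemma sum_keys_superset:
 assumes "finite S" "Poly_Mapping.keys f \<subseteq> S" "!!x. h x 0 = 0"
 shows "(SUM x:Poly_Mapping.keys f. h x (Poly_Mapping.lookup f x)) = (SUM x:S. h x (Poly_Mapping.lookup f x))"
 using assms by (intro sum.mono_neutral_left) (auto simp: in_keys_iff)

lemma sum_keys_add: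
 fixes h :: "_ => complex => 'c :: comm_monoid_add"
 assumes "!!x. h x 0 = 0" "!!x a b. h x (a + b) = h x a + h x b"
 shows "(SUM x:Poly_Mapping.keys (f + g). h x (Poly_Mapping.lookup (f + g) x)) =
 (SUM x:Poly_Mapping.keys f. h x (Poly_Mapping.lookup f x)) +
 (SUM x:Poly_Mapping.keys g. h x (Poly_Mapping.lookup g x))"
proof -
 let ?S = "Poly_Mapping.keys f \<union> Poly_Mapping.keys g"
 have S: "finite ?S" by simp
 show ?thesis
 using sum_keys_superset[OF S, of "f + g" h] sum_keys_superset[OF S, of f h]
  sum_keys_superset[OF S, of g h] assms Poly_Mapping.keys_add[of f g]
 by (simp add: lookup_add sum.distrib)
qed

lemma sum_keys_scale:
 fixes h :: "_ => complex => 'c :: comm_monoid_add"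
 assumes "!!x. h x 0 = 0"
 shows "(SUM x:Poly_Mapping.keys (comb_scale c f). h x (Poly_Mapping.lookup (comb_scale c f) x)) =
 (SUM x:Poly_Mapping.keys f. h x (c * Poly_Mapping.lookup f x))"
proof -
 have S: "finite (Poly_Mapping.keys f)" by simp
 show ?thesis
 using sum_keys_superset[OF S keys_comb_scale, of h] assms by simp
qed

locale quiver = fin_digraph G for G :: "('v, 'e) pre_digraph" (structure) +
 assumes verts_nonempty: "verts G ~= {}"
begin

abbreviation "H \<equiv> path_face_alg G"

definition path_pairs :: "(('v, 'e) path \<times> ('v, 'e) path) set" where
 "path_pairs = (\<Union>m. paths G m \<times> paths G m)"

definition mul :: "('v, 'e) path_comb => ('v, 'e) path_comb => ('v, 'e) path_comb" where
 "mul = (%f g. SUM x:Poly_Mapping.keys f. SUM y:Poly_Mapping.keys g.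
  comb_scale (Poly_Mapping.lookup f x * Poly_Mapping.lookup g y) (e_basis_mult G x y))"

lemma H_simps:
 "carrier H = {f. Poly_Mapping.keys f \<subseteq> path_pairs}"
 "f \<otimes>\<^bsub>H\<^esub> g = mul f g"
 "\<one>\<^bsub>H\<^esub> = (SUM i:verts G. SUM j:verts G. e_basis (i, []) (j, []))"
 "\<zero>\<^bsub>H\<^esub> = 0" "f \<oplus>\<^bsub>H\<^esub> g = f + g" "c \<odot>\<^bsub>H\<^esub> f = comb_scale c f"
 by (simp_all add: path_face_alg_def path_module_def module.defs face_alg.defs path_pairs_def mul_def)

lemma H_idem:
 "face_idem H j = (SUM i:verts G. e_basis (i, []) (j, []))"
 "face_idem_ring H i = (SUM j:verts G. e_basis (i, []) (j, []))"
 by (simp_all add: path_face_alg_def module.defs face_alg.defs)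

lemma H_counit_raw:
 "counit H f = (SUM (p, q):Poly_Mapping.keys f. Poly_Mapping.lookup f (p, q) * (if p = q then 1 else 0))"
 by (simp add: path_face_alg_def module.defs face_alg.defs)

lemma bilinear_form_path_module: "bilinear_form (path_module G) B = bilinear_form H B"
 by (simp add: bilinear_form_def linear_form_def H_simps path_module_def path_pairs_def)

lemma H_comult_raw:
 "comult H f B = (SUM (p, q):Poly_Mapping.keys f. Poly_Mapping.lookup f (p, q) *
  (SUM r:paths G (length (snd p)). pure_tensor H (e_basis p r) (e_basis r q) B))"
proof -
 have pt: "pure_tensor (path_module G) x y B = pure_tensor H x y B" for x y
 by (simp only: pure_tensor_def bilinear_form_path_module)
 have "comult H f B = (SUM (p, q):Poly_Mapping.keys f. Poly_Mapping.lookup f (p, q) *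
  (SUM r:paths G (length (snd p)). pure_tensor (path_module G) (e_basis p r) (e_basis r q) B))"
 by (simp add: path_face_alg_def module.defs face_alg.defs)
 then show ?thesis unfolding pt .
qed

lemma keys_e_basis [simp]: "Poly_Mapping.keys (e_basis p q) = {(p, q)}"
 by (simp add: e_basis_def)

lemma lookup_e_basis: "Poly_Mapping.lookup (e_basis p q) x = (if x = (p, q) then 1 else 0)"
 by (simp add: e_basis_def lookup_single when_def)

lemma path_pairsI: "p : paths G m ==> q : paths G m ==> (p, q) : path_pairs"
 by (auto simp: path_pairs_def)

lemma path_pairs_iff: "(p, q) : path_pairs \<longleftrightarrow> p : paths G (length (snd p)) & q : paths G (length (snd p))"
 using path_length by (fastforce simp: path_pairs_def)

lemma e_basis_carrier: "(p, q) : path_pairs ==> e_basis p q : carrier H"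
 by (simp add: H_simps)

lemma H_zero_in: "0 : carrier H"
 by (simp add: H_simps)

lemma H_add_in: "f : carrier H ==> g : carrier H ==> f + g : carrier H"
 using Poly_Mapping.keys_add[of f g] by (auto simp: H_simps)

lemma H_scale_in: "f : carrier H ==> comb_scale c f : carrier H"
 using keys_comb_scale[of c f] by (auto simp: H_simps)

lemma H_sum_in: "(!!i. i : S ==> f i : carrier H) ==> (SUM i:S. f i) : carrier H"
 by (induction S rule: infinite_finite_induct) (auto intro: H_add_in H_zero_in)

lemma mul_add_left: "mul (f + g) h = mul f h + mul g h"
 using sum_keys_add[of "%x a. SUM y:Poly_Mapping.keys h. comb_scale (a * Poly_Mapping.lookup h y) (e_basis_mult G x y)" f g]
 by (simp add: mul_def comb_scale_simps algebra_simps sum.distrib)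

lemma mul_scale_left: "mul (comb_scale c f) h = comb_scale c (mul f h)"
 using sum_keys_scale[of "%x a. SUM y:Poly_Mapping.keys h. comb_scale (a * Poly_Mapping.lookup h y) (e_basis_mult G x y)" c f]
 by (simp add: mul_def comb_scale_simps comb_scale_sum algebra_simps)

lemma mul_swap: "mul f h = (SUM y:Poly_Mapping.keys h. SUM x:Poly_Mapping.keys f.
 comb_scale (Poly_Mapping.lookup f x * Poly_Mapping.lookup h y) (e_basis_mult G x y))"
 unfolding mul_def by (rule sum.swap)

lemma mul_add_right: "mul h (f + g) = mul h f + mul h g"
 using sum_keys_add[of "%y a. SUM x:Poly_Mapping.keys h. comb_scale (Poly_Mapping.lookup h x * a) (e_basis_mult G x y)" f g]
 by (simp add: mul_swap comb_scale_simps algebra_simps sum.distrib)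

lemma mul_scale_right: "mul h (comb_scale c f) = comb_scale c (mul h f)"
 using sum_keys_scale[of "%y a. SUM x:Poly_Mapping.keys h. comb_scale (Poly_Mapping.lookup h x * a) (e_basis_mult G x y)" c f]
 by (simp add: mul_swap comb_scale_simps comb_scale_sum algebra_simps)

lemma mul_zero [simp]: "mul 0 f = 0" "mul f 0 = 0"
 by (simp_all add: mul_def)

lemma mul_sum_left: "mul (SUM i:S. f i) h = (SUM i:S. mul (f i) h)"
 by (induction S rule: infinite_finite_induct) (simp_all add: mul_add_left)

lemma mul_sum_right: "mul h (SUM i:S. f i) = (SUM i:S. mul h (f i))"
 by (induction S rule: infinite_finite_induct) (simp_all add: mul_add_right)

lemma mul_basis:
 "mul (e_basis p q) (e_basis r s) =
 (if path_end G p = fst r & path_end G q = fst s then e_basis (path_concat p r) (path_concat q s) else 0)"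
 by (simp add: mul_def lookup_e_basis e_basis_mult_def comb_scale_simps)

lemma H_induct [consumes 1, case_names basis add scale]:
 assumes f: "f : carrier H"
 and basis: "!!m p q. p : paths G m ==> q : paths G m ==> P (e_basis p q)"
 and add: "!!f g. f : carrier H ==> g : carrier H ==> P f ==> P g ==> P (f + g)"
 and scale: "!!c f. f : carrier H ==> P f ==> P (comb_scale c f)"
 shows "P f"
proof -
 obtain i where "i : verts G" using verts_nonempty by auto
 then have i: "(i, []) : paths G 0" by (simp add: path_Nil_iff)
 have "P (comb_scale 0 (e_basis (i, []) (i, [])))"
 by (rule scale[OF e_basis_carrier[OF path_pairsI[OF i i]] basis[OF i i]])
 then have P0: "P 0" by (simp add: comb_scale_simps)
 have P_basis: "P (e_basis (fst x) (snd x))" if "x : path_pairs" for x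
 using that basis by (auto simp: path_pairs_def)
 have b_in: "e_basis (fst x) (snd x) : carrier H" if "x : path_pairs" for x
 using that e_basis_carrier[of "fst x" "snd x"] by simp
 have "P (SUM x:S. comb_scale (Poly_Mapping.lookup f x) (e_basis (fst x) (snd x)))"
 if "finite S" "S \<subseteq> path_pairs" for S
 using that
 proof (induction S rule: finite_induct)
 case empty
 then show ?case using P0 by simp
 next
 case (insert x F)
 have "P (comb_scale (Poly_Mapping.lookup f x) (e_basis (fst x) (snd x)) +
  (SUM x:F. comb_scale (Poly_Mapping.lookup f x) (e_basis (fst x) (snd x))))"
  by (rule add) (use insert in \<open>auto intro!: H_sum_in H_scale_in b_in scale P_basis\<close>)
 then show ?case using insert by simp
 qed
 from this[of "Poly_Mapping.keys f"] show ?thesis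
 using f path_comb_expand[of f] by (simp add: H_simps)
qed

lemma linear_form_H_eqI:
 assumes X: "linear_form H X" and Y: "linear_form H Y"
 and eq: "!!m p q. p : paths G m ==> q : paths G m ==> X (e_basis p q) = Y (e_basis p q)"
 and f: "f : carrier H"
 shows "X f = Y f"
 using f
proof (induction rule: H_induct)
 case (add f g)
 then show ?case using linear_form_add[OF X, of f g] linear_form_add[OF Y, of f g] by (simp add: H_simps(5))
next
 case (scale c f)
 then show ?case using linear_form_smult[OF X, of f c] linear_form_smult[OF Y, of f c] by (simp add: H_simps(6))
qed (rule eq)

lemma mul_in: "f : carrier H ==> g : carrier H ==> mul f g : carrier H"
proof (induction rule: H_induct)
 case (basis m p q)
 from basis(3) show ?case
 proof (induction rule: H_induct)
 case (basis n r s)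
 then show ?case using \<open>p : paths G m\<close> \<open>q : paths G m\<close>
  by (auto simp: mul_basis H_zero_in intro!: e_basis_carrier path_pairsI path_concat_in)
 qed (auto simp: mul_add_right mul_scale_right intro: H_add_in H_scale_in)
qed (auto simp: mul_add_left mul_scale_left intro: H_add_in H_scale_in)

lemma mul_assoc:
 assumes "f : carrier H" "g : carrier H" "h : carrier H"
 shows "mul (mul f g) h = mul f (mul g h)"
 using assms(1)
proof (induction rule: H_induct)
 case (basis m p q)
 note p = basis
 from assms(2) show ?case
 proof (induction rule: H_induct)
 case (basis n r s)
 note r = basis
 from assms(3) show ?case
 proof (induction rule: H_induct)
  case (basis k u v)
  then show ?case by (simp add: mul_basis path_end_concat path_concat_assoc)
 qed (simp_all add: mul_add_right mul_scale_right)
 qed (simp_all add: mul_add_right mul_add_left mul_scale_right mul_scale_left)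
qed (simp_all add: mul_add_left mul_scale_left)

lemma vertex_path: "i : verts G ==> (i, []) : paths G 0"
 by (simp add: path_Nil_iff)

lemma mul_vertex_left:
 "mul (e_basis (i, []) (j, [])) (e_basis p q) = (if i = fst p & j = fst q then e_basis p q else 0)"
 by (simp add: mul_basis path_concat_def)

lemma mul_vertex_right:
 "mul (e_basis p q) (e_basis (i, []) (j, [])) = (if i = path_end G p & j = path_end G q then e_basis p q else 0)"
 by (auto simp: mul_basis path_concat_def)

lemma H_idem_in:
 "i : verts G ==> face_idem H i : carrier H" "i : verts G ==> face_idem_ring H i : carrier H"
 by (auto simp: H_idem intro!: H_sum_in e_basis_carrier path_pairsI vertex_path)

lemma mul_idem_right:
 assumes "p : paths G m" "q : paths G m"
 shows "mul (e_basis p q) (face_idem H k) = (if path_end G q = k then e_basis p q else 0)"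
 using assms path_end_vert[OF assms(1)]
 by (auto simp: H_idem mul_sum_right mul_vertex_right if_if_eq_conj[symmetric])

lemma mul_idem_ring_left:
 assumes "p : paths G m" "q : paths G m"
 shows "mul (face_idem_ring H k) (e_basis p q) = (if fst p = k then e_basis p q else 0)"
 using assms path_start[OF assms(2)]
 by (auto simp: H_idem mul_sum_left mul_vertex_left if_if_eq_conj[symmetric])

lemma mul_idem_ring_idem:
 assumes "i : verts G" "j : verts G"
 shows "mul (face_idem_ring H i) (face_idem H j) = e_basis (i, []) (j, [])"
proof -
 have "mul (face_idem_ring H i) (face_idem H j) = (SUM k:verts G. if k = i then e_basis (i, []) (j, []) else 0)"
 unfolding H_idem(1) mul_sum_right
 using assms by (intro sum.cong refl) (auto simp: mul_idem_ring_left[OF vertex_path vertex_path])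
 then show ?thesis using assms by simp
qed

lemma mul_idem_idem_ring:
 assumes "i : verts G" "j : verts G"
 shows "mul (face_idem H j) (face_idem_ring H i) = e_basis (i, []) (j, [])"
proof -
 have "mul (face_idem H j) (face_idem_ring H i) =
  (SUM l:verts G. SUM k:verts G. if k = i then if l = j then e_basis (i, []) (j, []) else 0 else 0)"
 unfolding H_idem mul_sum_right mul_sum_left mul_vertex_left
 by (intro sum.cong refl) auto
 then show ?thesis using assms by simp
qed

lemma H_comult:
 assumes "bilinear_form H B"
 shows "comult H f B = (SUM x:Poly_Mapping.keys f. Poly_Mapping.lookup f x *
  (SUM r:paths G (length (snd (fst x))). B (e_basis (fst x) r) (e_basis r (snd x))))"
 using assms by (simp add: H_comult_raw pure_tensor_def case_prod_unfold)

lemma H_comult_basis: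
 assumes "bilinear_form H B" "p : paths G m"
 shows "comult H (e_basis p q) B = (SUM r:paths G m. B (e_basis p r) (e_basis r q))"
 using assms by (simp add: H_comult lookup_e_basis path_length)

lemma H_comult_add: "comult H (f + g) B = comult H f B + comult H g B"
 unfolding H_comult_raw case_prod_unfold
 using sum_keys_add[of "%x a. a * (SUM r:paths G (length (snd (fst x))). pure_tensor H (e_basis (fst x) r) (e_basis r (snd x)) B)" f g]
 by (simp add: algebra_simps)

lemma H_comult_scale: "comult H (comb_scale c f) B = c * comult H f B"
 unfolding H_comult_raw case_prod_unfold
 using sum_keys_scale[of "%x a. a * (SUM r:paths G (length (snd (fst x))). pure_tensor H (e_basis (fst x) r) (e_basis r (snd x)) B)" c f]
 by (simp add: algebra_simps sum_distrib_left)

lemma H_counit_basis [simp]: "counit H (e_basis p q) = (if p = q then 1 else 0)"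
 by (simp add: H_counit_raw lookup_e_basis)

lemma H_counit_linear: "linear_form H (counit H)"
proof -
 have "counit H (f + g) = counit H f + counit H g" for f g
 unfolding H_counit_raw case_prod_unfold
 using sum_keys_add[of "%x a. a * (if fst x = snd x then 1 else 0)" f g] by (simp add: algebra_simps)
 moreover have "counit H (comb_scale c f) = c * counit H f" for c f
 unfolding H_counit_raw case_prod_unfold
 using sum_keys_scale[of "%x a. a * (if fst x = snd x then 1 else 0)" c f]
 by (simp add: algebra_simps sum_distrib_left)
 ultimately show ?thesis by (simp add: linear_form_def H_simps(5,6))
qed

lemma linear_form_H_mul:
 assumes "linear_form H X" "g : carrier H"
 shows "linear_form H (%f. X (mul f g))" "linear_form H (%f. X (mul g f))"
proof -
 have "X (mul f g + mul f' g) = X (mul f g) + X (mul f' g)" "X (mul g f + mul g f') = X (mul g f) + X (mul g f')"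
 if "f : carrier H" "f' : carrier H" for f f'
 using linear_form_add[OF assms(1)] that assms(2) mul_in by (simp_all add: H_simps(5))
 moreover have "X (comb_scale c (mul f g)) = c * X (mul f g)" "X (comb_scale c (mul g f)) = c * X (mul g f)"
 if "f : carrier H" for f c
 using linear_form_smult[OF assms(1)] that assms(2) mul_in by (simp_all add: H_simps(6))
 ultimately show "linear_form H (%f. X (mul f g))" "linear_form H (%f. X (mul g f))"
 by (simp_all add: linear_form_def H_simps(5,6) mul_add_left mul_add_right mul_scale_left mul_scale_right)
qed

lemma linear_form_H_comult: "linear_form H (%f. comult H f B)"
 by (simp add: linear_form_def H_simps(5,6) H_comult_add H_comult_scale)

lemma H_comult_param:
 assumes lin: "!!x y. x : carrier H ==> y : carrier H ==> linear_form H (%z. B z x y)"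
 and bil: "!!z. z : carrier H ==> bilinear_form H (B z)" and f: "f : carrier H"
 shows "linear_form H (%z. comult H f (B z))"
proof -
 let ?F = "%z. SUM x:Poly_Mapping.keys f. Poly_Mapping.lookup f x *
  (SUM r:paths G (length (snd (fst x))). B z (e_basis (fst x) r) (e_basis r (snd x)))"
 have "linear_form H ?F"
 proof (intro linear_form_sum linear_form_times)
 fix x r assume x: "x : Poly_Mapping.keys f" and r: "r : paths G (length (snd (fst x)))"
 have "x : path_pairs" using f x by (auto simp: H_simps)
 then have "fst x : paths G (length (snd (fst x)))" "snd x : paths G (length (snd (fst x)))"
  using path_pairs_iff[of "fst x" "snd x"] by simp_all
 with r show "linear_form H (%z. B z (e_basis (fst x) r) (e_basis r (snd x)))"
  by (intro lin e_basis_carrier path_pairsI)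
 qed
 moreover have "comult H f (B z) = ?F z" if "z : carrier H" for z
 by (rule H_comult[OF bil[OF that]])
 ultimately show ?thesis
 using H_add_in H_scale_in by (simp add: linear_form_def H_simps(5,6))
qed

lemma tensor_square_H_basis:
 assumes f: "f : carrier H"
 shows "comult H f : tensor_square H"
 using f
proof (induction rule: H_induct)
 case (basis m p q)
 have ms: "set (map (%r. (e_basis p r, e_basis r q)) xs) \<subseteq> carrier H \<times> carrier H" if "set xs = paths G m" for xs
 using that basis by (auto intro!: e_basis_carrier path_pairsI)
 obtain xs where xs: "set xs = paths G m" "distinct xs"
 using finite_distinct_list[OF finite_paths] by blast
 have "comult H (e_basis p q) B = (\<Sum>(x, y)\<leftarrow>map (%r. (e_basis p r, e_basis r q)) xs. pure_tensor H x y B)" for B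
 using xs basis by (simp add: H_comult_raw lookup_e_basis path_length comp_def sum_list_distinct_conv_sum_set)
 then show ?case using ms[OF xs(1)] unfolding tensor_square_def by blast
next
 case (add f g)
 then obtain xs ys where "comult H f = (%B. \<Sum>(x, y)\<leftarrow>xs. pure_tensor H x y B)" "set xs \<subseteq> carrier H \<times> carrier H"
 "comult H g = (%B. \<Sum>(x, y)\<leftarrow>ys. pure_tensor H x y B)" "set ys \<subseteq> carrier H \<times> carrier H"
 by (auto simp: tensor_square_def)
 then have "comult H (f + g) = (%B. \<Sum>(x, y)\<leftarrow>xs @ ys. pure_tensor H x y B)" "set (xs @ ys) \<subseteq> carrier H \<times> carrier H"
 by (auto simp: H_comult_add)
 then show ?case unfolding tensor_square_def by blast
next
 case (scale c f)
 then obtain xs where xs: "comult H f = (%B. \<Sum>(x, y)\<leftarrow>xs. pure_tensor H x y B)" "set xs \<subseteq> carrier H \<times> carrier H"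
 by (auto simp: tensor_square_def)
 let ?ys = "map (%(x, y). (comb_scale c x, y)) xs"
 have "c * pure_tensor H x y B = pure_tensor H (comb_scale c x) y B" if "(x, y) : set xs" for x y B
 proof -
 have "x : carrier H" "y : carrier H" using that xs(2) by auto
 then show ?thesis
  using linear_form_smult[OF bilinear_form_left, of H B y x c] by (simp add: pure_tensor_def H_simps(6))
 qed
 then have "comult H (comb_scale c f) B = (\<Sum>(x, y)\<leftarrow>?ys. pure_tensor H x y B)" for B
 unfolding H_comult_scale xs(1) sum_list_const_mult[symmetric]
 by (simp add: comp_def case_prod_unfold) (intro arg_cong[where f = sum_list] map_cong, auto)
 then have "comult H (comb_scale c f) = (%B. \<Sum>(x, y)\<leftarrow>?ys. pure_tensor H x y B)" by blast
 moreover have "set ?ys \<subseteq> carrier H \<times> carrier H" using xs(2) by (auto intro!: H_scale_in)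
 ultimately show ?case unfolding tensor_square_def by blast
qed

lemma H_ring: "ring H"
proof (rule ringI)
 show "abelian_group H"
 proof (rule abelian_groupI)
 fix f assume f: "f : carrier H"
 have "comb_scale (- 1) f + f = 0" by (rule poly_mapping_eqI) (simp add: lookup_add)
 then show "EX g:carrier H. g \<oplus>\<^bsub>H\<^esub> f = \<zero>\<^bsub>H\<^esub>"
  using H_scale_in[OF f] by (auto simp: H_simps(4,5))
 qed (auto simp: H_simps(4,5) add_ac intro: H_add_in H_zero_in)
 have one_in: "\<one>\<^bsub>H\<^esub> : carrier H"
 unfolding H_simps(3) by (intro H_sum_in e_basis_carrier path_pairsI[of _ 0] vertex_path)
 have one_l: "mul \<one>\<^bsub>H\<^esub> f = f" if "f : carrier H" for f
 using that
 proof (induction rule: H_induct)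
 case (basis m p q)
 have "mul \<one>\<^bsub>H\<^esub> (e_basis p q) = (SUM i:verts G. if i = fst p then SUM j:verts G. if j = fst q then e_basis p q else 0 else 0)"
  unfolding H_simps(3) mul_sum_left mul_vertex_left by (intro sum.cong refl) auto
 then show ?case
  using path_start[OF basis(1)] path_start[OF basis(2)] by simp
 qed (simp_all add: mul_add_right mul_scale_right)
 have one_r: "mul f \<one>\<^bsub>H\<^esub> = f" if "f : carrier H" for f
 using that
 proof (induction rule: H_induct)
 case (basis m p q)
 have "mul (e_basis p q) \<one>\<^bsub>H\<^esub> = (SUM i:verts G. if i = path_end G p then SUM j:verts G. if j = path_end G q then e_basis p q else 0 else 0)"
  unfolding H_simps(3) mul_sum_right mul_vertex_right by (intro sum.cong refl) auto
 then show ?case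
  using path_end_vert[OF basis(1)] path_end_vert[OF basis(2)] by simp
 qed (simp_all add: mul_add_left mul_scale_left)
 show "Group.monoid H"
 by (rule Group.monoidI) (simp_all add: one_in one_l one_r H_simps(2) mul_in mul_assoc)
qed (simp_all add: H_simps(2,5) mul_add_left mul_add_right)

lemma H_module: "Module.module complex_ring H"
proof (rule moduleI)
 show "abelian_group H" using H_ring by (simp add: ring_def)
 show "cring complex_ring" by (rule cring_complex_ring)
qed (simp_all add: H_simps(5,6) comb_scale_simps H_scale_in complex_ring_def)

lemma H_finsum:
 assumes "finite S" "!!k. k : S ==> f k : carrier H"
 shows "(\<Oplus>\<^bsub>H\<^esub>k\<in>S. f k) = (SUM k:S. f k)"
proof -
 interpret ring H by (rule H_ring)
 show ?thesis using assms
 by (induction S rule: finite_induct) (simp_all add: H_simps(4,5))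
qed

lemma linear_form_H_zero: "linear_form H X ==> X 0 = 0"
 using linear_form_smult[of H X 0 0] H_zero_in by (simp add: H_simps(6) comb_scale_simps)

lemma bilinear_form_H_zero:
 "bilinear_form H B ==> f : carrier H ==> B 0 f = 0"
 "bilinear_form H B ==> f : carrier H ==> B f 0 = 0"
 using linear_form_H_zero[OF bilinear_form_left] linear_form_H_zero[OF bilinear_form_right] by blast+

lemma paths_0: "paths G 0 = (%i. (i, [])) ` verts G"
 by (auto simp: path_Nil_iff)

lemma sum_paths_0: "(SUM r:paths G 0. f r) = (SUM i:verts G. f (i, []))"
 unfolding paths_0 by (subst sum.reindex) (auto simp: inj_on_def)

lemma H_coassoc:
 assumes f: "f : carrier H" and T: "trilinear_form H T"
 shows "comult H f (%x y. comult H x (%x1 x2. T x1 x2 y)) =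
   comult H f (%x y. comult H y (%y1 y2. T x y1 y2))"
proof -
 have lin: "linear_form H (%z. T z x y)" "linear_form H (%z. T x z y)" "linear_form H (%z. T x y z)"
 if "x : carrier H" "y : carrier H" for x y
 using T that by (auto simp: trilinear_form_def)
 note TB = trilinear_formD[OF T]
 have B1: "bilinear_form H (%x y. comult H x (%x1 x2. T x1 x2 y))"
 unfolding bilinear_form_def
 using H_comult_param[of "%z x1 x2. T x1 x2 z", OF lin(3) TB(1)] linear_form_H_comult by auto
 have B2: "bilinear_form H (%x y. comult H y (T x))"
 unfolding bilinear_form_def
 using H_comult_param[of T, OF lin(1) TB(2)] linear_form_H_comult by auto
 show ?thesis
 proof (rule linear_form_H_eqI[OF linear_form_H_comult linear_form_H_comult _ f])
 fix m p q assume p: "p : paths G m" and q: "q : paths G m"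
 have "comult H (e_basis p q) (%x y. comult H x (%x1 x2. T x1 x2 y)) =
  (SUM r:paths G m. SUM s:paths G m. T (e_basis p s) (e_basis s r) (e_basis r q))"
  using p q TB by (simp add: H_comult_basis[OF B1 p] H_comult_basis[OF TB(1)] e_basis_carrier path_pairsI)
 also have "... = (SUM s:paths G m. SUM r:paths G m. T (e_basis p s) (e_basis s r) (e_basis r q))"
  by (rule sum.swap)
 also have "... = comult H (e_basis p q) (%x y. comult H y (%y1 y2. T x y1 y2))"
  using p q TB by (simp add: H_comult_basis[OF B2 p] H_comult_basis[OF TB(2)] e_basis_carrier path_pairsI)
 finally show "comult H (e_basis p q) (%x y. comult H x (%x1 x2. T x1 x2 y)) =
  comult H (e_basis p q) (%x y. comult H y (%y1 y2. T x y1 y2))" .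
 qed
qed

lemma H_comult_mult:
 assumes f: "f : carrier H" and g: "g : carrier H" and B: "bilinear_form H B"
 shows "comult H (mul f g) B = comult H f (%a1 a2. comult H g (%b1 b2. B (mul a1 b1) (mul a2 b2)))"
proof -
 have bil: "bilinear_form H (%b1 b2. B (mul a1 b1) (mul a2 b2))" if "a1 : carrier H" "a2 : carrier H" for a1 a2
 using that linear_form_H_mul(2)[OF bilinear_form_left[OF B mul_in]]
  linear_form_H_mul(2)[OF bilinear_form_right[OF B mul_in]]
 unfolding bilinear_form_def by auto
 have Bg: "bilinear_form H (%a1 a2. comult H g (%b1 b2. B (mul a1 b1) (mul a2 b2)))"
 if g: "g : carrier H" for g
 unfolding bilinear_form_def
 proof (intro conjI ballI)
 fix y assume y: "y : carrier H"
 show "linear_form H (%a1. comult H g (%b1 b2. B (mul a1 b1) (mul y b2)))"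
  by (rule H_comult_param[OF _ bil[OF _ y] g])
  (auto intro: linear_form_H_mul(1)[OF bilinear_form_left[OF B mul_in[OF y]]])
 show "linear_form H (%a2. comult H g (%b1 b2. B (mul y b1) (mul a2 b2)))"
  by (rule H_comult_param[OF _ bil[OF y] g])
  (auto intro: linear_form_H_mul(1)[OF bilinear_form_right[OF B mul_in[OF y]]])
 qed
 have lin_g: "linear_form H (%g. comult H f (%a1 a2. comult H g (%b1 b2. B (mul a1 b1) (mul a2 b2))))"
 if f: "f : carrier H" for f
 by (rule H_comult_param[OF linear_form_H_comult Bg f])
 show ?thesis
 proof (rule linear_form_H_eqI[OF linear_form_H_mul(1)[OF linear_form_H_comult g] linear_form_H_comult _ f])
 fix m p q assume p: "p : paths G m" and q: "q : paths G m"
 note pq = e_basis_carrier[OF path_pairsI[OF p q]]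
 show "comult H (mul (e_basis p q) g) B =
  comult H (e_basis p q) (%a1 a2. comult H g (%b1 b2. B (mul a1 b1) (mul a2 b2)))"
 proof (rule linear_form_H_eqI[OF linear_form_H_mul(2)[OF linear_form_H_comult pq] lin_g[OF pq] _ g])
  fix n r s assume r: "r : paths G n" and s: "s : paths G n"
  note rs = e_basis_carrier[OF path_pairsI[OF r s]]
  note in_H = e_basis_carrier[OF path_pairsI]
  have "comult H (e_basis p q) (%a1 a2. comult H (e_basis r s) (%b1 b2. B (mul a1 b1) (mul a2 b2))) =
   (SUM u:paths G m. SUM v:paths G n. B (mul (e_basis p u) (e_basis r v)) (mul (e_basis u q) (e_basis v s)))"
  using p q by (simp add: H_comult_basis[OF Bg[OF rs] p] H_comult_basis[OF bil r] in_H)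
  also have "... = comult H (mul (e_basis p q) (e_basis r s)) B"
  proof (cases "path_end G p = fst r & path_end G q = fst s")
  case True
  then have "comult H (mul (e_basis p q) (e_basis r s)) B =
   (SUM x:paths G (m + n). B (e_basis (path_concat p r) x) (e_basis x (path_concat q s)))"
   using p r by (simp add: mul_basis H_comult_basis[OF B path_concat_in])
  also have "... = (SUM u:paths G m. SUM v:paths G n. if path_end G u = fst v
   then B (e_basis (path_concat p r) (path_concat u v)) (e_basis (path_concat u v) (path_concat q s)) else 0)"
   by (rule sum_paths_concat_if)
  also have "... = (SUM u:paths G m. SUM v:paths G n. B (mul (e_basis p u) (e_basis r v)) (mul (e_basis u q) (e_basis v s)))"
   using True by (intro sum.cong refl) (simp add: mul_basis bilinear_form_H_zero[OF B H_zero_in])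
  finally show ?thesis by simp
  next
  case False
  have "B (mul (e_basis p u) (e_basis r v)) (mul (e_basis u q) (e_basis v s)) = 0"
   if u: "u : paths G m" and v: "v : paths G n" for u v
  proof -
   have "mul (e_basis p u) (e_basis r v) : carrier H" "mul (e_basis u q) (e_basis v s) : carrier H"
   using p q r s u v by (auto intro!: mul_in in_H)
   moreover have "mul (e_basis p u) (e_basis r v) = 0 \<or> mul (e_basis u q) (e_basis v s) = 0"
   using False by (auto simp: mul_basis)
   ultimately show ?thesis using bilinear_form_H_zero[OF B] by metis
  qed
  moreover have "mul (e_basis p q) (e_basis r s) = 0" using False by (auto simp: mul_basis)
  moreover have "comult H 0 B = 0" using linear_form_H_zero[OF linear_form_H_comult] .
  ultimately show ?thesis by simp
  qed
  finally show "comult H (mul (e_basis p q) (e_basis r s)) B =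
  comult H (e_basis p q) (%a1 a2. comult H (e_basis r s) (%b1 b2. B (mul a1 b1) (mul a2 b2)))" by simp
 qed
 qed
qed

lemma H_counit_mult:
 assumes f: "f : carrier H" and g: "g : carrier H"
 shows "counit H (mul f g) =
 (SUM k:verts G. counit H (mul f (face_idem H k)) * counit H (mul (face_idem_ring H k) g))"
proof (rule linear_form_H_eqI[OF linear_form_H_mul(1)[OF H_counit_linear g] _ _ f])
 show "linear_form H (%f. SUM k:verts G. counit H (mul f (face_idem H k)) * counit H (mul (face_idem_ring H k) g))"
 by (intro linear_form_sum linear_form_times_right linear_form_H_mul(1)[OF H_counit_linear] H_idem_in)
 fix m p q assume p: "p : paths G m" and q: "q : paths G m"
 note pq = e_basis_carrier[OF path_pairsI[OF p q]]
 show "counit H (mul (e_basis p q) g) = (SUM k:verts G. counit H (mul (e_basis p q) (face_idem H k)) *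
  counit H (mul (face_idem_ring H k) g))"
 proof (rule linear_form_H_eqI[OF linear_form_H_mul(2)[OF H_counit_linear pq] _ _ g])
 show "linear_form H (%g. SUM k:verts G. counit H (mul (e_basis p q) (face_idem H k)) * counit H (mul (face_idem_ring H k) g))"
  by (intro linear_form_sum linear_form_times linear_form_H_mul(2)[OF H_counit_linear] H_idem_in)
 fix n r s assume r: "r : paths G n" and s: "s : paths G n"
 have c0: "counit H 0 = 0" by (rule linear_form_H_zero[OF H_counit_linear])
 have "(SUM k:verts G. counit H (mul (e_basis p q) (face_idem H k)) * counit H (mul (face_idem_ring H k) (e_basis r s))) =
  (SUM k:verts G. if path_end G q = k then (if p = q & r = s & fst r = k then 1 else 0) else 0)"
  by (intro sum.cong refl) (simp add: mul_idem_right[OF p q] mul_idem_ring_left[OF r s] c0)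
 also have "... = (if p = q & r = s & fst r = path_end G q then 1 else 0)"
  using path_end_vert[OF q] by simp
 also have "... = counit H (mul (e_basis p q) (e_basis r s))"
  using path_concat_inject[OF p q] by (auto simp: mul_basis c0)
 finally show "counit H (mul (e_basis p q) (e_basis r s)) = (SUM k:verts G. counit H (mul (e_basis p q) (face_idem H k)) *
  counit H (mul (face_idem_ring H k) (e_basis r s)))" by simp
 qed
qed

theorem H_face_algebra: "face_algebra (verts G) H"
proof -
 interpret RH: ring H by (rule H_ring)
 interpret MH: Module.module complex_ring H by (rule H_module)
 show ?thesis
 proof unfold_locales
 show "finite (verts G)" by simp
 show "verts G ~= {}" by (rule verts_nonempty)
 show "linear_form H (counit H)" by (rule H_counit_linear)
 next
 fix f g c assume "f : carrier H" "g : carrier H"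
 show "c \<odot>\<^bsub>H\<^esub> f \<otimes>\<^bsub>H\<^esub> g = c \<odot>\<^bsub>H\<^esub> (f \<otimes>\<^bsub>H\<^esub> g)" "f \<otimes>\<^bsub>H\<^esub> (c \<odot>\<^bsub>H\<^esub> g) = c \<odot>\<^bsub>H\<^esub> (f \<otimes>\<^bsub>H\<^esub> g)"
  by (simp_all add: H_simps(2,6) mul_scale_left mul_scale_right)
 next
 fix f assume f: "f : carrier H"
 show "comult H f : tensor_square H" by (rule tensor_square_H_basis[OF f])
 fix c show "comult H (c \<odot>\<^bsub>H\<^esub> f) = (%B. c * comult H f B)"
  by (auto simp: H_simps(6) H_comult_scale)
 fix g show "comult H (f \<oplus>\<^bsub>H\<^esub> g) = (%B. comult H f B + comult H g B)"
  by (auto simp: H_simps(5) H_comult_add)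
 next
 fix f T assume "f : carrier H" "trilinear_form H T"
 then show "comult H f (%x y. comult H x (%x1 x2. T x1 x2 y)) =
   comult H f (%x y. comult H y (%y1 y2. T x y1 y2))"
  by (rule H_coassoc)
 next
 fix f X assume f: "f : carrier H" and X: "linear_form H X"
 note bil = bilinear_form_prod[OF H_counit_linear X] bilinear_form_prod[OF X H_counit_linear]
 show "comult H f (%x y. counit H x * X y) = X f"
  by (rule linear_form_H_eqI[OF linear_form_H_comult X _ f])
  (simp add: H_comult_basis[OF bil(1)] if_distrib[of "%c. c * _"] cong: if_cong)
 show "comult H f (%x y. X x * counit H y) = X f"
  by (rule linear_form_H_eqI[OF linear_form_H_comult X _ f])
  (simp add: H_comult_basis[OF bil(2)] if_distrib[of "%c. _ * c"] cong: if_cong)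
 next
 fix f g B assume "f : carrier H" "g : carrier H" "bilinear_form H B"
 then show "comult H (f \<otimes>\<^bsub>H\<^esub> g) B = comult H f (%a1 a2. comult H g (%b1 b2. B (a1 \<otimes>\<^bsub>H\<^esub> b1) (a2 \<otimes>\<^bsub>H\<^esub> b2)))"
  unfolding H_simps(2) by (rule H_comult_mult)
 next
 fix i assume "i : verts G"
 then show "face_idem H i : carrier H" "face_idem_ring H i : carrier H"
  by (rule H_idem_in)+
 next
 fix i j assume ij: "i : verts G" "j : verts G"
 show "face_idem H i \<otimes>\<^bsub>H\<^esub> face_idem H j = (if i = j then face_idem H i else \<zero>\<^bsub>H\<^esub>)"
  unfolding H_simps(2,4) H_idem(1)[of i]
  by (auto simp: mul_sum_left mul_idem_right[OF vertex_path vertex_path] ij)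
 show "face_idem_ring H i \<otimes>\<^bsub>H\<^esub> face_idem_ring H j = (if i = j then face_idem_ring H i else \<zero>\<^bsub>H\<^esub>)"
 proof -
  have "mul (face_idem_ring H i) (face_idem_ring H j) =
   (SUM l:verts G. if j = i then e_basis (j, []) (l, []) else 0)"
  unfolding H_idem(2)[of j] mul_sum_right
  by (intro sum.cong refl) (simp add: mul_idem_ring_left[OF vertex_path vertex_path] ij)
  then show ?thesis by (simp add: H_simps(2,4) H_idem(2))
 qed
 show "face_idem H i \<otimes>\<^bsub>H\<^esub> face_idem_ring H j = face_idem_ring H j \<otimes>\<^bsub>H\<^esub> face_idem H i"
  using ij by (simp add: H_simps(2) mul_idem_ring_idem mul_idem_idem_ring)
 show "counit H (face_idem_ring H i \<otimes>\<^bsub>H\<^esub> face_idem H j) = (if i = j then 1 else 0)"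
  using ij by (simp add: H_simps(2) mul_idem_ring_idem)
 show "comult H (face_idem_ring H i \<otimes>\<^bsub>H\<^esub> face_idem H j) =
  (%B. SUM k:verts G. pure_tensor H (face_idem_ring H i \<otimes>\<^bsub>H\<^esub> face_idem H k)
   (face_idem_ring H k \<otimes>\<^bsub>H\<^esub> face_idem H j) B)"
  using ij by (auto simp: H_simps(2) mul_idem_ring_idem H_comult_raw lookup_e_basis sum_paths_0 intro!: sum.cong)
 next
 show "(\<Oplus>\<^bsub>H\<^esub>k\<in>verts G. face_idem H k) = \<one>\<^bsub>H\<^esub>"
  by (subst H_finsum[OF finite_verts H_idem_in(1)], assumption) (auto simp: H_idem H_simps(3) intro: sum.swap)
 show "(\<Oplus>\<^bsub>H\<^esub>k\<in>verts G. face_idem_ring H k) = \<one>\<^bsub>H\<^esub>"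
  by (subst H_finsum[OF finite_verts H_idem_in(2)], assumption) (auto simp: H_idem H_simps(3))
 next
 fix f g assume "f : carrier H" "g : carrier H"
 then show "counit H (f \<otimes>\<^bsub>H\<^esub> g) =
  (SUM k:verts G. counit H (f \<otimes>\<^bsub>H\<^esub> face_idem H k) * counit H (face_idem_ring H k \<otimes>\<^bsub>H\<^esub> g))"
  unfolding H_simps(2) by (rule H_counit_mult)
 qed
qed

end

section \<open>Braidings in terms of paths\<close>

lemma quasi_inverse_unique:
 fixes F F' K :: "'a => 'a => complex"
 assumes T: "finite T"
 and KF: "!!x y. x : T ==> y : T ==> (SUM z:T. K x z * F z y) = (if c x & x = y then 1 else 0)"
 and FF': "!!x y. x : T ==> y : T ==> (SUM z:T. F x z * F' z y) = (if d y & x = y then 1 else 0)"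
 and F': "!!x y. x : T ==> y : T ==> F' x y ~= 0 ==> c x"
 and K: "!!x y. x : T ==> y : T ==> K x y ~= 0 ==> d y"
 and xy: "x : T" "y : T"
 shows "K x y = F' x y"
proof -
 have "K x y = (SUM z:T. K x z * (if d y & z = y then 1 else 0))"
 using K[OF xy] T xy by (cases "d y") (auto simp: if_distrib[of "(*) _"] cong: if_cong)
 also have "... = (SUM z:T. K x z * (SUM w:T. F z w * F' w y))"
 by (intro sum.cong refl) (simp add: FF' xy)
 also have "... = (SUM w:T. (SUM z:T. K x z * F z w) * F' w y)"
 unfolding sum_distrib_left sum_distrib_right by (subst sum.swap) (simp add: mult_ac)
 also have "... = (SUM w:T. (if c x & x = w then 1 else 0) * F' w y)"
 by (intro sum.cong refl) (simp add: KF xy)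
 also have "... = F' x y"
 using F'[OF xy] T xy by (cases "c x") (auto simp: if_distrib[of "%a. a * _"] cong: if_cong)
 finally show ?thesis .
qed

lemma sum_triple: "(SUM z:A \<times> B \<times> C. f z) = (SUM x:A. SUM y:B. SUM z:C. f (x, y, z))"
 by (simp add: sum.cartesian_product case_prod_unfold)

lemma sum_if_const:
 "(SUM x:A. SUM y:B. if c then f x y else 0) = (if c then SUM x:A. SUM y:B. f x y else 0)"
 by simp

lemma sum_rotate:
 fixes f :: "_ => _ => _ => _ => complex"
 shows "(SUM x:A. SUM y:B. SUM v:C. SUM z:D. f x y v z) = (SUM x:A. SUM z:D. SUM y:B. SUM v:C. f x y v z)"
 and "(SUM x:A. SUM z:D. SUM y:B. SUM v:C. f x y v z) = (SUM y:B. SUM v:C. SUM x:A. SUM z:D. f x y v z)"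
 and "(SUM y:B. SUM v:C. SUM x:A. SUM z:D. f x y v z) = (SUM x:A. SUM y:B. SUM z:D. SUM v:C. f x y v z)"
proof -
 have flat: "(SUM x:A. SUM y:B. SUM v:C. SUM z:D. f x y v z) = (SUM (x, y, v, z):A \<times> B \<times> C \<times> D. f x y v z)"
 "(SUM x:A. SUM z:D. SUM y:B. SUM v:C. f x y v z) = (SUM (x, z, y, v):A \<times> D \<times> B \<times> C. f x y v z)"
 "(SUM y:B. SUM v:C. SUM x:A. SUM z:D. f x y v z) = (SUM (y, v, x, z):B \<times> C \<times> A \<times> D. f x y v z)"
 "(SUM x:A. SUM y:B. SUM z:D. SUM v:C. f x y v z) = (SUM (x, y, z, v):A \<times> B \<times> D \<times> C. f x y v z)"
 by (simp_all add: sum.cartesian_product case_prod_unfold)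
 show "(SUM x:A. SUM y:B. SUM v:C. SUM z:D. f x y v z) = (SUM x:A. SUM z:D. SUM y:B. SUM v:C. f x y v z)"
 unfolding flat by (rule sum.reindex_bij_witness[where i = "%(x, z, y, v). (x, y, v, z)" and j = "%(x, y, v, z). (x, z, y, v)"]) auto
 show "(SUM x:A. SUM z:D. SUM y:B. SUM v:C. f x y v z) = (SUM y:B. SUM v:C. SUM x:A. SUM z:D. f x y v z)"
 unfolding flat by (rule sum.reindex_bij_witness[where i = "%(y, v, x, z). (x, z, y, v)" and j = "%(x, z, y, v). (y, v, x, z)"]) auto
 show "(SUM y:B. SUM v:C. SUM x:A. SUM z:D. f x y v z) = (SUM x:A. SUM y:B. SUM z:D. SUM v:C. f x y v z)"
 unfolding flat by (rule sum.reindex_bij_witness[where i = "%(x, y, z, v). (y, v, x, z)" and j = "%(y, v, x, z). (x, y, z, v)"]) auto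
qed

lemma sum_exchange:
 fixes a :: "_ => _ => complex" and h :: "_ => _ => _ => complex"
 shows "(SUM x:A. SUM y:B. SUM v:C. (SUM z:D. a x z * b y z v) * c x y v) =
  (SUM x:A. SUM z:D. a x z * (SUM y:B. SUM v:C. b y z v * c x y v))"
 and "(SUM x:A. SUM z:D. a x z * (SUM y:B. SUM v:C. c' x y z v * d y v)) =
  (SUM y:B. SUM v:C. (SUM x:A. SUM z:D. a x z * c' x y z v) * d y v)"
 and "(SUM y:B. SUM v:C. (SUM x:A. SUM z:D. h x y z * g x z v) * e y v) =
  (SUM x:A. SUM y:B. SUM z:D. h x y z * (SUM v:C. g x z v * e y v))"
 unfolding sum_distrib_left sum_distrib_right mult.assoc
 by (rule sum_rotate)+

lemma sum_single:
 assumes "finite V" "a : V" "!!i. i : V ==> i ~= a ==> f i = 0"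
 shows "(SUM i:V. f i) = f a"
 using assms by (simp add: sum.remove)

text \<open>A family of orthogonal idempotent matrices \<open>M i j\<close>, whose rows and columns are labelled and
  which has a left inverse respecting the labels, consists of the elementary projections: the sum
  of all \<open>M i j\<close> is idempotent and left invertible, hence the identity.\<close>

lemma labelled_idempotents:
 fixes M N :: "'v => 'v => 'p => 'p => complex"
 assumes fin: "finite V" "finite P"
 and lab: "!!r. r : P ==> a r : V" "!!r. r : P ==> b r : V" "!!r. r : P ==> c r : V"
 and idem: "!!i j k l r s. i : V ==> j : V ==> k : V ==> l : V ==> r : P ==> s : P ==>
  (SUM v:P. M i j r v * M k l v s) = (if i = k & j = l then M i j r s else 0)"
 and inv: "!!i j r s. i : V ==> j : V ==> r : P ==> s : P ==>
  (SUM k:V. SUM v:P. N i k r v * M k j v s) = (if i = c r & i = j & r = s then 1 else 0)"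
 and M: "!!i j r s. i : V ==> j : V ==> r : P ==> s : P ==> M i j r s ~= 0 ==> i = a r & j = b s"
 and N: "!!i j r s. i : V ==> j : V ==> r : P ==> s : P ==> N i j r s ~= 0 ==> j = a s"
 and i: "i : V" and j: "j : V" and r: "r : P" and s: "s : P"
 shows "M i j r s = (if r = s & i = a r & j = b s then 1 else 0)"
proof -
 define Mt where "Mt r s = M (a r) (b s) r s" for r s
 define Nt where "Nt r s = (SUM i:V. N i (a s) r s)" for r s
 have idem_t: "(SUM v:P. Mt r v * Mt v s) = Mt r s" if rs: "r : P" "s : P" for r s
 proof -
 have "(SUM v:P. Mt r v * Mt v s) = (SUM v:P. SUM j:V. SUM i:V. M (a r) j r v * M i (b s) v s)"
 proof (intro sum.cong refl)
  fix v assume v: "v : P"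
  have "(SUM j:V. SUM i:V. M (a r) j r v * M i (b s) v s) = (SUM i:V. M (a r) (b v) r v * M i (b s) v s)"
  proof (rule sum_single[OF fin(1) lab(2)[OF v]])
  fix j assume j: "j : V" "j ~= b v"
  then have "M (a r) j r v = 0" using M[OF lab(1)[OF rs(1)] j(1) rs(1) v] by blast
  then show "(SUM i:V. M (a r) j r v * M i (b s) v s) = 0" by simp
  qed
  also have "... = Mt r v * Mt v s"
  unfolding Mt_def
  proof (rule sum_single[OF fin(1) lab(1)[OF v]])
  fix i assume i: "i : V" "i ~= a v"
  then have "M i (b s) v s = 0" using M[OF i(1) lab(2)[OF rs(2)] v rs(2)] by blast
  then show "M (a r) (b v) r v * M i (b s) v s = 0" by simp
  qed
  finally show "Mt r v * Mt v s = (SUM j:V. SUM i:V. M (a r) j r v * M i (b s) v s)" by simp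
 qed
 also have "... = (SUM j:V. SUM i:V. SUM v:P. M (a r) j r v * M i (b s) v s)"
  by (subst sum.swap, intro sum.cong refl, rule sum.swap)
 also have "... = (SUM j:V. SUM i:V. if i = a r then if j = b s then M (a r) (b s) r s else 0 else 0)"
  by (intro sum.cong refl) (auto simp: idem lab rs)
 also have "... = Mt r s" using fin lab rs by (simp add: Mt_def)
 finally show ?thesis .
 qed
 have inv_t: "(SUM v:P. Nt r v * Mt v s) = (if r = s then 1 else 0)" if rs: "r : P" "s : P" for r s
 proof -
 have "(SUM v:P. Nt r v * Mt v s) = (SUM v:P. SUM i:V. SUM k:V. SUM j:V. N i k r v * M k j v s)"
 proof (intro sum.cong refl)
  fix v assume v: "v : P"
  have "(SUM k:V. SUM j:V. N i k r v * M k j v s) = N i (a v) r v * Mt v s" if i: "i : V" for i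
  proof -
  have "(SUM k:V. SUM j:V. N i k r v * M k j v s) = (SUM j:V. N i (a v) r v * M (a v) j v s)"
  proof (rule sum_single[OF fin(1) lab(1)[OF v]])
   fix k assume k: "k : V" "k ~= a v"
   then have "N i k r v = 0" using N[OF i k(1) rs(1) v] by blast
   then show "(SUM j:V. N i k r v * M k j v s) = 0" by simp
  qed
  also have "... = N i (a v) r v * Mt v s"
   unfolding Mt_def
  proof (rule sum_single[OF fin(1) lab(2)[OF rs(2)]])
   fix j assume j: "j : V" "j ~= b s"
   then have "M (a v) j v s = 0" using M[OF lab(1)[OF v] j(1) v rs(2)] by blast
   then show "N i (a v) r v * M (a v) j v s = 0" by simp
  qed
  finally show ?thesis .
  qed
  then show "Nt r v * Mt v s = (SUM i:V. SUM k:V. SUM j:V. N i k r v * M k j v s)"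
  by (simp add: Nt_def sum_distrib_right)
 qed
 also have "... = (SUM i:V. SUM v:P. SUM j:V. SUM k:V. N i k r v * M k j v s)"
  by (subst sum.swap, rule sum.cong[OF refl], rule sum.cong[OF refl], rule sum.swap)
 also have "... = (SUM i:V. SUM j:V. SUM k:V. SUM v:P. N i k r v * M k j v s)"
  by (rule sum.cong[OF refl], subst sum.swap, rule sum.cong[OF refl], rule sum.swap)
 also have "... = (SUM i:V. SUM j:V. if j = i then if i = c r & r = s then 1 else 0 else 0)"
  by (intro sum.cong refl) (auto simp: inv rs)
 also have "... = (if r = s then 1 else 0)"
  using fin lab rs by simp
 finally show ?thesis .
 qed
 have Mt_id: "Mt r s = (if r = s then 1 else 0)" if rs: "r : P" "s : P" for r s
 proof -
 have "Mt r s = (SUM v:P. (if r = v then 1 else 0) * Mt v s)"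
  using fin rs by (simp add: if_distrib[of "%a. a * _"] cong: if_cong)
 also have "... = (SUM v:P. (SUM u:P. Nt r u * Mt u v) * Mt v s)"
  by (intro sum.cong refl) (simp add: inv_t rs)
 also have "... = (SUM u:P. Nt r u * (SUM v:P. Mt u v * Mt v s))"
  unfolding sum_distrib_left sum_distrib_right by (subst sum.swap) (simp add: mult_ac)
 also have "... = (SUM u:P. Nt r u * Mt u s)"
  by (intro sum.cong refl) (simp add: idem_t rs)
 finally show ?thesis by (simp add: inv_t rs)
 qed
 show ?thesis
 using M[OF i j r s] Mt_id[OF r s] by (cases "M i j r s = 0") (auto simp: Mt_def)
qed

context quiver
begin

text \<open>The multiplication of the matrices with rows \<open>(p, r)\<close> and columns \<open>(q, s)\<close>, which is the
  convolution of bilinear forms on a quotient of the path algebra.\<close>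

definition mp where
 "mp m n F K p q r s = (SUM (u, v):paths G m \<times> paths G n. F p u r v * K u q v s :: complex)"

lemma mp_nested: "mp m n F K p q r s = (SUM u:paths G m. SUM v:paths G n. F p u r v * K u q v s)"
 by (simp add: mp_def sum.cartesian_product)

lemma mp_assoc: "mp m n (mp m n F K) L p q r s = mp m n F (mp m n K L) p q r s"
proof -
 let ?T = "paths G m \<times> paths G n"
 have "mp m n (mp m n F K) L p q r s =
  (SUM y:?T. SUM x:?T. F p (fst x) r (snd x) * K (fst x) (fst y) (snd x) (snd y) * L (fst y) q (snd y) s)"
 by (simp add: mp_def case_prod_unfold sum_distrib_right)
 also have "... = (SUM x:?T. SUM y:?T. F p (fst x) r (snd x) * K (fst x) (fst y) (snd x) (snd y) * L (fst y) q (snd y) s)"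
 by (rule sum.swap)
 also have "... = mp m n F (mp m n K L) p q r s"
 by (simp add: mp_def case_prod_unfold sum_distrib_left mult_ac)
 finally show ?thesis .
qed

lemma mp_cong:
 assumes "!!u v. u : paths G m ==> v : paths G n ==> F p u r v = F' p u r v"
 and "!!u v. u : paths G m ==> v : paths G n ==> K u q v s = K' u q v s"
 shows "mp m n F K p q r s = mp m n F' K' p q r s"
 unfolding mp_nested using assms by (intro sum.cong refl) simp

lemma mp_flip: "mp m n (%p q r s. F r s p q) (%p q r s. K r s p q) p q r s = mp n m F K r s p q"
 unfolding mp_nested by (rule sum.swap)

definition delta_mat where
 "delta_mat c p q r s = (if c p r & p = q & r = s then 1 else 0 :: complex)"

lemma delta_mat_left:
 assumes "p : paths G m" "r : paths G n"
 shows "mp m n (delta_mat c) F p q r s = (if c p r then F p q r s else 0)"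
proof -
 have "mp m n (delta_mat c) F p q r s = (SUM u:paths G m. if u = p then (SUM v:paths G n. if v = r then (if c p r then F p q r s else 0) else 0) else 0)"
 unfolding mp_nested delta_mat_def using assms
 by (intro sum.cong refl) (auto simp: if_distrib[of "%a. a * _"] if_distrib[of "(*) _"] if_if_eq_conj[symmetric] cong: if_cong)
 then show ?thesis using assms by simp
qed

lemma delta_mat_right:
 assumes "q : paths G m" "s : paths G n"
 shows "mp m n F (delta_mat c) p q r s = (if c q s then F p q r s else 0)"
proof -
 have d: "delta_mat c u q v s = (if u = q then if v = s then if c q s then 1 else 0 else 0 else 0)" for u v
 by (simp add: delta_mat_def)
 have "mp m n F (delta_mat c) p q r s = (SUM u:paths G m. if u = q then (SUM v:paths G n. if v = s then (if c q s then F p q r s else 0) else 0) else 0)"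
 unfolding mp_nested d by (intro sum.cong refl) (auto simp: if_distrib[of "(*) _"] cong: if_cong)
 then show ?thesis using assms by simp
qed

text \<open>The axioms of a braiding which do not involve the relations of the algebra, for
  \<open>rho p q r s = R(e p q, e r s)\<close>.\<close>

definition rmatrix_pair where
 "rmatrix_pair rho rho' \<longleftrightarrow>
 (ALL m n. ALL p:paths G m. ALL q:paths G m. ALL r:paths G n. ALL s:paths G n.
  mp m n rho' rho p q r s = delta_mat (%p r. path_end G p = fst r) p q r s \<and>
  mp m n rho rho' p q r s = delta_mat (%p r. path_end G r = fst p) p q r s \<and>
  (rho p q r s ~= 0 --> path_end G r = fst p) \<and>
  (rho' p q r s ~= 0 --> path_end G p = fst r)) \<and>
 (ALL m k n. ALL p:paths G m. ALL q:paths G m. ALL p':paths G k. ALL q':paths G k. ALL r:paths G n. ALL s:paths G n.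
  (SUM v:paths G n. rho p q r v * rho p' q' v s) =
  (if path_end G p = fst p' & path_end G q = fst q' then rho (path_concat p p') (path_concat q q') r s else 0)) \<and>
 (ALL m n k. ALL p:paths G m. ALL q:paths G m. ALL r:paths G n. ALL s:paths G n. ALL r':paths G k. ALL s':paths G k.
  (SUM u:paths G m. rho p u r' s' * rho u q r s) =
  (if path_end G r = fst r' & path_end G s = fst s' then rho p q (path_concat r r') (path_concat s s') else 0))"

lemma rmatrix_pairD:
 assumes "rmatrix_pair rho rho'" "p : paths G m" "q : paths G m" "r : paths G n" "s : paths G n"
 shows "mp m n rho' rho p q r s = delta_mat (%p r. path_end G p = fst r) p q r s"
 and "mp m n rho rho' p q r s = delta_mat (%p r. path_end G r = fst p) p q r s"
 and "rho p q r s ~= 0 ==> path_end G r = fst p"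
 and "rho' p q r s ~= 0 ==> path_end G p = fst r"
 using conjunct1[OF assms(1)[unfolded rmatrix_pair_def], rule_format, OF assms(2-5)] by auto

lemma rmatrix_hexagon1:
 assumes "rmatrix_pair rho rho'" "p : paths G m" "q : paths G m" "p' : paths G k" "q' : paths G k"
 "r : paths G n" "s : paths G n"
 shows "(SUM v:paths G n. rho p q r v * rho p' q' v s) =
 (if path_end G p = fst p' & path_end G q = fst q' then rho (path_concat p p') (path_concat q q') r s else 0)"
 using assms unfolding rmatrix_pair_def by blast

lemma rmatrix_hexagon2:
 assumes "rmatrix_pair rho rho'" "p : paths G m" "q : paths G m" "r : paths G n" "s : paths G n"
 "r' : paths G k" "s' : paths G k"
 shows "(SUM u:paths G m. rho p u r' s' * rho u q r s) =
 (if path_end G r = fst r' & path_end G s = fst s' then rho p q (path_concat r r') (path_concat s s') else 0)"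
 using assms unfolding rmatrix_pair_def by blast

lemma rmatrix_right_support:
 assumes R: "rmatrix_pair rho rho'" and p: "p : paths G m" "q : paths G m" and r: "r : paths G n" "s : paths G n"
 shows "rho p q r s ~= 0 ==> path_end G q = fst s" and "rho' p q r s ~= 0 ==> path_end G s = fst q"
proof -
 note D = rmatrix_pairD[OF R]
 have "mp m n (mp m n rho rho') rho p q r s = mp m n (delta_mat (%p r. path_end G r = fst p)) rho p q r s"
 by (rule mp_cong) (simp_all add: D(2) p r)
 moreover have "mp m n rho (mp m n rho' rho) p q r s = mp m n rho (delta_mat (%p r. path_end G p = fst r)) p q r s"
 by (rule mp_cong) (simp_all add: D(1) p r)
 ultimately have "(if path_end G r = fst p then rho p q r s else 0) = (if path_end G q = fst s then rho p q r s else 0)"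
 by (simp add: mp_assoc delta_mat_left delta_mat_right p r)
 then show "rho p q r s ~= 0 ==> path_end G q = fst s"
 using D(3)[OF p r] by (auto split: if_splits)
 have "mp m n (mp m n rho' rho) rho' p q r s = mp m n (delta_mat (%p r. path_end G p = fst r)) rho' p q r s"
 by (rule mp_cong) (simp_all add: D(1) p r)
 moreover have "mp m n rho' (mp m n rho rho') p q r s = mp m n rho' (delta_mat (%p r. path_end G r = fst p)) p q r s"
 by (rule mp_cong) (simp_all add: D(2) p r)
 ultimately have "(if path_end G p = fst r then rho' p q r s else 0) = (if path_end G s = fst q then rho' p q r s else 0)"
 by (simp add: mp_assoc delta_mat_left delta_mat_right p r)
 then show "rho' p q r s ~= 0 ==> path_end G s = fst q"
 using D(4)[OF p r] by (auto split: if_splits)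
qed

lemma concat_vertices: "path_concat (i, []) (i, []) = (i, [])"
 by (simp add: path_concat_def)

text \<open>The entries at vertices are forced: they are orthogonal idempotents labelled by pairs of vertices,
  and a quasi-inverse exists only if each of them is the identity on its block.\<close>

lemma rmatrix_vertex_left:
 assumes R: "rmatrix_pair rho rho'" and i: "i : verts G" "j : verts G" and r: "r : paths G n" "s : paths G n"
 shows "rho (i, []) (j, []) r s = (if r = s & i = path_end G r & j = fst s then 1 else 0)"
proof (rule labelled_idempotents[where V = "verts G" and P = "paths G n" and c = fst
  and N = "%i j r s. rho' (i, []) (j, []) r s"])
 note D = rmatrix_pairD[OF R] and S = rmatrix_right_support[OF R]
 fix i j r s assume ij: "i : verts G" "j : verts G" and rs: "r : paths G n" "s : paths G n"
 note v = vertex_path[OF ij(1)] vertex_path[OF ij(2)]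
 show "(SUM k:verts G. SUM v:paths G n. rho' (i, []) (k, []) r v * rho (k, []) (j, []) v s) =
  (if i = fst r & i = j & r = s then 1 else 0)"
 using D(1)[OF v rs] by (simp add: mp_nested sum_paths_0 delta_mat_def)
 show "rho (i, []) (j, []) r s ~= 0 ==> i = path_end G r & j = fst s"
 using D(3)[OF v rs] S(1)[OF v rs] by simp
 show "rho' (i, []) (j, []) r s ~= 0 ==> j = path_end G s"
 using S(2)[OF v rs] by simp
 fix k l assume kl: "k : verts G" "l : verts G"
 show "(SUM v:paths G n. rho (i, []) (j, []) r v * rho (k, []) (l, []) v s) =
  (if i = k & j = l then rho (i, []) (j, []) r s else 0)"
 using rmatrix_hexagon1[OF R v vertex_path[OF kl(1)] vertex_path[OF kl(2)] rs]
 by (auto simp: concat_vertices)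
qed (use i r path_start path_end_vert in auto)

lemma rmatrix_vertex_right:
 assumes R: "rmatrix_pair rho rho'" and i: "i : verts G" "j : verts G" and p: "p : paths G m" "q : paths G m"
 shows "rho p q (i, []) (j, []) = (if p = q & i = fst p & j = path_end G q then 1 else 0)"
proof (rule labelled_idempotents[where V = "verts G" and P = "paths G m" and c = "path_end G" and M = "%i j p q. rho p q (i, []) (j, [])"
  and N = "%i j p q. rho' p q (i, []) (j, [])"])
 note D = rmatrix_pairD[OF R] and S = rmatrix_right_support[OF R]
 fix i j p q assume ij: "i : verts G" "j : verts G" and pq: "p : paths G m" "q : paths G m"
 note v = vertex_path[OF ij(1)] vertex_path[OF ij(2)]
 have "(SUM k:verts G. SUM u:paths G m. rho' p u (i, []) (k, []) * rho u q (k, []) (j, [])) = mp m 0 rho' rho p q (i, []) (j, [])"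
 unfolding mp_nested sum_paths_0 by (rule sum.swap)
 then show "(SUM k:verts G. SUM u:paths G m. rho' p u (i, []) (k, []) * rho u q (k, []) (j, [])) =
  (if i = path_end G p & i = j & p = q then 1 else 0)"
 using D(1)[OF pq v] by (auto simp: delta_mat_def)
 show "rho p q (i, []) (j, []) ~= 0 ==> i = fst p & j = path_end G q"
 using D(3)[OF pq v] S(1)[OF pq v] by simp
 show "rho' p q (i, []) (j, []) ~= 0 ==> j = fst q"
 using S(2)[OF pq v] by simp
 fix k l assume kl: "k : verts G" "l : verts G"
 show "(SUM u:paths G m. rho p u (i, []) (j, []) * rho u q (k, []) (l, [])) =
  (if i = k & j = l then rho p q (i, []) (j, []) else 0)"
 using rmatrix_hexagon2[OF R pq vertex_path[OF kl(1)] vertex_path[OF kl(2)] v]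
 by (auto simp: concat_vertices)
qed (use i p path_start path_end_vert in auto)

lemma rmatrix_face_support:
 assumes R: "rmatrix_pair rho rho'" and p: "p : paths G m" "q : paths G m" and r: "r : paths G n" "s : paths G n"
 and nz: "rho p q r s ~= 0"
 shows "fst r = fst q" "path_end G s = path_end G p"
proof -
 note v = vertex_path[OF path_start]
 have "(SUM v:paths G n. rho (fst p, []) (fst q, []) r v * rho p q v s) = rho p q r s"
 using rmatrix_hexagon1[OF R v[OF p(1)] v[OF p(2)] p r] by (simp add: path_concat_def)
 moreover have "(SUM v:paths G n. rho (fst p, []) (fst q, []) r v * rho p q v s) =
  (SUM v:paths G n. if r = v then if fst p = path_end G r & fst q = fst r then rho p q r s else 0 else 0)"
 by (intro sum.cong refl) (auto simp: rmatrix_vertex_left[OF R path_start[OF p(1)] path_start[OF p(2)] r(1)])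
 ultimately show "fst r = fst q" using r nz by (auto split: if_splits)
 note w = vertex_path[OF path_end_vert]
 have "(SUM v:paths G n. rho p q r v * rho (path_end G p, []) (path_end G q, []) v s) = rho p q r s"
 using rmatrix_hexagon1[OF R p w[OF p(1)] w[OF p(2)] r] by (simp add: path_concat_def)
 moreover have "(SUM v:paths G n. rho p q r v * rho (path_end G p, []) (path_end G q, []) v s) =
  (SUM v:paths G n. if v = s then if path_end G p = path_end G s & path_end G q = fst s then rho p q r s else 0 else 0)"
 by (intro sum.cong refl) (auto simp: rmatrix_vertex_left[OF R path_end_vert[OF p(1)] path_end_vert[OF p(2)] _ r(2)])
 ultimately show "path_end G s = path_end G p" using r nz by (auto split: if_splits)
qed

lemma rmatrix_inverse_face_support:
 assumes R: "rmatrix_pair rho rho'" and p: "p : paths G m" "q : paths G m" and r: "r : paths G n" "s : paths G n"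
 and nz: "rho' p q r s ~= 0"
 shows "fst p = fst s" "path_end G r = path_end G q"
proof -
 note D = rmatrix_pairD[OF R] and S = rmatrix_right_support[OF R] and F = rmatrix_face_support[OF R]
 have key: "f p r = g q s"
 if fg: "!!u1 u2 v1 v2. u1 : paths G m ==> u2 : paths G m ==> v1 : paths G n ==> v2 : paths G n ==>
  rho u1 u2 v1 v2 ~= 0 ==> f u2 v2 = g u1 v1" for f g :: "_ => _ => complex"
 proof -
 have "mp m n (mp m n rho' rho) (%p q r s. f p r * rho' p q r s) p q r s =
  mp m n (delta_mat (%p r. path_end G p = fst r)) (%p q r s. f p r * rho' p q r s) p q r s"
  by (rule mp_cong) (simp_all add: D(1) p r)
 also have "... = f p r * rho' p q r s"
  using D(4)[OF p r nz] by (simp add: delta_mat_left p r)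
 finally have 1: "mp m n rho' (mp m n rho (%p q r s. f p r * rho' p q r s)) p q r s = f p r * rho' p q r s"
  by (simp add: mp_assoc)
 have "mp m n rho (%p q r s. f p r * rho' p q r s) u q v s = g u v * mp m n rho rho' u q v s"
  if "u : paths G m" "v : paths G n" for u v
  unfolding mp_nested sum_distrib_left
 proof (intro sum.cong refl)
  fix u2 v2 assume "u2 : paths G m" "v2 : paths G n"
  then show "rho u u2 v v2 * (f u2 v2 * rho' u2 q v2 s) = g u v * (rho u u2 v v2 * rho' u2 q v2 s)"
  using fg[OF that(1) _ that(2)] by (cases "rho u u2 v v2 = 0") auto
 qed
 then have "mp m n rho' (mp m n rho (%p q r s. f p r * rho' p q r s)) p q r s =
  mp m n rho' (%p q r s. g q s * delta_mat (%p r. path_end G r = fst p) p q r s) p q r s"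
  by (intro mp_cong refl) (auto simp: D(2) p r delta_mat_def)
 also have "... = g q s * mp m n rho' (delta_mat (%p r. path_end G r = fst p)) p q r s"
  by (simp add: mp_nested sum_distrib_left mult_ac)
 also have "... = g q s * rho' p q r s"
  using S(2)[OF p r nz] by (simp add: delta_mat_right p r)
 finally show ?thesis using 1 nz by simp
 qed
 have "(if fst p = fst p then 1 else 0 :: complex) = (if fst s = fst p then 1 else 0)"
 by (rule key[of "%u v. if fst u = fst p then 1 else 0" "%u v. if fst v = fst p then 1 else 0"])
  (use F(1) in auto)
 then show "fst p = fst s" by (auto split: if_splits)
 have "(if path_end G r = path_end G r then 1 else 0 :: complex) = (if path_end G q = path_end G r then 1 else 0)"
 by (rule key[of "%u v. if path_end G v = path_end G r then 1 else 0" "%u v. if path_end G u = path_end G r then 1 else 0"])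
  (use F(2) in auto)
 then show "path_end G r = path_end G q" by (auto split: if_splits)
qed

text \<open>Passing from \<open>R\<close> to the flipped inverse: both sides of a hexagon identity for \<open>rho'\<close> invert the
  corresponding product of two copies of \<open>rho\<close>.\<close>

lemma rmatrix_inverse_hexagon1:
 assumes R: "rmatrix_pair rho rho'" and p: "p : paths G m" "q : paths G m" and p': "p' : paths G k" "q' : paths G k"
 and r: "r : paths G n" "s : paths G n"
 shows "(SUM v:paths G n. rho' r v p q * rho' v s p' q') =
 (if path_end G p = fst p' & path_end G q = fst q' then rho' r s (path_concat p p') (path_concat q q') else 0)"
proof -
 note D = rmatrix_pairD[OF R] and S = rmatrix_right_support[OF R] and F = rmatrix_face_support[OF R]
 and F' = rmatrix_inverse_face_support[OF R]
 let ?P = "paths G n" and ?A = "paths G m" and ?B = "paths G k"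
 let ?T = "?P \<times> ?A \<times> ?B"
 define K where "K = (%(r, p, p') (s, q, q'). SUM v:?P. rho' r v p q * rho' v s p' q')"
 define L where "L = (%(r, p, p') (s, q, q'). SUM u:?P. rho r u p' q' * rho u s p q)"
 define L' where "L' = (%(r, p, p') (s, q, q'). if path_end G p = fst p' & path_end G q = fst q'
  then rho' r s (path_concat p p') (path_concat q q') else 0)"
 have "K (r, p, p') (s, q, q') = L' (r, p, p') (s, q, q')"
 proof (rule quasi_inverse_unique[where T = ?T and F = L
  and c = "%(r, p, p'). path_end G r = fst p & path_end G p = fst p'"
  and d = "%(r, p, p'). path_end G p = fst p' & path_end G p' = fst r"])
 fix x y assume "x : ?T" "y : ?T"
 then obtain r p p' s q q' where x: "x = (r, p, p')" "r : ?P" "p : ?A" "p' : ?B"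
  and y: "y = (s, q, q')" "s : ?P" "q : ?A" "q' : ?B" by auto
 have "(SUM z:?T. K x z * L z y) =
  (SUM w:?P. SUM a:?A. SUM b:?B. SUM v:?P. SUM u:?P. (rho' r v p a * rho' v w p' b) * (rho w u b q' * rho u s a q))"
  by (simp add: sum_triple K_def L_def x y sum_product)
 also have "... = (SUM (w, a, b, v, u):?P \<times> ?A \<times> ?B \<times> ?P \<times> ?P. (rho' r v p a * rho' v w p' b) * (rho w u b q' * rho u s a q))"
  by (simp add: sum.cartesian_product[symmetric])
 also have "... = (SUM (v, a, u, w, b):?P \<times> ?A \<times> ?P \<times> ?P \<times> ?B. (rho' r v p a * rho' v w p' b) * (rho w u b q' * rho u s a q))"
  by (rule sum.reindex_bij_witness[where i = "%(v, a, u, w, b). (w, a, b, v, u)" and j = "%(w, a, b, v, u). (v, a, u, w, b)"]) auto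
 also have "... = (SUM v:?P. SUM a:?A. SUM u:?P. rho' r v p a * mp n k rho' rho v u p' q' * rho u s a q)"
  by (simp add: sum.cartesian_product[symmetric] mp_nested sum_distrib_left sum_distrib_right mult_ac)
 also have "... = (SUM v:?P. SUM a:?A. SUM u:?P. if v = u then if path_end G v = fst p' & p' = q' then rho' r v p a * rho v s a q else 0 else 0)"
  using x y by (intro sum.cong refl) (simp add: D(1) delta_mat_def)
 also have "... = (SUM v:?P. SUM a:?A. if path_end G q = fst p' & p' = q' then rho' r v p a * rho v s a q else 0)"
 proof (intro sum.cong refl)
  fix v a assume v: "v : ?P" and a: "a : ?A"
  have "rho v s a q ~= 0 ==> path_end G q = path_end G v"
  using F(2)[OF v y(2) a y(3)] .
  then show "(SUM u:?P. if v = u then if path_end G v = fst p' & p' = q' then rho' r v p a * rho v s a q else 0 else 0) =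
   (if path_end G q = fst p' & p' = q' then rho' r v p a * rho v s a q else 0)"
  using v by (cases "rho v s a q = 0") simp_all
 qed
 also have "... = (if path_end G q = fst p' & p' = q' then mp n m rho' rho r s p q else 0)"
  unfolding mp_nested by (rule sum_if_const)
 also have "... = (if (case x of (r, p, p') => path_end G r = fst p & path_end G p = fst p') & x = y then 1 else 0)"
  unfolding D(1)[OF x(2) y(2) x(3) y(3)] delta_mat_def x(1) y(1)
  by (cases "p = q"; cases "p' = q'"; cases "r = s") simp_all
 finally show "(SUM z:?T. K x z * L z y) =
  (if (case x of (r, p, p') => path_end G r = fst p & path_end G p = fst p') & x = y then 1 else 0)" .
 have L: "L (r, p, p') (s, q, q') = (if path_end G p = fst p' & path_end G q = fst q'
  then rho r s (path_concat p p') (path_concat q q') else 0)"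
  if "r : ?P" "s : ?P" "p : ?A" "q : ?A" "p' : ?B" "q' : ?B" for r s p q p' q'
  using rmatrix_hexagon2[OF R, of r n s p m q p' k q'] that by (simp add: L_def)
 have "(SUM z:?T. L x z * L' z y) = (SUM w:?P. SUM a:?A. SUM b:?B. if path_end G a = fst b
  then (if path_end G p = fst p' & path_end G q = fst q' then rho r w (path_concat p p') (path_concat a b) *
   rho' w s (path_concat a b) (path_concat q q') else 0) else 0)"
  unfolding sum_triple using x y
  by (intro sum.cong refl) (simp add: L L'_def)
 also have "... = (if path_end G p = fst p' & path_end G q = fst q' then mp n (m + k) rho rho' r s (path_concat p p') (path_concat q q') else 0)"
  by (cases "path_end G p = fst p'"; cases "path_end G q = fst q'") (simp_all add: mp_nested sum_paths_concat_if cong: if_cong)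
 also have "... = (if (case y of (r, p, p') => path_end G p = fst p' & path_end G p' = fst r) & x = y then 1 else 0)"
 proof (cases "path_end G p = fst p' & path_end G q = fst q'")
  case True
  then have pc: "path_concat p p' : paths G (m + k)" "path_concat q q' : paths G (m + k)"
  using x y by (auto intro: path_concat_in)
  have "path_concat p p' = path_concat q q' \<longleftrightarrow> p = q & p' = q'"
  using path_concat_inject[OF x(3) y(3), of p' q'] True by blast
  moreover have "path_end G (path_concat p p') = path_end G p'" using True by (simp add: path_end_concat)
  ultimately show ?thesis
  using True unfolding D(2)[OF x(2) y(2) pc] delta_mat_def x(1) y(1)
  by (cases "p = q"; cases "p' = q'"; cases "r = s") simp_all
 next
  case False
  then show ?thesis unfolding x(1) y(1) by (subst if_not_P[OF False]) auto
 qed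
 finally show "(SUM z:?T. L x z * L' z y) =
  (if (case y of (r, p, p') => path_end G p = fst p' & path_end G p' = fst r) & x = y then 1 else 0)" .
 show "L' x y ~= 0 ==> case x of (r, p, p') => path_end G r = fst p & path_end G p = fst p'"
 proof -
  assume nz: "L' x y ~= 0"
  then have c: "path_end G p = fst p'" "path_end G q = fst q'" "rho' r s (path_concat p p') (path_concat q q') ~= 0"
  by (simp_all add: L'_def x(1) y(1) split: if_splits)
  then show ?thesis
  using D(4)[OF x(2) y(2) path_concat_in[OF x(3,4)] path_concat_in[OF y(3,4)]] unfolding x(1) by simp
 qed
 show "K x y ~= 0 ==> case y of (r, p, p') => path_end G p = fst p' & path_end G p' = fst r"
 proof -
  assume "K x y ~= 0"
  then have "(SUM v:?P. rho' r v p q * rho' v s p' q') ~= 0" by (simp add: K_def x y)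
  then obtain v where v: "v : ?P" "rho' r v p q ~= 0" "rho' v s p' q' ~= 0"
  by (metis (no_types, lifting) mult_zero_left mult_zero_right sum.neutral)
  then show ?thesis
  using S(2)[OF x(2) v(1) x(3) y(3)] S(2)[OF v(1) y(2) x(4) y(4)] F'(1)[OF v(1) y(2) x(4) y(4)] y by simp
 qed
 qed (use p p' r in auto)
 then show ?thesis by (simp add: K_def L'_def)
qed

lemma rmatrix_inverse_hexagon2:
 assumes R: "rmatrix_pair rho rho'" and p: "p : paths G m" "q : paths G m" and r: "r : paths G n" "s : paths G n"
 and r': "r' : paths G k" "s' : paths G k"
 shows "(SUM u:paths G m. rho' r' s' p u * rho' r s u q) =
 (if path_end G r = fst r' & path_end G s = fst s' then rho' (path_concat r r') (path_concat s s') p q else 0)"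
proof -
 note D = rmatrix_pairD[OF R] and S = rmatrix_right_support[OF R] and F = rmatrix_face_support[OF R]
 and F' = rmatrix_inverse_face_support[OF R]
 let ?P = "paths G m" and ?A = "paths G n" and ?B = "paths G k"
 let ?T = "?P \<times> ?A \<times> ?B"
 define K where "K = (%(p, r, r') (q, s, s'). SUM u:?P. rho' r' s' p u * rho' r s u q)"
 define L where "L = (%(p, r, r') (q, s, s'). SUM v:?P. rho r s p v * rho r' s' v q)"
 define L' where "L' = (%(p, r, r') (q, s, s'). if path_end G r = fst r' & path_end G s = fst s'
  then rho' (path_concat r r') (path_concat s s') p q else 0)"
 have "K (p, r, r') (q, s, s') = L' (p, r, r') (q, s, s')"
 proof (rule quasi_inverse_unique[where T = ?T and F = L
  and c = "%(p, r, r'). path_end G r = fst r' & path_end G r' = fst p"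
  and d = "%(p, r, r'). path_end G p = fst r & path_end G r = fst r'"])
 fix x y assume "x : ?T" "y : ?T"
 then obtain p r r' q s s' where x: "x = (p, r, r')" "p : ?P" "r : ?A" "r' : ?B"
  and y: "y = (q, s, s')" "q : ?P" "s : ?A" "s' : ?B" by auto
 have "(SUM z:?T. K x z * L z y) =
  (SUM w:?P. SUM a:?A. SUM b:?B. SUM u:?P. SUM v:?P. (rho' r' b p u * rho' r a u w) * (rho a s w v * rho b s' v q))"
  by (simp add: sum_triple K_def L_def x y sum_product)
 also have "... = (SUM (w, a, b, u, v):?P \<times> ?A \<times> ?B \<times> ?P \<times> ?P. (rho' r' b p u * rho' r a u w) * (rho a s w v * rho b s' v q))"
  by (simp add: sum.cartesian_product[symmetric])
 also have "... = (SUM (b, u, v, a, w):?B \<times> ?P \<times> ?P \<times> ?A \<times> ?P. (rho' r' b p u * rho' r a u w) * (rho a s w v * rho b s' v q))"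
  by (rule sum.reindex_bij_witness[where i = "%(b, u, v, a, w). (w, a, b, u, v)" and j = "%(w, a, b, u, v). (b, u, v, a, w)"]) auto
 also have "... = (SUM b:?B. SUM u:?P. SUM v:?P. rho' r' b p u * mp n m rho' rho r s u v * rho b s' v q)"
  by (simp add: sum.cartesian_product[symmetric] mp_nested sum_distrib_left sum_distrib_right mult_ac)
 also have "... = (SUM b:?B. SUM u:?P. SUM v:?P. if u = v then if path_end G r = fst u & r = s then rho' r' b p u * rho b s' u q else 0 else 0)"
  using x y by (intro sum.cong refl) (auto simp: D(1) delta_mat_def)
 also have "... = (SUM b:?B. SUM u:?P. if path_end G r = fst s' & r = s then rho' r' b p u * rho b s' u q else 0)"
 proof (intro sum.cong refl)
  fix b u assume b: "b : ?B" and u: "u : ?P"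
  have "rho b s' u q ~= 0 ==> fst u = fst s'"
  using F(1)[OF b y(4) u y(2)] .
  then show "(SUM v:?P. if u = v then if path_end G r = fst u & r = s then rho' r' b p u * rho b s' u q else 0 else 0) =
   (if path_end G r = fst s' & r = s then rho' r' b p u * rho b s' u q else 0)"
  using u by (cases "rho b s' u q = 0") simp_all
 qed
 also have "... = (if path_end G r = fst s' & r = s then mp k m rho' rho r' s' p q else 0)"
  unfolding mp_nested by (rule sum_if_const)
 also have "... = (if (case x of (p, r, r') => path_end G r = fst r' & path_end G r' = fst p) & x = y then 1 else 0)"
  unfolding D(1)[OF x(4) y(4) x(2) y(2)] delta_mat_def x(1) y(1)
  by (cases "p = q"; cases "r' = s'"; cases "r = s") simp_all
 finally show "(SUM z:?T. K x z * L z y) =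
  (if (case x of (p, r, r') => path_end G r = fst r' & path_end G r' = fst p) & x = y then 1 else 0)" .
 have L: "L (p, r, r') (q, s, s') = (if path_end G r = fst r' & path_end G s = fst s'
  then rho (path_concat r r') (path_concat s s') p q else 0)"
  if "p : ?P" "q : ?P" "r : ?A" "s : ?A" "r' : ?B" "s' : ?B" for r s p q r' s'
  using rmatrix_hexagon1[OF R, of r n s r' k s' p m q] that by (simp add: L_def)
 have "(SUM z:?T. L x z * L' z y) = (SUM w:?P. SUM a:?A. SUM b:?B. if path_end G a = fst b
  then (if path_end G r = fst r' & path_end G s = fst s' then rho (path_concat r r') (path_concat a b) p w *
   rho' (path_concat a b) (path_concat s s') w q else 0) else 0)"
  unfolding sum_triple using x y
  by (intro sum.cong refl) (simp add: L L'_def)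
 also have "... = (SUM w:?P. SUM z:paths G (n + k). if path_end G r = fst r' & path_end G s = fst s' then rho (path_concat r r') z p w *
   rho' z (path_concat s s') w q else 0)"
  by (cases "path_end G r = fst r'"; cases "path_end G s = fst s'") (simp_all add: sum_paths_concat_if cong: if_cong)
 also have "... = (if path_end G r = fst r' & path_end G s = fst s' then mp (n + k) m rho rho' (path_concat r r') (path_concat s s') p q else 0)"
  unfolding mp_nested by (subst sum.swap) (rule sum_if_const)
 also have "... = (if (case y of (p, r, r') => path_end G p = fst r & path_end G r = fst r') & x = y then 1 else 0)"
 proof (cases "path_end G r = fst r' & path_end G s = fst s'")
  case True
  then have pc: "path_concat r r' : paths G (n + k)" "path_concat s s' : paths G (n + k)"
  using x y by (auto intro: path_concat_in)
  have "path_concat r r' = path_concat s s' \<longleftrightarrow> r = s & r' = s'"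
  using path_concat_inject[OF x(3) y(3), of r' s'] True by blast
  then show ?thesis
  using True unfolding D(2)[OF pc x(2) y(2)] delta_mat_def x(1) y(1)
  by (cases "p = q"; cases "r' = s'"; cases "r = s") simp_all
 next
  case False
  then show ?thesis unfolding x(1) y(1) by (subst if_not_P[OF False]) auto
 qed
 finally show "(SUM z:?T. L x z * L' z y) =
  (if (case y of (p, r, r') => path_end G p = fst r & path_end G r = fst r') & x = y then 1 else 0)" .
 show "L' x y ~= 0 ==> case x of (p, r, r') => path_end G r = fst r' & path_end G r' = fst p"
 proof -
  assume nz: "L' x y ~= 0"
  then have c: "path_end G r = fst r'" "path_end G s = fst s'" "rho' (path_concat r r') (path_concat s s') p q ~= 0"
  by (simp_all add: L'_def x(1) y(1) split: if_splits)
  then show ?thesis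
  using D(4)[OF path_concat_in[OF x(3,4)] path_concat_in[OF y(3,4)] x(2) y(2)] unfolding x(1)
  by (simp add: path_end_concat)
 qed
 show "K x y ~= 0 ==> case y of (p, r, r') => path_end G p = fst r & path_end G r = fst r'"
 proof -
  assume "K x y ~= 0"
  then have "(SUM u:?P. rho' r' s' p u * rho' r s u q) ~= 0" by (simp add: K_def x y)
  then obtain u where u: "u : ?P" "rho' r' s' p u ~= 0" "rho' r s u q ~= 0"
  by (metis (no_types, lifting) mult_zero_left mult_zero_right sum.neutral)
  then show ?thesis
  using S(2)[OF x(4) y(4) x(2) u(1)] S(2)[OF x(3) y(3) u(1) y(2)] F'(2)[OF x(3) y(3) u(1) y(2)] y by simp
 qed
 qed (use p r r' in auto)
 then show ?thesis by (simp add: K_def L'_def)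
qed

text \<open>The flipped inverse of a braiding is a braiding; only the hexagons for the inverse need an argument,
  because inverses of products are products of inverses in the opposite order.\<close>

theorem rmatrix_pair_swap:
 assumes R: "rmatrix_pair rho rho'"
 shows "rmatrix_pair (%p q r s. rho' r s p q) (%p q r s. rho r s p q)"
 unfolding rmatrix_pair_def
proof (intro conjI allI ballI)
 note D = rmatrix_pairD[OF R]
 fix m n p q r s assume p: "p : paths G m" "q : paths G m" and r: "r : paths G n" "s : paths G n"
 show "mp m n (%p q r s. rho r s p q) (%p q r s. rho' r s p q) p q r s = delta_mat (%p r. path_end G p = fst r) p q r s"
 unfolding mp_flip[of m n rho rho'] D(2)[OF r p] by (auto simp: delta_mat_def)
 show "mp m n (%p q r s. rho' r s p q) (%p q r s. rho r s p q) p q r s = delta_mat (%p r. path_end G r = fst p) p q r s"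
 unfolding mp_flip[of m n rho' rho] D(1)[OF r p] by (auto simp: delta_mat_def)
 show "rho' r s p q ~= 0 --> path_end G r = fst p" "rho r s p q ~= 0 --> path_end G p = fst r"
 using D(3,4)[OF r p] by auto
qed (simp_all add: rmatrix_inverse_hexagon1[OF R] rmatrix_inverse_hexagon2[OF R])

end


section \<open>Quotients of the path algebra\<close>

text \<open>Both \<open>\<AA>(w)\<close> and the SOS algebra are quotients of the path algebra; all that is needed
  about them is the projection, which is a morphism of face algebras.\<close>

locale path_quotient = quiver G + face_algebra "verts G" Q
 for G :: "('v, 'e) pre_digraph" and Q :: "('q, 'v) face_alg" +
 fixes \<pi> :: "('v, 'e) path_comb => 'q"
 assumes pi_carrier: "carrier Q = \<pi> ` carrier H"
 and pi_add: "\<lbrakk>f : carrier H; g : carrier H\<rbrakk> \<Longrightarrow> \<pi> (f + g) = \<pi> f \<oplus>\<^bsub>Q\<^esub> \<pi> g"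
 and pi_scale: "f : carrier H ==> \<pi> (comb_scale c f) = c \<odot>\<^bsub>Q\<^esub> \<pi> f"
 and pi_mult: "\<lbrakk>f : carrier H; g : carrier H\<rbrakk> \<Longrightarrow> \<pi> (mul f g) = \<pi> f \<otimes>\<^bsub>Q\<^esub> \<pi> g"
 and pi_comult: "\<lbrakk>f : carrier H; bilinear_form Q B\<rbrakk> \<Longrightarrow>
  comult Q (\<pi> f) B = comult H f (%x y. B (\<pi> x) (\<pi> y))"
 and pi_counit: "f : carrier H ==> counit Q (\<pi> f) = counit H f"
 and pi_idem: "i : verts G ==> face_idem Q i = \<pi> (face_idem H i)"
  "i : verts G ==> face_idem_ring Q i = \<pi> (face_idem_ring H i)"
begin

abbreviation "E p q \<equiv> \<pi> (e_basis p q)"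

lemma pi_in: "f : carrier H ==> \<pi> f : carrier Q"
 by (simp add: pi_carrier)

lemma E_in: "p : paths G m ==> q : paths G m ==> E p q : carrier Q"
 by (intro pi_in e_basis_carrier path_pairsI)

lemma linear_form_pi: "linear_form Q X \<longleftrightarrow> linear_form H (%f. X (\<pi> f))"
 by (auto simp: linear_form_def pi_carrier pi_add[symmetric] pi_scale[symmetric] H_simps(5,6))

lemma bilinear_form_pi: "bilinear_form Q B \<longleftrightarrow> bilinear_form H (%f g. B (\<pi> f) (\<pi> g))"
 by (simp add: bilinear_form_def pi_carrier linear_form_pi)

lemma pi_zero: "\<pi> 0 = \<zero>\<^bsub>Q\<^esub>"
proof -
 have "\<pi> (comb_scale 0 0) = 0 \<odot>\<^bsub>Q\<^esub> \<pi> 0" by (rule pi_scale[OF H_zero_in])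
 then show ?thesis
 using pi_in[OF H_zero_in] smult_l_null by (simp add: comb_scale_simps complex_ring_def)
qed

lemma linear_form_Q_zero: "linear_form Q X ==> X \<zero>\<^bsub>Q\<^esub> = 0"
 unfolding pi_zero[symmetric] linear_form_pi by (rule linear_form_H_zero)

lemma E_mult:
 assumes "p : paths G m" "q : paths G m" "r : paths G n" "s : paths G n"
 shows "E p q \<otimes>\<^bsub>Q\<^esub> E r s =
 (if path_end G p = fst r & path_end G q = fst s then E (path_concat p r) (path_concat q s) else \<zero>\<^bsub>Q\<^esub>)"
 using assms by (simp add: pi_mult[symmetric] e_basis_carrier path_pairsI mul_basis pi_zero)

lemma E_comult:
 assumes "bilinear_form Q B" "p : paths G m" "q : paths G m"
 shows "comult Q (E p q) B = (SUM r:paths G m. B (E p r) (E r q))"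
 using assms by (simp add: pi_comult e_basis_carrier path_pairsI H_comult_basis bilinear_form_pi)

lemma E_counit: "p : paths G m ==> q : paths G m ==> counit Q (E p q) = (if p = q then 1 else 0)"
 by (simp add: pi_counit e_basis_carrier path_pairsI)

lemma linear_form_Q_eqI:
 assumes "linear_form Q X" "linear_form Q Y"
 and "!!m p q. p : paths G m ==> q : paths G m ==> X (E p q) = Y (E p q)" and "a : carrier Q"
 shows "X a = Y a"
 using linear_form_H_eqI[of "%f. X (\<pi> f)" "%f. Y (\<pi> f)"] assms by (auto simp: linear_form_pi pi_carrier)

lemma form_eq_iff:
 assumes X: "bilinear_form Q X" and Y: "bilinear_form Q Y"
 shows "form_eq X Y \<longleftrightarrow> (ALL m n. ALL p:paths G m. ALL q:paths G m. ALL r:paths G n. ALL s:paths G n.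
 X (E p q) (E r s) = Y (E p q) (E r s))"
proof
 assume "form_eq X Y"
 then show "ALL m n. ALL p:paths G m. ALL q:paths G m. ALL r:paths G n. ALL s:paths G n. X (E p q) (E r s) = Y (E p q) (E r s)"
 unfolding form_eq_def using E_in by blast
next
 assume eq: "ALL m n. ALL p:paths G m. ALL q:paths G m. ALL r:paths G n. ALL s:paths G n. X (E p q) (E r s) = Y (E p q) (E r s)"
 show "form_eq X Y"
 unfolding form_eq_def
 proof (intro ballI)
 fix a b assume a: "a : carrier Q" and b: "b : carrier Q"
 have "X (E p q) b = Y (E p q) b" if "p : paths G m" "q : paths G m" for m p q
  using linear_form_Q_eqI[OF bilinear_form_right[OF X E_in] bilinear_form_right[OF Y E_in] _ b] that eq by blast
 then show "X a b = Y a b"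
  using linear_form_Q_eqI[OF bilinear_form_left[OF X b] bilinear_form_left[OF Y b] _ a] by blast
 qed
qed

lemma conv_E:
 assumes X: "bilinear_form Q X" and Y: "bilinear_form Q Y"
 and p: "p : paths G m" "q : paths G m" and r: "r : paths G n" "s : paths G n"
 shows "conv X Y (E p q) (E r s) =
 mp m n (%p q r s. X (E p q) (E r s)) (%p q r s. Y (E p q) (E r s)) p q r s"
proof -
 have "conv X Y (E p q) (E r s) = (SUM u:paths G m. comult Q (E r s) (%b1 b2. X (E p u) b1 * Y (E u q) b2))"
 unfolding conv_def by (rule E_comult[OF bilinear_form_conv_inner[OF E_in[OF r] X Y] p])
 also have "... = (SUM u:paths G m. SUM v:paths G n. X (E p u) (E r v) * Y (E u q) (E v s))"
 using p by (intro sum.cong refl E_comult[OF bilinear_form_prod[OF bilinear_form_right[OF X E_in] bilinear_form_right[OF Y E_in]] r])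
 finally show ?thesis by (simp add: mp_nested)
qed

definition commutes where
 "commutes rho \<longleftrightarrow> (ALL X. linear_form Q X -->
 (ALL m n. ALL p:paths G m. ALL q:paths G m. ALL r:paths G n. ALL s:paths G n.
  mp m n rho (%p q r s. X (E p q \<otimes>\<^bsub>Q\<^esub> E r s)) p q r s = mp m n (%p q r s. X (E r s \<otimes>\<^bsub>Q\<^esub> E p q)) rho p q r s))"

lemma E_mult_zero:
 assumes "linear_form Q X" "p : paths G m" "q : paths G m" "r : paths G n" "s : paths G n"
 and "~ (path_end G p = fst r & path_end G q = fst s)"
 shows "X (E p q \<otimes>\<^bsub>Q\<^esub> E r s) = 0"
 using assms(6) by (simp only: E_mult[OF assms(2-5)] if_False linear_form_Q_zero[OF assms(1)])

lemma commutes_swap: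
 assumes R: "rmatrix_pair rho rho'" and c: "commutes rho"
 shows "commutes (%p q r s. rho' r s p q)"
 unfolding commutes_def
proof (intro allI impI ballI)
 note D = rmatrix_pairD[OF R]
 fix X m n p q r s
 assume X: "linear_form Q X" and p: "p : paths G m" "q : paths G m" and r: "r : paths G n" "s : paths G n"
 let ?m = "%p q r s. X (E p q \<otimes>\<^bsub>Q\<^esub> E r s)" and ?mo = "%p q r s. X (E r s \<otimes>\<^bsub>Q\<^esub> E p q)"
 have "mp n m rho' ?mo r s p q = mp n m rho' (mp n m ?mo (delta_mat (%p r. path_end G r = fst p))) r s p q"
 by (rule mp_cong) (use p r in \<open>auto simp: delta_mat_right E_mult_zero[OF X]\<close>)
 also have "... = mp n m rho' (mp n m ?mo (mp n m rho rho')) r s p q"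
 by (intro mp_cong refl) (simp_all add: D(2) p r)
 also have "... = mp n m rho' (mp n m (mp n m rho ?m) rho') r s p q"
 proof (rule mp_cong)
 fix u v assume uv: "u : paths G n" "v : paths G m"
 show "mp n m ?mo (mp n m rho rho') u s v q = mp n m (mp n m rho ?m) rho' u s v q"
  unfolding mp_assoc[symmetric] by (rule mp_cong) (use c X uv in \<open>simp_all add: commutes_def\<close>)
 qed simp
 also have "... = mp n m rho' (mp n m rho (mp n m ?m rho')) r s p q"
 by (rule mp_cong) (simp_all add: mp_assoc)
 also have "... = mp n m (mp n m rho' rho) (mp n m ?m rho') r s p q"
 by (simp add: mp_assoc)
 also have "... = mp n m (delta_mat (%p r. path_end G p = fst r)) (mp n m ?m rho') r s p q"
 by (intro mp_cong refl) (simp_all add: D(1) p r)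
 also have "... = mp n m ?m rho' r s p q"
 proof (cases "path_end G r = fst p")
 case False
 then have "mp n m ?m rho' r s p q = 0"
  unfolding mp_nested using p r by (intro sum.neutral ballI) (simp add: E_mult_zero[OF X])
 then show ?thesis using False by (simp add: delta_mat_left p r)
 qed (simp add: delta_mat_left p r)
 finally have "mp n m rho' ?mo r s p q = mp n m ?m rho' r s p q" .
 then show "mp m n (%p q r s. rho' r s p q) ?m p q r s = mp m n ?mo (%p q r s. rho' r s p q) p q r s"
 using mp_flip[of m n rho' ?mo p q r s] mp_flip[of m n ?m rho' p q r s] by simp
qed

theorem braiding_pair_iff:
 "braiding_pair Rp Rm \<longleftrightarrow> bilinear_form Q Rp & bilinear_form Q Rm \<and>
 rmatrix_pair (%p q r s. Rp (E p q) (E r s)) (%p q r s. Rm (E p q) (E r s)) \<and>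
 commutes (%p q r s. Rp (E p q) (E r s))"
proof (cases "bilinear_form Q Rp & bilinear_form Q Rm")
 case False
 then show ?thesis by (auto simp: braiding_pair_def)
next
 case True
 then have Rp: "bilinear_form Q Rp" and Rm: "bilinear_form Q Rm" by auto
 define rho rho' where "rho = (%p q r s. Rp (E p q) (E r s))" and "rho' = (%p q r s. Rm (E p q) (E r s))"
 note bc = bilinear_form_conv
 have ms: "(%p q r s. m_star X (E p q) (E r s)) = (%p q r s. X (E p q \<otimes>\<^bsub>Q\<^esub> E r s))"
 and mos: "(%p q r s. mop_star X (E p q) (E r s)) = (%p q r s. X (E r s \<otimes>\<^bsub>Q\<^esub> E p q))" for X
 by (simp_all add: m_star_def mop_star_def)
 have eps: "m_star (counit Q) (E p q) (E r s) = delta_mat (%p r. path_end G p = fst r) p q r s"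
 "mop_star (counit Q) (E p q) (E r s) = delta_mat (%p r. path_end G r = fst p) p q r s"
 if pr: "p : paths G m" "q : paths G m" "r : paths G n" "s : paths G n" for m n p q r s
 proof -
 have z: "counit Q \<zero>\<^bsub>Q\<^esub> = 0" by (rule linear_form_Q_zero[OF counit_linear])
 show "m_star (counit Q) (E p q) (E r s) = delta_mat (%p r. path_end G p = fst r) p q r s"
 proof (cases "path_end G p = fst r & path_end G q = fst s")
  case True
  then have "m_star (counit Q) (E p q) (E r s) = counit Q (E (path_concat p r) (path_concat q s))"
  by (simp add: m_star_def E_mult[OF pr])
  also have "... = (if path_concat p r = path_concat q s then 1 else 0)"
  using True pr by (intro E_counit[of _ "m + n"] path_concat_in) auto
  also have "(path_concat p r = path_concat q s) = (p = q & r = s)"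
  using path_concat_inject[OF pr(1,2), of r s] True by blast
  finally show ?thesis using True by (simp add: delta_mat_def)
 qed (auto simp: m_star_def E_mult[OF pr] z delta_mat_def)
 show "mop_star (counit Q) (E p q) (E r s) = delta_mat (%p r. path_end G r = fst p) p q r s"
 proof (cases "path_end G r = fst p & path_end G s = fst q")
  case True
  then have "mop_star (counit Q) (E p q) (E r s) = counit Q (E (path_concat r p) (path_concat s q))"
  by (simp add: mop_star_def E_mult[OF pr(3,4,1,2)])
  also have "... = (if path_concat r p = path_concat s q then 1 else 0)"
  using True pr by (intro E_counit[of _ "n + m"] path_concat_in) auto
  also have "(path_concat r p = path_concat s q) = (r = s & p = q)"
  using path_concat_inject[OF pr(3,4), of p q] True by blast
  finally show ?thesis using True by (auto simp: delta_mat_def)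
 qed (auto simp: mop_star_def E_mult[OF pr(3,4,1,2)] z delta_mat_def)
 qed
 have conv_mp: "conv X Y (E p q) (E r s) = mp m n (%p q r s. X (E p q) (E r s)) (%p q r s. Y (E p q) (E r s)) p q r s"
 if "bilinear_form Q X" "bilinear_form Q Y" "p : paths G m" "q : paths G m" "r : paths G n" "s : paths G n"
 for X Y m n p q r s
 using conv_E that by blast
 have conv_mp3: "conv (conv X Y) Z (E p q) (E r s) = mp m n (mp m n (%p q r s. X (E p q) (E r s)) (%p q r s. Y (E p q) (E r s)))
  (%p q r s. Z (E p q) (E r s)) p q r s"
 if X: "bilinear_form Q X" "bilinear_form Q Y" "bilinear_form Q Z" and pr: "p : paths G m" "q : paths G m" "r : paths G n" "s : paths G n"
 for X Y Z m n p q r s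
 unfolding conv_E[OF bc[OF X(1,2)] X(3) pr]
 by (rule mp_cong) (use X pr in \<open>simp_all add: conv_E\<close>)
 define P1 where "P1 \<longleftrightarrow> (ALL m n. ALL p:paths G m. ALL q:paths G m. ALL r:paths G n. ALL s:paths G n.
  mp m n rho' rho p q r s = delta_mat (%p r. path_end G p = fst r) p q r s)"
 define P2 where "P2 \<longleftrightarrow> (ALL m n. ALL p:paths G m. ALL q:paths G m. ALL r:paths G n. ALL s:paths G n.
  mp m n rho rho' p q r s = delta_mat (%p r. path_end G r = fst p) p q r s)"
 define P3 where "P3 \<longleftrightarrow> (ALL m n. ALL p:paths G m. ALL q:paths G m. ALL r:paths G n. ALL s:paths G n.
  rho p q r s ~= 0 --> path_end G r = fst p)"
 define P4 where "P4 \<longleftrightarrow> (ALL m n. ALL p:paths G m. ALL q:paths G m. ALL r:paths G n. ALL s:paths G n.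
  rho' p q r s ~= 0 --> path_end G p = fst r)"
 define P6 where "P6 \<longleftrightarrow> (ALL m k n. ALL p:paths G m. ALL q:paths G m. ALL p':paths G k. ALL q':paths G k. ALL r:paths G n. ALL s:paths G n.
  (SUM v:paths G n. rho p q r v * rho p' q' v s) =
  (if path_end G p = fst p' & path_end G q = fst q' then rho (path_concat p p') (path_concat q q') r s else 0))"
 define P7 where "P7 \<longleftrightarrow> (ALL m n k. ALL p:paths G m. ALL q:paths G m. ALL r:paths G n. ALL s:paths G n. ALL r':paths G k. ALL s':paths G k.
  (SUM u:paths G m. rho p u r' s' * rho u q r s) =
  (if path_end G r = fst r' & path_end G s = fst s' then rho p q (path_concat r r') (path_concat s s') else 0))"
 have rp: "rmatrix_pair rho rho' \<longleftrightarrow> P1 & P2 & P3 & P4 & P6 & P7"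
 unfolding rmatrix_pair_def P1_def P2_def P3_def P4_def P6_def P7_def
 by (simp only: ball_conj_distrib all_conj_distrib conj_assoc)
 have 1: "form_eq (conv Rm Rp) (m_star (counit Q)) \<longleftrightarrow> P1"
 unfolding form_eq_iff[OF bc[OF Rm Rp] bilinear_form_m_star[OF counit_linear]] P1_def
 by (intro iff_allI ball_cong refl) (simp add: conv_mp Rp Rm eps rho_def rho'_def)
 have 2: "form_eq (conv Rp Rm) (mop_star (counit Q)) \<longleftrightarrow> P2"
 unfolding form_eq_iff[OF bc[OF Rp Rm] bilinear_form_mop_star[OF counit_linear]] P2_def
 by (intro iff_allI ball_cong refl) (simp add: conv_mp Rp Rm eps rho_def rho'_def)
 have 3: "form_eq (conv (conv Rp Rm) Rp) Rp \<longleftrightarrow> P3" if P2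
 proof -
 have "conv (conv Rp Rm) Rp (E p q) (E r s) = Rp (E p q) (E r s) \<longleftrightarrow> (rho p q r s ~= 0 --> path_end G r = fst p)"
  if pr: "p : paths G m" "q : paths G m" "r : paths G n" "s : paths G n" for m n p q r s
 proof -
  have "conv (conv Rp Rm) Rp (E p q) (E r s) = mp m n (mp m n rho rho') rho p q r s"
  unfolding rho_def rho'_def by (rule conv_mp3[OF Rp Rm Rp pr])
  also have "... = mp m n (delta_mat (%p r. path_end G r = fst p)) rho p q r s"
  by (rule mp_cong) (use \<open>P2\<close> pr in \<open>simp_all add: P2_def\<close>)
  also have "... = (if path_end G r = fst p then rho p q r s else 0)"
  by (simp add: delta_mat_left pr)
  finally show ?thesis by (auto simp: rho_def)
 qed
 then show ?thesis unfolding form_eq_iff[OF bc[OF bc[OF Rp Rm] Rp] Rp] P3_def by blast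
 qed
 have 4: "form_eq (conv (conv Rm Rp) Rm) Rm \<longleftrightarrow> P4" if P1
 proof -
 have "conv (conv Rm Rp) Rm (E p q) (E r s) = Rm (E p q) (E r s) \<longleftrightarrow> (rho' p q r s ~= 0 --> path_end G p = fst r)"
  if pr: "p : paths G m" "q : paths G m" "r : paths G n" "s : paths G n" for m n p q r s
 proof -
  have "conv (conv Rm Rp) Rm (E p q) (E r s) = mp m n (mp m n rho' rho) rho' p q r s"
  unfolding rho_def rho'_def by (rule conv_mp3[OF Rm Rp Rm pr])
  also have "... = mp m n (delta_mat (%p r. path_end G p = fst r)) rho' p q r s"
  by (rule mp_cong) (use \<open>P1\<close> pr in \<open>simp_all add: P1_def\<close>)
  also have "... = (if path_end G p = fst r then rho' p q r s else 0)"
  by (simp add: delta_mat_left pr)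
  finally show ?thesis by (auto simp: rho'_def)
 qed
 then show ?thesis unfolding form_eq_iff[OF bc[OF bc[OF Rm Rp] Rm] Rm] P4_def by blast
 qed
 have 5: "(ALL X. linear_form Q X --> form_eq (conv (conv Rp (m_star X)) Rm) (mop_star X)) \<longleftrightarrow> commutes rho"
 if P1 P2
 proof -
 have "form_eq (conv (conv Rp (m_star X)) Rm) (mop_star X) \<longleftrightarrow>
  (ALL m n. ALL p:paths G m. ALL q:paths G m. ALL r:paths G n. ALL s:paths G n.
  mp m n rho (%p q r s. X (E p q \<otimes>\<^bsub>Q\<^esub> E r s)) p q r s = mp m n (%p q r s. X (E r s \<otimes>\<^bsub>Q\<^esub> E p q)) rho p q r s)"
  if X: "linear_form Q X" for X
 proof -
  let ?m = "%p q r s. X (E p q \<otimes>\<^bsub>Q\<^esub> E r s)" and ?mo = "%p q r s. X (E r s \<otimes>\<^bsub>Q\<^esub> E p q)"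
  note bm = bilinear_form_m_star[OF X] and bmo = bilinear_form_mop_star[OF X]
  have c3: "conv (conv Rp (m_star X)) Rm (E p q) (E r s) = mp m n (mp m n rho ?m) rho' p q r s"
  if "p : paths G m" "q : paths G m" "r : paths G n" "s : paths G n" for m n p q r s
  using conv_mp3[OF Rp bm Rm that] by (simp add: rho_def rho'_def m_star_def)
  have fe: "form_eq (conv (conv Rp (m_star X)) Rm) (mop_star X) \<longleftrightarrow>
  (ALL m n. ALL p:paths G m. ALL q:paths G m. ALL r:paths G n. ALL s:paths G n. mp m n (mp m n rho ?m) rho' p q r s = ?mo p q r s)"
  unfolding form_eq_iff[OF bc[OF bc[OF Rp bm] Rm] bmo]
  by (intro iff_allI ball_cong refl) (simp add: c3 mop_star_def)
  show ?thesis unfolding fe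
  proof (intro iffI allI ballI)
  fix m n p q r s
  assume eq: "ALL m n. ALL p:paths G m. ALL q:paths G m. ALL r:paths G n. ALL s:paths G n. mp m n (mp m n rho ?m) rho' p q r s = ?mo p q r s"
   and pr: "p : paths G m" "q : paths G m" "r : paths G n" "s : paths G n"
  have "mp m n ?mo rho p q r s = mp m n (mp m n (mp m n rho ?m) rho') rho p q r s"
   by (rule mp_cong) (use eq pr in simp_all)
  also have "... = mp m n (mp m n rho ?m) (delta_mat (%p r. path_end G p = fst r)) p q r s"
   unfolding mp_assoc[of m n "mp m n rho ?m"] by (rule mp_cong) (use \<open>P1\<close> pr in \<open>simp_all add: P1_def\<close>)
  also have "... = mp m n rho ?m p q r s"
  proof (cases "path_end G q = fst s")
   case False
   then have "mp m n rho ?m p q r s = 0"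
   unfolding mp_nested using pr by (intro sum.neutral ballI) (simp add: E_mult_zero[OF X])
   then show ?thesis using False by (simp add: delta_mat_right pr)
  qed (simp add: delta_mat_right pr)
  finally show "mp m n rho ?m p q r s = mp m n ?mo rho p q r s" by simp
  next
  fix m n p q r s
  assume eq: "ALL m n. ALL p:paths G m. ALL q:paths G m. ALL r:paths G n. ALL s:paths G n. mp m n rho ?m p q r s = mp m n ?mo rho p q r s"
   and pr: "p : paths G m" "q : paths G m" "r : paths G n" "s : paths G n"
  have "mp m n (mp m n rho ?m) rho' p q r s = mp m n (mp m n ?mo rho) rho' p q r s"
   by (rule mp_cong) (use eq pr in simp_all)
  also have "... = mp m n ?mo (delta_mat (%p r. path_end G r = fst p)) p q r s"
   unfolding mp_assoc by (rule mp_cong) (use \<open>P2\<close> pr in \<open>simp_all add: P2_def\<close>)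
  also have "... = ?mo p q r s"
   using pr by (auto simp: delta_mat_right E_mult_zero[OF X])
  finally show "mp m n (mp m n rho ?m) rho' p q r s = ?mo p q r s" .
  qed
 qed
 then show ?thesis unfolding commutes_def by blast
 qed
 have 6: "(ALL a:carrier Q. ALL b:carrier Q. ALL c:carrier Q. Rp (a \<otimes>\<^bsub>Q\<^esub> b) c = comult Q c (%c1 c2. Rp a c1 * Rp b c2)) \<longleftrightarrow> P6"
 proof -
 note lr = bilinear_form_right[OF Rp] and ll = bilinear_form_left[OF Rp]
 have rhs: "comult Q (E r s) (%c1 c2. Rp (E p q) c1 * Rp (E p' q') c2) = (SUM v:paths G n. rho p q r v * rho p' q' v s)"
  if "p : paths G m" "q : paths G m" "p' : paths G k" "q' : paths G k" "r : paths G n" "s : paths G n" for m k n p q p' q' r s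
  using E_comult[OF bilinear_form_prod[OF lr[OF E_in[OF that(1,2)]] lr[OF E_in[OF that(3,4)]]] that(5,6)]
  by (simp add: rho_def)
 have lhs: "Rp (E p q \<otimes>\<^bsub>Q\<^esub> E p' q') (E r s) =
  (if path_end G p = fst p' & path_end G q = fst q' then rho (path_concat p p') (path_concat q q') r s else 0)"
  if "p : paths G m" "q : paths G m" "p' : paths G k" "q' : paths G k" "r : paths G n" "s : paths G n" for m k n p q p' q' r s
  using linear_form_Q_zero[OF ll[OF E_in[OF that(5,6)]]] by (simp add: E_mult[OF that(1-4)] rho_def)
 show ?thesis
 proof
  assume h: "ALL a:carrier Q. ALL b:carrier Q. ALL c:carrier Q. Rp (a \<otimes>\<^bsub>Q\<^esub> b) c = comult Q c (%c1 c2. Rp a c1 * Rp b c2)"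
  show P6 unfolding P6_def
  proof (intro allI ballI)
  fix m k n p q p' q' r s
  assume pr: "p : paths G m" "q : paths G m" "p' : paths G k" "q' : paths G k" "r : paths G n" "s : paths G n"
  show "(SUM v:paths G n. rho p q r v * rho p' q' v s) =
   (if path_end G p = fst p' & path_end G q = fst q' then rho (path_concat p p') (path_concat q q') r s else 0)"
   unfolding rhs[OF pr, symmetric] lhs[OF pr, symmetric] by (rule h[rule_format, symmetric]) (rule E_in[OF pr(1,2)] E_in[OF pr(3,4)] E_in[OF pr(5,6)])+
  qed
 next
  assume h: P6
  have E3: "Rp (E p q \<otimes>\<^bsub>Q\<^esub> E p' q') (E r s) = comult Q (E r s) (%c1 c2. Rp (E p q) c1 * Rp (E p' q') c2)"
  if "p : paths G m" "q : paths G m" "p' : paths G k" "q' : paths G k" "r : paths G n" "s : paths G n" for m k n p q p' q' r s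
  unfolding rhs[OF that] lhs[OF that] by (rule h[unfolded P6_def, rule_format, OF that, symmetric])
  show "ALL a:carrier Q. ALL b:carrier Q. ALL c:carrier Q. Rp (a \<otimes>\<^bsub>Q\<^esub> b) c = comult Q c (%c1 c2. Rp a c1 * Rp b c2)"
  proof (intro ballI)
  fix a b c assume a: "a : carrier Q" and b: "b : carrier Q" and c: "c : carrier Q"
  have c_lin: "linear_form Q (%c. comult Q c (%c1 c2. Rp a c1 * Rp b c2))" if "a : carrier Q" "b : carrier Q" for a b
   by (rule linear_form_comult[OF bilinear_form_prod[OF lr[OF that(1)] lr[OF that(2)]]])
  have c1: "Rp (E p q \<otimes>\<^bsub>Q\<^esub> E p' q') c = comult Q c (%c1 c2. Rp (E p q) c1 * Rp (E p' q') c2)"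
   if pr: "p : paths G m" "q : paths G m" "p' : paths G k" "q' : paths G k" for m k p q p' q'
  proof (rule linear_form_Q_eqI[OF lr c_lin E3[OF pr] c])
   have "E p q \<otimes>\<^bsub>Q\<^esub> E p' q' = \<pi> (mul (e_basis p q) (e_basis p' q'))"
   using pr by (simp add: pi_mult e_basis_carrier path_pairsI)
   then show "E p q \<otimes>\<^bsub>Q\<^esub> E p' q' : carrier Q"
   using pr by (simp add: pi_in mul_in e_basis_carrier path_pairsI)
  qed (use pr E_in in auto)
  have b_lin: "linear_form Q (%b. comult Q c (%c1 c2. Rp a c1 * Rp b c2))" if a: "a : carrier Q" for a
   by (rule linear_form_comult_param[OF c linear_form_times[OF ll] bilinear_form_prod[OF lr[OF a] lr]])
   (simp_all add: smult_in)
  have a_lin: "linear_form Q (%a. comult Q c (%c1 c2. Rp a c1 * Rp b c2))"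
   by (rule linear_form_comult_param[OF c linear_form_times_right[OF ll] bilinear_form_prod[OF lr lr[OF b]]])
   (simp_all add: smult_in)
  have c2: "Rp (E p q \<otimes>\<^bsub>Q\<^esub> b) c = comult Q c (%c1 c2. Rp (E p q) c1 * Rp b c2)"
   if pr: "p : paths G m" "q : paths G m" for m p q
   by (rule linear_form_Q_eqI[OF linear_form_mult_right[OF ll[OF c] E_in[OF pr]] b_lin[OF E_in[OF pr]] c1[OF pr] b])
  show "Rp (a \<otimes>\<^bsub>Q\<^esub> b) c = comult Q c (%c1 c2. Rp a c1 * Rp b c2)"
   by (rule linear_form_Q_eqI[OF linear_form_mult_left[OF ll[OF c] b] a_lin c2 a])
  qed
 qed
 qed
 have 7: "(ALL a:carrier Q. ALL b:carrier Q. ALL c:carrier Q. Rp a (b \<otimes>\<^bsub>Q\<^esub> c) = comult Q a (%a1 a2. Rp a1 c * Rp a2 b)) \<longleftrightarrow> P7"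
 proof -
 note lr = bilinear_form_right[OF Rp] and ll = bilinear_form_left[OF Rp]
 have rhs: "comult Q (E p q) (%c1 c2. Rp c1 (E r' s') * Rp c2 (E r s)) = (SUM u:paths G m. rho p u r' s' * rho u q r s)"
  if "p : paths G m" "q : paths G m" "r : paths G n" "s : paths G n" "r' : paths G k" "s' : paths G k" for m k n p q r s r' s'
  using E_comult[OF bilinear_form_prod[OF ll[OF E_in[OF that(5,6)]] ll[OF E_in[OF that(3,4)]]] that(1,2)]
  by (simp add: rho_def)
 have lhs: "Rp (E p q) (E r s \<otimes>\<^bsub>Q\<^esub> E r' s') =
  (if path_end G r = fst r' & path_end G s = fst s' then rho p q (path_concat r r') (path_concat s s') else 0)"
  if "p : paths G m" "q : paths G m" "r : paths G n" "s : paths G n" "r' : paths G k" "s' : paths G k" for m k n p q r s r' s'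
  using linear_form_Q_zero[OF lr[OF E_in[OF that(1,2)]]] by (simp add: E_mult[OF that(3-6)] rho_def)
 show ?thesis
 proof
  assume h: "ALL a:carrier Q. ALL b:carrier Q. ALL c:carrier Q. Rp a (b \<otimes>\<^bsub>Q\<^esub> c) = comult Q a (%a1 a2. Rp a1 c * Rp a2 b)"
  show P7 unfolding P7_def
  proof (intro allI ballI)
  fix m n k p q r s r' s'
  assume pr: "p : paths G m" "q : paths G m" "r : paths G n" "s : paths G n" "r' : paths G k" "s' : paths G k"
  show "(SUM u:paths G m. rho p u r' s' * rho u q r s) =
   (if path_end G r = fst r' & path_end G s = fst s' then rho p q (path_concat r r') (path_concat s s') else 0)"
   unfolding rhs[OF pr, symmetric] lhs[OF pr, symmetric] by (rule h[rule_format, symmetric]) (rule E_in[OF pr(1,2)] E_in[OF pr(3,4)] E_in[OF pr(5,6)])+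
  qed
 next
  assume h: P7
  have E3: "Rp (E p q) (E r s \<otimes>\<^bsub>Q\<^esub> E r' s') = comult Q (E p q) (%c1 c2. Rp c1 (E r' s') * Rp c2 (E r s))"
  if "r : paths G n" "s : paths G n" "r' : paths G k" "s' : paths G k" "p : paths G m" "q : paths G m" for m k n p q r s r' s'
  unfolding rhs[OF that(5,6,1-4)] lhs[OF that(5,6,1-4)] by (rule h[unfolded P7_def, rule_format, OF that(5,6,1-4), symmetric])
  show "ALL a:carrier Q. ALL b:carrier Q. ALL c:carrier Q. Rp a (b \<otimes>\<^bsub>Q\<^esub> c) = comult Q a (%a1 a2. Rp a1 c * Rp a2 b)"
  proof (intro ballI)
  fix c a b assume c: "c : carrier Q" and a: "a : carrier Q" and b: "b : carrier Q"
  have c_lin: "linear_form Q (%c. comult Q c (%c1 c2. Rp c1 b * Rp c2 a))" if "a : carrier Q" "b : carrier Q" for a b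
   by (rule linear_form_comult[OF bilinear_form_prod[OF ll[OF that(2)] ll[OF that(1)]]])
  have c1: "Rp c (E r s \<otimes>\<^bsub>Q\<^esub> E r' s') = comult Q c (%c1 c2. Rp c1 (E r' s') * Rp c2 (E r s))"
   if pr: "r : paths G n" "s : paths G n" "r' : paths G k" "s' : paths G k" for n k r s r' s'
  proof (rule linear_form_Q_eqI[OF ll c_lin E3[OF pr] c])
   have "E r s \<otimes>\<^bsub>Q\<^esub> E r' s' = \<pi> (mul (e_basis r s) (e_basis r' s'))"
   using pr by (simp add: pi_mult e_basis_carrier path_pairsI)
   then show "E r s \<otimes>\<^bsub>Q\<^esub> E r' s' : carrier Q"
   using pr by (simp add: pi_in mul_in e_basis_carrier path_pairsI)
  qed (use pr E_in in auto)
  have b_lin: "linear_form Q (%b. comult Q c (%c1 c2. Rp c1 b * Rp c2 a))" if a: "a : carrier Q" for a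
   by (rule linear_form_comult_param[OF c linear_form_times_right[OF lr] bilinear_form_prod[OF ll ll[OF a]]])
   (simp_all add: smult_in)
  have a_lin: "linear_form Q (%a. comult Q c (%c1 c2. Rp c1 b * Rp c2 a))"
   by (rule linear_form_comult_param[OF c linear_form_times[OF lr] bilinear_form_prod[OF ll[OF b] ll]])
   (simp_all add: smult_in)
  have c2: "Rp c (E r s \<otimes>\<^bsub>Q\<^esub> b) = comult Q c (%c1 c2. Rp c1 b * Rp c2 (E r s))"
   if pr: "r : paths G n" "s : paths G n" for n r s
   by (rule linear_form_Q_eqI[OF linear_form_mult_right[OF lr[OF c] E_in[OF pr]] b_lin[OF E_in[OF pr]] c1[OF pr] b])
  show "Rp c (a \<otimes>\<^bsub>Q\<^esub> b) = comult Q c (%c1 c2. Rp c1 b * Rp c2 a)"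
   by (rule linear_form_Q_eqI[OF linear_form_mult_left[OF lr[OF c] b] a_lin c2 a])
  qed
 qed
 qed
 show ?thesis
 unfolding braiding_pair_def rho_def[symmetric] rho'_def[symmetric] rp
 using Rp Rm 1 2 3 4 5 6 7 by blast
qed

definition com where
 "com rho m n \<longleftrightarrow> (ALL X. linear_form Q X --> (ALL p:paths G m. ALL q:paths G m. ALL r:paths G n. ALL s:paths G n.
  (SUM u:paths G m. SUM v:paths G n. rho p u r v * X (E u q \<otimes>\<^bsub>Q\<^esub> E v s)) =
  (SUM u:paths G m. SUM v:paths G n. X (E r v \<otimes>\<^bsub>Q\<^esub> E p u) * rho u q v s)))"

lemma commutes_com: "commutes rho \<longleftrightarrow> (ALL m n. com rho m n)"
 unfolding commutes_def com_def mp_nested by blast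

lemma comD:
 assumes "com rho m n" "linear_form Q X" "p : paths G m" "q : paths G m" "r : paths G n" "s : paths G n"
 shows "(SUM u:paths G m. SUM v:paths G n. rho p u r v * X (E u q \<otimes>\<^bsub>Q\<^esub> E v s)) =
  (SUM u:paths G m. SUM v:paths G n. X (E r v \<otimes>\<^bsub>Q\<^esub> E p u) * rho u q v s)"
 using assms unfolding com_def by blast

lemma E_assoc:
 assumes "p : paths G m" "q : paths G m" "r : paths G n" "s : paths G n" "u : paths G k" "v : paths G k"
 shows "E p q \<otimes>\<^bsub>Q\<^esub> E r s \<otimes>\<^bsub>Q\<^esub> E u v = E p q \<otimes>\<^bsub>Q\<^esub> (E r s \<otimes>\<^bsub>Q\<^esub> E u v)"
 by (rule A_m_assoc[OF E_in[OF assms(1,2)] E_in[OF assms(3,4)] E_in[OF assms(5,6)]])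

lemma E_concat:
 assumes "p : paths G m" "q : paths G m" "p' : paths G k" "q' : paths G k" "v : paths G n" "s : paths G n"
 and "path_end G p = fst p'" "path_end G q = fst q'"
 shows "E p q \<otimes>\<^bsub>Q\<^esub> (E p' q' \<otimes>\<^bsub>Q\<^esub> E v s) = E (path_concat p p') (path_concat q q') \<otimes>\<^bsub>Q\<^esub> E v s"
 and "E v s \<otimes>\<^bsub>Q\<^esub> E p q \<otimes>\<^bsub>Q\<^esub> E p' q' = E v s \<otimes>\<^bsub>Q\<^esub> E (path_concat p p') (path_concat q q')"
 using E_assoc[OF assms(1-6)] E_assoc[OF assms(5,6,1-4)] E_mult[OF assms(1-4)] assms(7,8) by simp_all

lemma com_left:
 assumes R: "rmatrix_pair rho rho'" and c1: "com rho m n" and c2: "com rho k n"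
 shows "com rho (m + k) n"
 unfolding com_def
proof (intro allI impI ballI)
 fix X p q r s
 assume X: "linear_form Q X" and pq: "p : paths G (m + k)" "q : paths G (m + k)" and r: "r : paths G n" "s : paths G n"
 obtain p1 p2 where p: "p1 : paths G m" "p2 : paths G k" "path_end G p1 = fst p2" "p = path_concat p1 p2"
 using path_split[OF pq(1)] by metis
 obtain q1 q2 where q: "q1 : paths G m" "q2 : paths G k" "path_end G q1 = fst q2" "q = path_concat q1 q2"
 using path_split[OF pq(2)] by metis
 let ?A = "paths G m" and ?B = "paths G k" and ?P = "paths G n"
 note XL = linear_form_mult_left[OF X] and XR = linear_form_mult_right[OF X]
 have "(SUM u:paths G (m + k). SUM v:?P. rho p u r v * X (E u q \<otimes>\<^bsub>Q\<^esub> E v s)) =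
  (SUM u1:?A. SUM u2:?B. SUM v:?P. (SUM z:?P. rho p1 u1 r z * rho p2 u2 z v) * X (E u1 q1 \<otimes>\<^bsub>Q\<^esub> (E u2 q2 \<otimes>\<^bsub>Q\<^esub> E v s)))"
 unfolding sum_paths_concat_if
 proof (intro sum.cong refl)
 fix u1 u2 assume u: "u1 : ?A" "u2 : ?B"
 have hex: "(SUM z:?P. rho p1 u1 r z * rho p2 u2 z v) = (if path_end G u1 = fst u2 then rho p (path_concat u1 u2) r v else 0)"
  if "v : ?P" for v
  using rmatrix_hexagon1[OF R p(1) u(1) p(2) u(2) r(1) that] p(3,4) by simp
 show "(if path_end G u1 = fst u2 then SUM v:?P. rho p (path_concat u1 u2) r v * X (E (path_concat u1 u2) q \<otimes>\<^bsub>Q\<^esub> E v s) else 0) =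
  (SUM v:?P. (SUM z:?P. rho p1 u1 r z * rho p2 u2 z v) * X (E u1 q1 \<otimes>\<^bsub>Q\<^esub> (E u2 q2 \<otimes>\<^bsub>Q\<^esub> E v s)))"
  using E_concat(1)[OF u(1) q(1) u(2) q(2) _ r(2) _ q(3)] q(4)
  by (cases "path_end G u1 = fst u2") (simp_all add: hex)
 qed
 also have "... = (SUM u1:?A. SUM z:?P. rho p1 u1 r z *
  (SUM u2:?B. SUM v:?P. rho p2 u2 z v * X (E u1 q1 \<otimes>\<^bsub>Q\<^esub> (E u2 q2 \<otimes>\<^bsub>Q\<^esub> E v s))))"
 by (rule sum_exchange(1))
 also have "... = (SUM u1:?A. SUM z:?P. rho p1 u1 r z *
  (SUM u2:?B. SUM v:?P. X (E u1 q1 \<otimes>\<^bsub>Q\<^esub> (E z v \<otimes>\<^bsub>Q\<^esub> E p2 u2)) * rho u2 q2 v s))"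
 using comD[OF c2 XR[OF E_in] p(2) q(2) _ r(2)] q(1) by (intro sum.cong refl) simp
 also have "... = (SUM u2:?B. SUM v:?P. (SUM u1:?A. SUM z:?P. rho p1 u1 r z * X (E u1 q1 \<otimes>\<^bsub>Q\<^esub> (E z v \<otimes>\<^bsub>Q\<^esub> E p2 u2))) * rho u2 q2 v s)"
 by (rule sum_exchange(2))
 also have "... = (SUM u2:?B. SUM v:?P. (SUM u1:?A. SUM z:?P. X (E r z \<otimes>\<^bsub>Q\<^esub> E p1 u1 \<otimes>\<^bsub>Q\<^esub> E p2 u2) * rho u1 q1 z v) * rho u2 q2 v s)"
 proof (rule sum.cong[OF refl], rule sum.cong[OF refl], rule arg_cong2[where f = "(*)", OF _ refl])
 fix u2 v assume u2: "u2 : ?B" and v: "v : ?P"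
 have "(SUM u1:?A. SUM z:?P. rho p1 u1 r z * X (E u1 q1 \<otimes>\<^bsub>Q\<^esub> (E z v \<otimes>\<^bsub>Q\<^esub> E p2 u2))) =
  (SUM u1:?A. SUM z:?P. rho p1 u1 r z * X (E u1 q1 \<otimes>\<^bsub>Q\<^esub> E z v \<otimes>\<^bsub>Q\<^esub> E p2 u2))"
  using q p u2 v by (intro sum.cong refl) (simp add: E_assoc)
 also have "... = (SUM u1:?A. SUM z:?P. X (E r z \<otimes>\<^bsub>Q\<^esub> E p1 u1 \<otimes>\<^bsub>Q\<^esub> E p2 u2) * rho u1 q1 z v)"
  by (rule comD[OF c1 XL[OF E_in[OF p(2) u2]] p(1) q(1) r(1) v])
 finally show "(SUM u1:?A. SUM z:?P. rho p1 u1 r z * X (E u1 q1 \<otimes>\<^bsub>Q\<^esub> (E z v \<otimes>\<^bsub>Q\<^esub> E p2 u2))) =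
  (SUM u1:?A. SUM z:?P. X (E r z \<otimes>\<^bsub>Q\<^esub> E p1 u1 \<otimes>\<^bsub>Q\<^esub> E p2 u2) * rho u1 q1 z v)" .
 qed
 also have "... = (SUM u1:?A. SUM u2:?B. SUM z:?P. X (E r z \<otimes>\<^bsub>Q\<^esub> E p1 u1 \<otimes>\<^bsub>Q\<^esub> E p2 u2) * (SUM v:?P. rho u1 q1 z v * rho u2 q2 v s))"
 by (rule sum_exchange(3))
 also have "... = (SUM u:paths G (m + k). SUM v:?P. X (E r v \<otimes>\<^bsub>Q\<^esub> E p u) * rho u q v s)"
 unfolding sum_paths_concat_if
 proof (intro sum.cong refl)
 fix u1 u2 assume u: "u1 : ?A" "u2 : ?B"
 have hex: "(SUM v:?P. rho u1 q1 z v * rho u2 q2 v s) = (if path_end G u1 = fst u2 then rho (path_concat u1 u2) q z s else 0)"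
  if "z : ?P" for z
  using rmatrix_hexagon1[OF R u(1) q(1) u(2) q(2) that r(2)] q(3,4) by simp
 show "(SUM z:?P. X (E r z \<otimes>\<^bsub>Q\<^esub> E p1 u1 \<otimes>\<^bsub>Q\<^esub> E p2 u2) * (SUM v:?P. rho u1 q1 z v * rho u2 q2 v s)) =
  (if path_end G u1 = fst u2 then SUM v:?P. X (E r v \<otimes>\<^bsub>Q\<^esub> E p (path_concat u1 u2)) * rho (path_concat u1 u2) q v s else 0)"
  using E_concat(2)[OF p(1) u(1) p(2) u(2) r(1) _ p(3)] p(4)
  by (cases "path_end G u1 = fst u2") (simp_all add: hex)
 qed
 finally show "(SUM u:paths G (m + k). SUM v:?P. rho p u r v * X (E u q \<otimes>\<^bsub>Q\<^esub> E v s)) =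
 (SUM u:paths G (m + k). SUM v:?P. X (E r v \<otimes>\<^bsub>Q\<^esub> E p u) * rho u q v s)" .
qed

lemma com_right:
 assumes R: "rmatrix_pair rho rho'" and c1: "com rho m n" and c2: "com rho m k"
 shows "com rho m (n + k)"
 unfolding com_def
proof (intro allI impI ballI)
 fix X p q r s
 assume X: "linear_form Q X" and p: "p : paths G m" "q : paths G m" and rs: "r : paths G (n + k)" "s : paths G (n + k)"
 obtain r1 r2 where r: "r1 : paths G n" "r2 : paths G k" "path_end G r1 = fst r2" "r = path_concat r1 r2"
 using path_split[OF rs(1)] by metis
 obtain s1 s2 where s: "s1 : paths G n" "s2 : paths G k" "path_end G s1 = fst s2" "s = path_concat s1 s2"
 using path_split[OF rs(2)] by metis
 let ?A = "paths G n" and ?B = "paths G k" and ?P = "paths G m"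
 note XL = linear_form_mult_left[OF X] and XR = linear_form_mult_right[OF X]
 have "(SUM u:?P. SUM v:paths G (n + k). rho p u r v * X (E u q \<otimes>\<^bsub>Q\<^esub> E v s)) =
  (SUM v:paths G (n + k). SUM u:?P. rho p u r v * X (E u q \<otimes>\<^bsub>Q\<^esub> E v s))"
 by (rule sum.swap)
 also have "... = (SUM v1:?A. SUM v2:?B. SUM u:?P. (SUM z:?P. rho p z r2 v2 * rho z u r1 v1) * X (E u q \<otimes>\<^bsub>Q\<^esub> E v1 s1 \<otimes>\<^bsub>Q\<^esub> E v2 s2))"
 unfolding sum_paths_concat_if
 proof (intro sum.cong refl)
 fix v1 v2 assume v: "v1 : ?A" "v2 : ?B"
 have hex: "(SUM z:?P. rho p z r2 v2 * rho z u r1 v1) = (if path_end G v1 = fst v2 then rho p u r (path_concat v1 v2) else 0)"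
  if "u : ?P" for u
  using rmatrix_hexagon2[OF R p(1) that r(1) v(1) r(2) v(2)] r(3,4) by simp
 show "(if path_end G v1 = fst v2 then SUM u:?P. rho p u r (path_concat v1 v2) * X (E u q \<otimes>\<^bsub>Q\<^esub> E (path_concat v1 v2) s) else 0) =
  (SUM u:?P. (SUM z:?P. rho p z r2 v2 * rho z u r1 v1) * X (E u q \<otimes>\<^bsub>Q\<^esub> E v1 s1 \<otimes>\<^bsub>Q\<^esub> E v2 s2))"
  using E_concat(2)[OF v(1) s(1) v(2) s(2) _ p(2) _ s(3)] s(4)
  by (cases "path_end G v1 = fst v2") (simp_all add: hex)
 qed
 also have "... = (SUM v2:?B. SUM v1:?A. SUM u:?P. (SUM z:?P. rho p z r2 v2 * rho z u r1 v1) * X (E u q \<otimes>\<^bsub>Q\<^esub> E v1 s1 \<otimes>\<^bsub>Q\<^esub> E v2 s2))"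
 by (rule sum.swap)
 also have "... = (SUM v2:?B. SUM z:?P. rho p z r2 v2 * (SUM v1:?A. SUM u:?P. rho z u r1 v1 * X (E u q \<otimes>\<^bsub>Q\<^esub> E v1 s1 \<otimes>\<^bsub>Q\<^esub> E v2 s2)))"
 by (rule sum_exchange(1))
 also have "... = (SUM v2:?B. SUM z:?P. rho p z r2 v2 * (SUM v1:?A. SUM u:?P. X (E r1 v1 \<otimes>\<^bsub>Q\<^esub> (E z u \<otimes>\<^bsub>Q\<^esub> E v2 s2)) * rho u q v1 s1))"
 proof (rule sum.cong[OF refl], rule sum.cong[OF refl], rule arg_cong2[where f = "(*)", OF refl])
 fix v2 z assume v2: "v2 : ?B" and z: "z : ?P"
 have "(SUM v1:?A. SUM u:?P. rho z u r1 v1 * X (E u q \<otimes>\<^bsub>Q\<^esub> E v1 s1 \<otimes>\<^bsub>Q\<^esub> E v2 s2)) =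
  (SUM u:?P. SUM v1:?A. rho z u r1 v1 * X (E u q \<otimes>\<^bsub>Q\<^esub> E v1 s1 \<otimes>\<^bsub>Q\<^esub> E v2 s2))" by (rule sum.swap)
 also have "... = (SUM u:?P. SUM v1:?A. X (E r1 v1 \<otimes>\<^bsub>Q\<^esub> E z u \<otimes>\<^bsub>Q\<^esub> E v2 s2) * rho u q v1 s1)"
  by (rule comD[OF c1 XL[OF E_in[OF v2 s(2)]] z p(2) r(1) s(1)])
 also have "... = (SUM v1:?A. SUM u:?P. X (E r1 v1 \<otimes>\<^bsub>Q\<^esub> E z u \<otimes>\<^bsub>Q\<^esub> E v2 s2) * rho u q v1 s1)" by (rule sum.swap)
 also have "... = (SUM v1:?A. SUM u:?P. X (E r1 v1 \<otimes>\<^bsub>Q\<^esub> (E z u \<otimes>\<^bsub>Q\<^esub> E v2 s2)) * rho u q v1 s1)"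
  using r s v2 z by (intro sum.cong refl) (simp add: E_assoc)
 finally show "(SUM v1:?A. SUM u:?P. rho z u r1 v1 * X (E u q \<otimes>\<^bsub>Q\<^esub> E v1 s1 \<otimes>\<^bsub>Q\<^esub> E v2 s2)) =
  (SUM v1:?A. SUM u:?P. X (E r1 v1 \<otimes>\<^bsub>Q\<^esub> (E z u \<otimes>\<^bsub>Q\<^esub> E v2 s2)) * rho u q v1 s1)" .
 qed
 also have "... = (SUM v1:?A. SUM u:?P. (SUM v2:?B. SUM z:?P. rho p z r2 v2 * X (E r1 v1 \<otimes>\<^bsub>Q\<^esub> (E z u \<otimes>\<^bsub>Q\<^esub> E v2 s2))) * rho u q v1 s1)"
 by (rule sum_exchange(2))
 also have "... = (SUM v1:?A. SUM u:?P. (SUM v2:?B. SUM z:?P. X (E r1 v1 \<otimes>\<^bsub>Q\<^esub> (E r2 v2 \<otimes>\<^bsub>Q\<^esub> E p z)) * rho z u v2 s2) * rho u q v1 s1)"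
 proof (rule sum.cong[OF refl], rule sum.cong[OF refl], rule arg_cong2[where f = "(*)", OF _ refl])
 fix v1 u assume v1: "v1 : ?A" and u: "u : ?P"
 have "(SUM v2:?B. SUM z:?P. rho p z r2 v2 * X (E r1 v1 \<otimes>\<^bsub>Q\<^esub> (E z u \<otimes>\<^bsub>Q\<^esub> E v2 s2))) =
  (SUM z:?P. SUM v2:?B. rho p z r2 v2 * X (E r1 v1 \<otimes>\<^bsub>Q\<^esub> (E z u \<otimes>\<^bsub>Q\<^esub> E v2 s2)))" by (rule sum.swap)
 also have "... = (SUM z:?P. SUM v2:?B. X (E r1 v1 \<otimes>\<^bsub>Q\<^esub> (E r2 v2 \<otimes>\<^bsub>Q\<^esub> E p z)) * rho z u v2 s2)"
  by (rule comD[OF c2 XR[OF E_in[OF r(1) v1]] p(1) u r(2) s(2)])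
 also have "... = (SUM v2:?B. SUM z:?P. X (E r1 v1 \<otimes>\<^bsub>Q\<^esub> (E r2 v2 \<otimes>\<^bsub>Q\<^esub> E p z)) * rho z u v2 s2)" by (rule sum.swap)
 finally show "(SUM v2:?B. SUM z:?P. rho p z r2 v2 * X (E r1 v1 \<otimes>\<^bsub>Q\<^esub> (E z u \<otimes>\<^bsub>Q\<^esub> E v2 s2))) =
  (SUM v2:?B. SUM z:?P. X (E r1 v1 \<otimes>\<^bsub>Q\<^esub> (E r2 v2 \<otimes>\<^bsub>Q\<^esub> E p z)) * rho z u v2 s2)" .
 qed
 also have "... = (SUM v2:?B. SUM v1:?A. SUM z:?P. X (E r1 v1 \<otimes>\<^bsub>Q\<^esub> (E r2 v2 \<otimes>\<^bsub>Q\<^esub> E p z)) * (SUM u:?P. rho z u v2 s2 * rho u q v1 s1))"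
 by (rule sum_exchange(3))
 also have "... = (SUM v1:?A. SUM v2:?B. SUM z:?P. X (E r1 v1 \<otimes>\<^bsub>Q\<^esub> (E r2 v2 \<otimes>\<^bsub>Q\<^esub> E p z)) * (SUM u:?P. rho z u v2 s2 * rho u q v1 s1))"
 by (rule sum.swap)
 also have "... = (SUM v:paths G (n + k). SUM u:?P. X (E r v \<otimes>\<^bsub>Q\<^esub> E p u) * rho u q v s)"
 unfolding sum_paths_concat_if
 proof (intro sum.cong refl)
 fix v1 v2 assume v: "v1 : ?A" "v2 : ?B"
 have hex: "(SUM u:?P. rho z u v2 s2 * rho u q v1 s1) = (if path_end G v1 = fst v2 then rho z q (path_concat v1 v2) s else 0)"
  if "z : ?P" for z
  using rmatrix_hexagon2[OF R that p(2) v(1) s(1) v(2) s(2)] s(3,4) by simp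
 show "(SUM z:?P. X (E r1 v1 \<otimes>\<^bsub>Q\<^esub> (E r2 v2 \<otimes>\<^bsub>Q\<^esub> E p z)) * (SUM u:?P. rho z u v2 s2 * rho u q v1 s1)) =
  (if path_end G v1 = fst v2 then SUM u:?P. X (E r (path_concat v1 v2) \<otimes>\<^bsub>Q\<^esub> E p u) * rho u q (path_concat v1 v2) s else 0)"
  using E_concat(1)[OF r(1) v(1) r(2) v(2) p(1) _ r(3)] r(4)
  by (cases "path_end G v1 = fst v2") (simp_all add: hex)
 qed
 also have "... = (SUM u:?P. SUM v:paths G (n + k). X (E r v \<otimes>\<^bsub>Q\<^esub> E p u) * rho u q v s)"
 by (rule sum.swap)
 finally show "(SUM u:?P. SUM v:paths G (n + k). rho p u r v * X (E u q \<otimes>\<^bsub>Q\<^esub> E v s)) =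
 (SUM u:?P. SUM v:paths G (n + k). X (E r v \<otimes>\<^bsub>Q\<^esub> E p u) * rho u q v s)" .
qed

lemma E_vertex_left:
 assumes "i : verts G" "j : verts G" and p: "p : paths G m" "q : paths G m"
 shows "E (i, []) (j, []) \<otimes>\<^bsub>Q\<^esub> E p q = (if i = fst p & j = fst q then E p q else \<zero>\<^bsub>Q\<^esub>)"
 unfolding E_mult[OF vertex_path[OF assms(1)] vertex_path[OF assms(2)] p] by (auto simp: path_concat_def)

lemma com_vertex_left:
 assumes R: "rmatrix_pair rho rho'"
 shows "com rho 0 n"
 unfolding com_def
proof (intro allI impI ballI)
 fix X p q r s
 assume X: "linear_form Q X" and p: "p : paths G 0" "q : paths G 0" and r: "r : paths G n" "s : paths G n"
 obtain i j where ij: "p = (i, [])" "q = (j, [])" "i : verts G" "j : verts G"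
 using p by (auto simp: paths_0)
 have "(SUM u:paths G 0. SUM v:paths G n. rho p u r v * X (E u q \<otimes>\<^bsub>Q\<^esub> E v s)) =
  (SUM v:paths G n. SUM k:verts G. rho (i, []) (k, []) r v * X (E (k, []) (j, []) \<otimes>\<^bsub>Q\<^esub> E v s))"
 unfolding sum_paths_0 ij by (rule sum.swap)
 also have "... = (SUM v:paths G n. SUM k:verts G. if v = r & k = fst r & i = path_end G r then X (E (k, []) (j, []) \<otimes>\<^bsub>Q\<^esub> E v s) else 0)"
 using ij r by (intro sum.cong refl) (auto simp: rmatrix_vertex_left[OF R])
 also have "... = (if i = path_end G r then X (E (fst r, []) (j, []) \<otimes>\<^bsub>Q\<^esub> E r s) else 0)"
 using r path_start[OF r(1)] by (subst sum_single[of _ r]) (auto intro!: sum.neutral simp: sum_single[of _ "fst r"])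
 also have "... = (if i = path_end G r & j = fst s then X (E r s) else 0)"
 using path_start[OF r(1)] path_start[OF r(2)] ij(4) by (auto simp: E_vertex_left[OF _ _ r] linear_form_Q_zero[OF X])
 finally have L: "(SUM u:paths G 0. SUM v:paths G n. rho p u r v * X (E u q \<otimes>\<^bsub>Q\<^esub> E v s)) =
  (if i = path_end G r & j = fst s then X (E r s) else 0)" .
 have "(SUM u:paths G 0. SUM v:paths G n. X (E r v \<otimes>\<^bsub>Q\<^esub> E p u) * rho u q v s) =
  (SUM v:paths G n. SUM k:verts G. X (E r v \<otimes>\<^bsub>Q\<^esub> E (i, []) (k, [])) * rho (k, []) (j, []) v s)"
 unfolding sum_paths_0 ij by (rule sum.swap)
 also have "... = (SUM v:paths G n. SUM k:verts G. if v = s & k = path_end G s & j = fst s then X (E r v \<otimes>\<^bsub>Q\<^esub> E (i, []) (k, [])) else 0)"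
 using ij r by (intro sum.cong refl) (auto simp: rmatrix_vertex_left[OF R])
 also have "... = (if j = fst s then X (E r s \<otimes>\<^bsub>Q\<^esub> E (i, []) (path_end G s, [])) else 0)"
 using r path_end_vert[OF r(2)] by (subst sum_single[of _ s]) (auto intro!: sum.neutral simp: sum_single[of _ "path_end G s"])
 also have "... = (if i = path_end G r & j = fst s then X (E r s) else 0)"
 using r ij path_end_vert[OF r(2)]
 by (auto simp: E_mult[OF r vertex_path vertex_path] linear_form_Q_zero[OF X] path_concat_def)
 finally show "(SUM u:paths G 0. SUM v:paths G n. rho p u r v * X (E u q \<otimes>\<^bsub>Q\<^esub> E v s)) =
  (SUM u:paths G 0. SUM v:paths G n. X (E r v \<otimes>\<^bsub>Q\<^esub> E p u) * rho u q v s)" using L by simp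
qed

lemma com_vertex_right:
 assumes R: "rmatrix_pair rho rho'"
 shows "com rho m 0"
 unfolding com_def
proof (intro allI impI ballI)
 fix X p q r s
 assume X: "linear_form Q X" and p: "p : paths G m" "q : paths G m" and r: "r : paths G 0" "s : paths G 0"
 obtain i j where ij: "r = (i, [])" "s = (j, [])" "i : verts G" "j : verts G"
 using r by (auto simp: paths_0)
 have "(SUM u:paths G m. SUM v:paths G 0. rho p u r v * X (E u q \<otimes>\<^bsub>Q\<^esub> E v s)) =
  (SUM u:paths G m. SUM k:verts G. if u = p & k = path_end G p & i = fst p then X (E u q \<otimes>\<^bsub>Q\<^esub> E (k, []) (j, [])) else 0)"
 unfolding sum_paths_0 ij(1,2) using ij(3,4) p by (intro sum.cong refl) (auto simp: rmatrix_vertex_right[OF R])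
 also have "... = (if i = fst p then X (E p q \<otimes>\<^bsub>Q\<^esub> E (path_end G p, []) (j, [])) else 0)"
 using p path_end_vert[OF p(1)] by (subst sum_single[of _ p]) (auto intro!: sum.neutral simp: sum_single[of _ "path_end G p"])
 also have "... = (if i = fst p & j = path_end G q then X (E p q) else 0)"
 using p ij path_end_vert[OF p(1)]
 by (auto simp: E_mult[OF p vertex_path vertex_path] linear_form_Q_zero[OF X] path_concat_def)
 finally have L: "(SUM u:paths G m. SUM v:paths G 0. rho p u r v * X (E u q \<otimes>\<^bsub>Q\<^esub> E v s)) =
  (if i = fst p & j = path_end G q then X (E p q) else 0)" .
 have "(SUM u:paths G m. SUM v:paths G 0. X (E r v \<otimes>\<^bsub>Q\<^esub> E p u) * rho u q v s) =
  (SUM u:paths G m. SUM k:verts G. if u = q & k = fst q & j = path_end G q then X (E (i, []) (k, []) \<otimes>\<^bsub>Q\<^esub> E p u) else 0)"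
 unfolding sum_paths_0 ij(1,2) using ij(3,4) p by (intro sum.cong refl) (auto simp: rmatrix_vertex_right[OF R])
 also have "... = (if j = path_end G q then X (E (i, []) (fst q, []) \<otimes>\<^bsub>Q\<^esub> E p q) else 0)"
 using p path_start[OF p(2)] by (subst sum_single[of _ q]) (auto intro!: sum.neutral simp: sum_single[of _ "fst q"])
 also have "... = (if i = fst p & j = path_end G q then X (E p q) else 0)"
 unfolding ij(1,2) using path_start[OF p(1)] path_start[OF p(2)] ij(3) by (auto simp: E_vertex_left[OF _ _ p] linear_form_Q_zero[OF X])
 finally show "(SUM u:paths G m. SUM v:paths G 0. rho p u r v * X (E u q \<otimes>\<^bsub>Q\<^esub> E v s)) =
  (SUM u:paths G m. SUM v:paths G 0. X (E r v \<otimes>\<^bsub>Q\<^esub> E p u) * rho u q v s)" using L by simp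
qed

text \<open>Both sides of the intertwining relation are multiplicative in each argument by the hexagon
  identities, so the relation propagates from edges to all paths.\<close>

theorem commutes_generators:
 assumes R: "rmatrix_pair rho rho'" and c: "com rho 1 1"
 shows "commutes rho"
proof -
 have c1: "com rho 1 n" for n
 by (induction n) (use com_vertex_right[OF R] com_right[OF R c] in auto)
 have "com rho m n" for m n
 by (induction m) (use com_vertex_left[OF R] com_left[OF R c1] in auto)
 then show ?thesis by (simp add: commutes_com)
qed

lemma path_quotient_quotient:
 assumes I: "biideal Q I"
 shows "path_quotient G (quotient_face_alg Q I) (%f. I +>\<^bsub>Q\<^esub> \<pi> f)"
proof -
 interpret B: biideal_quotient "verts G" Q I by unfold_locales (rule I)
 interpret F: face_algebra "verts G" B.Q by (rule B.Q_face_algebra)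
 show ?thesis
 proof unfold_locales
 show "carrier B.Q = (%f. I +>\<^bsub>Q\<^esub> \<pi> f) ` carrier H"
  by (auto simp: B.Q_carrier pi_carrier)
 next
 fix f B assume f: "f : carrier H" and B: "bilinear_form B.Q B"
 then show "comult B.Q (I +>\<^bsub>Q\<^esub> \<pi> f) B = comult H f (%x y. B (I +>\<^bsub>Q\<^esub> \<pi> x) (I +>\<^bsub>Q\<^esub> \<pi> y))"
  by (simp add: B.pr_comult pi_in pi_comult B.bilinear_form_pr)
 next
 fix i assume "i : verts G"
 then show "face_idem B.Q i = I +>\<^bsub>Q\<^esub> \<pi> (face_idem H i)" "face_idem_ring B.Q i = I +>\<^bsub>Q\<^esub> \<pi> (face_idem_ring H i)"
  by (simp_all add: B.pr_idem pi_idem)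
 qed (simp_all add: pi_add pi_scale pi_mult pi_in B.pr_add B.pr_smult B.pr_mult B.pr_counit pi_counit)
qed

end

context quiver
begin

lemma path_quotient_H: "path_quotient G H (%f. f)"
proof -
 interpret F: face_algebra "verts G" H by (rule H_face_algebra)
 show ?thesis by unfold_locales (simp_all add: H_simps(2,5,6))
qed

end

section \<open>Transfer matrices\<close>

definition face_supported where
 "face_supported G X \<longleftrightarrow> (ALL r p q s. X r p q s ~= 0 --> is_face G r p q s)"

context quiver
begin

fun tr :: "'e face_weight => 'e list => 'e list => 'e => 'e => complex" where
 "tr X (a # as) (b # bs) r s = (SUM u:arcs G. X r b a u * tr X as bs u s)"
| "tr X _ _ r s = (if r = s then 1 else 0)"

definition transfer :: "'e face_weight => ('v, 'e) path => ('v, 'e) path => 'e => 'e => complex" where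
 "transfer X p q r s = (if head G r = fst p & tail G r = fst q then tr X (snd p) (snd q) r s else 0)"

lemma tr_append:
 assumes "length as = length bs" "s : arcs G" "r : arcs G"
 shows "tr X (as @ cs) (bs @ ds) r s = (SUM u:arcs G. tr X as bs r u * tr X cs ds u s)"
 using assms(1,3)
proof (induction as bs arbitrary: r rule: list_induct2)
 case Nil
 then show ?case by (simp add: if_distrib[of "%x. x * _"] cong: if_cong)
next
 case (Cons a as b bs)
 have "tr X ((a # as) @ cs) ((b # bs) @ ds) r s =
  (SUM v:arcs G. X r b a v * (SUM u:arcs G. tr X as bs v u * tr X cs ds u s))"
 using Cons.IH by simp
 also have "... = (SUM u:arcs G. (SUM v:arcs G. X r b a v * tr X as bs v u) * tr X cs ds u s)"
 unfolding sum_distrib_left sum_distrib_right by (subst sum.swap) (simp add: mult.assoc)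
 finally show ?case by simp
qed

lemma tr_support:
 assumes X: "face_supported G X"
 and "(i, as) : paths G m" "(j, bs) : paths G m" "head G r = i" "tail G r = j" "tr X as bs r s ~= 0"
 shows "head G s = path_end G (i, as) & tail G s = path_end G (j, bs)"
 using assms(2-)
proof (induction m arbitrary: i as j bs r)
 case 0
 then show ?case by (auto simp: path_Nil_iff split: if_splits)
next
 case (Suc m)
 obtain a as' b bs' where l: "as = a # as'" "bs = b # bs'"
 using path_length[OF Suc.prems(1)] path_length[OF Suc.prems(2)] by (cases as; cases bs) auto
 obtain u where u: "X r b a u ~= 0" "tr X as' bs' u s ~= 0"
 proof -
 have "(SUM u:arcs G. X r b a u * tr X as' bs' u s) ~= 0" using Suc.prems(5) by (simp add: l)
 then obtain u where "X r b a u * tr X as' bs' u s ~= 0" by (rule sum.not_neutral_contains_not_neutral)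
 then show ?thesis using that by auto
 qed
 then have "is_face G r b a u" using X by (auto simp: face_supported_def)
 then have "head G u = head G a" "tail G u = head G b" by (auto simp: is_face_def)
 then show ?case
 using Suc.IH[of "head G a" as' "head G b" bs' u] Suc.prems u l by (simp add: path_Cons_iff path_end_Cons)
qed

lemma transfer_concat:
 assumes X: "face_supported G X" and p: "p : paths G m" "q : paths G m" and p': "p' : paths G n" "q' : paths G n"
 and r: "r : arcs G" "s : arcs G"
 shows "(SUM u:arcs G. transfer X p q r u * transfer X p' q' u s) =
 (if path_end G p = fst p' & path_end G q = fst q' then transfer X (path_concat p p') (path_concat q q') r s else 0)"
proof -
 have sup: "head G u = path_end G p & tail G u = path_end G q" if "transfer X p q r u ~= 0" for u
 using tr_support[OF X, of "fst p" "snd p" m "fst q" "snd q" r u] p that by (auto simp: transfer_def split: if_splits)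
 show ?thesis
 proof (cases "path_end G p = fst p' & path_end G q = fst q'")
 case True
 have "transfer X p q r u * transfer X p' q' u s =
  (if head G r = fst p & tail G r = fst q then tr X (snd p) (snd q) r u * tr X (snd p') (snd q') u s else 0)" for u
  by (cases "tr X (snd p) (snd q) r u = 0") (use sup[of u] True in \<open>auto simp: transfer_def\<close>)
 then have "(SUM u:arcs G. transfer X p q r u * transfer X p' q' u s) =
  (SUM u:arcs G. if head G r = fst p & tail G r = fst q then tr X (snd p) (snd q) r u * tr X (snd p') (snd q') u s else 0)"
  by (intro sum.cong refl)
 also have "... = (if head G r = fst p & tail G r = fst q
  then SUM u:arcs G. tr X (snd p) (snd q) r u * tr X (snd p') (snd q') u s else 0)"
  by (cases "head G r = fst p"; cases "tail G r = fst q") simp_all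
 also have "... = transfer X (path_concat p p') (path_concat q q') r s"
  using tr_append[of "snd p" "snd q" s r X "snd p'" "snd q'"] r path_length[OF p(1)] path_length[OF p(2)]
  by (simp add: transfer_def path_concat_def)
 finally show ?thesis using True by simp
 next
 case False
 have "transfer X p q r u * transfer X p' q' u s = 0" for u
  by (cases "tr X (snd p) (snd q) r u = 0") (use sup[of u] False in \<open>auto simp: transfer_def\<close>)
 then have "(SUM u:arcs G. transfer X p q r u * transfer X p' q' u s) = 0" by (intro sum.neutral ballI)
 then show ?thesis by (subst if_not_P[OF False])
 qed
qed

definition transfer_form :: "'e face_weight => 'e => 'e => ('v, 'e) path_comb => complex" where
 "transfer_form X r s f = (SUM x:Poly_Mapping.keys f. Poly_Mapping.lookup f x * transfer X (fst x) (snd x) r s)"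

lemma transfer_form_basis [simp]: "transfer_form X r s (e_basis p q) = transfer X p q r s"
 by (simp add: transfer_form_def lookup_e_basis)

lemma transfer_form_add: "transfer_form X r s (f + g) = transfer_form X r s f + transfer_form X r s g"
 unfolding transfer_form_def
 using sum_keys_add[of "%x a. a * transfer X (fst x) (snd x) r s" f g] by (simp add: algebra_simps)

lemma transfer_form_scale: "transfer_form X r s (comb_scale c f) = c * transfer_form X r s f"
 unfolding transfer_form_def
 using sum_keys_scale[of "%x a. a * transfer X (fst x) (snd x) r s" c f] by (simp add: algebra_simps sum_distrib_left)

lemma transfer_form_linear: "linear_form H (transfer_form X r s)"
 by (simp add: linear_form_def H_simps(5,6) transfer_form_add transfer_form_scale)

lemma transfer_form_zero [simp]: "transfer_form X r s 0 = 0"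
 by (simp add: transfer_form_def)

lemma transfer_form_diff: "transfer_form X r s (f - g) = transfer_form X r s f - transfer_form X r s g"
 using transfer_form_add[of X r s "f - g" g] by simp

lemma transfer_form_mul:
 assumes X: "face_supported G X" and r: "r : arcs G" "s : arcs G" and f: "f : carrier H" and g: "g : carrier H"
 shows "transfer_form X r s (mul f g) = (SUM u:arcs G. transfer_form X r u f * transfer_form X u s g)"
 using f
proof (induction rule: H_induct)
 case (basis m p q)
 note p = basis
 from g show ?case
 proof (induction rule: H_induct)
 case (basis n p' q')
 then show ?case using transfer_concat[OF X p basis r] by (simp add: mul_basis)
 qed (simp_all add: mul_add_right mul_scale_right transfer_form_add transfer_form_scale sum.distrib
  sum_distrib_left algebra_simps)
qed (simp_all add: mul_add_left mul_scale_left transfer_form_add transfer_form_scale sum.distrib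
 sum_distrib_left algebra_simps)

lemma paths_1: "paths G 1 = edge_path G ` arcs G"
proof (intro equalityI subsetI)
 fix p assume p: "p : paths G 1"
 then obtain u e where pe: "p = (u, [e])" using path_length[OF p] by (cases p; cases "snd p") auto
 then have "e : arcs G" "tail G e = u" using p path_Cons_iff[of u e "[]" 0] by auto
 then show "p : edge_path G ` arcs G" using pe by (auto simp: edge_path_def)
next
 fix p assume "p : edge_path G ` arcs G"
 then obtain e where "e : arcs G" "p = (tail G e, [e])" by (auto simp: edge_path_def)
 then show "p : paths G 1" using path_Cons_iff[of "tail G e" e "[]" 0] by (simp add: path_Nil_iff)
qed

lemma sum_paths_1: "(SUM p:paths G 1. f p) = (SUM a:arcs G. f (edge_path G a))"
 unfolding paths_1 by (subst sum.reindex) (auto simp: inj_on_def edge_path_def)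

lemma edge_path_in: "a : arcs G ==> edge_path G a : paths G 1"
 unfolding paths_1 by (rule imageI)

lemma edge_path_eq [simp]: "edge_path G a = edge_path G b \<longleftrightarrow> a = b"
 by (auto simp: edge_path_def)

lemma edge_path_simps [simp]: "fst (edge_path G a) = tail G a" "path_end G (edge_path G a) = head G a" "snd (edge_path G a) = [a]"
 by (simp_all add: edge_path_def path_end_Cons)

definition edge_weight where
 "edge_weight rho r q p s = (if {r, q, p, s} \<subseteq> arcs G then rho (edge_path G p) (edge_path G q) (edge_path G r) (edge_path G s) else 0)"

lemma edge_weight_face_supported:
 assumes R: "rmatrix_pair rho rho'"
 shows "face_supported G (edge_weight rho)"
 unfolding face_supported_def
proof (intro allI impI)
 fix r q p s assume nz: "edge_weight rho r q p s ~= 0"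
 then have a: "r : arcs G" "q : arcs G" "p : arcs G" "s : arcs G" by (auto simp: edge_weight_def split: if_splits)
 note e = a[THEN edge_path_in]
 have nz: "rho (edge_path G p) (edge_path G q) (edge_path G r) (edge_path G s) ~= 0"
 using nz a by (simp add: edge_weight_def)
 show "is_face G r q p s"
 using rmatrix_pairD(3)[OF R e(3,2,1,4) nz] rmatrix_right_support(1)[OF R e(3,2,1,4) nz]
  rmatrix_face_support[OF R e(3,2,1,4) nz] a by (simp add: is_face_def)
qed

text \<open>The functional \<open>R(\<sqdot>, e(r/s))\<close> of a braiding is the transfer matrix of its values on edges.\<close>

lemma rmatrix_transfer:
 assumes R: "rmatrix_pair rho rho'" and r: "r : arcs G" "s : arcs G"
 and p: "p : paths G m" "q : paths G m"
 shows "rho p q (edge_path G r) (edge_path G s) = transfer (edge_weight rho) p q r s"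
 using p r(1)
proof (induction m arbitrary: p q r)
 case 0
 obtain i j where "p = (i, [])" "q = (j, [])" "i : verts G" "j : verts G"
 using 0 by (auto simp: paths_0)
 then show ?case
 using rmatrix_vertex_left[OF R _ _ edge_path_in edge_path_in, of i j r s] 0 r(2)
 by (auto simp: transfer_def)
next
 case (Suc m)
 have p1: "p : paths G (1 + m)" "q : paths G (1 + m)" using Suc by auto
 obtain p1 p2 where pp: "p1 : paths G 1" "p2 : paths G m" "path_end G p1 = fst p2" "p = path_concat p1 p2"
 using path_split[OF p1(1)] by metis
 obtain q1 q2 where qq: "q1 : paths G 1" "q2 : paths G m" "path_end G q1 = fst q2" "q = path_concat q1 q2"
 using path_split[OF p1(2)] by metis
 obtain a b where ab: "p1 = edge_path G a" "q1 = edge_path G b" "a : arcs G" "b : arcs G"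
 using pp(1) qq(1) unfolding paths_1 by blast
 have F: "face_supported G (edge_weight rho)" by (rule edge_weight_face_supported[OF R])
 have "rho p q (edge_path G r) (edge_path G s) = (SUM v:paths G 1. rho p1 q1 (edge_path G r) v * rho p2 q2 v (edge_path G s))"
 using rmatrix_hexagon1[OF R pp(1) qq(1) pp(2) qq(2) edge_path_in edge_path_in, of r s] pp qq Suc.prems r(2) by simp
 also have "... = (SUM u:arcs G. edge_weight rho r b a u * transfer (edge_weight rho) p2 q2 u s)"
 unfolding sum_paths_1
 proof (intro sum.cong refl)
 fix u assume u: "u : arcs G"
 then have "edge_weight rho r b a u = rho p1 q1 (edge_path G r) (edge_path G u)"
  using Suc.prems(3) ab by (simp add: edge_weight_def)
 then show "rho p1 q1 (edge_path G r) (edge_path G u) * rho p2 q2 (edge_path G u) (edge_path G s) =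
  edge_weight rho r b a u * transfer (edge_weight rho) p2 q2 u s"
  using Suc.IH[OF pp(2) qq(2) u] by simp
 qed
 also have "... = (SUM u:arcs G. if head G r = fst p & tail G r = fst q then edge_weight rho r b a u * tr (edge_weight rho) (snd p2) (snd q2) u s else 0)"
 proof (intro sum.cong refl)
 fix u
 have "edge_weight rho r b a u ~= 0 ==> is_face G r b a u" using F by (auto simp: face_supported_def)
 then show "edge_weight rho r b a u * transfer (edge_weight rho) p2 q2 u s =
  (if head G r = fst p & tail G r = fst q then edge_weight rho r b a u * tr (edge_weight rho) (snd p2) (snd q2) u s else 0)"
  by (cases "edge_weight rho r b a u = 0") (use pp(3,4) qq(3,4) ab in \<open>auto simp: transfer_def is_face_def\<close>)
 qed
 also have "... = transfer (edge_weight rho) p q r s"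
 unfolding pp(4) qq(4) ab(1,2)
 by (cases "head G r = tail G a"; cases "tail G r = tail G b") (simp_all add: transfer_def path_concat_def)
 finally show ?case .
qed

lemma transfer_pair:
 assumes X: "face_supported G X" and "c : arcs G" "d : arcs G" "p : arcs G" "q : arcs G" "y : arcs G"
 shows "transfer X (edge_pair_path G c d) (edge_pair_path G p q) x y = (SUM u:arcs G. X x p c u * X u q d y)"
proof -
 have "transfer X (edge_pair_path G c d) (edge_pair_path G p q) x y =
  (if head G x = tail G c & tail G x = tail G p then SUM u:arcs G. X x p c u * X u q d y else 0)"
 using assms by (simp add: transfer_def edge_pair_path_def if_distrib[of "(*) _"] cong: if_cong)
 moreover have "(SUM u:arcs G. X x p c u * X u q d y) = 0" if "~ (head G x = tail G c & tail G x = tail G p)"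
 proof (intro sum.neutral ballI)
 fix u
 have "X x p c u ~= 0 ==> is_face G x p c u" using X by (auto simp: face_supported_def)
 then show "X x p c u * X u q d y = 0" by (cases "X x p c u = 0") (use that in \<open>auto simp: is_face_def\<close>)
 qed
 ultimately show ?thesis by auto
qed

end

section \<open>The SOS graph\<close>

lemma q_int_minus: "q_int t (- n) = - q_int t n"
 by (simp add: q_int_def minus_divide_left)

locale sos =
 fixes N L :: nat and t \<epsilon> :: complex
 assumes N2: "N \<ge> 2" and L2: "L \<ge> 2" and t_root: "t ^ (2 * (N + L)) = 1"
 and t_prim: "ALL k. 0 < k & k < 2 * (N + L) --> t ^ k ~= 1"
 and eps: "\<epsilon> : {1, -1}"
begin

abbreviation "G \<equiv> sos_graph N L"
abbreviation "V \<equiv> sos_verts N L"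
abbreviation "I \<equiv> {1..N}"
abbreviation "st \<equiv> sos_step N"
abbreviation "K \<equiv> int N + int L"
abbreviation qn ("\<lbrakk>_\<rbrakk>") where "\<lbrakk>n\<rbrakk> \<equiv> q_int t n"

lemma t_nz: "t ~= 0"
 using t_root N2 by (auto simp: power_0_left)

lemma t_powi_eq_1: "t powi m = 1 \<longleftrightarrow> 2 * K dvd m"
proof -
 let ?M = "2 * K"
 have M: "?M > 0" using N2 by simp
 have tM: "t powi ?M = 1"
 proof -
 have "t powi ?M = t ^ (2 * (N + L))" by (metis int_ops(7) of_nat_add of_nat_numeral power_int_of_nat)
 then show ?thesis using t_root by simp
 qed
 have "t powi m = t powi (?M * (m div ?M) + m mod ?M)" by simp
 also have "... = (t powi ?M) powi (m div ?M) * t powi (m mod ?M)"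
 using t_nz by (simp only: power_int_add power_int_mult simp_thms)
 finally have red: "t powi m = t powi (m mod ?M)" using tM by simp
 have rng: "0 <= m mod ?M" "m mod ?M < ?M" using M by (auto intro: pos_mod_sign pos_mod_bound)
 then have "t powi (m mod ?M) = t ^ nat (m mod ?M)" by (simp add: power_int_def)
 moreover have "t ^ nat (m mod ?M) = 1 \<longleftrightarrow> m mod ?M = 0"
 using t_prim[rule_format, of "nat (m mod ?M)"] rng by (cases "m mod ?M = 0") auto
 ultimately show ?thesis using red by (simp add: dvd_eq_mod_eq_0)
qed

lemma t_diff_nz: "t - inverse t ~= 0"
proof
 assume "t - inverse t = 0"
 then have "t powi 2 = 1" using t_nz by (simp add: power2_eq_square field_simps)
 then have "2 * K dvd 2" by (rule iffD1[OF t_powi_eq_1])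
 then show False using N2 L2 by (auto dest: zdvd_imp_le)
qed

lemma qn_zero_iff: "\<lbrakk>n\<rbrakk> = 0 \<longleftrightarrow> K dvd n"
proof -
 have "\<lbrakk>n\<rbrakk> = 0 \<longleftrightarrow> t powi n = t powi (- n)" using t_diff_nz by (simp add: q_int_def)
 also have "... \<longleftrightarrow> t powi n * t powi n = 1" using t_nz by (simp add: power_int_minus field_simps)
 also have "... \<longleftrightarrow> t powi (2 * n) = 1" using t_nz by (simp add: power_int_add[symmetric])
 also have "... \<longleftrightarrow> K dvd n" by (simp add: t_powi_eq_1 del: distrib_left_numeral)
 finally show ?thesis .
qed

lemma sum_t_nz: "t + inverse t ~= 0"
proof
 assume "t + inverse t = 0"
 then have "t * t = - 1" using t_nz by (simp add: field_simps add_eq_0_iff)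
 then have "t powi 4 = 1" by (metis power4_eq_xxxx power_int_numeral mult.assoc mult_minus1 minus_minus)
 then have "2 * K dvd 4" by (rule iffD1[OF t_powi_eq_1])
 then show False using N2 L2 by (auto dest: zdvd_imp_le)
qed

subsection \<open>Vertices as configurations of particles on a circle\<close>

text \<open>Put \<open>N\<close> particles at the distinct sites \<open>i - \<lambda>\<^sub>i\<close> of a circle with \<open>N + L\<close> sites.  The
  distances between them are the numbers \<open>d\<close>, and a step in direction \<open>i\<close> moves the \<open>i\<close>-th particle
  back by one site, which is allowed if that site is empty.\<close>

lemma d_step:
 assumes "k : I" "i : I" "j : I"
 shows "sos_d (st l k) i j = sos_d l i j + (if k = i then 1 else 0) - (if k = j then 1 else 0)"
 using assms by (auto simp: sos_d_def sos_step_def normalise_def)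

lemma step_commute: "i : I ==> j : I ==> st (st l i) j = st (st l j) i"
 by (auto simp: sos_step_def normalise_def fun_eq_iff)

lemma d_swap: "sos_d l j i = - sos_d l i j"
 by (simp add: sos_d_def)

lemma d_add: "sos_d l i j + sos_d l j k = sos_d l i k"
 by (simp add: sos_d_def)

lemma V_antimono:
 assumes "l : V" "i : I" "j : I" "i <= j"
 shows "l i \<ge> l j"
 using assms(4,3,2)
proof (induction j rule: dec_induct)
 case (step n)
 then have "n : {1..<N}" by auto
 then have "l n \<ge> l (n + 1)" using assms(1) by (auto simp: sos_verts_def)
 then show ?case using step by auto
qed auto

lemma d_bounds:
 assumes l: "l : V" and "i : I" "j : I" "i < j"
 shows "1 <= sos_d l i j" "sos_d l i j < K"
proof -
 have "l i \<ge> l j" "l 1 \<ge> l i" "l j \<ge> l N" using V_antimono[OF l] assms N2 by auto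
 moreover have "int L \<ge> l 1" "l N = 0" using l by (auto simp: sos_verts_def)
 ultimately show "1 <= sos_d l i j" "sos_d l i j < K" using assms by (auto simp: sos_d_def)
qed

lemma d_mod_nz:
 assumes l: "l : V" and ij: "i : I" "j : I" "i ~= j"
 shows "sos_d l i j mod K ~= 0"
proof (cases "i < j")
 case True
 then show ?thesis using d_bounds[OF l, of i j] ij by simp
next
 case False
 then have "~ K dvd sos_d l j i" using d_bounds[OF l, of j i] ij by (auto dest: zdvd_imp_le)
 then show ?thesis by (simp add: d_swap[of l j i] dvd_eq_mod_eq_0[symmetric])
qed

lemma qn_d_nz: "l : V ==> i : I ==> j : I ==> i ~= j ==> \<lbrakk>sos_d l i j\<rbrakk> ~= 0"
 using d_mod_nz by (simp add: qn_zero_iff dvd_eq_mod_eq_0)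

text \<open>A step is possible exactly if the site before the particle is free.\<close>

theorem step_valid_iff:
 assumes l: "l : V" and i: "i : I"
 shows "st l i : V \<longleftrightarrow> (ALL j:I. j ~= i --> sos_d l j i mod K ~= 1)"
proof
 assume s: "st l i : V"
 show "ALL j:I. j ~= i --> sos_d l j i mod K ~= 1"
 proof (intro ballI impI notI)
 fix j assume j: "j : I" "j ~= i" and one: "sos_d l j i mod K = 1"
 have "sos_d (st l i) j i = sos_d l j i - 1" using d_step[OF i j(1) i] j by simp
 moreover have "(sos_d l j i - 1) mod K = 0" using one by (metis mod_diff_left_eq diff_self mod_0)
 ultimately show False using d_mod_nz[OF s j(1) i j(2)] by simp
 qed
next
 assume free: "ALL j:I. j ~= i --> sos_d l j i mod K ~= 1"
 have K1: "K > 1" using N2 by simp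
 have lN: "l N = 0" and l1: "l 1 <= int L" and mono: "ALL k:{1..<N}. l k \<ge> l (k + 1)"
 using l by (auto simp: sos_verts_def)
 have "st l i N = 0" using N2 by (simp add: sos_step_def normalise_def)
 moreover have "ALL k. k \<notin> I --> st l i k = 0" by (simp add: sos_step_def normalise_def)
 moreover have "st l i 1 <= int L"
 proof (cases "i = 1")
 case True
 have "l 1 ~= int L"
 proof
  assume "l 1 = int L"
  then have "sos_d l N i = 1 - K" using True lN N2 by (simp add: sos_d_def)
  then have "sos_d l N i mod K = 1 mod K" by (simp only: minus_mod_self2)
  then have "sos_d l N i mod K = 1" using K1 by simp
  then show False using free True N2 by auto
 qed
 then show ?thesis using True l1 lN N2 by (auto simp: sos_step_def normalise_def)
 next
 case False
 then show ?thesis using l1 lN N2 by (auto simp: sos_step_def normalise_def)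
 qed
 moreover have "ALL k:{1..<N}. st l i k \<ge> st l i (k + 1)"
 proof
 fix k assume k: "k : {1..<N}"
 have "~ (i = k + 1 & l k = l (k + 1))"
 proof
  assume e: "i = k + 1 & l k = l (k + 1)"
  then have "sos_d l k i = 1" by (simp add: sos_d_def)
  then have "sos_d l k i mod K = 1" using K1 by simp
  then show False using free e k by auto
 qed
 then show "st l i k \<ge> st l i (k + 1)"
  using mono[rule_format, OF k] k by (auto simp: sos_step_def normalise_def)
 qed
 ultimately show "st l i : V" by (auto simp: sos_verts_def)
qed

lemma step_diamond:
 assumes l: "l : V" and ij: "i : I" "j : I" "i ~= j" and s: "st l i : V" "st l j : V"
 shows "st (st l i) j : V"
 unfolding step_valid_iff[OF s(1) ij(2)]
proof (intro ballI impI)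
 fix k assume k: "k : I" "k ~= j"
 show "sos_d (st l i) k j mod K ~= 1"
 proof (cases "k = i")
 case True
 then have e: "sos_d (st l i) k j = sos_d l i j + 1" using d_step[OF ij(1) k(1) ij(2)] ij by simp
 show ?thesis
 proof
  assume "sos_d (st l i) k j mod K = 1"
  then have "(sos_d l i j + 1 - 1) mod K = 0" unfolding e by (metis mod_diff_left_eq diff_self mod_0)
  then show False using d_mod_nz[OF l ij] by simp
 qed
 next
 case False
 then show ?thesis using d_step[OF ij(1) k(1) ij(2), of l] step_valid_iff[OF l ij(2)] s(2) k ij by auto
 qed
qed

lemma step_blocked:
 assumes l: "l : V" and ij: "i : I" "j : I" "i ~= j" and s: "st l i : V" "st (st l i) j : V" "st l j \<notin> V"
 shows "sos_d l i j mod K = 1"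
proof -
 obtain k where k: "k : I" "k ~= j" "sos_d l k j mod K = 1"
 using step_valid_iff[OF l ij(2)] s(3) by auto
 have "k = i"
 proof (rule ccontr)
 assume "k ~= i"
 then have "sos_d (st l i) k j mod K = 1" using d_step[OF ij(1) k(1) ij(2), of l] k ij by simp
 then show False using step_valid_iff[OF s(1) ij(2)] s(2) k by auto
 qed
 then show ?thesis using k by simp
qed

lemma qn_blocked:
 assumes "l : V" "i : I" "j : I" "i ~= j" "st l i : V" "st (st l i) j : V" "st l j \<notin> V"
 shows "\<lbrakk>sos_d l i j - 1\<rbrakk> = 0"
proof -
 have "(sos_d l i j - 1) mod K = 0" using step_blocked[OF assms] by (metis mod_diff_left_eq diff_self mod_0)
 then show ?thesis by (simp add: qn_zero_iff dvd_eq_mod_eq_0)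
qed

lemma finite_V: "finite V"
proof -
 have "V \<subseteq> {f. ALL x. (x : I --> f x : {0..int L}) & (x \<notin> I --> f x = 0)}"
 proof
 fix l assume l: "l : V"
 have "l x : {0..int L}" if x: "x : I" for x
 proof -
  have "l x \<ge> l N" "l 1 \<ge> l x" using V_antimono[OF l] x N2 by auto
  then show ?thesis using l by (auto simp: sos_verts_def)
 qed
 then show "l : {f. ALL x. (x : I --> f x : {0..int L}) & (x \<notin> I --> f x = 0)}"
  using l by (auto simp: sos_verts_def)
 qed
 then show ?thesis by (rule finite_subset) (intro finite_set_of_finite_funs, auto)
qed

lemma zero_V: "(%_. 0) : V"
 by (simp add: sos_verts_def)

subsection \<open>Paths as words\<close>

fun wend :: "weight => nat list => weight" where
 "wend l [] = l" | "wend l (i # w) = wend (st l i) w"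

fun valid :: "weight => nat list => bool" where
 "valid l [] \<longleftrightarrow> l : V" | "valid l (i # w) \<longleftrightarrow> l : V & i : I & valid (st l i) w"

fun warcs :: "weight => nat list => sos_arc list" where
 "warcs l [] = []" | "warcs l (i # w) = (l, i) # warcs (st l i) w"

definition wpath :: "weight => nat list => (weight, sos_arc) path" where
 "wpath l w = (l, warcs l w)"

lemma wend_append: "wend l (v @ w) = wend (wend l v) w"
 by (induction v arbitrary: l) auto

lemma valid_append: "valid l (v @ w) \<longleftrightarrow> valid l v & valid (wend l v) w"
proof (induction v arbitrary: l)
 case Nil
 then show ?case by (cases w) auto
qed auto

lemma valid_V: "valid l w ==> l : V" "valid l w ==> wend l w : V"
 by (induction w arbitrary: l) auto

lemma valid_letters: "valid l w ==> set w \<subseteq> I"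
 by (induction w arbitrary: l) auto

lemma G_simps [simp]:
 "verts G = V" "tail G = fst" "head G = (%(l, i). st l i)"
 "(l, i) : arcs G \<longleftrightarrow> l : V & i : I & st l i : V"
 by (auto simp: sos_graph_def)

lemma finite_arcs_G: "finite (arcs G)"
proof -
 have "arcs G \<subseteq> V \<times> I" by (auto simp: sos_graph_def)
 then show ?thesis using finite_V by (auto intro: finite_subset)
qed

sublocale quiver G
 by unfold_locales (use finite_V finite_arcs_G zero_V in \<open>auto simp: sos_graph_def\<close>)

lemma wpath_in: "valid l w ==> wpath l w : paths G (length w)"
 unfolding wpath_def
proof (induction w arbitrary: l)
 case (Cons i w)
 then show ?case using valid_V(1)[of "st l i" w] by (auto simp: path_Cons_iff)
qed (simp add: path_Nil_iff)

lemma wpath_end [simp]: "path_end G (wpath l w) = wend l w"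
 unfolding wpath_def by (induction w arbitrary: l) (simp_all add: path_end_Cons)

lemma wpath_simps [simp]: "fst (wpath l w) = l" "snd (wpath l w) = warcs l w" "length (warcs l w) = length w" "map snd (warcs l w) = w"
 unfolding wpath_def by (induction w arbitrary: l) simp_all

lemma path_wpath:
 assumes "p : paths G m"
 obtains w where "p = wpath (fst p) w" "valid (fst p) w" "length w = m"
proof -
 have "EX w. p = wpath (fst p) w & valid (fst p) w & length w = m" using assms
 proof (induction m arbitrary: p)
 case 0
 then show ?case by (cases p) (auto simp: path_Nil_iff wpath_def intro!: exI[of _ "[]"])
 next
 case (Suc m)
 obtain u e es where p: "p = (u, e # es)" using path_length[OF Suc.prems] by (cases p; cases "snd p") auto
 obtain l i where e: "e = (l, i)" by (cases e)
 have pr: "l : V" "i : I" "st l i : V" "u = l" "(st l i, es) : paths G m"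
  using Suc.prems unfolding p e by (auto simp: path_Cons_iff)
 obtain w where "(st l i, es) = wpath (st l i) w" "valid (st l i) w" "length w = m"
  using Suc.IH[OF pr(5)] by auto
 then show ?case using pr unfolding p e by (intro exI[of _ "i # w"]) (simp add: wpath_def)
 qed
 then show ?thesis using that by auto
qed

lemma wpath_inject [simp]: "wpath l v = wpath l w \<longleftrightarrow> v = w"
 unfolding wpath_def prod.inject by (metis wpath_simps(4))

lemma wpath_append: "wpath l (v @ w) = path_concat (wpath l v) (wpath (wend l v) w)"
 unfolding path_concat_def wpath_def by (induction v arbitrary: l) simp_all

lemma wend_d:
 assumes "set w \<subseteq> I" "i : I" "j : I"
 shows "sos_d (wend l w) i j = sos_d l i j + int (count_list w i) - int (count_list w j)"
 using assms(1)
proof (induction w arbitrary: l)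
 case (Cons k w)
 then show ?case using d_step[of k i j l] assms(2,3) by (auto split: if_splits)
qed simp

text \<open>The letters of a path determine, and are determined up to order by, its end points.\<close>

lemma V_eqI:
 assumes "l : V" "m : V" "!!i. i : I ==> sos_d l i N = sos_d m i N"
 shows "l = m"
proof
 fix k
 show "l k = m k"
 proof (cases "k : I")
 case True
 then show ?thesis using assms(3)[OF True] assms(1,2) by (simp add: sos_d_def sos_verts_def)
 qed (use assms in \<open>auto simp: sos_verts_def\<close>)
qed

lemma count_sum: "set w \<subseteq> I ==> (SUM i:I. count_list w i) = length w"
 by (rule sum_count_set) auto

lemma same_end_count:
 assumes v: "set v \<subseteq> I" and w: "set w \<subseteq> I" and len: "length v = length w"
 and d: "!!i j. i : I ==> j : I ==> sos_d (wend l v) i j = sos_d (wend l w) i j"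
 and i: "i : I"
 shows "count_list v i = count_list w i"
proof -
 let ?c = "%i. int (count_list v i) - int (count_list w i)"
 have eq: "?c j = ?c i" if j: "j : I" for j
 using d[OF i j] wend_d[OF v i j, of l] wend_d[OF w i j, of l] by linarith
 have "(SUM j:I. ?c j) = int (SUM j:I. count_list v j) - int (SUM j:I. count_list w j)"
 by (simp add: sum_subtractf)
 also have "... = 0" using len by (simp only: count_sum[OF v] count_sum[OF w])
 finally have "(SUM j:I. ?c i) = 0" using eq by (metis (no_types, lifting) sum.cong)
 then show ?thesis using N2 by simp
qed

subsection \<open>The face operators\<close>

text \<open>The operator of the face model with \<open>\<zeta> = 1\<close>, acting on functionals (from the right).  The formulas are
  used for arbitrary letters: when the exchanged path leaves the alcove, its coefficient vanishes
  by itself.\<close>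

definition wa where "wa l i j = (if i = j then t else - (t powi (- sos_d l i j)) * (1 / \<lbrakk>sos_d l i j\<rbrakk>))"
definition wb where "wb l i j = (if i = j then 0 else \<epsilon> * (\<lbrakk>sos_d l i j - 1\<rbrakk> / \<lbrakk>sos_d l i j\<rbrakk>))"

definition h where "h = t - inverse t"

lemma h_nz: "h ~= 0"
 unfolding h_def by (rule t_diff_nz)

definition W :: "weight => (nat => nat => complex) => nat => nat => complex" where
 "W l f i j = wa l i j * f i j + wb l i j * f j i"

definition W1 where "W1 l g i j k = W l (%i j. g i j k) i j"
definition W2 where "W2 l g i j k = W (st l i) (g i) j k"

lemma eps2: "\<epsilon> * \<epsilon> = 1"
 using eps by auto

lemma eps2': "\<epsilon> * (\<epsilon> * x) = x"
 using eps by auto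

text \<open>With \<open>u = t\<^sup>2\<^sup>d\<close> the coefficients are rational functions of \<open>u\<close>.\<close>

lemma u_nz: "t powi n ~= 0"
 using t_nz by simp

lemma qn_ne_iff: "\<lbrakk>n\<rbrakk> ~= 0 \<longleftrightarrow> (t powi n)\<^sup>2 ~= 1"
proof -
 have "\<lbrakk>n\<rbrakk> = 0 \<longleftrightarrow> t powi n = inverse (t powi n)"
 using t_diff_nz by (simp add: q_int_def power_int_minus)
 also have "... \<longleftrightarrow> (t powi n)\<^sup>2 = 1" using u_nz[of n] by (simp add: field_simps power2_eq_square)
 finally show ?thesis by simp
qed

lemma wa_u:
 assumes "i ~= j" "\<lbrakk>sos_d l i j\<rbrakk> ~= 0" and u: "u = (t powi sos_d l i j)\<^sup>2"
 shows "wa l i j = - h / (u - 1)" "wb l i j = \<epsilon> * (u * inverse t - t) / (u - 1)" "u ~= 1" "u ~= 0"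
proof -
 define x where "x = t powi sos_d l i j"
 have x: "x ~= 0" "x\<^sup>2 ~= 1" using assms(2) u_nz by (auto simp: x_def qn_ne_iff)
 have d: "\<lbrakk>sos_d l i j\<rbrakk> = (x - inverse x) / h" by (simp add: q_int_def h_def x_def power_int_minus)
 have d1: "\<lbrakk>sos_d l i j - 1\<rbrakk> = (x / t - t / x) / h"
 using t_nz by (simp add: q_int_def h_def x_def power_int_minus power_int_diff divide_inverse mult.commute)
 have ux: "u = x\<^sup>2" by (simp add: u x_def)
 note hne = h_nz
 have xx: "x - inverse x = (x\<^sup>2 - 1) / x" using x by (simp add: field_simps power2_eq_square)
 have xt: "x / t - t / x = (x\<^sup>2 * inverse t - t) / x" using x t_nz by (simp add: field_simps power2_eq_square)
 have "wa l i j = - (inverse x) * (1 / ((x - inverse x) / h))"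
 using assms(1) by (simp add: wa_def d power_int_minus x_def)
 also have "... = - h / (u - 1)" using x hne unfolding xx ux by (simp add: field_simps)
 finally show "wa l i j = - h / (u - 1)" .
 have "wb l i j = \<epsilon> * ((x / t - t / x) / h / ((x - inverse x) / h))"
 using assms(1) by (simp add: wb_def d d1)
 also have "... = \<epsilon> * (u * inverse t - t) / (u - 1)"
 proof -
 have "a / x / h / (b / x / h) = a / b" for a b using x hne by simp
 then show ?thesis unfolding xx xt ux by simp
 qed
 finally show "wb l i j = \<epsilon> * (u * inverse t - t) / (u - 1)" .
 show "u ~= 1" "u ~= 0" using x by (simp_all add: ux)
qed

lemma u_minus: "(t powi (- n))\<^sup>2 = inverse ((t powi n)\<^sup>2)"
 by (simp add: power_int_minus power_inverse)

lemma u_add: "(t powi (m + n))\<^sup>2 = (t powi m)\<^sup>2 * (t powi n)\<^sup>2"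
 using t_nz by (simp add: power_int_add power_mult_distrib)

lemma wa_swap:
 assumes "i ~= j" "\<lbrakk>sos_d l i j\<rbrakk> ~= 0" and u: "u = (t powi sos_d l i j)\<^sup>2"
 shows "wa l j i = h * u / (u - 1)" "wb l j i = \<epsilon> * (u * t - inverse t) / (u - 1)"
proof -
 have d: "sos_d l j i = - sos_d l i j" by (rule d_swap)
 have nz: "\<lbrakk>sos_d l j i\<rbrakk> ~= 0" using assms(2) by (simp add: d q_int_minus)
 have v: "inverse u = (t powi sos_d l j i)\<^sup>2" by (simp add: d u_minus u)
 note B = wa_u[OF assms(1)[symmetric] nz v] and A = wa_u[OF assms]
 have e: "inverse u - 1 = - (u - 1) / u" using A(4) by (simp add: field_simps)
 show "wa l j i = h * u / (u - 1)" using B(1) A(3,4) unfolding e by (simp add: field_simps)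
 have frac: "x / (- w / u) = x * (- u / w)" for x w :: complex by simp
 have "wb l j i = \<epsilon> * (inverse u * inverse t - t) * (- u / (u - 1))" unfolding B(2) e by (rule frac)
 also have "... = \<epsilon> * (u * t - inverse t) / (u - 1)" using A(3,4) t_nz by (simp add: field_simps)
 finally show "wb l j i = \<epsilon> * (u * t - inverse t) / (u - 1)" .
qed

lemma hecke_coeffs:
 assumes "i ~= j" "\<lbrakk>sos_d l i j\<rbrakk> ~= 0"
 shows "wa l i j + wa l j i = h" "wa l i j * wa l i j + wb l i j * wb l j i = 1 + h * wa l i j"
proof -
 define u where "u = (t powi sos_d l i j)\<^sup>2"
 note A = wa_u[OF assms u_def] wa_swap[OF assms u_def]
 have u1: "u - 1 ~= 0" using A(3) by simp
 have ee: "\<epsilon> * (u * inverse t - t) / (u - 1) * (\<epsilon> * (u * t - inverse t) / (u - 1)) =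
  (u * inverse t - t) * (u * t - inverse t) / ((u - 1) * (u - 1))"
 using eps by (auto simp: field_simps)
 have "wa l i j + wa l j i = (h * (u - 1)) / (u - 1)"
 unfolding A(1,5) by (simp add: add_divide_distrib[symmetric] algebra_simps)
 then show "wa l i j + wa l j i = h" using u1 by simp
 have "wa l i j * wa l i j + wb l i j * wb l j i = (h * h + (u * inverse t - t) * (u * t - inverse t)) / ((u - 1) * (u - 1))"
 unfolding A(1,2,6) ee by (simp add: add_divide_distrib)
 also have "h * h + (u * inverse t - t) * (u * t - inverse t) = (u - 1 - h * h) * (u - 1)"
 unfolding h_def using t_nz by (simp add: field_simps power2_eq_square)
 also have "(u - 1 - h * h) * (u - 1) / ((u - 1) * (u - 1)) = 1 + h * wa l i j"
 proof -
 have "(w - h * h) * w / (w * w) = 1 + h * (- h / w)" if "w ~= 0" for w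
  using that by (simp add: field_simps)
 then show ?thesis unfolding A(1) using u1 by blast
 qed
 finally show "wa l i j * wa l i j + wb l i j * wb l j i = 1 + h * wa l i j" .
qed

lemma hecke_same: "t * t = 1 + h * t"
 unfolding h_def using t_nz by (simp add: field_simps)

lemma W_hecke:
 assumes "valid l [i, j]"
 shows "W l (W l f) i j = f i j + h * W l f i j"
proof (cases "i = j")
 case True
 have "t * (t * x) = x + h * (t * x)" for x
 using hecke_same by (metis mult.assoc distrib_right mult_1)
 then show ?thesis using True by (simp add: W_def wa_def wb_def)
next
 case False
 have nz: "\<lbrakk>sos_d l i j\<rbrakk> ~= 0" using qn_d_nz[of l i j] assms False by auto
 note H = hecke_coeffs[OF False nz]
 have "W l (W l f) i j = (wa l i j * wa l i j + wb l i j * wb l j i) * f i j + wb l i j * (wa l i j + wa l j i) * f j i"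
 by (simp add: W_def algebra_simps)
 then show ?thesis unfolding H by (simp add: W_def algebra_simps)
qed

lemma swap_valid:
 assumes "valid l [i, j]" "wb l i j ~= 0"
 shows "valid l [j, i]"
proof -
 have v: "l : V" "i : I" "j : I" "st l i : V" "st (st l i) j : V" "i ~= j"
 using assms by (auto simp: wb_def)
 have "st l j : V"
 proof (rule ccontr)
 assume "st l j \<notin> V"
 then have "\<lbrakk>sos_d l i j - 1\<rbrakk> = 0" using qn_blocked v by blast
 then show False using assms(2) by (simp add: wb_def split: if_splits)
 qed
 then show ?thesis using v step_commute[of i j l] by simp
qed

lemma W_cong:
 assumes "valid l [i, j]" "!!i j. valid l [i, j] ==> f i j = f' i j"
 shows "W l f i j = W l f' i j"
 using assms swap_valid[OF assms(1)] by (cases "wb l i j = 0") (auto simp: W_def)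

lemma W1_cong:
 assumes "valid l [i, j, k]" "!!i j k. valid l [i, j, k] ==> g i j k = g' i j k"
 shows "W1 l g i j k = W1 l g' i j k"
proof -
 have "g j i k = g' j i k" if "wb l i j ~= 0"
 proof -
 have "valid l [i, j]" using assms(1) valid_V by auto
 then have "valid l [j, i]" by (rule swap_valid) (rule that)
 then have "valid l [j, i, k]" using assms(1) step_commute[of i j l] by auto
 then show ?thesis by (rule assms(2))
 qed
 then show ?thesis using assms(2)[OF assms(1)] by (cases "wb l i j = 0") (auto simp: W1_def W_def)
qed

lemma W2_cong:
 assumes "valid l [i, j, k]" "!!i j k. valid l [i, j, k] ==> g i j k = g' i j k"
 shows "W2 l g i j k = W2 l g' i j k"
 unfolding W2_def by (rule W_cong) (use assms in auto)

lemma d_step_other: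
 assumes "k : I" "i : I" "j : I" "k ~= i" "k ~= j"
 shows "wa (st l k) i j = wa l i j" "wb (st l k) i j = wb l i j"
 using d_step[OF assms(1-3), of l] assms by (simp_all add: wa_def wb_def)

text \<open>By the Hecke relation the quadratic identities between the coefficients follow from the bilinear
  ones.\<close>

lemma yb_from_linear:
 assumes "a * b + (h - a) * c = c * b"
 shows "a * b * a + c * (1 + h * a - a * a) = b * a * b + c * (1 + h * b - b * b)"
proof -
 have "(a * b * a + c * (1 + h * a - a * a)) - (b * a * b + c * (1 + h * b - b * b)) =
  (a - b) * ((a * b + (h - a) * c) - c * b)"
 by (simp add: algebra_simps)
 then show ?thesis using assms by simp
qed

lemma yb_two:
 assumes ij: "i : I" "j : I" "i ~= j" and nz: "\<lbrakk>sos_d l i j\<rbrakk> ~= 0" "\<lbrakk>sos_d (st l i) i j\<rbrakk> ~= 0"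
 shows "W1 l (W2 l (W1 l g)) i i j = W2 l (W1 l (W2 l g)) i i j"
 and "W1 l (W2 l (W1 l g)) i j i = W2 l (W1 l (W2 l g)) i j i"
 and "W1 l (W2 l (W1 l g)) j i i = W2 l (W1 l (W2 l g)) j i i"
proof -
 define u where "u = (t powi sos_d l i j)\<^sup>2"
 have d1: "sos_d (st l i) i j = sos_d l i j + 1" using d_step[OF ij(1) ij(1) ij(2), of l] ij by simp
 have v: "u * (t * t) = (t powi sos_d (st l i) i j)\<^sup>2"
 unfolding d1 u_add by (simp add: u_def power2_eq_square)
 note A = wa_u(1,2)[OF ij(3) nz(1) u_def] wa_swap[OF ij(3) nz(1) u_def]
 wa_u(1,2)[OF ij(3) nz(2) v] wa_swap[OF ij(3) nz(2) v]
 have ne: "u - 1 ~= 0" "u * (t * t) - 1 ~= 0"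
 using wa_u(3)[OF ij(3) nz(1) u_def] wa_u(3)[OF ij(3) nz(2) v] by auto
 define s where "s = inverse t"
 have ts: "t * s = 1" "s * t = 1" "t * (s * x) = x" "s * (t * x) = x" for x using t_nz by (simp_all add: s_def)
 let ?a = "wa l i j" and ?a' = "wa l j i" and ?b = "wb l i j" and ?b' = "wb l j i"
 and ?c = "wa (st l i) i j" and ?c' = "wa (st l i) j i" and ?e = "wb (st l i) i j" and ?e' = "wb (st l i) j i"
 have k2: "t * ?a = t * ?c + ?a * ?c'"
 unfolding A h_def s_def[symmetric] using ne by (simp add: divide_simps) (simp add: algebra_simps ts)
 note H = hecke_coeffs[OF ij(3) nz(1)] and H' = hecke_coeffs[OF ij(3) nz(2)]
 have sum: "?a' = h - ?a" "?c' = h - ?c" using H(1) H'(1) by (simp_all add: algebra_simps)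
 have bb: "?b * ?b' = 1 + h * ?a - ?a * ?a" "?b * ?b' = 1 + h * ?a' - ?a' * ?a'"
 "?e * ?e' = 1 + h * ?c - ?c * ?c" "?e * ?e' = 1 + h * ?c' - ?c' * ?c'"
 using H(2) H'(2) unfolding sum by (simp_all add: algebra_simps)
 have k5: "?a * ?c' + t * ?a' = ?c' * t"
 using k2 unfolding sum by (simp add: algebra_simps)
 have k1: "t * ?c * t = ?c * t * ?c + ?e * ?a * ?e'"
 proof -
 have "t * ?c + (h - t) * ?a = ?a * ?c" using k2 unfolding sum by (simp add: algebra_simps)
 from yb_from_linear[OF this] have "t * ?c * t = ?c * t * ?c + ?a * (?e * ?e')"
  unfolding bb(3) hecke_same by simp
 then show ?thesis by (simp add: mult_ac)
 qed
 have k4: "?a * ?c' * ?a + ?b * t * ?b' = ?c' * ?a * ?c' + ?e' * t * ?e"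
 proof -
 have "?a * ?c' + (h - ?a) * t = t * ?c'" using k2 unfolding sum by (simp add: algebra_simps)
 from yb_from_linear[OF this] have "?a * ?c' * ?a + t * (?b * ?b') = ?c' * ?a * ?c' + t * (?e * ?e')"
  unfolding bb(1,4) by simp
 then show ?thesis by (simp add: mult_ac)
 qed
 have k7: "?a' * t * ?a' + ?b' * ?c' * ?b = t * ?a' * t"
 proof -
 have "?a' * t + (h - ?a') * ?c' = ?c' * t" using k5 unfolding sum by (simp add: algebra_simps)
 from yb_from_linear[OF this] have "?a' * t * ?a' + ?c' * (?b * ?b') = t * ?a' * t"
  unfolding bb(2) hecke_same by simp
 then show ?thesis by (simp add: mult_ac)
 qed
 have same: "wa m i i = t" "wb m i i = 0" for m by (simp_all add: wa_def wb_def)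
 have W: "W1 l g i i k = t * g i i k" "W2 l g k i i = t * g k i i" for g k
 by (simp_all add: W1_def W2_def W_def same)
 have "W1 l (W2 l (W1 l g)) i i j = t * ?c * t * g i i j + ?e * (t * ?a) * g i j i + t * ?e * ?b * g j i i"
 by (simp add: W1_def W2_def W_def same algebra_simps)
 moreover have "W2 l (W1 l (W2 l g)) i i j = (?c * t * ?c + ?e * ?a * ?e') * g i i j + ?e * (t * ?c + ?a * ?c') * g i j i + t * ?e * ?b * g j i i"
 by (simp add: W1_def W2_def W_def same algebra_simps)
 ultimately show "W1 l (W2 l (W1 l g)) i i j = W2 l (W1 l (W2 l g)) i i j" by (simp only: k1 k2)
 have "W1 l (W2 l (W1 l g)) i j i = (?a * ?c' * ?a + ?b * t * ?b') * g i j i + ?b * (?a * ?c' + t * ?a') * g j i i + ?e' * (t * ?a) * g i i j"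
 by (simp add: W1_def W2_def W_def same algebra_simps)
 moreover have "W2 l (W1 l (W2 l g)) i j i = (?c' * ?a * ?c' + ?e' * t * ?e) * g i j i + ?b * (?c' * t) * g j i i + ?e' * (t * ?c + ?a * ?c') * g i i j"
 by (simp add: W1_def W2_def W_def same algebra_simps)
 ultimately show "W1 l (W2 l (W1 l g)) i j i = W2 l (W1 l (W2 l g)) i j i" by (simp only: k4 k5 k2)
 have "W1 l (W2 l (W1 l g)) j i i = (?a' * t * ?a' + ?b' * ?c' * ?b) * g j i i + ?b' * (?a * ?c' + t * ?a') * g i j i + t * ?b' * ?e' * g i i j"
 by (simp add: W1_def W2_def W_def same algebra_simps)
 moreover have "W2 l (W1 l (W2 l g)) j i i = t * ?a' * t * g j i i + ?b' * (?c' * t) * g i j i + t * ?b' * ?e' * g i i j"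
 by (simp add: W1_def W2_def W_def same algebra_simps)
 ultimately show "W1 l (W2 l (W1 l g)) j i i = W2 l (W1 l (W2 l g)) j i i" by (simp only: k7 k5)
qed

text \<open>With three different letters the coefficients are rational functions of two variables; with two
  equal letters only three words occur.  All quadratic identities come from one linear one by the
  Hecke relation.\<close>

theorem yang_baxter:
 assumes v: "valid l [i, j, k]"
 shows "W1 l (W2 l (W1 l g)) i j k = W2 l (W1 l (W2 l g)) i j k"
proof -
 have I3: "i : I" "j : I" "k : I" and l: "l : V" "st l i : V" "st (st l i) j : V" "st (st (st l i) j) k : V"
 using v by auto
 consider "i = j" "j = k" | "i = j" "j ~= k" | "i = k" "i ~= j" | "j = k" "i ~= j" | "i ~= j" "j ~= k" "i ~= k"
 by blast
 then show ?thesis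
 proof cases
 case 1
 then show ?thesis by (simp add: W1_def W2_def W_def wb_def wa_def)
 next
 case 5
 note D = d_step_other[OF I3(1) I3(2) I3(3) 5(1,3)] d_step_other[OF I3(1) I3(3) I3(2) 5(3,1)]
  d_step_other[OF I3(2) I3(1) I3(3) 5(1)[symmetric] 5(2)] d_step_other[OF I3(2) I3(3) I3(1) 5(2) 5(1)[symmetric]]
  d_step_other[OF I3(3) I3(1) I3(2) 5(3)[symmetric] 5(2)[symmetric]] d_step_other[OF I3(3) I3(2) I3(1) 5(2)[symmetric] 5(3)[symmetric]]
 define u v where "u = (t powi sos_d l i j)\<^sup>2" and "v = (t powi sos_d l j k)\<^sup>2"
 have nz: "\<lbrakk>sos_d l i j\<rbrakk> ~= 0" "\<lbrakk>sos_d l j k\<rbrakk> ~= 0" "\<lbrakk>sos_d l i k\<rbrakk> ~= 0" using qn_d_nz l I3 5 by auto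
 have uv: "u * v = (t powi sos_d l i k)\<^sup>2" unfolding u_def v_def u_add[symmetric] d_add ..
 note A = wa_u(1,2)[OF 5(1) nz(1) u_def] wa_swap[OF 5(1) nz(1) u_def] wa_u(1,2)[OF 5(2) nz(2) v_def] wa_swap[OF 5(2) nz(2) v_def]
  wa_u(1,2)[OF 5(3) nz(3) uv] wa_swap[OF 5(3) nz(3) uv]
 have ne: "u - 1 ~= 0" "v - 1 ~= 0" "u * v - 1 ~= 0"
  using wa_u(3)[OF 5(1) nz(1) u_def] wa_u(3)[OF 5(2) nz(2) v_def] wa_u(3)[OF 5(3) nz(3) uv] by auto
 define s where "s = inverse t"
 have ts: "t * s = 1" "s * t = 1" "t * (s * x) = x" "s * (t * x) = x" for x using t_nz by (simp_all add: s_def)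
 have key3: "wa l i j * wa l j k + wa l j i * wa l i k = wa l i k * wa l j k"
  unfolding A h_def s_def[symmetric] using ne by (simp add: divide_simps) (simp add: algebra_simps ts)
 note H1 = hecke_coeffs[OF 5(1) nz(1)] and H2 = hecke_coeffs[OF 5(2) nz(2)]
 have sum: "wa l j i = h - wa l i j" "wa l k j = h - wa l j k" using H1(1) H2(1) by (simp_all add: algebra_simps)
 have key5: "wa l j k * wa l i j + wa l k j * wa l i k = wa l i k * wa l i j"
  using key3 unfolding sum by (simp add: algebra_simps)
 have key1: "wa l i j * wa l j k * wa l i j + wb l i j * wa l i k * wb l j i =
  wa l j k * wa l i j * wa l j k + wb l j k * wa l i k * wb l k j"
 proof -
  have b: "wb l i j * wb l j i = 1 + h * wa l i j - wa l i j * wa l i j"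
  "wb l j k * wb l k j = 1 + h * wa l j k - wa l j k * wa l j k"
  using H1(2) H2(2) by (simp_all add: algebra_simps)
  have "wa l i j * wa l j k + (h - wa l i j) * wa l i k = wa l i k * wa l j k" using key3 unfolding sum .
  from yb_from_linear[OF this] have "wa l i j * wa l j k * wa l i j + wa l i k * (wb l i j * wb l j i) =
   wa l j k * wa l i j * wa l j k + wa l i k * (wb l j k * wb l k j)" unfolding b .
  then show ?thesis by (simp add: mult_ac)
 qed
 have L: "W1 l (W2 l (W1 l g)) i j k =
  (wa l i j * wa l j k * wa l i j + wb l i j * wa l i k * wb l j i) * g i j k
  + wb l i j * (wa l i j * wa l j k + wa l j i * wa l i k) * g j i k
  + wa l i j * wb l j k * wa l i k * g i k j + wa l i j * wb l j k * wb l i k * g k i j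
  + wb l i j * wb l i k * wa l j k * g j k i + wb l i j * wb l i k * wb l j k * g k j i"
  by (simp add: W1_def W2_def W_def D algebra_simps)
 have R: "W2 l (W1 l (W2 l g)) i j k =
  (wa l j k * wa l i j * wa l j k + wb l j k * wa l i k * wb l k j) * g i j k
  + wa l j k * wb l i j * wa l i k * g j i k
  + wb l j k * (wa l j k * wa l i j + wa l k j * wa l i k) * g i k j + wa l i j * wb l j k * wb l i k * g k i j
  + wb l i j * wb l i k * wa l j k * g j k i + wb l i j * wb l i k * wb l j k * g k j i"
  by (simp add: W1_def W2_def W_def D algebra_simps)
 show ?thesis unfolding L R key1 key3 key5 by (simp add: algebra_simps)
 next
 case 2
 have "\<lbrakk>sos_d l i k\<rbrakk> ~= 0" "\<lbrakk>sos_d (st l i) i k\<rbrakk> ~= 0" using qn_d_nz l I3 2 by auto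
 then show ?thesis using yb_two[of i k l g] 2 I3 by simp
 next
 case 3
 have "\<lbrakk>sos_d l i j\<rbrakk> ~= 0" "\<lbrakk>sos_d (st l i) i j\<rbrakk> ~= 0" using qn_d_nz l I3 3 by auto
 then show ?thesis using yb_two[of i j l g] 3 I3 by simp
 next
 case 4
 have "sos_d (st (st (st l i) j) j) i j = sos_d l i j - 1"
  "sos_d (st l j) j i = - (sos_d l i j - 1)"
  using I3 4 by (simp_all add: d_step d_swap[of l k i])
 moreover have "\<lbrakk>sos_d (st (st (st l i) j) j) i j\<rbrakk> ~= 0" using qn_d_nz l I3 4 by auto
 ultimately have "\<lbrakk>sos_d (st l j) j i\<rbrakk> ~= 0" by (simp add: q_int_minus del: minus_diff_eq)
 moreover have "\<lbrakk>sos_d l j i\<rbrakk> ~= 0" using qn_d_nz l I3 4 by auto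
 ultimately show ?thesis using yb_two[of j i l g] 4 I3 by simp
 qed
qed

end

section \<open>The face ideal\<close>

context quiver
begin

lemma composable_pairs_iff: "(a, b) : composable_pairs G \<longleftrightarrow> a : arcs G & b : arcs G & head G a = tail G b"
 by (simp add: composable_pairs_def)

lemma finite_composable [simp]: "finite (composable_pairs G)"
 by (rule finite_subset[of _ "arcs G \<times> arcs G"]) (auto simp: composable_pairs_def)

lemma paths_2: "paths G 2 = (%(a, b). edge_pair_path G a b) ` composable_pairs G"
proof (intro equalityI subsetI)
 fix p assume p: "p : paths G 2"
 then obtain u a b where pe: "p = (u, [a, b])"
 using path_length[OF p] by (cases p) (auto simp: numeral_2_eq_2 length_Suc_conv)
 then show "p : (%(a, b). edge_pair_path G a b) ` composable_pairs G"
 using p by (auto simp: path_Cons_iff numeral_2_eq_2 path_Nil_iff edge_pair_path_def composable_pairs_iff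
  intro!: image_eqI[of _ _ "(a, b)"])
next
 fix p assume "p : (%(a, b). edge_pair_path G a b) ` composable_pairs G"
 then show "p : paths G 2"
 by (auto simp: path_Cons_iff numeral_2_eq_2 path_Nil_iff edge_pair_path_def composable_pairs_iff)
qed

lemma sum_paths_2: "(SUM p:paths G 2. f p) = (SUM (a, b):composable_pairs G. f (edge_pair_path G a b))"
 unfolding paths_2 by (subst sum.reindex) (auto simp: inj_on_def edge_pair_path_def intro!: sum.cong)

lemma edge_pair_in: "(a, b) : composable_pairs G ==> edge_pair_path G a b : paths G 2"
 unfolding paths_2 by auto

lemma edge_pair_simps [simp]:
 "fst (edge_pair_path G a b) = tail G a" "path_end G (edge_pair_path G a b) = head G b"
 "edge_pair_path G a b = edge_pair_path G c d \<longleftrightarrow> a = c & b = d"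
 by (auto simp: edge_pair_path_def path_end_Cons)

lemma linear_form_H_lincomb:
 assumes X: "linear_form H X" and f: "!!i. i : S ==> f i : carrier H"
 shows "X (SUM i:S. comb_scale (k i) (f i)) = (SUM i:S. k i * X (f i))"
 using f
proof (induction S rule: infinite_finite_induct)
 case (insert x S)
 have "(SUM i:S. comb_scale (k i) (f i)) : carrier H"
 using insert by (intro H_sum_in H_scale_in) auto
 then show ?case
 using insert linear_form_add[OF X, of "comb_scale (k x) (f x)"] linear_form_smult[OF X, of "f x" "k x"] H_scale_in
 by (simp add: H_simps(5,6))
qed (use linear_form_H_zero[OF X] in auto)

lemma linear_form_H_diff:
 assumes "linear_form H X" "f : carrier H" "g : carrier H"
 shows "X (f - g) = X f - X g"
proof -
 have "f - g : carrier H"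
 using H_add_in[OF assms(2) H_scale_in[OF assms(3), of "-1"]]
 by (simp add: poly_mapping_eq_iff comb_scale_simps(1) H_simps(1) fun_eq_iff) (metis (no_types, lifting) ext add.commute diff_conv_add_uminus lookup_comb_scale lookup_minus lookup_uminus lookup_add mult_minus1 poly_mapping_eqI)
 then show ?thesis
 using linear_form_add[OF assms(1), of "f - g" g] assms by (simp add: H_simps(5))
qed

definition face_col :: "'e face_weight => 'e => 'e => ('v, 'e) path => ('v, 'e) path_comb" where
 "face_col w a b q = (SUM (c, d):composable_pairs G. comb_scale (w a c b d) (e_basis (edge_pair_path G c d) q))"

definition face_row :: "'e face_weight => ('v, 'e) path => 'e => 'e => ('v, 'e) path_comb" where
 "face_row w p c d = (SUM (r, s):composable_pairs G. comb_scale (w r c s d) (e_basis p (edge_pair_path G r s)))"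

lemma face_relations_alt:
 "face_relations G w = {face_col w a b (edge_pair_path G c d) - face_row w (edge_pair_path G a b) c d
 | a b c d. (c, d) : composable_pairs G & (a, b) : composable_pairs G}"
 unfolding face_relations_def face_col_def face_row_def ..

lemma face_col_in: "q : paths G 2 ==> face_col w a b q : carrier H"
 unfolding face_col_def by (intro H_sum_in) (auto intro!: H_scale_in e_basis_carrier path_pairsI edge_pair_in)

lemma face_row_in: "p : paths G 2 ==> face_row w p c d : carrier H"
 unfolding face_row_def by (intro H_sum_in) (auto intro!: H_scale_in e_basis_carrier path_pairsI edge_pair_in)

lemma H_diff_in: "f : carrier H ==> g : carrier H ==> f - g : carrier H"
 using keys_diff[of f g] by (auto simp: H_simps(1))

lemma face_relations_in: "face_relations G w \<subseteq> carrier H"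
 unfolding face_relations_alt by (auto intro!: H_diff_in face_col_in face_row_in edge_pair_in)

lemma face_relation_in_ideal: "face_relations G w \<subseteq> face_ideal G w"
 unfolding face_ideal_def by (rule ring.genideal_self[OF H_ring face_relations_in])

lemma linear_form_face_col:
 assumes "linear_form H X" "q : paths G 2"
 shows "X (face_col w a b q) = (SUM (c, d):composable_pairs G. w a c b d * X (e_basis (edge_pair_path G c d) q))"
 unfolding face_col_def case_prod_unfold
 by (rule linear_form_H_lincomb[OF assms(1)]) (use assms(2) in \<open>auto intro!: e_basis_carrier path_pairsI edge_pair_in\<close>)

lemma linear_form_face_row:
 assumes "linear_form H X" "p : paths G 2"
 shows "X (face_row w p c d) = (SUM (r, s):composable_pairs G. w r c s d * X (e_basis p (edge_pair_path G r s)))"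
 unfolding face_row_def case_prod_unfold
 by (rule linear_form_H_lincomb[OF assms(1)]) (use assms(2) in \<open>auto intro!: e_basis_carrier path_pairsI edge_pair_in\<close>)

text \<open>A face relation is the difference of \<open>w\<close> acting on the upper and on the lower index.  Under the coproduct
  the operator is moved through the middle index, once in each factor, modulo the ideal.\<close>

theorem biideal_face_ideal:
 assumes w: "face_supported G w"
 shows "biideal H (face_ideal G w)"
proof -
 interpret HF: face_algebra "verts G" H by (rule H_face_algebra)
 show ?thesis unfolding face_ideal_def
 proof (rule HF.biideal_genideal[OF face_relations_in])
 fix g k l assume "g : face_relations G w" and k: "k : verts G" and l: "l : verts G"
 then obtain a b c d where g: "g = face_col w a b (edge_pair_path G c d) - face_row w (edge_pair_path G a b) c d"
  and cd: "(c, d) : composable_pairs G" and ab: "(a, b) : composable_pairs G"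
  unfolding face_relations_alt by blast
 let ?X = "%f. counit H (mul (face_idem_ring H k) (mul f (face_idem H l)))"
 have X: "linear_form H ?X"
  using linear_form_H_mul(1)[OF linear_form_H_mul(2)[OF H_counit_linear H_idem_in(2)[OF k]] H_idem_in(1)[OF l]] .
 have Xe: "?X (e_basis p q) = (if p = q & fst p = k & path_end G q = l then 1 else 0)"
  if "p : paths G 2" "q : paths G 2" for p q
  using that linear_form_H_zero[OF H_counit_linear] by (auto simp: mul_idem_right mul_idem_ring_left)
 have f: "w a c b d ~= 0 ==> is_face G a c b d" using w by (auto simp: face_supported_def)
 have "?X (face_col w a b (edge_pair_path G c d)) = (SUM x:composable_pairs G.
  if x = (c, d) then w a c b d * (if tail G c = k & head G d = l then 1 else 0) else 0)"
  unfolding linear_form_face_col[OF X edge_pair_in[OF cd]]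
  by (intro sum.cong refl) (auto simp: Xe edge_pair_in cd split: if_splits)
 moreover have "?X (face_row w (edge_pair_path G a b) c d) = (SUM x:composable_pairs G.
  if x = (a, b) then w a c b d * (if tail G a = k & head G b = l then 1 else 0) else 0)"
  unfolding linear_form_face_row[OF X edge_pair_in[OF ab]]
  by (intro sum.cong refl) (auto simp: Xe edge_pair_in ab split: if_splits)
 ultimately have "?X g = 0"
  unfolding g linear_form_H_diff[OF X face_col_in[OF edge_pair_in[OF cd]] face_row_in[OF edge_pair_in[OF ab]]]
  by (cases "w a c b d = 0") (use f cd ab in \<open>auto simp: is_face_def\<close>)
 then show "counit H (face_idem_ring H k \<otimes>\<^bsub>H\<^esub> (g \<otimes>\<^bsub>H\<^esub> face_idem H l)) = 0" by (simp add: H_simps(2))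
 next
 fix g B assume "g : face_relations G w" and B: "bilinear_form H B"
  and van: "!!z y. z : Idl\<^bsub>H\<^esub> face_relations G w ==> y : carrier H ==> B z y = 0 & B y z = 0"
 then obtain a b c d where g: "g = face_col w a b (edge_pair_path G c d) - face_row w (edge_pair_path G a b) c d"
  and cd: "(c, d) : composable_pairs G" and ab: "(a, b) : composable_pairs G"
  unfolding face_relations_alt by blast
 let ?e = "%x y. e_basis (edge_pair_path G (fst x) (snd x)) (edge_pair_path G (fst y) (snd y))"
 let ?C = "composable_pairs G"
 have e: "?e x y : carrier H" if "x : ?C" "y : ?C" for x y
  using that by (auto intro!: e_basis_carrier path_pairsI edge_pair_in)
 have swap: "B (face_col w p q (edge_pair_path G r s)) y = B (face_row w (edge_pair_path G p q) r s) y"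
  "B y (face_col w p q (edge_pair_path G r s)) = B y (face_row w (edge_pair_path G p q) r s)"
  if pq: "(p, q) : ?C" and rs: "(r, s) : ?C" and y: "y : carrier H" for p q r s y
 proof -
  have "face_col w p q (edge_pair_path G r s) - face_row w (edge_pair_path G p q) r s : Idl\<^bsub>H\<^esub> face_relations G w"
  using face_relation_in_ideal pq rs unfolding face_ideal_def face_relations_alt by blast
  note z = van[OF this y] and in' = face_col_in[OF edge_pair_in[OF rs]] face_row_in[OF edge_pair_in[OF pq]]
  show "B (face_col w p q (edge_pair_path G r s)) y = B (face_row w (edge_pair_path G p q) r s) y"
  using z linear_form_H_diff[OF bilinear_form_left[OF B y] in'] by simp
  show "B y (face_col w p q (edge_pair_path G r s)) = B y (face_row w (edge_pair_path G p q) r s)"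
  using z linear_form_H_diff[OF bilinear_form_right[OF B y] in'] by simp
 qed
 have co: "comult H (?e x y) B = (SUM z:?C. B (?e x z) (?e z y))" if "x : ?C" for x y
  using H_comult_basis[OF B edge_pair_in, of "fst x" "snd x"] that
  by (simp add: sum_paths_2 case_prod_unfold)
 have L: "linear_form H (%f. comult H f B)" by (rule linear_form_H_comult)
 have "comult H (face_col w a b (edge_pair_path G c d)) B =
  (SUM x:?C. w a (fst x) b (snd x) * (SUM z:?C. B (?e x z) (?e z (c, d))))"
  unfolding linear_form_face_col[OF L edge_pair_in[OF cd]] case_prod_unfold
  by (intro sum.cong refl) (use co[of _ "(c, d)"] in simp)
 also have "... = (SUM z:?C. B (face_col w a b (edge_pair_path G (fst z) (snd z))) (?e z (c, d)))"
 proof (subst sum_distrib_left, subst sum.swap, rule sum.cong[OF refl])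
  fix z assume z: "z : ?C"
  show "(SUM x:?C. w a (fst x) b (snd x) * B (?e x z) (?e z (c, d))) = B (face_col w a b (edge_pair_path G (fst z) (snd z))) (?e z (c, d))"
  using linear_form_face_col[OF bilinear_form_left[OF B e[OF z cd]] edge_pair_in, of "fst z" "snd z" w a b] z
  by (simp add: case_prod_unfold)
 qed
 also have "... = (SUM z:?C. B (face_row w (edge_pair_path G a b) (fst z) (snd z)) (?e z (c, d)))"
  by (rule sum.cong[OF refl]) (use swap(1)[OF ab _ e[OF _ cd]] in auto)
 also have "... = (SUM z:?C. SUM x:?C. w (fst x) (fst z) (snd x) (snd z) * B (?e (a, b) x) (?e z (c, d)))"
 proof (rule sum.cong[OF refl])
  fix z assume z: "z : ?C"
  show "B (face_row w (edge_pair_path G a b) (fst z) (snd z)) (?e z (c, d)) =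
   (SUM x:?C. w (fst x) (fst z) (snd x) (snd z) * B (?e (a, b) x) (?e z (c, d)))"
  using linear_form_face_row[OF bilinear_form_left[OF B e[OF z cd]] edge_pair_in[OF ab], of w "fst z" "snd z"]
  by (simp add: case_prod_unfold)
 qed
 also have "... = (SUM x:?C. B (?e (a, b) x) (face_col w (fst x) (snd x) (edge_pair_path G c d)))"
 proof (subst sum.swap, rule sum.cong[OF refl])
  fix x assume x: "x : ?C"
  show "(SUM z:?C. w (fst x) (fst z) (snd x) (snd z) * B (?e (a, b) x) (?e z (c, d))) =
   B (?e (a, b) x) (face_col w (fst x) (snd x) (edge_pair_path G c d))"
  using linear_form_face_col[OF bilinear_form_right[OF B e[OF ab x]] edge_pair_in[OF cd], of w "fst x" "snd x"]
  by (simp add: case_prod_unfold)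
 qed
 also have "... = (SUM x:?C. B (?e (a, b) x) (face_row w (edge_pair_path G (fst x) (snd x)) c d))"
  by (rule sum.cong[OF refl]) (use swap(2)[OF _ cd e[OF ab]] in auto)
 also have "... = (SUM x:?C. SUM z:?C. w (fst z) c (snd z) d * B (?e (a, b) x) (?e x z))"
 proof (rule sum.cong[OF refl])
  fix x assume x: "x : ?C"
  show "B (?e (a, b) x) (face_row w (edge_pair_path G (fst x) (snd x)) c d) =
   (SUM z:?C. w (fst z) c (snd z) d * B (?e (a, b) x) (?e x z))"
  using linear_form_face_row[OF bilinear_form_right[OF B e[OF ab x]] edge_pair_in, of "fst x" "snd x" w c d] x
  by (simp add: case_prod_unfold)
 qed
 also have "... = (SUM z:?C. w (fst z) c (snd z) d * comult H (?e (a, b) z) B)"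
  unfolding co[OF ab] sum_distrib_left by (rule sum.swap)
 also have "... = comult H (face_row w (edge_pair_path G a b) c d) B"
  unfolding linear_form_face_row[OF L edge_pair_in[OF ab]] case_prod_unfold by simp
 finally show "comult H g B = 0"
  unfolding g by (subst linear_form_H_diff[OF L face_col_in[OF edge_pair_in[OF cd]] face_row_in[OF edge_pair_in[OF ab]]]) simp
 qed
qed

lemma face_ideal_scale:
 assumes c: "c ~= 0"
 shows "face_ideal G (%r p q s. c * w r p q s) = face_ideal G w"
proof -
 interpret HF: face_algebra "verts G" H by (rule H_face_algebra)
 have mon: "monoid H" by (rule ring.is_monoid[OF H_ring])
 have one: "\<one>\<^bsub>H\<^esub> : carrier H" by (rule monoid.one_closed[OF mon])
 have sub: "face_relations G (%r p q s. k * w r p q s) \<subseteq> face_ideal G w" for k w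
 proof
 fix x assume "x : face_relations G (%r p q s. k * w r p q s)"
 then obtain a b c d where x: "x = face_col (%r p q s. k * w r p q s) a b (edge_pair_path G c d) - face_row (%r p q s. k * w r p q s) (edge_pair_path G a b) c d"
  and cd: "(c, d) : composable_pairs G" and ab: "(a, b) : composable_pairs G"
  unfolding face_relations_alt by blast
 let ?y = "face_col w a b (edge_pair_path G c d) - face_row w (edge_pair_path G a b) c d"
 have y: "?y : face_ideal G w" using face_relation_in_ideal ab cd unfolding face_relations_alt by blast
 have yH: "?y : carrier H" using face_relations_in ab cd unfolding face_relations_alt by blast
 have "x = comb_scale k ?y"
  unfolding x face_col_def face_row_def
  by (rule poly_mapping_eqI)
  (simp add: lookup_minus lookup_sum case_prod_unfold sum_distrib_left algebra_simps)
 also have "... = (k \<odot>\<^bsub>H\<^esub> \<one>\<^bsub>H\<^esub>) \<otimes>\<^bsub>H\<^esub> ?y"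
  using HF.smult_mult_l[OF one yH, of k] monoid.l_one[OF mon yH] by (simp add: H_simps(6))
 also have "... : face_ideal G w"
  using ideal.I_l_closed[OF _ y, of H "k \<odot>\<^bsub>H\<^esub> \<one>\<^bsub>H\<^esub>"] HF.smult_in[OF one, of k]
  ring.genideal_ideal[OF H_ring face_relations_in[of w]] unfolding face_ideal_def by blast
 finally show "x : face_ideal G w" .
 qed
 have "face_ideal G (%r p q s. k * w r p q s) \<subseteq> face_ideal G w" for k w
 using ring.genideal_minimal[OF H_ring ring.genideal_ideal[OF H_ring face_relations_in[of w]]] sub[of k w]
 unfolding face_ideal_def by blast
 from this[of c w] this[of "inverse c" "%r p q s. c * w r p q s"] show ?thesis
 using c by (simp add: mult.assoc[symmetric])
qed

end

section \<open>Face operators on words\<close>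

context sos
begin

lemma face_arcs:
 assumes v: "valid l [i, j]" and f: "is_face G r (l, i) q (st l i, j)"
 shows "(r = (l, i) & q = (st l i, j)) \<or> (i ~= j & r = (l, j) & q = (st l j, i))"
proof -
 obtain l' a m b where rq: "r = (l', a)" "q = (m, b)" by (cases r; cases q)
 have lm: "l' = l" "m = st l a" "st (st l a) b = st (st l i) j" and ab: "a : I" "b : I"
 using f by (auto simp: is_face_def rq)
 have ij: "i : I" "j : I" using v by auto
 have c: "count_list [a, b] x = count_list [i, j] x" if "x : I" for x
 by (rule same_end_count[of _ _ l]) (use lm ab ij that in auto)
 show ?thesis
 proof (cases "a = i")
 case True
 then have "b = j" using c[of j] ij by (auto split: if_splits)
 then show ?thesis using True rq lm by simp
 next
 case False
 then have "a = j" using c[of a] ab by (auto split: if_splits)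
 moreover have "b = i" using c[of i] False ij by (auto split: if_splits)
 ultimately show ?thesis using False rq lm by auto
 qed
qed

definition fop :: "sos_arc face_weight => weight => (nat => nat => complex) => nat => nat => complex" where
 "fop X l f i j = X (l, i) (l, i) (st l i, j) (st l i, j) * f i j +
  (if i = j then 0 else X (l, j) (l, i) (st l j, i) (st l i, j) * f j i)"

lemma face_sum:
 assumes X: "face_supported G X" and v: "valid l [i, j]"
 shows "(SUM x:arcs G. SUM c:arcs G. X x (l, i) c (st l i, j) * F x c) = fop X l (%a b. F (l, a) (st l a, b)) i j"
proof -
 let ?g = "%y. X (fst y) (l, i) (snd y) (st l i, j) * F (fst y) (snd y)"
 let ?T = "{((l, i), (st l i, j)), ((l, j), (st l j, i))}"
 have "(SUM x:arcs G. SUM c:arcs G. X x (l, i) c (st l i, j) * F x c) = (SUM y:arcs G \<times> arcs G. ?g y)"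
 by (simp add: sum.cartesian_product case_prod_unfold)
 also have "... = (SUM y:?T. ?g y)"
 proof (rule sum.mono_neutral_cong)
 fix y assume y: "y : arcs G \<times> arcs G - ?T"
 have "~ is_face G (fst y) (l, i) (snd y) (st l i, j)"
  using face_arcs[OF v, of "fst y" "snd y"] y by (cases y) auto
 then show "?g y = 0" using X unfolding face_supported_def by (metis mult_zero_left)
 next
 fix y assume y: "y : ?T - arcs G \<times> arcs G"
 have "~ is_face G (fst y) (l, i) (snd y) (st l i, j)" using y by (cases y) (auto simp: is_face_def)
 then show "?g y = 0" using X unfolding face_supported_def by (metis mult_zero_left)
 qed (auto simp: finite_arcs_G)
 also have "... = fop X l (%a b. F (l, a) (st l a, b)) i j" by (cases "i = j") (simp_all add: fop_def)
 finally show ?thesis .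
qed

lemma fop_cong:
 assumes X: "face_supported G X" and v: "valid l [i, j]" and f: "f i j = f' i j"
 "i ~= j ==> valid l [j, i] ==> f j i = f' j i"
 shows "fop X l f i j = fop X l f' i j"
proof (cases "i = j \<or> X (l, j) (l, i) (st l j, i) (st l i, j) = 0")
 case False
 then have "is_face G (l, j) (l, i) (st l j, i) (st l i, j)" using X by (auto simp: face_supported_def)
 then have "valid l [j, i]" by (auto simp: is_face_def)
 then show ?thesis using f False by (simp add: fop_def)
qed (use f(1) in \<open>auto simp: fop_def\<close>)

lemma face_ext:
 assumes X: "face_supported G X" and Y: "face_supported G Y"
 and eq: "!!l i j f. valid l [i, j] ==> fop X l f i j = fop Y l f i j"
 shows "X r p q s = Y r p q s"
proof (cases "is_face G r p q s")
 case False
 then show ?thesis using X Y unfolding face_supported_def by metis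
next
 case True
 obtain l i m j where ps: "p = (l, i)" "s = (m, j)" by (cases p; cases s)
 have m: "m = st l i" and v: "valid l [i, j]" using True by (auto simp: is_face_def ps)
 let ?F = "%x c. if x = r & c = q then 1 else 0 :: complex"
 have "(SUM x:arcs G. SUM c:arcs G. Z x p c s * ?F x c) = Z r p q s" for Z :: "sos_arc face_weight"
 proof -
 have "(SUM x:arcs G. SUM c:arcs G. Z x p c s * ?F x c) = (SUM x:arcs G. SUM c:arcs G. if x = r then if c = q then Z r p q s else 0 else 0)"
  by (intro sum.cong) auto
 also have "... = (SUM x:arcs G. if x = r then (SUM c:arcs G. if c = q then Z r p q s else 0) else 0)"
  by (intro sum.cong refl) simp
 also have "... = Z r p q s" using True finite_arcs_G by (simp add: is_face_def)
 finally show ?thesis .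
 qed
 from this[of X] this[of Y] show ?thesis
 using face_sum[OF X v, of ?F] face_sum[OF Y v, of ?F] eq[OF v] by (simp add: ps m)
qed

abbreviation "sw \<equiv> sos_weight N L t \<epsilon>"

lemma sw_supported: "face_supported G (sw \<zeta>)"
 by (simp add: face_supported_def sos_weight_def)

lemma sw_scale: "sw \<zeta> = (%r p q s. inverse \<zeta> * sw 1 r p q s)"
 by (simp add: fun_eq_iff sos_weight_def Let_def)

lemma sw_values:
 assumes v: "valid l [i, j]"
 shows "sw \<zeta> (l, i) (l, i) (st l i, j) (st l i, j) = inverse \<zeta> * wa l i j"
 and "i ~= j ==> sw \<zeta> (l, j) (l, i) (st l j, i) (st l i, j) = inverse \<zeta> * (if valid l [j, i] then wb l i j else 0)"
proof -
 have "is_face G (l, i) (l, i) (st l i, j) (st l i, j)" using v by (auto simp: is_face_def)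
 then show "sw \<zeta> (l, i) (l, i) (st l i, j) (st l i, j) = inverse \<zeta> * wa l i j"
 by (simp add: sos_weight_def Let_def wa_def)
 assume ij: "i ~= j"
 have "is_face G (l, j) (l, i) (st l j, i) (st l i, j) \<longleftrightarrow> valid l [j, i]"
 using v step_commute[of i j l] by (auto simp: is_face_def)
 then show "sw \<zeta> (l, j) (l, i) (st l j, i) (st l i, j) = inverse \<zeta> * (if valid l [j, i] then wb l i j else 0)"
 using ij by (simp add: sos_weight_def Let_def wb_def)
qed

lemma fop_sw:
 assumes v: "valid l [i, j]"
 shows "fop (sw \<zeta>) l f i j = inverse \<zeta> * W l f i j"
proof (cases "i = j")
 case True
 then show ?thesis using sw_values(1)[OF v] by (simp add: fop_def W_def wb_def)
next
 case False
 then show ?thesis using sw_values[OF v] swap_valid[OF v]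
 by (cases "valid l [j, i]") (auto simp: fop_def W_def algebra_simps)
qed

lemma fop_sw_flip:
 assumes v: "valid l [i, j]"
 shows "fop (%r p q s. sw \<zeta> p r s q) l f i j = inverse \<zeta> * (wa l i j * f i j + (if valid l [j, i] then wb l j i * f j i else 0))"
proof (cases "i = j")
 case True
 then show ?thesis using sw_values(1)[OF v] by (simp add: fop_def wb_def)
next
 case False
 have "valid l [j, i] ==> sw \<zeta> (l, i) (l, j) (st l i, j) (st l j, i) = inverse \<zeta> * wb l j i"
 using sw_values(2)[of l j i \<zeta>] False v by simp
 moreover have "~ valid l [j, i] ==> sw \<zeta> (l, i) (l, j) (st l i, j) (st l j, i) = 0"
 using sw_supported[of \<zeta>] unfolding face_supported_def by (force simp: is_face_def)
 ultimately show ?thesis using sw_values(1)[OF v] False by (auto simp: fop_def algebra_simps)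
qed

subsection \<open>Two rows of faces\<close>

definition O1 where "O1 X l g i j k = fop X l (%i j. g i j k) i j"
definition O2 where "O2 X l g i j k = fop X (st l i) (g i) j k"
definition words3 where "words3 l F i j k = F (l, i) (st l i, j) (st (st l i) j, k)"

lemma sum6_flat:
 "(SUM a:A. SUM b:A. SUM c:A. SUM d:A. SUM e:A. SUM f:A. g a b c d e f) =
 (SUM (a, b, c, d, e, f):A \<times> A \<times> A \<times> A \<times> A \<times> A. g a b c d e f)"
 by (simp only: sum.cartesian_product[symmetric])

text \<open>Two faces in a row below or above a third one.  Summing the partition function of such a strip
  against a function of the lower boundary composes the three face operators.\<close>

lemma strip_left:
 assumes X: "face_supported G X" and Y: "face_supported G Y" and Z: "face_supported G Z" and v: "valid l [i, j, k]"
 shows "(SUM x:arcs G. SUM r:arcs G. SUM p:arcs G. (SUM u:arcs G. SUM v:arcs G. Z r u p v *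
  (SUM z:arcs G. X x (l, i) u z * Y z (st l i, j) v (st (st l i) j, k))) * F x r p) =
 O2 Y l (O1 X l (O2 Z l (words3 l F))) i j k" (is "?L = ?R")
proof -
 define F1 where "F1 x u v = (SUM r:arcs G. SUM p:arcs G. Z r u p v * F x r p)" for x u v
 define F2 where "F2 z v = (SUM x:arcs G. SUM u:arcs G. X x (l, i) u z * F1 x u v)" for z v
 have F1: "F1 (l, a) (st l a, b) (st (st l a) b, c) = O2 Z l (words3 l F) a b c" if "valid l [a, b, c]" for a b c
 unfolding F1_def O2_def words3_def by (rule face_sum[OF Z]) (use that in auto)
 have F2: "F2 (st l i, a) (st (st l i) a, b) = O1 X l (O2 Z l (words3 l F)) i a b" if v: "valid l [i, a, b]" for a b
 proof -
 have "valid l [i, a]" using v valid_V by auto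
 then have "F2 (st l i, a) (st (st l i) a, b) = fop X l (%a' b'. F1 (l, a') (st l a', b') (st (st l i) a, b)) i a"
  unfolding F2_def by (rule face_sum[OF X])
 also have "... = fop X l (%a' b'. O2 Z l (words3 l F) a' b' b) i a"
 proof (rule fop_cong[OF X \<open>valid l [i, a]\<close>])
  show "F1 (l, i) (st l i, a) (st (st l i) a, b) = O2 Z l (words3 l F) i a b" by (rule F1[OF v])
  assume "valid l [a, i]"
  moreover have c: "st (st l a) i = st (st l i) a" using v step_commute[of i a l] by auto
  ultimately have "valid l [a, i, b]" using v by auto
  from F1[OF this] show "F1 (l, a) (st l a, i) (st (st l i) a, b) = O2 Z l (words3 l F) a i b" by (simp add: c)
 qed
 finally show ?thesis unfolding O1_def .
 qed
 have "?L = (SUM z:arcs G. SUM v:arcs G. Y z (st l i, j) v (st (st l i) j, k) * F2 z v)"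
 unfolding F2_def F1_def sum_distrib_left sum_distrib_right sum6_flat
 by (rule sum.reindex_bij_witness[where i="%(z, v, x, u, r, p). (x, r, p, u, v, z)" and j="%(x, r, p, u, v, z). (z, v, x, u, r, p)"])
  (auto simp: mult_ac)
 also have "... = fop Y (st l i) (%a b. F2 (st l i, a) (st (st l i) a, b)) j k"
 by (rule face_sum[OF Y]) (use v in auto)
 also have "... = ?R" unfolding O2_def[of Y]
 by (rule fop_cong[OF Y]) (use v F2 in auto)
 finally show ?thesis .
qed

lemma strip_right:
 assumes X: "face_supported G X" and Y: "face_supported G Y" and Z: "face_supported G Z" and v: "valid l [i, j, k]"
 shows "(SUM x:arcs G. SUM r:arcs G. SUM p:arcs G. (SUM v:arcs G. SUM u:arcs G. Z v (l, i) u (st l i, j) *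
  (SUM z:arcs G. X x v r z * Y z u p (st (st l i) j, k))) * F x r p) =
 O1 Z l (O2 Y l (O1 X l (words3 l F))) i j k" (is "?L = ?R")
proof -
 define F1 where "F1 v z p = (SUM x:arcs G. SUM r:arcs G. X x v r z * F x r p)" for v z p
 define F2 where "F2 v u = (SUM z:arcs G. SUM p:arcs G. Y z u p (st (st l i) j, k) * F1 v z p)" for v u
 have F1: "F1 (l, a) (st l a, b) (st (st l a) b, c) = O1 X l (words3 l F) a b c" if v: "valid l [a, b, c]" for a b c
 proof -
 have ab: "valid l [a, b]" using v valid_V by auto
 then have "F1 (l, a) (st l a, b) (st (st l a) b, c) = fop X l (%a' b'. F (l, a') (st l a', b') (st (st l a) b, c)) a b"
  unfolding F1_def by (rule face_sum[OF X])
 also have "... = O1 X l (words3 l F) a b c" unfolding O1_def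
  by (rule fop_cong[OF X ab]) (use v step_commute[of a b l] in \<open>auto simp: words3_def\<close>)
 finally show ?thesis .
 qed
 have F2: "F2 (l, a) (st l a, b) = O2 Y l (O1 X l (words3 l F)) a b k"
 if v: "valid l [a, b, k]" and c: "st (st l a) b = st (st l i) j" for a b
 proof -
 have "F2 (l, a) (st l a, b) = fop Y (st l a) (%x y. F1 (l, a) (st l a, x) (st (st l a) x, y)) b k"
  unfolding F2_def c[symmetric] by (rule face_sum[OF Y]) (use v in auto)
 also have "... = O2 Y l (O1 X l (words3 l F)) a b k" unfolding O2_def
  by (rule fop_cong[OF Y]) (use v F1 in auto)
 finally show ?thesis .
 qed
 have ij: "valid l [i, j]" using v valid_V by auto
 have "?L = (SUM v:arcs G. SUM u:arcs G. Z v (l, i) u (st l i, j) * F2 v u)"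
 unfolding F2_def F1_def sum_distrib_left sum_distrib_right sum6_flat
 by (rule sum.reindex_bij_witness[where i="%(v, u, z, p, x, r). (x, r, p, v, u, z)" and j="%(x, r, p, v, u, z). (v, u, z, p, x, r)"])
  (auto simp: mult_ac)
 also have "... = fop Z l (%a b. F2 (l, a) (st l a, b)) i j" by (rule face_sum[OF Z ij])
 also have "... = ?R" unfolding O1_def[of Z]
 by (rule fop_cong[OF Z ij]) (use v F2 step_commute[of i j l] in auto)
 finally show ?thesis .
qed

lemma sum3_indicator:
 assumes "finite A" "a : A" "b : A" "c : A"
 shows "(SUM x:A. SUM y:A. SUM z:A. f x y z * (if x = a & y = b & z = c then 1 else 0 :: complex)) = f a b c"
proof -
 have "(SUM x:A. SUM y:A. SUM z:A. f x y z * (if x = a & y = b & z = c then 1 else 0 :: complex)) =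
 (SUM x:A. if x = a then SUM y:A. if y = b then SUM z:A. if z = c then f a b c else 0 else 0 else 0)"
 by (intro sum.cong refl) (auto intro!: sum.cong sum.neutral)
 then show ?thesis using assms by simp
qed

lemma sum_composable:
 assumes "!!c d. f c d ~= 0 ==> head G c = tail G d"
 shows "(SUM (c, d):composable_pairs G. f c d) = (SUM c:arcs G. SUM d:arcs G. f c d :: complex)"
 unfolding sum.cartesian_product
 by (rule sum.mono_neutral_left) (use assms in \<open>auto simp: composable_pairs_def finite_arcs_G\<close>)

lemma transfer_face_relation:
 assumes X: "face_supported G X" and w: "face_supported G w"
 and cd: "(c, d) : composable_pairs G" and ab: "(a, b) : composable_pairs G" and y: "y : arcs G"
 shows "transfer_form X x y (face_col w a b (edge_pair_path G c d) - face_row w (edge_pair_path G a b) c d) =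
 (SUM u:arcs G. SUM v:arcs G. w a u b v * (SUM z:arcs G. X x c u z * X z d v y)) -
 (SUM v:arcs G. SUM u:arcs G. w v c u d * (SUM z:arcs G. X x v a z * X z u b y))"
proof -
 have f: "w p q r s ~= 0 ==> is_face G p q r s" for p q r s using w unfolding face_supported_def by blast
 have "transfer_form X x y (face_col w a b (edge_pair_path G c d)) =
  (SUM (u, v):composable_pairs G. w a u b v * (SUM z:arcs G. X x c u z * X z d v y))"
 unfolding linear_form_face_col[OF transfer_form_linear edge_pair_in[OF cd]]
 by (rule sum.cong[OF refl]) (use transfer_pair[OF X, of _ _ c d y x] cd y in \<open>force simp: composable_pairs_def simp del: G_simps\<close>)
 also have "... = (SUM u:arcs G. SUM v:arcs G. w a u b v * (SUM z:arcs G. X x c u z * X z d v y))"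
 by (rule sum_composable) (use f in \<open>fastforce simp: is_face_def\<close>)
 finally have 1: "transfer_form X x y (face_col w a b (edge_pair_path G c d)) = ..." .
 have "transfer_form X x y (face_row w (edge_pair_path G a b) c d) =
  (SUM (v, u):composable_pairs G. w v c u d * (SUM z:arcs G. X x v a z * X z u b y))"
 unfolding linear_form_face_row[OF transfer_form_linear edge_pair_in[OF ab]]
 by (rule sum.cong[OF refl]) (use transfer_pair[OF X, of a b _ _ y x] ab y in \<open>force simp: composable_pairs_def simp del: G_simps\<close>)
 also have "... = (SUM v:arcs G. SUM u:arcs G. w v c u d * (SUM z:arcs G. X x v a z * X z u b y))"
 by (rule sum_composable) (use f in \<open>fastforce simp: is_face_def\<close>)
 finally show ?thesis using 1 by (simp add: transfer_form_diff)
qed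

lemma transfer_kills_relations:
 assumes X: "face_supported G X" and w: "face_supported G w"
 and yb: "!!l i j k F. valid l [i, j, k] ==>
  O2 X l (O1 X l (O2 w l (words3 l F))) i j k = O1 w l (O2 X l (O1 X l (words3 l F))) i j k"
 and g: "g : face_relations G w" and xy: "x : arcs G" "y : arcs G"
 shows "transfer_form X x y g = 0"
proof -
 obtain a b c d where g: "g = face_col w a b (edge_pair_path G c d) - face_row w (edge_pair_path G a b) c d"
 and cd: "(c, d) : composable_pairs G" and ab: "(a, b) : composable_pairs G"
 using g unfolding face_relations_alt by blast
 have a: "a : arcs G" "b : arcs G" using ab by (auto simp: composable_pairs_iff)
 let ?F = "%p q r. if p = x & q = a & r = b then 1 else 0 :: complex"
 obtain l i j k m m' where cdy: "c = (l, i)" "d = (m, j)" "y = (m', k)" by (cases c; cases d; cases y)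
 show ?thesis
 proof (cases "m' = head G d")
 case True
 have m: "m = st l i" "m' = st (st l i) j" and v: "valid l [i, j, k]"
  using cd xy True by (auto simp: composable_pairs_iff cdy)
 show ?thesis
  using strip_left[OF X X w v, of ?F] strip_right[OF X X w v, of ?F]
  unfolding g transfer_face_relation[OF X w cd ab xy(2)] sum3_indicator[OF finite_arcs_G xy(1) a] yb[OF v]
  by (simp add: cdy m)
 next
 case False
 have "X z d v y = 0" for z v
 proof (rule ccontr)
  assume "X z d v y ~= 0"
  then have "is_face G z d v y" using X unfolding face_supported_def by blast
  then have "head G d = tail G y" unfolding is_face_def by metis
  then show False using False cdy(3) by simp
 qed
 moreover have "w v c u d * (X x v a z * X z u b y) = 0" for u v z
 proof (rule ccontr)
  assume "w v c u d * (X x v a z * X z u b y) ~= 0"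
  then have "w v c u d ~= 0" "X z u b y ~= 0" by auto
  then have "is_face G v c u d" "is_face G z u b y" using w X unfolding face_supported_def by blast+
  then have "head G d = tail G y" unfolding is_face_def by metis
  then show False using False cdy(3) by simp
 qed
 ultimately show ?thesis
  unfolding g transfer_face_relation[OF X w cd ab xy(2)] sum_distrib_left
  by (simp only: mult_zero_right sum.neutral_const diff_self)
 qed
qed

text \<open>A functional \<open>R(-, e(x/y))\<close> that vanishes on the face relations yields an equation of Yang-Baxter type.\<close>

lemma transfer_relations_yb:
 assumes X: "face_supported G X" and w: "face_supported G w"
 and kill: "!!g x y. g : face_relations G w ==> x : arcs G ==> y : arcs G ==> transfer_form X x y g = 0"
 and v: "valid l [i, j, k]"
 shows "O2 X l (O1 X l (O2 w l (words3 l F))) i j k = O1 w l (O2 X l (O1 X l (words3 l F))) i j k"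
 unfolding strip_left[OF X X w v, symmetric] strip_right[OF X X w v, symmetric]
proof (rule sum.cong[OF refl], rule sum.cong[OF refl], rule sum.cong[OF refl])
 fix x a b assume xab: "x : arcs G" "a : arcs G" "b : arcs G"
 let ?c = "(l, i)" and ?d = "(st l i, j)" and ?y = "(st (st l i) j, k)"
 have c: "(?c, ?d) : composable_pairs G" and y: "?y : arcs G"
 using v valid_V(1)[of "st (st (st l i) j) k" "[]"] by (auto simp: composable_pairs_iff)
 have "(SUM u:arcs G. SUM v:arcs G. w a u b v * (SUM z:arcs G. X x ?c u z * X z ?d v ?y)) =
  (SUM v:arcs G. SUM u:arcs G. w v ?c u ?d * (SUM z:arcs G. X x v a z * X z u b ?y))"
 proof (cases "(a, b) : composable_pairs G")
 case True
 have "face_col w a b (edge_pair_path G ?c ?d) - face_row w (edge_pair_path G a b) ?c ?d : face_relations G w"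
  unfolding face_relations_alt using c True by blast
 from kill[OF this xab(1) y] show ?thesis unfolding transfer_face_relation[OF X w c True y] by simp
 next
 case False
 then have ne: "head G a ~= tail G b" using xab by (simp add: composable_pairs_iff)
 have "w a u b v = 0" for u v using w ne unfolding face_supported_def is_face_def by blast
 moreover have "X x v a z * X z u b ?y = 0" for u v z
  using X ne unfolding face_supported_def is_face_def by (metis mult_eq_0_iff)
 ultimately show ?thesis by (simp only: mult_zero_left mult_zero_right sum.neutral_const)
 qed
 then show "(SUM u:arcs G. SUM v:arcs G. w a u b v * (SUM z:arcs G. X x ?c u z * X z ?d v ?y)) * F x a b =
  (SUM v:arcs G. SUM u:arcs G. w v ?c u ?d * (SUM z:arcs G. X x v a z * X z u b ?y)) * F x a b" by simp
qed

text \<open>The Yang-Baxter equation says that the transfer matrices of the model respect its face relations.\<close>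

lemma fop_W: "O1 (sw \<zeta>) l g i j k = inverse \<zeta> * W1 l g i j k" if "valid l [i, j, k]"
 unfolding O1_def W1_def by (rule fop_sw) (use that valid_V in auto)

lemma fop_W': "O2 (sw \<zeta>) l g i j k = inverse \<zeta> * W2 l g i j k" if "valid l [i, j, k]"
 unfolding O2_def W2_def by (rule fop_sw) (use that in auto)

lemma W1_scale: "W1 l (%i j k. c * g i j k) i j k = c * W1 l g i j k"
 by (simp add: W1_def W_def algebra_simps)

lemma W2_scale: "W2 l (%i j k. c * g i j k) i j k = c * W2 l g i j k"
 by (simp add: W2_def W_def algebra_simps)

lemma transfer_sw_kills:
 assumes g: "g : face_relations G (sw 1)" and xy: "x : arcs G" "y : arcs G"
 shows "transfer_form (sw \<zeta>) x y g = 0"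
proof (rule transfer_kills_relations[OF sw_supported sw_supported _ g xy])
 fix l i j k and F :: "sos_arc => sos_arc => sos_arc => complex" assume v: "valid l [i, j, k]"
 let ?g = "words3 l F"
 have "O2 (sw \<zeta>) l (O1 (sw \<zeta>) l (O2 (sw 1) l ?g)) i j k =
  inverse \<zeta> * W2 l (O1 (sw \<zeta>) l (O2 (sw 1) l ?g)) i j k" by (rule fop_W'[OF v])
 also have "W2 l (O1 (sw \<zeta>) l (O2 (sw 1) l ?g)) i j k = W2 l (%i j k. inverse \<zeta> * W1 l (O2 (sw 1) l ?g) i j k) i j k"
 by (rule W2_cong[OF v]) (rule fop_W)
 also have "... = inverse \<zeta> * W2 l (W1 l (O2 (sw 1) l ?g)) i j k" by (rule W2_scale)
 also have "W2 l (W1 l (O2 (sw 1) l ?g)) i j k = W2 l (W1 l (W2 l ?g)) i j k"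
 by (rule W2_cong[OF v], rule W1_cong, assumption) (simp add: fop_W')
 finally have L: "O2 (sw \<zeta>) l (O1 (sw \<zeta>) l (O2 (sw 1) l ?g)) i j k = inverse \<zeta> * (inverse \<zeta> * W2 l (W1 l (W2 l ?g)) i j k)" .
 have "O1 (sw 1) l (O2 (sw \<zeta>) l (O1 (sw \<zeta>) l ?g)) i j k = W1 l (O2 (sw \<zeta>) l (O1 (sw \<zeta>) l ?g)) i j k"
 using fop_W[OF v, of 1] by simp
 also have "... = W1 l (%i j k. inverse \<zeta> * W2 l (O1 (sw \<zeta>) l ?g) i j k) i j k"
 by (rule W1_cong[OF v]) (rule fop_W')
 also have "... = inverse \<zeta> * W1 l (W2 l (O1 (sw \<zeta>) l ?g)) i j k" by (rule W1_scale)
 also have "W1 l (W2 l (O1 (sw \<zeta>) l ?g)) i j k = W1 l (W2 l (%i j k. inverse \<zeta> * W1 l ?g i j k)) i j k"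
 by (rule W1_cong[OF v], rule W2_cong, assumption) (rule fop_W)
 also have "... = inverse \<zeta> * W1 l (W2 l (W1 l ?g)) i j k"
 by (simp add: W2_scale[abs_def] W1_scale)
 finally show "O2 (sw \<zeta>) l (O1 (sw \<zeta>) l (O2 (sw 1) l ?g)) i j k = O1 (sw 1) l (O2 (sw \<zeta>) l (O1 (sw \<zeta>) l ?g)) i j k"
 unfolding L yang_baxter[OF v] by simp
qed

lemma face_ideal_sw: "\<zeta> ~= 0 ==> face_ideal G (sw \<zeta>) = face_ideal G (sw 1)"
 by (subst sw_scale) (rule face_ideal_scale, simp)

end

section \<open>Antisymmetric functionals\<close>

fun ascents :: "nat list => nat" where
 "ascents [] = 0" | "ascents (x # w) = length (filter (%y. x < y) w) + ascents w"

context sos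
begin

definition antisym :: "weight => nat => (nat list => complex) => bool" where
 "antisym m n \<Phi> \<longleftrightarrow> (ALL u i j v. valid m (u @ [i, j] @ v) & length (u @ [i, j] @ v) = n -->
  (i = j --> \<Phi> (u @ [i, j] @ v) = 0) \<and>
  (i ~= j & valid m (u @ [j, i] @ v) --> \<Phi> (u @ [j, i] @ v) = - \<epsilon> * \<Phi> (u @ [i, j] @ v)))"

lemma antisym_equal: "antisym m n \<Phi> ==> valid m (u @ i # i # v) ==> length (u @ i # i # v) = n ==> \<Phi> (u @ i # i # v) = 0"
 unfolding antisym_def by fastforce

lemma antisym_exchange:
 assumes "antisym m n \<Phi>" "valid m (u @ i # j # v)" "length (u @ i # j # v) = n" "i ~= j" "valid m (u @ j # i # v)"
 shows "\<Phi> (u @ j # i # v) = - \<epsilon> * \<Phi> (u @ i # j # v)"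
proof -
 have "valid m (u @ [i, j] @ v) & length (u @ [i, j] @ v) = n" "i ~= j & valid m (u @ [j, i] @ v)" using assms by auto
 then have "\<Phi> (u @ [j, i] @ v) = - \<epsilon> * \<Phi> (u @ [i, j] @ v)" using assms(1) unfolding antisym_def by blast
 then show ?thesis by simp
qed

lemma antisym_Cons:
 assumes "antisym m (Suc n) \<Phi>" "m : V" "a : I"
 shows "antisym (st m a) n (%w. \<Phi> (a # w))"
 unfolding antisym_def
proof (intro allI impI conjI)
 fix u i j v assume v: "valid (st m a) (u @ [i, j] @ v) & length (u @ [i, j] @ v) = n"
 then have v': "valid m ((a # u) @ i # j # v)" "length ((a # u) @ i # j # v) = Suc n" using assms by auto
 { assume "i = j" then show "\<Phi> (a # u @ [i, j] @ v) = 0" using antisym_equal[OF assms(1), of "a # u" j v] v' by simp }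
 { assume "i ~= j & valid (st m a) (u @ [j, i] @ v)"
 then show "\<Phi> (a # u @ [j, i] @ v) = - \<epsilon> * \<Phi> (a # u @ [i, j] @ v)"
  using antisym_exchange[OF assms(1) v'] assms by simp }
qed

text \<open>A letter that can be played now can be moved to the front: the steps in between stay possible
  because of the diamond property.\<close>

lemma move_front:
 assumes "valid m (w @ u @ y # v)" "y \<notin> set u" "st (wend m w) y : V"
 shows "valid m (w @ y # u @ v) \<and>
 (antisym m n \<Phi> --> length (w @ u @ y # v) = n --> \<Phi> (w @ y # u @ v) = (- \<epsilon>) ^ length u * \<Phi> (w @ u @ y # v))"
 using assms
proof (induction u arbitrary: w)
 case (Cons a u)
 let ?l = "wend m w"
 have ay: "a ~= y" using Cons.prems by auto
 have l: "?l : V" "a : I" "st ?l a : V" "y : I" "valid m w"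
 using Cons.prems(1) valid_letters[OF Cons.prems(1)] by (auto simp: valid_append dest: valid_V)
 have "st (st ?l a) y : V" by (rule step_diamond[OF l(1,2,4) ay l(3) Cons.prems(3)])
 then have IH: "valid m (w @ a # y # u @ v)"
 "antisym m n \<Phi> ==> length (w @ a # u @ y # v) = n ==> \<Phi> (w @ a # y # u @ v) = (- \<epsilon>) ^ length u * \<Phi> (w @ a # u @ y # v)"
 using Cons.IH[of "w @ [a]"] Cons.prems by (simp_all add: wend_append)
 have v: "valid m (w @ y # a # u @ v)"
 using IH(1) Cons.prems(3) l step_commute[of a y ?l] by (simp add: valid_append)
 have "\<Phi> (w @ y # a # u @ v) = - \<epsilon> * \<Phi> (w @ a # y # u @ v)" if "antisym m n \<Phi>" "length (w @ (a # u) @ y # v) = n"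
 by (rule antisym_exchange[OF that(1) IH(1) _ ay v]) (use that(2) in simp)
 then show ?case using v IH(2) by simp
qed simp

text \<open>Antisymmetric functionals on words with given distinct letters are unique up to a factor.\<close>

lemma antisym_proportional:
 assumes "antisym m n \<Phi>" "antisym m n \<Psi>" "valid m q" "valid m q'" "distinct q" "distinct q'" "set q = set q'" "length q = n"
 shows "\<Phi> q * \<Psi> q' = \<Phi> q' * \<Psi> q"
 using assms
proof (induction q arbitrary: m n \<Phi> \<Psi> q')
 case (Cons a q)
 have "a : set q'" using Cons.prems by auto
 then obtain B C where q': "q' = B @ a # C" by (auto dest: split_list)
 have len: "length q' = n" using Cons.prems by (metis distinct_card)
 have ma: "m : V" "a : I" "st m a : V" using Cons.prems(3) valid_V by auto
 have aB: "a \<notin> set B" using Cons.prems(6) by (auto simp: q')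
 have mf: "valid m (a # B @ C)" and F: "!!\<Phi>. antisym m n \<Phi> ==> \<Phi> (a # B @ C) = (- \<epsilon>) ^ length B * \<Phi> q'"
 using move_front[of m "[]" B a C n] Cons.prems(4) aB ma(3) len by (simp_all add: q')
 obtain k where n: "n = Suc k" using Cons.prems(8) by (cases n) auto
 have "\<Phi> (a # q) * \<Psi> (a # B @ C) = \<Phi> (a # B @ C) * \<Psi> (a # q)"
 proof (rule Cons.IH[of "st m a" k "%w. \<Phi> (a # w)" "%w. \<Psi> (a # w)"])
 show "antisym (st m a) k (%w. \<Phi> (a # w))" "antisym (st m a) k (%w. \<Psi> (a # w))"
  using antisym_Cons[OF _ ma(1,2)] Cons.prems(1,2) by (simp_all add: n)
 have "set (B @ C) = set q' - {a}" using Cons.prems(6) by (auto simp: q')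
 then show "set q = set (B @ C)" using Cons.prems(5,7) by auto
 qed (use Cons.prems mf n in \<open>auto simp: q'\<close>)
 then have "(- \<epsilon>) ^ length B * (\<Phi> (a # q) * \<Psi> q') = (- \<epsilon>) ^ length B * (\<Phi> q' * \<Psi> (a # q))"
 unfolding F[OF Cons.prems(1)] F[OF Cons.prems(2)] by (simp add: mult_ac)
 moreover have "(- \<epsilon>) ^ length B ~= 0" using eps by auto
 ultimately show ?case by auto
qed simp

text \<open>Between two occurrences of \<open>i\<close> in a shortest such stretch \<open>i A i\<close> no letter of \<open>A\<close> can be played
  first, or it could be moved out.  So each of them waits for its predecessor on the circle, and they
  form a queue immediately behind \<open>i\<close>.  Since the queue is shorter than the rest of the circle by at
  least two sites, it does not obstruct the second step of \<open>i\<close>, which can therefore be made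
  immediately after the first.\<close>

lemma queue:
 assumes v: "valid l (i # A)" and A: "distinct A" "i \<notin> set A" and blocked: "!!y. y : set A ==> st l y \<notin> V"
 and y: "y : set A"
 shows "EX j. 1 <= j & j <= int (length A) & sos_d l i y mod K = j mod K"
 using v A blocked y
proof (induction A arbitrary: y rule: rev_induct)
 case (snoc b A)
 have vA: "valid l (i # A)" using snoc.prems(1) valid_append[of l "i # A" "[b]"] by simp
 note IH = snoc.IH[OF vA]
 have l: "l : V" "i : I" "b : I" using snoc.prems(1) valid_letters[OF snoc.prems(1)] by auto
 show ?case
 proof (cases "y = b")
 case False
 then obtain j where "1 <= j" "j <= int (length A)" "sos_d l i y mod K = j mod K"
  using IH[of y] snoc.prems by auto
 then show ?thesis by (intro exI[of _ j]) auto
 next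
 case True
 obtain z where z: "z : I" "z ~= b" "sos_d l z b mod K = 1"
  using step_valid_iff[OF l(1,3)] snoc.prems(4)[of b] by auto
 have e: "wend l (i # A) : V" "st (wend l (i # A)) b : V"
  using valid_V(2)[OF vA] valid_V(2)[OF snoc.prems(1)] by (simp_all add: wend_append)
 have "z = i \<or> z : set A"
 proof (rule ccontr)
  assume no: "~ (z = i \<or> z : set A)"
  have "sos_d (wend l (i # A)) z b = sos_d l z b"
  using wend_d[OF valid_letters[OF vA] z(1) l(3), of l] no snoc.prems(2,3) by auto
  then show False using step_valid_iff[OF e(1) l(3)] e(2) z by auto
 qed
 then show ?thesis
 proof
  assume "z = i"
  then show ?thesis using z True N2 by (intro exI[of _ 1]) auto
 next
  assume "z : set A"
  then obtain j where j: "1 <= j" "j <= int (length A)" "sos_d l i z mod K = j mod K"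
  using IH[of z] snoc.prems by auto
  have "sos_d l i b mod K = (sos_d l i z mod K + sos_d l z b mod K) mod K"
  by (simp only: d_add[of l i z b, symmetric] mod_add_eq)
  also have "... = (j + 1) mod K" unfolding j(3) z(3) by (simp add: mod_add_left_eq)
  finally show ?thesis using j True by (intro exI[of _ "j + 1"]) auto
 qed
 qed
qed simp

lemma antisym_repeat:
 assumes \<Phi>: "antisym m n \<Phi>" and v: "valid m (u @ i # A @ i # v)" and n: "length (u @ i # A @ i # v) = n"
 and A: "distinct A" "i \<notin> set A"
 shows "\<Phi> (u @ i # A @ i # v) = 0"
 using v n A
proof (induction "length A" arbitrary: u A rule: less_induct)
 case less
 let ?l = "wend m u"
 have vl: "valid ?l (i # A @ i # v)" using less.prems(1) by (simp add: valid_append)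
 then have vA: "valid ?l (i # A)" and l: "?l : V" "i : I"
 using valid_append[of ?l "i # A" "i # v"] by auto
 show ?case
 proof (cases "EX y:set A. st ?l y : V")
 case True
 then obtain y where y: "y : set A" "st ?l y : V" by auto
 then obtain B C where BC: "A = B @ y # C" by (auto dest: split_list)
 have "y \<notin> set (i # B)" using less.prems y by (auto simp: BC)
 from move_front[of m u "i # B" y "C @ i # v" n \<Phi>, OF _ this y(2)] less.prems
 have mf: "valid m ((u @ [y]) @ i # (B @ C) @ i # v)"
  "\<Phi> ((u @ [y]) @ i # (B @ C) @ i # v) = (- \<epsilon>) ^ length (i # B) * \<Phi> (u @ i # A @ i # v)"
  using \<Phi> by (simp_all add: BC)
 have "\<Phi> ((u @ [y]) @ i # (B @ C) @ i # v) = 0"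
  by (rule less.hyps) (use less.prems mf(1) in \<open>auto simp: BC\<close>)
 then show ?thesis using mf(2) eps by auto
 next
 case False
 have "st (st ?l i) i : V"
 proof (rule ccontr)
  assume no: "st (st ?l i) i \<notin> V"
  have sl: "st ?l i : V" using vA valid_V(1) by auto
  obtain z where z: "z : I" "z ~= i" "sos_d (st ?l i) z i mod K = 1"
  using step_valid_iff[OF sl l(2)] no by auto
  have "valid (st ?l i) (A @ [i])" using vl valid_append[of "st ?l i" "A @ [i]" v] by simp
  then have e: "wend (st ?l i) A : V" "st (wend (st ?l i) A) i : V" and vA': "valid (st ?l i) A"
  using valid_V(2)[of "st ?l i"] by (force simp: valid_append wend_append dest: valid_V)+
  have zA: "z : set A"
  proof (rule ccontr)
  assume "z \<notin> set A"
  then have "sos_d (wend (st ?l i) A) z i = sos_d (st ?l i) z i"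
   using wend_d[OF valid_letters[OF vA'] z(1) l(2)] less.prems(4) by auto
  then show False using step_valid_iff[OF e(1) l(2)] e(2) z by auto
  qed
  obtain j where j: "1 <= j" "j <= int (length A)" "sos_d ?l i z mod K = j mod K"
  using queue[OF vA less.prems(3,4) _ zA] False by auto
  have "sos_d (st ?l i) z i = - sos_d ?l i z - 1"
  using d_step[OF l(2) z(1) l(2), of ?l] z d_swap[of ?l z i] by simp
  then have "1 mod K = (- sos_d ?l i z - 1) mod K" using z(3) N2 by simp
  then have "K dvd 1 - (- sos_d ?l i z - 1)" by (simp add: mod_eq_dvd_iff)
  then have a: "K dvd sos_d ?l i z + 2" by (simp add: algebra_simps)
  have b: "K dvd sos_d ?l i z - j" using j(3) by (simp add: mod_eq_dvd_iff)
  have "K dvd (sos_d ?l i z + 2) - (sos_d ?l i z - j)" by (rule dvd_diff[OF a b])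
  then have "K dvd j + 2" by (simp add: algebra_simps)
  then have "K <= j + 2" using j(1) by (auto dest: zdvd_imp_le)
  moreover have "length A <= N - 1"
  proof -
  have "length A = card (set A)" using less.prems(3) by (simp add: distinct_card)
  also have "... <= card (I - {i})"
   using valid_letters[OF vA'] less.prems(4) by (intro card_mono) auto
  finally show ?thesis using l(2) by simp
  qed
  ultimately show False using j(2) N2 L2 by linarith
 qed
 then have "valid m ((u @ [i]) @ i # A @ v)"
  "\<Phi> ((u @ [i]) @ i # A @ v) = (- \<epsilon>) ^ length A * \<Phi> (u @ i # A @ i # v)"
  using move_front[of m "u @ [i]" A i v n \<Phi>] less.prems \<Phi> by (simp_all add: wend_append)
 moreover from this(1) have "\<Phi> (u @ i # i # A @ v) = 0"
  by (intro antisym_equal[OF \<Phi>]) (use less.prems in auto)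
 ultimately show ?thesis using eps by auto
 qed
qed

lemma antisym_not_distinct:
 assumes \<Phi>: "antisym m n \<Phi>" and v: "valid m w" "length w = n" and w: "~ distinct w"
 shows "\<Phi> w = 0"
proof -
 define P where "P A \<longleftrightarrow> (EX u i v. w = u @ i # A @ i # v)" for A
 have "EX A. P A" using not_distinct_decomp[OF w] by (force simp: P_def)
 then obtain A where A: "P A" "!!B. P B ==> length A <= length B"
 using ex_has_least_nat[of P _ length] by blast
 then obtain u i v where w: "w = u @ i # A @ i # v" by (auto simp: P_def)
 have "i \<notin> set A"
 proof
 assume "i : set A"
 then obtain B C where BC: "A = B @ i # C" by (auto dest: split_list)
 have "w = u @ i # B @ i # (C @ i # v)" by (simp add: w BC)
 then have "P B" "length B < length A" unfolding P_def by (blast, simp add: BC)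
 then show False using A(2)[of B] by simp
 qed
 moreover have "distinct A"
 proof (rule ccontr)
 assume "~ distinct A"
 then obtain xs y ys zs where A': "A = xs @ [y] @ ys @ [y] @ zs" using not_distinct_decomp by blast
 have "w = (u @ i # xs) @ y # ys @ y # (zs @ i # v)" by (simp add: w A')
 then have "P ys" "length ys < length A" unfolding P_def by (blast, simp add: A')
 then show False using A(2)[of ys] by simp
 qed
 ultimately show ?thesis using antisym_repeat[OF \<Phi>, of u i A v] v w by simp
qed

subsection \<open>The sign\<close>

definition sg :: "nat list => complex" where
 "sg w = (if distinct w then (- \<epsilon>) ^ ascents w else 0)"

lemma count_distinct: "distinct w ==> count_list w i = (if i : set w then 1 else 0)"
 by (induction w) auto

lemma me2: "(- \<epsilon>) * (- \<epsilon>) = 1" "(- \<epsilon>) * ((- \<epsilon>) * x) = x"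
 using eps by auto

lemma ascents_swap: "i ~= j ==> (- \<epsilon>) ^ ascents (u @ j # i # v) = - \<epsilon> * (- \<epsilon>) ^ ascents (u @ i # j # v)"
proof (induction u)
 case Nil
 then show ?case using me2 by (cases "i < j") (auto simp: power_add mult_ac)
next
 case (Cons a u)
 have "length (filter (%y. a < y) (u @ j # i # v)) = length (filter (%y. a < y) (u @ i # j # v))" by simp
 then show ?case using Cons by (simp add: power_add mult_ac del: filter_append)
qed

lemma sg_swap: "i ~= j ==> sg (u @ j # i # v) = - \<epsilon> * sg (u @ i # j # v)"
 using ascents_swap[of i j u v] by (auto simp: sg_def)

lemma antisym_sg: "antisym m n sg"
 unfolding antisym_def
proof (intro allI impI conjI)
 fix u i j v
 show "i = j ==> sg (u @ [i, j] @ v) = 0" by (simp add: sg_def)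
 show "i ~= j & valid m (u @ [j, i] @ v) ==> sg (u @ [j, i] @ v) = - \<epsilon> * sg (u @ [i, j] @ v)"
 using sg_swap[of i j u v] by simp
qed

lemma sg_square: "distinct w ==> sg w * sg w = 1"
proof -
 have "(- \<epsilon>) ^ k * (- \<epsilon>) ^ k = 1" for k
 by (simp only: power_mult_distrib[symmetric] me2 power_one)
 then show "distinct w ==> sg w * sg w = 1" by (simp add: sg_def)
qed

lemma antisym_eq_sg:
 assumes \<Phi>: "antisym m n \<Phi>" and q: "valid m q" "valid m q'" "distinct q'" "set q' = I" and len: "length q = n" "n = N"
 shows "\<Phi> q = sg q * (sg q' * \<Phi> q')"
proof (cases "distinct q")
 case True
 have "card (set q) = card I" using True len by (simp add: distinct_card)
 then have "set q = I" using card_subset_eq[of I "set q"] valid_letters[OF q(1)] by simp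
 then have "\<Phi> q * sg q' = \<Phi> q' * sg q"
 by (intro antisym_proportional[OF \<Phi> antisym_sg q(1,2) True q(3)]) (use q len in auto)
 then show ?thesis using sg_square[OF q(3)] by (metis mult.assoc mult.commute mult_1)
qed (use antisym_not_distinct[OF \<Phi> q(1) len(1)] in \<open>simp add: sg_def\<close>)

subsection \<open>Closed words\<close>

text \<open>The letters not yet played cannot all be blocked: a blocked one has its predecessor on the circle
  occupied, by another unplayed letter, and so they would fill the circle.\<close>

lemma unplayed_letter:
 assumes v: "valid m w" and w: "distinct w" "set w ~= I"
 shows "EX y. y \<notin> set w & valid m (w @ [y])"
proof (rule ccontr)
 assume no: "~ ?thesis"
 define U where "U = I - set w"
 let ?l = "wend m w"
 have m: "m : V" "?l : V" "set w \<subseteq> I" using valid_V[OF v] valid_letters[OF v] by auto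
 have "EX z:U. sos_d ?l z y mod K = 1" if y: "y : U" for y
 proof -
 have yI: "y : I" "y \<notin> set w" using y by (auto simp: U_def)
 have "st ?l y \<notin> V" using no v m yI by (auto simp: valid_append)
 then obtain z where z: "z : I" "z ~= y" "sos_d ?l z y mod K = 1" using step_valid_iff[OF m(2) yI(1)] by blast
 have "z \<notin> set w"
 proof
  assume zw: "z : set w"
  have "sos_d ?l z y = sos_d m z y + 1"
  using wend_d[OF m(3) z(1) yI(1), of m] zw w(1) yI(2) by (simp add: count_distinct)
  then have "(sos_d m z y + 1 - 1) mod K = 0" using z(3) by (metis mod_diff_left_eq diff_self mod_0)
  then show False using d_mod_nz[OF m(1) z(1) yI(1) z(2)] by simp
 qed
 then show ?thesis using z by (auto simp: U_def)
 qed
 then obtain f where f: "!!y. y : U ==> f y : U & sos_d ?l (f y) y mod K = 1" by metis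
 obtain y where y: "y : U" using w(2) m(3) unfolding U_def by blast
 have chain: "(f ^^ k) y : U & sos_d ?l ((f ^^ k) y) y mod K = int k mod K" for k
 proof (induction k)
 case (Suc k)
 let ?z = "(f ^^ k) y"
 have "sos_d ?l (f ?z) y mod K = (sos_d ?l (f ?z) ?z mod K + sos_d ?l ?z y mod K) mod K"
  by (simp only: d_add[of ?l "f ?z" ?z y, symmetric] mod_add_eq)
 also have "... = (1 + int k mod K) mod K" using Suc f[of ?z] by (simp only: simp_thms)
 also have "... = int (Suc k) mod K" by (simp only: mod_add_right_eq of_nat_Suc)
 finally show ?case using Suc f[of ?z] by simp
 qed (use y in \<open>simp add: sos_d_def\<close>)
 have "inj_on (%k. (f ^^ k) y) {0..<N + L}"
 proof (rule inj_onI)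
 fix k k' assume k: "k : {0..<N + L}" "k' : {0..<N + L}" and e: "(f ^^ k) y = (f ^^ k') y"
 have "int k mod K = int k' mod K" by (metis chain e)
 moreover have "0 <= int k" "int k < K" "0 <= int k'" "int k' < K" using k by auto
 ultimately show "k = k'" by (simp only: mod_pos_pos_trivial of_nat_eq_iff)
 qed
 then have "card {0..<N + L} <= card U"
 by (rule card_inj_on_le) (use chain in blast, simp add: U_def)
 also have "card U <= card I" unfolding U_def by (intro card_mono) auto
 finally show False using L2 by simp
qed

definition closed_words where
 "closed_words m = {q. valid m q & distinct q & set q = I}"

lemma closed_word_exists:
 assumes "valid m w" "distinct w"
 shows "EX v. w @ v : closed_words m"
 using assms
proof (induction "N - length w" arbitrary: w rule: less_induct)
 case less
 show ?case
 proof (cases "set w = I")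
 case True
 then show ?thesis using less.prems by (intro exI[of _ "[]"]) (simp add: closed_words_def)
 next
 case False
 obtain y where y: "y \<notin> set w" "valid m (w @ [y])" using unplayed_letter[OF less.prems False] by auto
 have "set w \<subset> I" using False valid_letters[OF less.prems(1)] by auto
 then have "card (set w) < card I" by (intro psubset_card_mono) auto
 then have "length w < N" using less.prems by (simp add: distinct_card)
 then have "EX v. (w @ [y]) @ v : closed_words m"
  by (intro less.hyps) (use y less.prems in auto)
 then show ?thesis by auto
 qed
qed

lemma closed_wordsD:
 assumes "q : closed_words m"
 shows "valid m q" "distinct q" "set q = I" "length q = N" "wend m q = m"
proof -
 show q: "valid m q" "distinct q" "set q = I" using assms by (auto simp: closed_words_def)
 show "length q = N" using q by (metis distinct_card card_atLeastAtMost diff_Suc_1)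
 show "wend m q = m"
 proof (rule V_eqI)
 show "wend m q : V" "m : V" using valid_V[OF q(1)] by auto
 fix i assume "i : I"
 then show "sos_d (wend m q) i N = sos_d m i N"
  using wend_d[of q i N m] q N2 by (simp add: count_distinct)
 qed
qed

lemma closed_wordsI:
 assumes v: "valid m q" and len: "length q = N" and e: "wend m q = m"
 shows "q : closed_words m"
proof -
 have q: "set q \<subseteq> I" using valid_letters[OF v] .
 have eq: "count_list q i = count_list q N" if "i : I" for i
 using wend_d[OF q that, of N m] N2 by (simp add: e)
 have "N = (SUM i:I. count_list q i)" using count_sum[OF q] len by (simp only:)
 also have "... = (SUM i:I. count_list q N)" by (rule sum.cong[OF refl]) (rule eq)
 finally have "count_list q N = 1" using N2 by simp
 then have one: "count_list q i = 1" if "i : I" for i using eq[OF that] by simp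
 have "I \<subseteq> set q"
 proof
 fix i assume "i : I"
 then show "i : set q" using one[of i] count_notin[of i q] by (metis zero_neq_one)
 qed
 then have s: "set q = I" using q by auto
 then have "distinct q" by (intro card_distinct) (simp add: len)
 then show ?thesis using v s unfolding closed_words_def by blast
qed

lemma distinct_closed: "valid m q ==> length q = N ==> distinct q ==> q : closed_words m"
proof -
 assume q: "valid m q" "length q = N" "distinct q"
 then have "card (set q) = card I" by (simp add: distinct_card)
 then have "set q = I" using card_subset_eq[of I "set q"] valid_letters[OF q(1)] by simp
 then show ?thesis using q by (simp add: closed_words_def)
qed

lemma finite_closed_words: "finite (closed_words m)"
 by (rule finite_subset[OF _ finite_lists_length_eq[of I N]]) (use closed_wordsD in auto)

lemma closed_sos_paths_eq:
 assumes "m : V"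
 shows "closed_sos_paths N L m = wpath m ` closed_words m"
proof (intro equalityI subsetI)
 fix p assume "p : closed_sos_paths N L m"
 then have p: "p : paths G N" "fst p = m" "path_end G p = m" by (auto simp: closed_sos_paths_def)
 obtain w where w: "p = wpath (fst p) w" "valid (fst p) w" "length w = N" using path_wpath[OF p(1)] .
 then have "p = wpath m w" "valid m w" using p(2) by auto
 moreover have "wend m w = m" using p(3) calculation(1) by simp
 ultimately show "p : wpath m ` closed_words m" using closed_wordsI w(3) by blast
next
 fix p assume "p : wpath m ` closed_words m"
 then obtain q where q: "q : closed_words m" "p = wpath m q" by auto
 have "wpath m q : paths G N"
 using wpath_in[OF closed_wordsD(1)[OF q(1)]] unfolding closed_wordsD(4)[OF q(1)] .
 then show "p : closed_sos_paths N L m"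
 unfolding closed_sos_paths_def q(2) using closed_wordsD(5)[OF q(1)] by simp
qed

lemma ascents_card: "ascents w = card {(k, l). k < l & l < length w & w ! k < w ! l}"
proof (induction w)
 case (Cons x w)
 let ?S = "{(k, l). k < l & l < length w & w ! k < w ! l}"
 let ?F = "{l. l < length w & x < w ! l}"
 have e: "{(k, l). k < l & l < length (x # w) & (x # w) ! k < (x # w) ! l} =
  (%l. (0, Suc l)) ` ?F \<union> (%(k, l). (Suc k, Suc l)) ` ?S" (is "?T = ?A \<union> ?B")
 proof (intro equalityI subsetI)
 fix y assume "y : ?T"
 then obtain k l where y: "y = (k, l)" "k < l" "l < length (x # w)" "(x # w) ! k < (x # w) ! l" by auto
 obtain l' where l: "l = Suc l'" using y(2) by (cases l) auto
 show "y : ?A \<union> ?B"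
 proof (cases k)
  case 0
  then have "y = (0, Suc l')" "l' : ?F" using y l by auto
  then show ?thesis by blast
 next
  case (Suc k')
  then have "y = (%(k, l). (Suc k, Suc l)) (k', l')" "(k', l') : ?S" using y l by auto
  then show ?thesis by blast
 qed
 next
 fix y assume "y : ?A \<union> ?B"
 then show "y : ?T"
 proof
  assume "y : ?A"
  then obtain l where "l < length w" "x < w ! l" "y = (0, Suc l)" by blast
  then show ?thesis by simp
 next
  assume "y : ?B"
  then obtain k l where "k < l" "l < length w" "w ! k < w ! l" "y = (Suc k, Suc l)" by auto
  then show ?thesis by simp
 qed
 qed
 have fin: "finite ?S" by (rule finite_subset[of _ "{..<length w} \<times> {..<length w}"]) auto
 have "card (?A \<union> ?B) = card ?A + card ?B" by (rule card_Un_disjoint) (use fin in auto)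
 also have "card ?A = card ?F" by (rule card_image) (auto simp: inj_on_def)
 also have "card ?B = card ?S" by (rule card_image) (auto simp: inj_on_def)
 finally show ?case unfolding e using Cons.IH by (simp add: length_filter_conv_card)
qed simp

lemma sos_length_wpath: "sos_length (wpath m w) = ascents w"
 unfolding sos_length_def Let_def wpath_simps(2,4) ascents_card ..

end

section \<open>The quantum determinant\<close>

lemma flip_supported: "face_supported G w ==> face_supported G (%r p q s. w p r s q)"
 unfolding face_supported_def is_face_def by simp

context face_algebra
begin

lemma form_minus:
 assumes "linear_form A X" "a : carrier A" "b : carrier A"
 shows "X (a \<ominus>\<^bsub>A\<^esub> b) = X a - X b"
proof -
 have "X (a \<ominus>\<^bsub>A\<^esub> b \<oplus>\<^bsub>A\<^esub> b) = X (a \<ominus>\<^bsub>A\<^esub> b) + X b"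
 using assms by (intro linear_form_add) auto
 moreover have "a \<ominus>\<^bsub>A\<^esub> b \<oplus>\<^bsub>A\<^esub> b = a"
 using assms by (simp add: a_minus_def A_a_ac(1) A_l_neg)
 ultimately show ?thesis by simp
qed

end

context path_quotient
begin

lemma pi_one: "\<pi> \<one>\<^bsub>H\<^esub> = \<one>\<^bsub>Q\<^esub>"
proof -
 have m: "monoid H" "monoid Q" by (rule ring.is_monoid[OF H_ring], rule ring.is_monoid[OF A_ring])
 have "\<one>\<^bsub>Q\<^esub> : \<pi> ` carrier H" using monoid.one_closed[OF m(2)] pi_carrier by simp
 then obtain f where f: "f : carrier H" "\<one>\<^bsub>Q\<^esub> = \<pi> f" by blast
 have o: "\<one>\<^bsub>H\<^esub> : carrier H" by (rule monoid.one_closed[OF m(1)])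
 have "\<pi> \<one>\<^bsub>H\<^esub> = \<pi> \<one>\<^bsub>H\<^esub> \<otimes>\<^bsub>Q\<^esub> \<one>\<^bsub>Q\<^esub>" by (rule monoid.r_one[OF m(2) pi_in[OF o], symmetric])
 also have "... = \<pi> (mul \<one>\<^bsub>H\<^esub> f)" unfolding f(2) by (rule pi_mult[OF o f(1), symmetric])
 also have "mul \<one>\<^bsub>H\<^esub> f = f" using monoid.l_one[OF m(1) f(1)] by (simp only: H_simps(2))
 finally show ?thesis using f(2) by simp
qed

text \<open>The common kernel of all entries of a transfer matrix is an ideal, because the transfer matrix of a
  product is the product of transfer matrices.\<close>

lemma transfer_vanish:
 assumes X: "face_supported G X"
 and T: "!!r s f. r : arcs G ==> s : arcs G ==> f : carrier H ==> T r s (\<pi> f) = transfer_form X r s f"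
 and S: "S \<subseteq> carrier Q" "!!g r s. g : S ==> r : arcs G ==> s : arcs G ==> T r s g = 0"
 and x: "x : Idl\<^bsub>Q\<^esub> S" and rs: "r : arcs G" "s : arcs G"
 shows "T r s x = 0"
proof -
 define K where "K = {x : carrier Q. ALL r:arcs G. ALL s:arcs G. T r s x = 0}"
 have pi: "EX f:carrier H. a = \<pi> f" if "a : carrier Q" for a using that pi_carrier by auto
 have "ideal K Q"
 proof (rule idealI_closed)
 show "K \<subseteq> carrier Q" by (auto simp: K_def)
 have "T r s \<zero>\<^bsub>Q\<^esub> = 0" if "r : arcs G" "s : arcs G" for r s
  using T[OF that H_zero_in] by (simp add: pi_zero)
 moreover have "\<zero>\<^bsub>Q\<^esub> : carrier Q" using pi_in[OF H_zero_in] by (simp add: pi_zero)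
 ultimately show "\<zero>\<^bsub>Q\<^esub> : K" by (simp add: K_def)
 next
 fix x y assume xy: "x : K" "y : K"
 then have "x : carrier Q" "y : carrier Q" by (auto simp: K_def)
 then obtain f g where fg: "f : carrier H" "x = \<pi> f" "g : carrier H" "y = \<pi> g"
  using pi by metis
 have "T r s (x \<oplus>\<^bsub>Q\<^esub> y) = 0" if rs: "r : arcs G" "s : arcs G" for r s
 proof -
  have "T r s (x \<oplus>\<^bsub>Q\<^esub> y) = transfer_form X r s (f + g)"
  using T[OF rs H_add_in[OF fg(1,3)]] by (simp add: fg pi_add)
  also have "... = T r s x + T r s y" using T[OF rs fg(1)] T[OF rs fg(3)] by (simp add: fg transfer_form_add)
  finally show ?thesis using xy rs by (simp add: K_def)
 qed
 moreover have "x \<oplus>\<^bsub>Q\<^esub> y : carrier Q" using pi_in[OF H_add_in[OF fg(1,3)]] fg by (simp add: pi_add)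
 ultimately show "x \<oplus>\<^bsub>Q\<^esub> y : K" by (simp add: K_def)
 next
 fix x a assume x: "x : K" and a: "a : carrier Q"
 then have "x : carrier Q" by (auto simp: K_def)
 then obtain f g where fg: "f : carrier H" "x = \<pi> f" "g : carrier H" "a = \<pi> g"
  using pi a by metis
 have z: "transfer_form X r s f = 0" if rs: "r : arcs G" "s : arcs G" for r s
  using T[OF rs fg(1)] x rs by (simp add: K_def fg)
 have c: "T r s (\<pi> (mul g f)) = 0" "T r s (\<pi> (mul f g)) = 0" if rs: "r : arcs G" "s : arcs G" for r s
  unfolding T[OF rs mul_in[OF fg(3,1)]] T[OF rs mul_in[OF fg(1,3)]]
  transfer_form_mul[OF X rs fg(3,1)] transfer_form_mul[OF X rs fg(1,3)]
  using z rs by simp_all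
 show "a \<otimes>\<^bsub>Q\<^esub> x : K" "x \<otimes>\<^bsub>Q\<^esub> a : K"
  using c pi_in[OF mul_in[OF fg(3,1)]] pi_in[OF mul_in[OF fg(1,3)]]
  unfolding K_def fg by (simp_all add: pi_mult[OF fg(3,1)] pi_mult[OF fg(1,3)])
 qed
 moreover have "S \<subseteq> K" using S by (auto simp: K_def)
 ultimately have "Idl\<^bsub>Q\<^esub> S \<subseteq> K" by (rule ring.genideal_minimal[OF A_ring])
 then show ?thesis using x rs by (auto simp: K_def)
qed

end

context quiver
begin

lemma linear_form_H_sum:
 assumes X: "linear_form H X" and f: "!!i. i : S ==> f i : carrier H"
 shows "X (SUM i:S. f i) = (SUM i:S. X (f i))"
proof -
 have "comb_scale 1 (f i) = f i" for i by (rule poly_mapping_eqI) simp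
 then show ?thesis using linear_form_H_lincomb[where S = S and k = "%_. 1" and f = f, OF X f] by simp
qed

lemma linear_form_H_scale: "linear_form H X ==> f : carrier H ==> X (comb_scale c f) = c * X f"
 using linear_form_smult[of H X f c] by (simp add: H_simps(6))

lemma transfer_edge:
 assumes X: "face_supported G X" and "a : arcs G" "b : arcs G" "x : arcs G" "u : arcs G"
 shows "transfer X (edge_path G a) (edge_path G b) x u = X x b a u"
proof (cases "head G x = tail G a & tail G x = tail G b")
 case True
 have "(SUM v:arcs G. X x b a v * (if v = u then 1 else 0)) = X x b a u"
 using assms by (simp add: if_distrib[of "(*) _"] cong: if_cong)
 then show ?thesis using True by (simp add: transfer_def)
next
 case False
 then have "X x b a u = 0" using X unfolding face_supported_def is_face_def by metis
 then show ?thesis using False by (auto simp: transfer_def)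
qed

lemma transfer_step:
 assumes X: "face_supported G X" and p: "p : arcs G" and Q: "R : paths G n" "head G p = fst R" and s: "s : arcs G"
 shows "(SUM x:arcs G. SUM P:paths G (Suc n). \<Phi> x P * transfer X P (path_concat (edge_path G p) R) x s) =
 (SUM u:arcs G. SUM P:paths G n. (SUM x:arcs G. SUM c:arcs G. X x p c u * \<Phi> x (path_concat (edge_path G c) P)) * transfer X P R u s)"
proof -
 have "(SUM x:arcs G. SUM P:paths G (Suc n). \<Phi> x P * transfer X P (path_concat (edge_path G p) R) x s) =
 (SUM x:arcs G. SUM c:arcs G. SUM P:paths G n. SUM u:arcs G. X x p c u * \<Phi> x (path_concat (edge_path G c) P) * transfer X P R u s)"
 proof (rule sum.cong[OF refl])
 fix x assume x: "x : arcs G"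
 have "(SUM P:paths G (Suc n). \<Phi> x P * transfer X P (path_concat (edge_path G p) R) x s) =
  (SUM P:paths G (1 + n). \<Phi> x P * transfer X P (path_concat (edge_path G p) R) x s)" by simp
 also have "... = (SUM c:arcs G. SUM P:paths G n. if path_end G (edge_path G c) = fst P
  then \<Phi> x (path_concat (edge_path G c) P) * transfer X (path_concat (edge_path G c) P) (path_concat (edge_path G p) R) x s else 0)"
  by (simp only: sum_paths_concat_if sum_paths_1)
 also have "... = (SUM c:arcs G. SUM P:paths G n. SUM u:arcs G. X x p c u * \<Phi> x (path_concat (edge_path G c) P) * transfer X P R u s)"
 proof (rule sum.cong[OF refl], rule sum.cong[OF refl])
  fix c P assume c: "c : arcs G" and P: "P : paths G n"
  have "(SUM u:arcs G. X x p c u * transfer X P R u s) =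
   (SUM u:arcs G. transfer X (edge_path G c) (edge_path G p) x u * transfer X P R u s)"
  by (rule sum.cong[OF refl]) (simp add: transfer_edge[OF X c p x])
  also have "... = (if path_end G (edge_path G c) = fst P then transfer X (path_concat (edge_path G c) P) (path_concat (edge_path G p) R) x s else 0)"
  using transfer_concat[OF X edge_path_in[OF c] edge_path_in[OF p] P Q(1) x s] Q(2) by simp
  finally have "\<Phi> x (path_concat (edge_path G c) P) * (SUM u:arcs G. X x p c u * transfer X P R u s) =
   (if path_end G (edge_path G c) = fst P
   then \<Phi> x (path_concat (edge_path G c) P) * transfer X (path_concat (edge_path G c) P) (path_concat (edge_path G p) R) x s else 0)"
  by auto
  then show "(if path_end G (edge_path G c) = fst P
   then \<Phi> x (path_concat (edge_path G c) P) * transfer X (path_concat (edge_path G c) P) (path_concat (edge_path G p) R) x s else 0) =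
   (SUM u:arcs G. X x p c u * \<Phi> x (path_concat (edge_path G c) P) * transfer X P R u s)"
  by (simp add: sum_distrib_left mult_ac)
 qed
 finally show "(SUM P:paths G (Suc n). \<Phi> x P * transfer X P (path_concat (edge_path G p) R) x s) =
  (SUM c:arcs G. SUM P:paths G n. SUM u:arcs G. X x p c u * \<Phi> x (path_concat (edge_path G c) P) * transfer X P R u s)" .
 qed
 also have "... = (SUM u:arcs G. SUM P:paths G n. (SUM x:arcs G. SUM c:arcs G. X x p c u * \<Phi> x (path_concat (edge_path G c) P)) * transfer X P R u s)"
 unfolding sum_distrib_right sum.cartesian_product
 by (rule sum.reindex_bij_witness[where i="%(u, P, x, c). (x, c, P, u)" and j="%(x, c, P, u). (u, P, x, c)"])
  auto
 finally show ?thesis .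
qed

end

context sos
begin

lemma wpath_pair: "wpath l [a, b] = edge_pair_path G (l, a) (st l a, b)"
 by (simp add: wpath_def edge_pair_path_def)

lemma wpath_Cons: "wpath l (a # w) = path_concat (edge_path G (l, a)) (wpath (st l a) w)"
 by (simp add: wpath_def path_concat_def edge_path_def)

lemma mul_words: "mul (e_basis (wpath l v) (wpath m w)) (e_basis (wpath (wend l v) v') (wpath (wend m w) w')) =
 e_basis (wpath l (v @ v')) (wpath m (w @ w'))"
 by (simp add: mul_basis wpath_append)

lemma e_word_in: "valid l v ==> valid m w ==> length v = length w ==> e_basis (wpath l v) (wpath m w) : carrier H"
 using wpath_in[of l v] wpath_in[of m w] by (metis e_basis_carrier path_pairsI)

text \<open>Multiplying a face relation by matrix units on both sides applies the face operator at an arbitrary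
  position of a word.\<close>

lemma word_relation:
 assumes xi: "linear_form H xi" and van: "!!z. z : face_ideal G (sw 1) ==> xi z = 0"
 and p: "valid l (p1 @ [a, b] @ p2)" and r: "valid m (r1 @ [i, j] @ r2)"
 and len: "length p1 = length r1" "length p2 = length r2"
 shows "wa (wend l p1) a b * xi (e_basis (wpath l (p1 @ [a, b] @ p2)) (wpath m (r1 @ [i, j] @ r2))) +
  (if valid (wend l p1) [b, a] then wb (wend l p1) b a * xi (e_basis (wpath l (p1 @ [b, a] @ p2)) (wpath m (r1 @ [i, j] @ r2))) else 0)
 = W (wend m r1) (%x y. xi (e_basis (wpath l (p1 @ [a, b] @ p2)) (wpath m (r1 @ [x, y] @ r2)))) i j"
proof -
 let ?l = "wend l p1" and ?m = "wend m r1"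
 have vp: "valid l p1" "valid ?l [a, b]" "valid (wend ?l [a, b]) p2" using p unfolding valid_append by blast+
 have vr: "valid m r1" "valid ?m [i, j]" "valid (wend ?m [i, j]) r2" using r unfolding valid_append by blast+
 let ?e1 = "e_basis (wpath l p1) (wpath m r1)"
 let ?e2 = "e_basis (wpath (wend ?l [a, b]) p2) (wpath (wend ?m [i, j]) r2)"
 have e: "?e1 : carrier H" "?e2 : carrier H" using e_word_in vp vr len by blast+
 define Y where "Y f = xi (mul (mul ?e1 f) ?e2)" for f
 have Y: "linear_form H Y"
 unfolding Y_def by (rule linear_form_H_mul(2)[OF linear_form_H_mul(1)[OF xi e(2)] e(1)])
 have Yval: "Y (e_basis (wpath ?l [x, y]) (wpath ?m [x', y'])) = xi (e_basis (wpath l (p1 @ [x, y] @ p2)) (wpath m (r1 @ [x', y'] @ r2)))"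
 if ends: "wend ?l [a, b] = wend ?l [x, y]" "wend ?m [i, j] = wend ?m [x', y']" for x y x' y'
 proof -
 have "mul (mul ?e1 (e_basis (wpath ?l [x, y]) (wpath ?m [x', y']))) ?e2 =
  mul (e_basis (wpath l (p1 @ [x, y])) (wpath m (r1 @ [x', y'])))
  (e_basis (wpath (wend l (p1 @ [x, y])) p2) (wpath (wend m (r1 @ [x', y'])) r2))"
  unfolding mul_words wend_append ends ..
 also have "... = e_basis (wpath l (p1 @ [x, y] @ p2)) (wpath m (r1 @ [x', y'] @ r2))"
  unfolding mul_words append_assoc ..
 finally show ?thesis unfolding Y_def by simp
 qed
 let ?a = "(?l, a)" and ?b = "(st ?l a, b)" and ?i = "(?m, i)" and ?j = "(st ?m i, j)"
 have ab: "(?a, ?b) : composable_pairs G" and ij: "(?i, ?j) : composable_pairs G"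
 using vp(2) vr(2) by (auto simp: composable_pairs_iff)
 let ?col = "face_col (sw 1) ?a ?b (edge_pair_path G ?i ?j)" and ?row = "face_row (sw 1) (edge_pair_path G ?a ?b) ?i ?j"
 have rel: "?col - ?row : face_relations G (sw 1)" unfolding face_relations_alt using ab ij by blast
 have in': "?col : carrier H" "?row : carrier H" by (rule face_col_in[OF edge_pair_in[OF ij]], rule face_row_in[OF edge_pair_in[OF ab]])
 have J: "ideal (face_ideal G (sw 1)) H" unfolding face_ideal_def by (rule ring.genideal_ideal[OF H_ring face_relations_in])
 have "?col - ?row : face_ideal G (sw 1)" using rel face_relation_in_ideal by blast
 then have "mul (mul ?e1 (?col - ?row)) ?e2 : face_ideal G (sw 1)"
 using ideal.I_l_closed[OF J _ e(1)] ideal.I_r_closed[OF J _ e(2)] by (simp only: H_simps(2)[symmetric])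
 then have "Y (?col - ?row) = 0" unfolding Y_def by (rule van)
 then have eq: "Y ?col = Y ?row" unfolding linear_form_H_diff[OF Y in'] by (simp only: right_minus_eq)
 have col: "Y ?col = wa ?l a b * xi (e_basis (wpath l (p1 @ [a, b] @ p2)) (wpath m (r1 @ [i, j] @ r2))) +
  (if valid ?l [b, a] then wb ?l b a * xi (e_basis (wpath l (p1 @ [b, a] @ p2)) (wpath m (r1 @ [i, j] @ r2))) else 0)"
 proof -
 have f: "sw 1 ?a c ?b d * Y (e_basis (edge_pair_path G c d) (edge_pair_path G ?i ?j)) ~= 0 ==> head G c = tail G d" for c d
  using sw_supported[of 1] unfolding face_supported_def is_face_def by (metis mult_zero_left)
 have c: "wend ?l [a, b] = wend ?l [b, a]" using vp(2) step_commute[of a b ?l] by simp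
 have "Y ?col = (SUM c:arcs G. SUM d:arcs G. sw 1 ?a c ?b d * Y (e_basis (edge_pair_path G c d) (edge_pair_path G ?i ?j)))"
  unfolding linear_form_face_col[OF Y edge_pair_in[OF ij]] by (rule sum_composable) (rule f)
 also have "... = fop (%r p q s. sw 1 p r s q) ?l (%x y. Y (e_basis (edge_pair_path G (?l, x) (st ?l x, y)) (edge_pair_path G ?i ?j))) a b"
  by (rule face_sum[OF flip_supported[OF sw_supported] vp(2)])
 also have "... = wa ?l a b * Y (e_basis (wpath ?l [a, b]) (wpath ?m [i, j])) +
  (if valid ?l [b, a] then wb ?l b a * Y (e_basis (wpath ?l [b, a]) (wpath ?m [i, j])) else 0)"
  unfolding fop_sw_flip[OF vp(2)] wpath_pair by simp
 finally show ?thesis unfolding Yval[OF refl refl] Yval[OF c refl] .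
 qed
 have row: "Y ?row = W ?m (%x y. xi (e_basis (wpath l (p1 @ [a, b] @ p2)) (wpath m (r1 @ [x, y] @ r2)))) i j"
 proof -
 have f: "sw 1 c ?i d ?j * Y (e_basis (edge_pair_path G ?a ?b) (edge_pair_path G c d)) ~= 0 ==> head G c = tail G d" for c d
  using sw_supported[of 1] unfolding face_supported_def is_face_def by (metis mult_zero_left)
 have c: "wend ?m [i, j] = wend ?m [j, i]" using vr(2) step_commute[of i j ?m] by simp
 have "Y ?row = (SUM c:arcs G. SUM d:arcs G. sw 1 c ?i d ?j * Y (e_basis (edge_pair_path G ?a ?b) (edge_pair_path G c d)))"
  unfolding linear_form_face_row[OF Y edge_pair_in[OF ab]] by (rule sum_composable) (rule f)
 also have "... = fop (sw 1) ?m (%x y. Y (e_basis (edge_pair_path G ?a ?b) (edge_pair_path G (?m, x) (st ?m x, y)))) i j"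
  by (rule face_sum[OF sw_supported vr(2)])
 also have "... = W ?m (%x y. Y (e_basis (wpath ?l [a, b]) (wpath ?m [x, y]))) i j"
  unfolding fop_sw[OF vr(2)] wpath_pair by simp
 finally show ?thesis unfolding W_def Yval[OF refl refl] Yval[OF refl c] .
 qed
 show ?thesis using eq unfolding col row .
qed

lemma wa_wb:
 assumes "i ~= j" "\<lbrakk>sos_d l i j\<rbrakk> ~= 0"
 shows "wa l i j - \<epsilon> * wb l i j = - inverse t"
proof -
 define u where "u = (t powi sos_d l i j)\<^sup>2"
 note A = wa_u[OF assms u_def]
 have e: "\<epsilon> * (\<epsilon> * x / y) = x / y" for x y using eps by auto
 have "wa l i j - \<epsilon> * wb l i j = (- h - (u * inverse t - t)) / (u - 1)"
 unfolding A(1,2) e by (simp add: diff_divide_distrib)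
 also have "- h - (u * inverse t - t) = - inverse t * (u - 1)" by (simp add: h_def algebra_simps)
 finally show ?thesis using A(3) by simp
qed

lemma wb_nz:
 assumes "valid l [i, j]" "valid l [j, i]" "i ~= j"
 shows "wb l i j ~= 0"
proof -
 have v: "l : V" "i : I" "j : I" "st l j : V" using assms by auto
 have "sos_d l i j mod K ~= 1" using step_valid_iff[OF v(1,3)] v(4) assms(3) v(2) by blast
 moreover have "sos_d l i j mod K = 1" if "K dvd sos_d l i j - 1"
 proof -
 have "sos_d l i j mod K = 1 mod K" using that by (simp only: mod_eq_dvd_iff)
 then show ?thesis using N2 by simp
 qed
 ultimately have "\<lbrakk>sos_d l i j - 1\<rbrakk> ~= 0" by (auto simp: qn_zero_iff)
 then show ?thesis using qn_d_nz[OF v(1,2,3) assms(3)] assms(3) eps by (auto simp: wb_def)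
qed

lemma antisymI:
 assumes eig: "!!u i j v. valid m (u @ [i, j] @ v) ==> length (u @ [i, j] @ v) = n ==>
  W (wend m u) (%x y. \<Phi> (u @ [x, y] @ v)) i j = - inverse t * \<Phi> (u @ [i, j] @ v)"
 shows "antisym m n \<Phi>"
 unfolding antisym_def
proof (intro allI impI conjI)
 fix u i j v assume v: "valid m (u @ [i, j] @ v) & length (u @ [i, j] @ v) = n"
 let ?l = "wend m u"
 have E: "wa ?l i j * \<Phi> (u @ [i, j] @ v) + wb ?l i j * \<Phi> (u @ [j, i] @ v) = - inverse t * \<Phi> (u @ [i, j] @ v)"
 using eig[of u i j v] v unfolding W_def by blast
 have vij: "valid ?l [i, j]" using v unfolding valid_append by blast
 { assume "i = j"
 then have "t * \<Phi> (u @ [i, j] @ v) = - inverse t * \<Phi> (u @ [i, j] @ v)" using E by (simp only: wa_def wb_def if_True simp_thms) simp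
 then have "(t + inverse t) * \<Phi> (u @ [i, j] @ v) = 0" by (simp only: distrib_right) simp
 then show "\<Phi> (u @ [i, j] @ v) = 0" using sum_t_nz by simp }
 { assume ij: "i ~= j & valid m (u @ [j, i] @ v)"
 then have vji: "valid ?l [j, i]" unfolding valid_append by blast
 have nz: "\<lbrakk>sos_d ?l i j\<rbrakk> ~= 0" using qn_d_nz[of ?l i j] vij ij by auto
 have a: "wa ?l i j = \<epsilon> * wb ?l i j - inverse t" using wa_wb[OF conjunct1[OF ij] nz] by (simp add: algebra_simps)
 define x y b where "x = \<Phi> (u @ [i, j] @ v)" and "y = \<Phi> (u @ [j, i] @ v)" and "b = wb ?l i j"
 have "(\<epsilon> * b - inverse t) * x + b * y = - inverse t * x" using E unfolding a x_def y_def b_def .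
 then have "b * (\<epsilon> * x + y) = 0" by (simp add: algebra_simps)
 moreover have "b ~= 0" unfolding b_def by (rule wb_nz[OF vij vji conjunct1[OF ij]])
 ultimately have "\<epsilon> * x + y = 0" by simp
 then show "\<Phi> (u @ [j, i] @ v) = - \<epsilon> * \<Phi> (u @ [i, j] @ v)"
  unfolding x_def[symmetric] y_def[symmetric] by (simp add: add_eq_0_iff) }
qed

definition detf where
 "detf xi l m r = (SUM p:closed_words l. sg p * xi (e_basis (wpath l p) (wpath m r)) :: complex)"

text \<open>The face relations move a face operator from the lower to the upper index, where the sign is an
  eigenvector of it.\<close>

lemma antisym_detf:
 assumes xi: "linear_form H xi" and van: "!!z. z : face_ideal G (sw 1) ==> xi z = 0"
 shows "antisym m N (detf xi l m)"
proof (rule antisymI)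
 fix u i j v assume r: "valid m (u @ [i, j] @ v)" and len: "length (u @ [i, j] @ v) = N"
 define n where "n = length u"
 define M where "M p r = xi (e_basis (wpath l p) (wpath m r))" for p r
 define sp where "sp p = take n p @ [p ! Suc n, p ! n] @ drop (n + 2) p" for p :: "nat list"
 define base where "base p = wend l (take n p)" for p
 let ?r = "u @ [i, j] @ v" and ?C = "closed_words l"
 have split: "EX A x y B. p = A @ [x, y] @ B & length A = n & length B = length v" if "p : ?C" for p
 proof -
 have "length p = n + 2 + length v" using closed_wordsD(4)[OF that] len by (simp add: n_def)
 then have "p = take n p @ [p ! n, p ! Suc n] @ drop (n + 2) p" "length (take n p) = n" "length (drop (n + 2) p) = length v"
  using id_take_nth_drop[of n p] Cons_nth_drop_Suc[of "Suc n" p] by simp_all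
 then show ?thesis by blast
 qed
 have spl: "p ! n = x" "p ! Suc n = y" "sp p = A @ [y, x] @ B" "base p = wend l A"
 if "p = A @ [x, y] @ B" "length A = n" for p A x y B
 using that by (simp_all add: sp_def base_def nth_append)
 have main: "sg p * (wa (base p) (p ! n) (p ! Suc n) * M p ?r) + (if sp p : ?C then sg (sp p) * wb (base p) (p ! n) (p ! Suc n) * M p ?r else 0)
  = - inverse t * (sg p * M p ?r)"
 and sp: "sp p : ?C \<longleftrightarrow> valid (base p) [p ! Suc n, p ! n]" "sp (sp p) = p" "base (sp p) = base p"
  "sp p ! n = p ! Suc n" "sp p ! Suc n = p ! n"
 and rel: "wa (base p) (p ! n) (p ! Suc n) * M p ?r + (if sp p : ?C then wb (base p) (p ! Suc n) (p ! n) * M (sp p) ?r else 0)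
  = W (wend m u) (%x y. M p (u @ [x, y] @ v)) i j"
 if p: "p : ?C" for p
 proof -
 obtain A x y B where AB: "p = A @ [x, y] @ B" "length A = n" "length B = length v" using split[OF p] by blast
 note s = spl[OF AB(1,2)] and s' = spl[of "sp p" A y x B, OF _ AB(2)]
 note cl = closed_wordsD[OF p]
 have v: "valid l A" "valid (wend l A) [x, y]" "valid (wend (wend l A) [x, y]) B"
  using cl(1) unfolding AB(1) valid_append by blast+
 have xy: "x ~= y" using cl(2) by (auto simp: AB(1))
 have "wend (wend l A) [y, x] = wend (wend l A) [x, y]" using v(2) step_commute[of x y "wend l A"] by simp
 then have "valid l (A @ [y, x] @ B) \<longleftrightarrow> valid (wend l A) [y, x]" using v unfolding valid_append by metis
 moreover have "distinct (A @ [y, x] @ B)" "set (A @ [y, x] @ B) = I" using cl(2,3) by (auto simp: AB(1))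
 ultimately show sp: "sp p : ?C \<longleftrightarrow> valid (base p) [p ! Suc n, p ! n]"
  unfolding closed_words_def s by blast
 show "sp (sp p) = p" "base (sp p) = base p" "sp p ! n = p ! Suc n" "sp p ! Suc n = p ! n"
  using s'[OF s(3)] s AB by simp_all
 show "wa (base p) (p ! n) (p ! Suc n) * M p ?r + (if sp p : ?C then wb (base p) (p ! Suc n) (p ! n) * M (sp p) ?r else 0)
  = W (wend m u) (%x y. M p (u @ [x, y] @ v)) i j"
  unfolding s M_def sp[unfolded s] unfolding AB(1)
  by (rule word_relation[OF xi van _ r]) (assumption, fact cl(1)[unfolded AB(1)], simp add: AB(2) n_def, simp add: AB(3))
 have nz: "\<lbrakk>sos_d (wend l A) x y\<rbrakk> ~= 0" using qn_d_nz[of "wend l A" x y] v xy valid_V by auto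
 have sg': "sg (sp p) = - \<epsilon> * sg p" unfolding s(3) unfolding AB(1) using sg_swap[OF xy, of A B] by simp
 have wb0: "wb (wend l A) x y = 0" if "sp p \<notin> ?C" using swap_valid[OF v(2)] that sp unfolding s by blast
 have a: "wa (wend l A) x y = \<epsilon> * wb (wend l A) x y - inverse t" using wa_wb[OF xy nz] by (simp add: algebra_simps)
 show "sg p * (wa (base p) (p ! n) (p ! Suc n) * M p ?r) + (if sp p : ?C then sg (sp p) * wb (base p) (p ! n) (p ! Suc n) * M p ?r else 0)
  = - inverse t * (sg p * M p ?r)"
  unfolding s(1,2,4) a sg' by (cases "sp p : ?C") (simp_all add: wb0 algebra_simps)
 qed
 have "W (wend m u) (%x y. detf xi l m (u @ [x, y] @ v)) i j =
  (SUM p:?C. sg p * W (wend m u) (%x y. M p (u @ [x, y] @ v)) i j)"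
 unfolding detf_def W_def M_def by (simp add: sum_distrib_left sum.distrib algebra_simps)
 also have "... = (SUM p:?C. sg p * (wa (base p) (p ! n) (p ! Suc n) * M p ?r)) +
  (SUM p:?C. if sp p : ?C then sg p * wb (base p) (p ! Suc n) (p ! n) * M (sp p) ?r else 0)"
 unfolding sum.distrib[symmetric]
 proof (rule sum.cong[OF refl])
 fix p assume p: "p : ?C"
 show "sg p * W (wend m u) (%x y. M p (u @ [x, y] @ v)) i j =
  sg p * (wa (base p) (p ! n) (p ! Suc n) * M p ?r) + (if sp p : ?C then sg p * wb (base p) (p ! Suc n) (p ! n) * M (sp p) ?r else 0)"
  unfolding rel[OF p, symmetric] by (cases "sp p : ?C") (simp_all only: if_True if_False distrib_left mult.assoc simp_thms mult_zero_right)
 qed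
 also have "(SUM p:?C. if sp p : ?C then sg p * wb (base p) (p ! Suc n) (p ! n) * M (sp p) ?r else 0) =
  (SUM p:{p : ?C. sp p : ?C}. sg p * wb (base p) (p ! Suc n) (p ! n) * M (sp p) ?r)"
 by (rule sum.inter_filter[OF finite_closed_words, symmetric])
 also have "... = (SUM p:{p : ?C. sp p : ?C}. sg (sp p) * wb (base p) (p ! n) (p ! Suc n) * M p ?r)"
 by (rule sum.reindex_bij_witness[of _ sp sp]) (use sp in auto)
 also have "... = (SUM p:?C. if sp p : ?C then sg (sp p) * wb (base p) (p ! n) (p ! Suc n) * M p ?r else 0)"
 by (rule sum.inter_filter[OF finite_closed_words])
 also have "(SUM p:?C. sg p * (wa (base p) (p ! n) (p ! Suc n) * M p ?r)) + ... = (SUM p:?C. - inverse t * (sg p * M p ?r))"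
 unfolding sum.distrib[symmetric] by (rule sum.cong[OF refl]) (rule main)
 also have "... = - inverse t * detf xi l m ?r" unfolding detf_def M_def by (rule sum_distrib_left[symmetric])
 finally show "W (wend m u) (%x y. detf xi l m (u @ [x, y] @ v)) i j = - inverse t * detf xi l m ?r" .
qed

lemma detf_value:
 assumes "linear_form H xi" "!!z. z : face_ideal G (sw 1) ==> xi z = 0"
 and "valid m r" "length r = N" "q : closed_words m"
 shows "detf xi l m r = sg r * (sg q * detf xi l m q)"
 by (rule antisym_eq_sg[OF antisym_detf[OF assms(1,2)] assms(3)])
 (use closed_wordsD[OF assms(5)] assms(4) in blast)+

definition qw where "qw m = (SOME w. w : closed_words m & wpath m w = (SOME q. q : closed_sos_paths N L m))"

lemma qw: assumes m: "m : V" shows "qw m : closed_words m" "(SOME q. q : closed_sos_paths N L m) = wpath m (qw m)"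
proof -
 obtain w where "w : closed_words m" using closed_word_exists[of m "[]"] m by auto
 then have "wpath m w : closed_sos_paths N L m" unfolding closed_sos_paths_eq[OF m] by (rule imageI)
 then have "(SOME q. q : closed_sos_paths N L m) : closed_sos_paths N L m"
 by (rule someI)
 then have "EX w. w : closed_words m & wpath m w = (SOME q. q : closed_sos_paths N L m)"
 unfolding closed_sos_paths_eq[OF m] image_iff by metis
 from someI_ex[OF this] show "qw m : closed_words m" "(SOME q. q : closed_sos_paths N L m) = wpath m (qw m)"
 unfolding qw_def by auto
qed

abbreviation "D \<equiv> sos_D N t"

lemma D_nz: "l : V ==> D l ~= 0"
proof -
 assume l: "l : V"
 have "finite {(i, j). 1 <= i & i < j & j <= N}" by (rule finite_subset[of _ "{..N} \<times> {..N}"]) auto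
 moreover have "\<lbrakk>sos_d l i j\<rbrakk> / \<lbrakk>sos_d (%_. 0) i j\<rbrakk> ~= 0" if "1 <= i" "i < j" "j <= N" for i j
 using qn_d_nz[OF l, of i j] qn_d_nz[OF zero_V, of i j] that by simp
 ultimately show "D l ~= 0" unfolding sos_D_def by (auto simp: prod_zero_iff)
qed

lemma det_comp_expand:
 assumes l: "l : V" and m: "m : V"
 shows "sos_det_comp N L t \<epsilon> l m = comb_scale (D m / D l)
 (SUM p:closed_words l. comb_scale (sg p * sg (qw m)) (e_basis (wpath l p) (wpath m (qw m))))"
proof -
 have "(SUM p:closed_sos_paths N L l. comb_scale ((- \<epsilon>) ^ (sos_length p + sos_length (wpath m (qw m)))) (e_basis p (wpath m (qw m)))) =
  (SUM p:closed_words l. comb_scale ((- \<epsilon>) ^ (ascents p + ascents (qw m))) (e_basis (wpath l p) (wpath m (qw m))))"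
 unfolding closed_sos_paths_eq[OF l]
 by (subst sum.reindex) (auto simp only: inj_on_def wpath_inject sos_length_wpath o_def)
 also have "... = (SUM p:closed_words l. comb_scale (sg p * sg (qw m)) (e_basis (wpath l p) (wpath m (qw m))))"
 proof (rule sum.cong[OF refl])
 fix p assume p: "p : closed_words l"
 have "sg p = (- \<epsilon>) ^ ascents p" using closed_wordsD(2)[OF p] by (simp add: sg_def)
 moreover have "sg (qw m) = (- \<epsilon>) ^ ascents (qw m)" using closed_wordsD(2)[OF qw(1)[OF m]] by (simp add: sg_def)
 ultimately show "comb_scale ((- \<epsilon>) ^ (ascents p + ascents (qw m))) (e_basis (wpath l p) (wpath m (qw m))) =
  comb_scale (sg p * sg (qw m)) (e_basis (wpath l p) (wpath m (qw m)))" by (simp only: power_add)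
 qed
 finally show ?thesis unfolding sos_det_comp_def Let_def qw(2)[OF m] by simp
qed

lemma closed_e_in:
 assumes p: "p : closed_words l" and q: "q : closed_words m"
 shows "e_basis (wpath l p) (wpath m q) : carrier H"
proof (rule e_word_in[OF closed_wordsD(1)[OF p] closed_wordsD(1)[OF q]])
 show "length p = length q" using closed_wordsD(4)[OF p] closed_wordsD(4)[OF q] by (simp only:)
qed

lemma det_comp_in:
 assumes l: "l : V" and m: "m : V"
 shows "sos_det_comp N L t \<epsilon> l m : carrier H"
 unfolding det_comp_expand[OF assms]
 by (intro H_scale_in H_sum_in closed_e_in qw(1)[OF m])

lemma form_det_comp:
 assumes xi: "linear_form H xi" and l: "l : V" and m: "m : V"
 shows "xi (sos_det_comp N L t \<epsilon> l m) = D m / D l * (sg (qw m) * detf xi l m (qw m))"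
proof -
 have e: "e_basis (wpath l p) (wpath m (qw m)) : carrier H" if "p : closed_words l" for p
 by (rule closed_e_in[OF that qw(1)[OF m]])
 have "xi (sos_det_comp N L t \<epsilon> l m) = D m / D l * xi (SUM p:closed_words l. comb_scale (sg p * sg (qw m)) (e_basis (wpath l p) (wpath m (qw m))))"
 unfolding det_comp_expand[OF l m] by (rule linear_form_H_scale[OF xi]) (intro H_sum_in H_scale_in e)
 also have "... = D m / D l * (sg (qw m) * detf xi l m (qw m))"
 proof -
 have "xi (SUM p:closed_words l. comb_scale (sg p * sg (qw m)) (e_basis (wpath l p) (wpath m (qw m)))) =
  (SUM p:closed_words l. sg p * sg (qw m) * xi (e_basis (wpath l p) (wpath m (qw m))))"
  by (rule linear_form_H_lincomb[OF xi e])
 then show ?thesis unfolding detf_def sum_distrib_left by (simp only: mult_ac sum_distrib_left)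
 qed
 finally show ?thesis .
qed

abbreviation "det \<equiv> sos_det N L t \<epsilon>"

lemma det_in: "det : carrier H"
 unfolding sos_det_def by (intro H_sum_in det_comp_in)

lemma form_det:
 assumes xi: "linear_form H xi"
 shows "xi det = (SUM l:V. SUM m:V. xi (sos_det_comp N L t \<epsilon> l m))"
proof -
 have "xi det = (SUM l:V. xi (SUM m:V. sos_det_comp N L t \<epsilon> l m))"
 unfolding sos_det_def by (rule linear_form_H_sum[OF xi]) (intro H_sum_in det_comp_in)
 also have "... = (SUM l:V. SUM m:V. xi (sos_det_comp N L t \<epsilon> l m))"
 by (rule sum.cong[OF refl], rule linear_form_H_sum[OF xi]) (rule det_comp_in)
 finally show ?thesis .
qed

lemma one_in: "\<one>\<^bsub>H\<^esub> : carrier H"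
 by (rule monoid.one_closed[OF ring.is_monoid[OF H_ring]])

lemma vertex_in: "i : V ==> j : V ==> e_basis (i, []) (j, []) : carrier H"
 using e_word_in[of i "[]" j "[]"] by (simp add: wpath_def)

lemma form_one:
 assumes xi: "linear_form H xi"
 shows "xi \<one>\<^bsub>H\<^esub> = (SUM i:V. SUM j:V. xi (e_basis (i, []) (j, [])))"
proof -
 have "xi \<one>\<^bsub>H\<^esub> = (SUM i:V. xi (SUM j:V. e_basis (i, []) (j, [])))"
 unfolding H_simps(3) G_simps(1) by (rule linear_form_H_sum[OF xi]) (intro H_sum_in vertex_in)
 also have "... = (SUM i:V. SUM j:V. xi (e_basis (i, []) (j, [])))"
 by (rule sum.cong[OF refl], rule linear_form_H_sum[OF xi]) (rule vertex_in)
 finally show ?thesis .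
qed

end

section \<open>The SOS algebra\<close>

lemma sum2_delta:
 assumes "finite A" "a : A" "b : A"
 shows "(SUM x:A. SUM y:A. if a = x & b = y then f x y else 0) = (f a b :: 'c::comm_monoid_add)"
proof -
 have "(SUM x:A. SUM y:A. if a = x & b = y then f x y else 0) = (SUM x:A. if x = a then f a b else 0)"
 proof (rule sum.cong[OF refl])
 fix x assume "x : A"
 show "(SUM y:A. if a = x & b = y then f x y else 0) = (if x = a then f a b else 0)"
  using assms by (cases "x = a") simp_all
 qed
 then show ?thesis using assms by simp
qed

lemma if_bool_conj: "(if P & Q then a else b) = (if P then if Q then a else b else b)"
 by simp

lemma if_equal_labels:
 "(if (i = j & x = x) & i = k & j = l then 1 else 0) = (if k = i & k = j then if k = l then 1 else 0 else (0 :: complex))"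
proof -
 have "((i = j & x = x) & i = k & j = l) = ((k = i & k = j) & k = l)" by metis
 then show ?thesis unfolding if_bool_conj[of "k = i & k = j", symmetric] by (rule arg_cong)
qed

context sos
begin

abbreviation "J \<equiv> face_ideal G (sw 1)"
abbreviation "AA \<equiv> sos_weight_alg N L t \<epsilon>"
abbreviation "pA \<equiv> weight_proj G (sw 1)"

lemma J_biideal: "biideal H J"
 by (rule biideal_face_ideal[OF sw_supported])

lemma A_path_quotient: "path_quotient G AA pA"
proof -
 have "path_quotient G (quotient_face_alg H J) (%f. J +>\<^bsub>H\<^esub> f)"
 by (rule path_quotient.path_quotient_quotient[OF path_quotient_H J_biideal])
 then show ?thesis unfolding sos_weight_alg_def weight_face_alg_def weight_proj_def[abs_def] .
qed

sublocale A: path_quotient G AA pA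
 by (rule A_path_quotient)

lemma H_biideal_quotient: "biideal_quotient (verts G) H J"
 unfolding biideal_quotient_def biideal_quotient_axioms_def using H_face_algebra J_biideal by blast

lemma pA_J: "z : J ==> pA z = \<zero>\<^bsub>AA\<^esub>"
 using biideal_quotient.pr_I[OF H_biideal_quotient, of z] A.pi_zero by (simp add: weight_proj_def H_simps(4))

lemma form_A:
 assumes "linear_form AA X"
 shows "linear_form H (%f. X (pA f))" "z : J ==> X (pA z) = 0"
 using A.linear_form_pi A.linear_form_Q_zero pA_J assms by simp_all

abbreviation "gS \<equiv> pA det \<ominus>\<^bsub>AA\<^esub> \<one>\<^bsub>AA\<^esub>"
abbreviation "SI \<equiv> sos_ideal N L t \<epsilon>"

lemma sos_ideal_eq: "SI = Idl\<^bsub>AA\<^esub> {gS}"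
 by (simp only: sos_ideal_def)

lemma one_A: "\<one>\<^bsub>AA\<^esub> = pA \<one>\<^bsub>H\<^esub>"
 by (rule A.pi_one[symmetric])

lemma gS_in: "gS : carrier AA"
 unfolding one_A
 by (rule abelian_group.minus_closed[OF A.A_abelian_group A.pi_in[OF det_in] A.pi_in[OF one_in]])

lemma form_gS:
 assumes X: "linear_form AA X"
 shows "X gS = X (pA det) - X (pA \<one>\<^bsub>H\<^esub>)"
 unfolding one_A by (rule A.form_minus[OF X A.pi_in[OF det_in] A.pi_in[OF one_in]])

lemma mul_vertex_det:
 assumes "l : V" "m : V"
 shows "mul (e_basis (l, []) (m, [])) det = sos_det_comp N L t \<epsilon> l m"
proof -
 have z: "comb_scale c 0 = 0" for c by (rule poly_mapping_eqI) simp
 have "mul (e_basis (l, []) (m, [])) (sos_det_comp N L t \<epsilon> l' m') =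
  (if l = l' & m = m' then sos_det_comp N L t \<epsilon> l' m' else 0)" if "l' : V" "m' : V" for l' m'
 unfolding det_comp_expand[OF that] mul_scale_right mul_sum_right mul_vertex_left wpath_simps
 by (cases "l = l' & m = m'") (simp_all only: if_True if_False simp_thms z sum.neutral_const)
 then have "mul (e_basis (l, []) (m, [])) det = (SUM l':V. SUM m':V. if l = l' & m = m' then sos_det_comp N L t \<epsilon> l' m' else 0)"
 unfolding sos_det_def mul_sum_right by (intro sum.cong[OF refl]) blast
 also have "... = sos_det_comp N L t \<epsilon> l m" by (rule sum2_delta[OF finite_V assms])
 finally show ?thesis .
qed

lemma wpath_eq_iff: "wpath l v = wpath m w \<longleftrightarrow> l = m & v = w"
proof
 assume e: "wpath l v = wpath m w"
 have "l = m" using arg_cong[OF e, of fst] by simp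
 then show "l = m & v = w" using e by simp
qed simp

lemma finite_words: "finite {w. valid l w & length w = n}"
 by (rule finite_subset[OF _ finite_lists_length_eq[of I n]]) (use valid_letters in auto)

lemma sum_paths_words:
 "(SUM r:paths G n. F r) = (SUM m:V. SUM w:{w. valid m w & length w = n}. F (wpath m w))"
proof -
 have e: "paths G n = (%(m, w). wpath m w) ` (SIGMA m:V. {w. valid m w & length w = n})"
 proof (intro equalityI subsetI)
 fix p assume p: "p : paths G n"
 obtain w where w: "p = wpath (fst p) w" "valid (fst p) w" "length w = n" using path_wpath[OF p] .
 have "(fst p, w) : (SIGMA m:V. {w. valid m w & length w = n})" using w(2,3) valid_V(1)[OF w(2)] by blast
 then show "p : (%(m, w). wpath m w) ` (SIGMA m:V. {w. valid m w & length w = n})"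
  using w(1) by (metis (mono_tags, lifting) case_prod_conv image_eqI)
 next
 fix p assume "p : (%(m, w). wpath m w) ` (SIGMA m:V. {w. valid m w & length w = n})"
 then obtain x where x: "x : (SIGMA m:V. {w. valid m w & length w = n})" "p = (%(m, w). wpath m w) x" by (rule imageE)
 obtain m w where mw: "x = (m, w)" by (cases x)
 have w: "p = wpath m w" "valid m w" "length w = n" using x unfolding mw by simp_all
 show "p : paths G n" using wpath_in[OF w(2)] unfolding w(1,3) .
 qed
 have inj: "inj_on (%(m, w). wpath m w) (SIGMA m:V. {w. valid m w & length w = n})"
 proof (rule inj_onI, clarify)
 fix m w m' w' assume e: "wpath m w = wpath m' w'"
 then show "m = m' & w = w'" unfolding wpath_eq_iff .
 qed
 show ?thesis unfolding e sum.reindex[OF inj]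
 by (subst sum.Sigma) (auto simp: finite_V finite_words intro!: sum.cong)
qed

lemma sum_closed:
 "(SUM w:{w. valid m w & length w = N}. sg w * f w) = (SUM w:closed_words m. sg w * f w)"
proof (rule sum.mono_neutral_right[OF finite_words])
 show "closed_words m \<subseteq> {w. valid m w & length w = N}" using closed_wordsD(1,4) by blast
 show "ALL w:{w. valid m w & length w = N} - closed_words m. sg w * f w = 0"
 using distinct_closed by (auto simp: sg_def)
qed

text \<open>The coproduct of the \<open>(l, m)\<close> component of the determinant is the sum over \<open>n\<close> of its \<open>(l, n)\<close> component
  times its \<open>(n, m)\<close> component, because the sum over the intermediate words is antisymmetric in them and hence reduces to closed words.
  Modulo the ideal each component equals the matrix unit of its vertices, so the determinant behaves like the unit.\<close>

theorem S_biideal: "biideal AA SI"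
 unfolding sos_ideal_eq
proof (rule A.biideal_genideal)
 show "{gS} \<subseteq> carrier AA" using gS_in by simp
next
 fix g k l assume g: "g : {gS}" and k: "k : verts G" and l: "l : verts G"
 define X where "X a = counit AA (face_idem_ring AA k \<otimes>\<^bsub>AA\<^esub> (a \<otimes>\<^bsub>AA\<^esub> face_idem AA l))" for a
 have X: "linear_form AA X" unfolding X_def
 by (rule A.linear_form_mult_left[OF A.linear_form_mult_right[OF A.counit_linear A.idem_ring_closed[OF k]] A.idem_closed[OF l]])
 define xi where "xi f = X (pA f)" for f
 have xi: "linear_form H xi" unfolding xi_def by (rule form_A(1)[OF X])
 have Xf: "xi f = counit H (mul (face_idem_ring H k) (mul f (face_idem H l)))" if f: "f : carrier H" for f
 unfolding xi_def X_def A.pi_idem(1)[OF l] A.pi_idem(2)[OF k]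
  A.pi_mult[OF f H_idem_in(1)[OF l], symmetric]
  A.pi_mult[OF H_idem_in(2)[OF k] mul_in[OF f H_idem_in(1)[OF l]], symmetric]
 by (rule A.pi_counit[OF mul_in[OF H_idem_in(2)[OF k] mul_in[OF f H_idem_in(1)[OF l]]]])
 have Xe: "xi (e_basis p q) = (if p = q & fst p = k & path_end G q = l then 1 else 0)"
 if "p : paths G n" "q : paths G n" for p q n
 proof -
 have "xi (e_basis p q) = counit H (mul (face_idem_ring H k) (mul (e_basis p q) (face_idem H l)))"
  by (rule Xf[OF e_basis_carrier[OF path_pairsI[OF that]]])
 then show ?thesis using linear_form_H_zero[OF H_counit_linear] mul_idem_right[OF that] mul_idem_ring_left[OF that]
  by (cases "path_end G q = l"; cases "fst p = k") simp_all
 qed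
 have comp: "xi (sos_det_comp N L t \<epsilon> l' m') = (if k = l' & k = m' then if k = l then 1 else 0 else 0)"
 if l': "l' : V" and m': "m' : V" for l' m'
 proof -
 let ?q = "qw m'"
 note q = closed_wordsD[OF qw(1)[OF m']]
 have qp: "wpath m' ?q : paths G N" using wpath_in[OF q(1)] unfolding q(4) .
 have "detf xi l' m' ?q = (SUM p:closed_words l'. if p = ?q then if k = l' & k = m' then if k = l then sg ?q else 0 else 0 else 0)"
  unfolding detf_def
 proof (rule sum.cong[OF refl])
  fix p assume p: "p : closed_words l'"
  have pp: "wpath l' p : paths G N" using wpath_in[OF closed_wordsD(1)[OF p]] unfolding closed_wordsD(4)[OF p] .
  have *: "xi (e_basis (wpath l' p) (wpath m' ?q)) = (if (l' = m' & p = ?q) & l' = k & m' = l then 1 else 0)"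
  unfolding Xe[OF pp qp] wpath_end q(5) wpath_simps(1) wpath_eq_iff ..
  show "sg p * xi (e_basis (wpath l' p) (wpath m' ?q)) =
   (if p = ?q then if k = l' & k = m' then if k = l then sg ?q else 0 else 0 else 0)"
  proof (cases "p = ?q")
  case True
  have "x * (if (l' = m' & True) & l' = k & m' = l then 1 else 0) =
   (if k = l' & k = m' then if k = l then x else 0 else 0)" for x :: complex
   by (cases "k = l'"; cases "k = m'"; cases "k = l") auto
  then show ?thesis unfolding * unfolding True by (simp only: simp_thms if_True)
  next
  case False
  then show ?thesis unfolding * by (simp only: simp_thms if_False mult_zero_right)
  qed
 qed
 also have "... = (if k = l' & k = m' then if k = l then sg ?q else 0 else 0)"
 proof (cases "k = l' & k = m'")
  case True
  have "(SUM p:closed_words l'. if p = ?q then c else 0) = (if ?q : closed_words l' then c else 0 :: complex)" for c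
  by (rule sum.delta[OF finite_closed_words])
  moreover have "?q : closed_words l'" using qw(1)[OF m'] True by metis
  ultimately show ?thesis using True by (simp only: simp_thms if_True)
 next
  case False
  then show ?thesis by (simp only: simp_thms if_False if_cancel sum.neutral_const)
 qed
 finally have d: "detf xi l' m' ?q = (if k = l' & k = m' then if k = l then sg ?q else 0 else 0)" .
 show ?thesis
 proof (cases "k = l' & k = m'")
  case True
  then have e: "l' = m'" by metis
  have "D m' / D m' * (sg ?q * (if k = l then sg ?q else 0)) = (if k = l then 1 else 0)"
  using sg_square[OF q(2)] D_nz[OF m'] by simp
  then show ?thesis unfolding form_det_comp[OF xi l' m'] d if_P[OF True] unfolding e .
 next
  case False
  show ?thesis unfolding form_det_comp[OF xi l' m'] d if_not_P[OF False] by (simp only: mult_zero_right)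
 qed
 qed
 have "xi det = (if k = l then 1 else 0)"
 unfolding form_det[OF xi] using sum2_delta[OF finite_V, of k k "%_ _. if k = l then 1 else 0 :: complex"] k comp
 by (simp only: G_simps(1) cong: sum.cong)
 moreover have "xi \<one>\<^bsub>H\<^esub> = (SUM i:V. SUM j:V. if k = i & k = j then if k = l then 1 else 0 else 0)"
 unfolding form_one[OF xi]
 proof (intro sum.cong[OF refl])
 fix i j assume "i : V" "j : V"
 then have v: "(i, []) : paths G 0" "(j, []) : paths G 0" by (simp_all add: path_Nil_iff)
 show "xi (e_basis (i, []) (j, [])) = (if k = i & k = j then if k = l then 1 else 0 else 0)"
  unfolding Xe[OF v] path_end_Nil prod.inject fst_conv by (rule if_equal_labels)
 qed
 ultimately have "X gS = 0"
 unfolding form_gS[OF X] xi_def[symmetric] using sum2_delta[OF finite_V, of k k "%_ _. if k = l then 1 else 0 :: complex"] k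
 by (simp only: G_simps(1) diff_self)
 then show "counit AA (face_idem_ring AA k \<otimes>\<^bsub>AA\<^esub> (g \<otimes>\<^bsub>AA\<^esub> face_idem AA l)) = 0" using g by (simp only: X_def singleton_iff)
next
 fix g B assume g: "g : {gS}" and B: "bilinear_form AA B"
 and van: "!!z y. z : Idl\<^bsub>AA\<^esub> {gS} ==> y : carrier AA ==> B z y = 0 & B y z = 0"
 define B' where "B' f f' = B (pA f) (pA f')" for f f'
 have B': "bilinear_form H B'" unfolding B'_def using A.bilinear_form_pi B by blast
 let ?d = "sos_det_comp N L t \<epsilon>" and ?e = "%l m. e_basis (l, []) (m, [])"
 have vanJ: "B' z y = 0" if "z : J" "y : carrier H" for z y
 using form_A(2)[OF bilinear_form_left[OF B A.pi_in[OF that(2)]] that(1)] by (simp add: B'_def)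
 have corner: "B' (?d l m) y = B' (?e l m) y" "B' y (?d l m) = B' y (?e l m)"
 if lm: "l : V" "m : V" and y: "y : carrier H" for l m y
 proof -
 note e = vertex_in[OF lm] and y' = A.pi_in[OF y]
 have I: "ideal (Idl\<^bsub>AA\<^esub> {gS}) AA" by (rule ring.genideal_ideal[OF A.A_ring]) (use gS_in in simp)
 have "gS : Idl\<^bsub>AA\<^esub> {gS}" using ring.genideal_self[OF A.A_ring, of "{gS}"] gS_in by simp
 from ideal.I_l_closed[OF I this A.pi_in[OF e]] have z: "pA (?e l m) \<otimes>\<^bsub>AA\<^esub> gS : Idl\<^bsub>AA\<^esub> {gS}" .
 have d: "pA (?e l m) \<otimes>\<^bsub>AA\<^esub> pA det = pA (?d l m)" "pA (?e l m) \<otimes>\<^bsub>AA\<^esub> pA \<one>\<^bsub>H\<^esub> = pA (?e l m)"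
  unfolding A.pi_mult[OF e det_in, symmetric] A.pi_mult[OF e one_in, symmetric] mul_vertex_det[OF lm]
  using monoid.r_one[OF ring.is_monoid[OF H_ring] e] by (simp_all only: H_simps(2))
 have "B (pA (?e l m) \<otimes>\<^bsub>AA\<^esub> gS) (pA y) = 0" "B (pA y) (pA (?e l m) \<otimes>\<^bsub>AA\<^esub> gS) = 0" using van[OF z y'] by blast+
 then show "B' (?d l m) y = B' (?e l m) y" "B' y (?d l m) = B' y (?e l m)"
  unfolding form_gS[OF A.linear_form_mult_right[OF bilinear_form_left[OF B y'] A.pi_in[OF e]]]
  form_gS[OF A.linear_form_mult_right[OF bilinear_form_right[OF B y'] A.pi_in[OF e]]] d B'_def
  by (simp_all only: right_minus_eq)
 qed
 have co: "comult H (?d l m) B' = (SUM n:V. B' (?d l n) (?d n m))" if l: "l : V" and m: "m : V" for l m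
 proof -
 define xi where "xi f = comult H f B'" for f
 have xi: "linear_form H xi" unfolding xi_def by (rule linear_form_H_comult)
 let ?q = "wpath m (qw m)"
 let ?b = "%n p w. B' (e_basis (wpath l p) (wpath n (qw n))) (e_basis (wpath n w) ?q)"
 have "detf xi l m (qw m) = (SUM p:closed_words l. sg p * (SUM r:paths G N. B' (e_basis (wpath l p) r) (e_basis r ?q)))"
  unfolding detf_def xi_def
 proof (rule sum.cong[OF refl])
  fix p assume p: "p : closed_words l"
  have pp: "wpath l p : paths G N" using wpath_in[OF closed_wordsD(1)[OF p]] unfolding closed_wordsD(4)[OF p] .
  show "sg p * comult H (e_basis (wpath l p) ?q) B' = sg p * (SUM r:paths G N. B' (e_basis (wpath l p) r) (e_basis r ?q))"
  unfolding H_comult_basis[OF B' pp] ..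
 qed
 also have "... = (SUM r:paths G N. SUM p:closed_words l. sg p * B' (e_basis (wpath l p) r) (e_basis r ?q))"
  unfolding sum_distrib_left by (rule sum.swap)
 also have "... = (SUM n:V. SUM w:{w. valid n w & length w = N}. detf (%f. B' f (e_basis (wpath n w) ?q)) l n w)"
  unfolding sum_paths_words detf_def ..
 also have "... = (SUM n:V. SUM w:closed_words n. sg w * (sg (qw n) * (SUM p:closed_words l. sg p * ?b n p w)))"
 proof (rule sum.cong[OF refl])
  fix n assume n: "n : V"
  have "(SUM w:{w. valid n w & length w = N}. detf (%f. B' f (e_basis (wpath n w) ?q)) l n w) =
   (SUM w:{w. valid n w & length w = N}. sg w * (sg (qw n) * detf (%f. B' f (e_basis (wpath n w) ?q)) l n (qw n)))"
  proof (rule sum.cong[OF refl])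
  fix w assume "w : {w. valid n w & length w = N}"
  then have w: "valid n w" "length w = N" by auto
  have y: "e_basis (wpath n w) ?q : carrier H"
   by (rule e_word_in[OF w(1) closed_wordsD(1)[OF qw(1)[OF m]]]) (simp only: w(2) closed_wordsD(4)[OF qw(1)[OF m]])
  show "detf (%f. B' f (e_basis (wpath n w) ?q)) l n w = sg w * (sg (qw n) * detf (%f. B' f (e_basis (wpath n w) ?q)) l n (qw n))"
   by (rule detf_value[OF bilinear_form_left[OF B' y] vanJ[OF _ y] w qw(1)[OF n]])
  qed
  then show "(SUM w:{w. valid n w & length w = N}. detf (%f. B' f (e_basis (wpath n w) ?q)) l n w) =
   (SUM w:closed_words n. sg w * (sg (qw n) * (SUM p:closed_words l. sg p * ?b n p w)))"
  unfolding sum_closed detf_def .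
 qed
 finally have A: "comult H (?d l m) B' = D m / D l * (sg (qw m) *
  (SUM n:V. SUM w:closed_words n. sg w * (sg (qw n) * (SUM p:closed_words l. sg p * ?b n p w))))"
  using form_det_comp[OF xi l m] by (simp only: xi_def)
 have "B' (?d l n) (?d n m) = D m / D l * (sg (qw m) *
  (SUM w:closed_words n. sg w * (sg (qw n) * (SUM p:closed_words l. sg p * ?b n p w))))" if n: "n : V" for n
 proof -
  have "B' (?d l n) (?d n m) = D n / D l * (sg (qw n) * (SUM p:closed_words l. sg p * B' (e_basis (wpath l p) (wpath n (qw n))) (?d n m)))"
  using form_det_comp[OF bilinear_form_left[OF B' det_comp_in[OF n m]] l n] by (simp only: detf_def)
  also have "(SUM p:closed_words l. sg p * B' (e_basis (wpath l p) (wpath n (qw n))) (?d n m)) =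
   (SUM p:closed_words l. sg p * (D m / D n * (sg (qw m) * (SUM w:closed_words n. sg w * ?b n p w))))"
  proof (rule sum.cong[OF refl])
  fix p assume p: "p : closed_words l"
  show "sg p * B' (e_basis (wpath l p) (wpath n (qw n))) (?d n m) = sg p * (D m / D n * (sg (qw m) * (SUM w:closed_words n. sg w * ?b n p w)))"
   using form_det_comp[OF bilinear_form_right[OF B' closed_e_in[OF p qw(1)[OF n]]] n m] by (simp only: detf_def)
  qed
  also have "... = D m / D n * (sg (qw m) * (SUM p:closed_words l. SUM w:closed_words n. sg p * (sg w * ?b n p w)))"
  by (simp only: sum_distrib_left mult_ac)
  also have "(SUM p:closed_words l. SUM w:closed_words n. sg p * (sg w * ?b n p w)) =
   (SUM w:closed_words n. sg w * (SUM p:closed_words l. sg p * ?b n p w))"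
  by (subst sum.swap) (simp only: sum_distrib_left mult_ac)
  finally have e: "B' (?d l n) (?d n m) = D n / D l * (sg (qw n) * (D m / D n * (sg (qw m) *
   (SUM w:closed_words n. sg w * (SUM p:closed_words l. sg p * ?b n p w)))))" .
  have f: "(SUM w:closed_words n. sg w * (sg (qw n) * (SUM p:closed_words l. sg p * ?b n p w))) =
   sg (qw n) * (SUM w:closed_words n. sg w * (SUM p:closed_words l. sg p * ?b n p w))"
  by (subst sum_distrib_left) (simp only: mult_ac)
  show ?thesis unfolding e f using D_nz[OF n] D_nz[OF l] by simp
 qed
 then show ?thesis unfolding A by (simp only: sum_distrib_left[symmetric] cong: sum.cong)
 qed
 have one: "comult H \<one>\<^bsub>H\<^esub> B' = (SUM l:V. SUM m:V. SUM n:V. B' (?e l n) (?e n m))"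
 unfolding form_one[OF linear_form_H_comult]
 proof (intro sum.cong[OF refl])
 fix l m assume "l : V" "m : V"
 then have "(l, []) : paths G 0" by (simp add: path_Nil_iff)
 then show "comult H (?e l m) B' = (SUM n:V. B' (?e l n) (?e n m))"
  using H_comult_basis[OF B'] sum_paths_0 by (simp only: G_simps(1))
 qed
 have "comult H det B' = (SUM l:V. SUM m:V. SUM n:V. B' (?d l n) (?d n m))"
 unfolding form_det[OF linear_form_H_comult] by (intro sum.cong[OF refl] co)
 also have "... = comult H \<one>\<^bsub>H\<^esub> B'" unfolding one
 proof (intro sum.cong[OF refl])
 fix l m n assume v: "l : V" "m : V" "n : V"
 show "B' (?d l n) (?d n m) = B' (?e l n) (?e n m)"
  unfolding corner(1)[OF v(1,3) det_comp_in[OF v(3,2)]] corner(2)[OF v(3,2) vertex_in[OF v(1,3)]] ..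
 qed
 finally have eq: "comult H det B' = comult H \<one>\<^bsub>H\<^esub> B'" .
 have "comult AA gS B = comult AA (pA det) B - comult AA (pA \<one>\<^bsub>H\<^esub>) B"
 by (rule form_gS[OF A.linear_form_comult[OF B]])
 also have "... = 0" unfolding A.pi_comult[OF det_in B] A.pi_comult[OF one_in B] using eq unfolding B'_def by (simp only: diff_self)
 finally show "comult AA g B = 0" using g by simp
qed

abbreviation "SS \<equiv> sos_algebra N L t \<epsilon>"
abbreviation "pS \<equiv> %f. SI +>\<^bsub>AA\<^esub> pA f"

lemma S_path_quotient: "path_quotient G SS pS"
 unfolding sos_algebra_def by (rule A.path_quotient_quotient[OF S_biideal])

sublocale S: path_quotient G SS pS
 by (rule S_path_quotient)

section \<open>The value of a transfer matrix on the determinant\<close>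

definition qm :: "weight => nat => nat => complex" where
 "qm m i x = - (\<lbrakk>sos_d m i x + 1\<rbrakk> / \<lbrakk>sos_d m i x\<rbrakk>)"

lemma sg_last: "sg (w @ u @ [i]) = (- \<epsilon>) ^ length u * sg (w @ i # u)" if "i \<notin> set u"
 using that
proof (induction u arbitrary: w)
 case (Cons a u)
 have "sg (w @ (a # u) @ [i]) = (- \<epsilon>) ^ length u * sg (w @ a # i # u)" using Cons.IH[of "w @ [a]"] Cons.prems by simp
 also have "sg (w @ a # i # u) = - \<epsilon> * sg (w @ i # a # u)" using sg_swap[of i a w u] Cons.prems by simp
 finally show ?case by simp
qed simp

lemma frac1:
 assumes "a ~= 0" "b ~= 0" "c ~= 0" and e: "k * c + p * b = r * a"
 shows "(- k / a) * (- k / b) - (p / a) * (- k / c) = - (r / b) * (- k / c :: complex)"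
proof -
 have "(- k / a) * (- k / b) - (p / a) * (- k / c) = k * (k * c + p * b) / (a * b * c)" using assms(1-3) by (simp add: field_simps)
 also have "... = - (r / b) * (- k / c)" unfolding e using assms(1-3) by simp
 finally show ?thesis .
qed

lemma frac2:
 assumes "a ~= 0" "b ~= 0" and e: "k * k * u + p * s * b = r * s * a"
 shows "(k * u / a) * (- k / b) - (p / a) * s = - (r / b) * (s :: complex)"
proof -
 have "(k * u / a) * (- k / b) - (p / a) * s = - (k * k * u + p * s * b) / (a * b)" using assms(1,2) by (simp add: field_simps)
 also have "... = - (r / b) * s" unfolding e using assms(1,2) by simp
 finally show ?thesis .
qed

text \<open>The line of the letter \<open>i\<close> passes the letter \<open>q\<close>; in an antisymmetric functional the two terms of
  the face operator combine to a multiple of the second.\<close>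

lemma pass_coeff:
 assumes m: "m : V" "i : I" "st m i : V" and qb: "q : I" "b : I" "q ~= i" "b ~= q"
 shows "wa (st m i) q b * wa m i q - \<epsilon> * wb (st m i) q b * wa m i b = qm m i q * wa m i b"
proof -
 define s where "s = inverse t"
 have ts: "t * s = 1" "s * t = 1" "t * (s * x) = x" "s * (t * x) = x" for x using t_nz by (simp_all add: s_def)
 define x where "x = (t powi sos_d m i q)\<^sup>2"
 have nz: "\<lbrakk>sos_d m i q\<rbrakk> ~= 0" using qn_d_nz[OF m(1,2) qb(1)] qb by simp
 note A = wa_u(1,3)[OF qb(3)[symmetric] nz x_def] wa_swap(2)[OF qb(3)[symmetric] nz x_def]
 have x1: "x - 1 ~= 0" using A(2) by simp
 have ee: "\<epsilon> * (\<epsilon> * z) = z" for z using eps by auto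
 have e2: "\<epsilon> * (\<epsilon> * z / y) = z / y" for z y using eps by auto
 have dq: "sos_d m q i - 1 = - (sos_d m i q + 1)" unfolding d_swap[of m q i] by simp
 have "wb m q i = \<epsilon> * (\<lbrakk>- (sos_d m i q + 1)\<rbrakk> / \<lbrakk>- sos_d m i q\<rbrakk>)"
 unfolding wb_def if_not_P[OF qb(3)] dq unfolding d_swap[of m q i] ..
 then have "\<epsilon> * wb m q i = - qm m i q" unfolding q_int_minus by (simp add: qm_def ee)
 then have qm: "qm m i q = - ((x * t - s) / (x - 1))" unfolding A(3) e2 s_def by (metis minus_minus)
 show ?thesis
 proof (cases "b = i")
 case True
 have nz': "\<lbrakk>sos_d (st m i) i q\<rbrakk> ~= 0" using qn_d_nz[OF m(3,2) qb(1)] qb by simp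
 have "sos_d (st m i) i q = sos_d m i q + 1" using d_step[OF m(2) m(2) qb(1), of m] qb by simp
 then have u: "x * (t * t) = (t powi sos_d (st m i) i q)\<^sup>2" unfolding x_def by (simp only: u_add) (simp add: power2_eq_square)
 note B = wa_swap[OF qb(3)[symmetric] nz' u] and u1 = wa_u(3)[OF qb(3)[symmetric] nz' u]
 have ne: "x * (t * t) - 1 ~= 0" using u1 by simp
 have "h * h * (x * (t * t)) + (x * (t * t) * t - s) * t * (x - 1) = (x * t - s) * t * (x * (t * t) - 1)"
  unfolding h_def s_def[symmetric] by (simp add: algebra_simps ts)
 from frac2[OF ne x1 this] show ?thesis
  unfolding True B A(1) qm e2 s_def[symmetric] by (simp add: wa_def)
 next
 case False
 define v where "v = (t powi sos_d (st m i) q b)\<^sup>2"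
 have nz': "\<lbrakk>sos_d (st m i) q b\<rbrakk> ~= 0" using qn_d_nz[OF m(3) qb(1,2)] qb by simp
 have nzb: "\<lbrakk>sos_d m i b\<rbrakk> ~= 0" using qn_d_nz[OF m(1,2) qb(2)] False by simp
 have "sos_d (st m i) q b = sos_d m q b" using d_step[OF m(2) qb(1,2), of m] qb False by simp
 then have y: "x * v = (t powi sos_d m i b)\<^sup>2" unfolding x_def v_def by (simp only: u_add[symmetric] d_add)
 note B = wa_u(1,2,3)[OF qb(4)[symmetric] nz' v_def] and C = wa_u(1,3)[OF False[symmetric] nzb y]
 have ne: "v - 1 ~= 0" "x * v - 1 ~= 0" using B(3) C(2) by simp_all
 have "h * (x * v - 1) + (v * s - t) * (x - 1) = (x * t - s) * (v - 1)"
  unfolding h_def s_def[symmetric] by (simp add: algebra_simps ts)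
 from frac1[OF ne(1) x1 ne(2) this] show ?thesis
  unfolding B(1,2) C(1) A(1) qm e2 s_def[symmetric] .
 qed
qed

lemma det_pass:
 assumes m: "m : V" "i : I" "st m i : V"
 and "valid (wend (st m i) dn) (w @ [y])" "distinct (dn @ w)" "i \<notin> set (dn @ w)" "set dn \<subseteq> I"
 and "!!u p. valid (wend (st m i) dn) (u # p) ==> length p = length w ==>
  \<Phi> (wend (st m i) dn, u) (wpath (st (wend (st m i) dn) u) p) = c * wa m i u * sg (dn @ u # p)"
 shows "(SUM x:arcs G. SUM P:paths G (length w). \<Phi> x P * transfer (sw \<zeta>) P (wpath (wend (st m i) dn) w) x (wend (wend (st m i) dn) w, y)) =
 inverse \<zeta> ^ length w * c * prod_list (map (qm m i) w) * wa m i y * sg (dn @ w @ [y])"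
 using assms(4-)
proof (induction w arbitrary: dn c \<Phi>)
 case Nil
 let ?b = "wend (st m i) dn"
 have b: "?b : V" "y : I" "st ?b y : V" using Nil.prems(1) by auto
 have "(SUM x:arcs G. SUM P:paths G 0. \<Phi> x P * transfer (sw \<zeta>) P (?b, []) x (?b, y)) =
  (SUM x:arcs G. if x = (?b, y) then (SUM v:V. if v = st ?b y then \<Phi> (?b, y) (st ?b y, []) else 0) else 0)"
 unfolding sum_paths_0 G_simps(1)
 proof (rule sum.cong[OF refl])
 fix x :: sos_arc
 show "(SUM v:V. \<Phi> x (v, []) * transfer (sw \<zeta>) (v, []) (?b, []) x (?b, y)) =
  (if x = (?b, y) then (SUM v:V. if v = st ?b y then \<Phi> (?b, y) (st ?b y, []) else 0) else 0)"
 proof (cases "x = (?b, y)")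
  case True
  have "\<Phi> x (v, []) * transfer (sw \<zeta>) (v, []) (?b, []) x (?b, y) = (if v = st ?b y then \<Phi> (?b, y) (st ?b y, []) else 0)" for v
  using True by (auto simp: transfer_def)
  then show ?thesis using True by simp
 next
  case False
  then have "\<Phi> x (v, []) * transfer (sw \<zeta>) (v, []) (?b, []) x (?b, y) = 0" for v
  by (simp add: transfer_def)
  then show ?thesis unfolding if_not_P[OF False] by (simp only: sum.neutral_const)
 qed
 qed
 also have "... = \<Phi> (?b, y) (st ?b y, [])" using b finite_V finite_arcs_G by simp
 also have "... = c * wa m i y * sg (dn @ [y])" using Nil.prems(5)[of y "[]"] b by (simp add: wpath_def)
 finally show ?case by (simp add: wpath_def)
next
 case (Cons q w)
 let ?b = "wend (st m i) dn"
 have b: "?b : V" "q : I" "st ?b q : V" and vw: "valid (st ?b q) (w @ [y])" "valid (st ?b q) w"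
 using Cons.prems(1) valid_append[of "st ?b q" w "[y]"] valid_V(1) by auto
 have b': "wend (st m i) (dn @ [q]) = st ?b q" by (simp add: wend_append)
 have s: "(wend (st ?b q) w, y) : arcs G" using vw(1) by (auto simp: valid_append dest: valid_V)
 define \<Phi>' where "\<Phi>' u P = (SUM x:arcs G. SUM c:arcs G. sw \<zeta> x (?b, q) c u * \<Phi> x (path_concat (edge_path G c) P))" for u P
 have "(SUM x:arcs G. SUM P:paths G (length (q # w)). \<Phi> x P * transfer (sw \<zeta>) P (wpath ?b (q # w)) x (wend ?b (q # w), y)) =
  (SUM u:arcs G. SUM P:paths G (length w). \<Phi>' u P * transfer (sw \<zeta>) P (wpath (st ?b q) w) u (wend (st ?b q) w, y))"
 unfolding wpath_Cons list.size(4) add_0_right add_Suc_right wend.simps \<Phi>'_def One_nat_def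
 by (rule transfer_step[OF sw_supported _ wpath_in[OF vw(2)] _ s]) (use b in simp_all)
 also have "... = inverse \<zeta> ^ length w * (inverse \<zeta> * c * qm m i q) * prod_list (map (qm m i) w) * wa m i y * sg ((dn @ [q]) @ w @ [y])"
 unfolding b'[symmetric]
 proof (rule Cons.IH)
 show "valid (wend (st m i) (dn @ [q])) (w @ [y])" unfolding b' by (rule vw)
 show "distinct ((dn @ [q]) @ w)" "i \<notin> set ((dn @ [q]) @ w)" "set (dn @ [q]) \<subseteq> I" using Cons.prems b by auto
 fix u p assume vu: "valid (wend (st m i) (dn @ [q])) (u # p)" and lp: "length p = length w"
 have vu': "valid (st ?b q) (u # p)" using vu unfolding b' .
 have u: "u : I" "valid ?b [q, u]" "valid ?b (q # u # p)" using vu' b valid_V by auto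
 let ?P = "wpath (st (st ?b q) u) p"
 have "\<Phi>' (st ?b q, u) ?P = fop (sw \<zeta>) ?b (%a d. \<Phi> (?b, a) (path_concat (edge_path G (st ?b a, d)) ?P)) q u"
  unfolding \<Phi>'_def by (rule face_sum[OF sw_supported u(2)])
 also have "... = inverse \<zeta> * W ?b (%a d. \<Phi> (?b, a) (path_concat (edge_path G (st ?b a, d)) ?P)) q u"
  by (rule fop_sw[OF u(2)])
 also have "W ?b (%a d. \<Phi> (?b, a) (path_concat (edge_path G (st ?b a, d)) ?P)) q u = c * qm m i q * wa m i u * sg ((dn @ [q]) @ u # p)"
 proof -
  have 1: "\<Phi> (?b, q) (path_concat (edge_path G (st ?b q, u)) ?P) = c * wa m i q * sg (dn @ q # u # p)"
  using Cons.prems(5)[of q "u # p"] u(3) lp unfolding wpath_Cons by simp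
  have 2: "wb ?b q u * \<Phi> (?b, u) (path_concat (edge_path G (st ?b u, q)) ?P) = wb ?b q u * (c * wa m i u * sg (dn @ u # q # p))"
  proof (cases "wb ?b q u = 0")
  case False
  have vv: "valid ?b [u, q]" by (rule swap_valid[OF u(2) False])
  have e: "st (st ?b u) q = st (st ?b q) u" by (rule step_commute[OF u(1) b(2)])
  have "valid ?b (u # q # p)" using vv u(3) e by auto
  then have "\<Phi> (?b, u) (wpath (st ?b u) (q # p)) = c * wa m i u * sg (dn @ u # q # p)" using Cons.prems(5)[of u "q # p"] lp by simp
  then show ?thesis unfolding wpath_Cons e by simp
  qed simp
  show ?thesis
  proof (cases "u = q \<or> u : set dn")
  case True
  then have "sg (dn @ q # u # p) = 0" "sg (dn @ u # q # p) = 0" by (auto simp: sg_def)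
  then show ?thesis unfolding W_def 1 2 by simp
  next
  case False
  have "sos_d ?b q u = sos_d (st m i) q u"
   using wend_d[OF Cons.prems(4) b(2) u(1), of "st m i"] Cons.prems(2) False by auto
  then have ab: "wa ?b q u = wa (st m i) q u" "wb ?b q u = wb (st m i) q u" by (simp_all add: wa_def wb_def)
  have sgs: "sg (dn @ u # q # p) = - \<epsilon> * sg (dn @ q # u # p)" using sg_swap[of q u dn p] False by simp
  have k: "wa (st m i) q u * wa m i q = qm m i q * wa m i u + \<epsilon> * wb (st m i) q u * wa m i u"
   using pass_coeff[OF m b(2) u(1)] Cons.prems(3) False by (simp add: algebra_simps)
  have "wa (st m i) q u * (c * wa m i q * S) + wb (st m i) q u * (c * wa m i u * (- \<epsilon> * S)) =
   c * S * (wa (st m i) q u * wa m i q) - c * S * (\<epsilon> * wb (st m i) q u * wa m i u)" for S by (simp add: algebra_simps)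
  then have fin: "wa (st m i) q u * (c * wa m i q * S) + wb (st m i) q u * (c * wa m i u * (- \<epsilon> * S)) =
   c * qm m i q * wa m i u * S" for S unfolding k by (simp add: algebra_simps)
  show ?thesis unfolding W_def 1 2 unfolding ab sgs append_assoc append_Cons append_Nil by (rule fin)
  qed
 qed
 finally show "\<Phi>' (wend (st m i) (dn @ [q]), u) (wpath (st (wend (st m i) (dn @ [q])) u) p) =
  inverse \<zeta> * c * qm m i q * wa m i u * sg ((dn @ [q]) @ u # p)"
  unfolding b' by (simp add: mult_ac)
 qed
 finally show ?case by (simp add: mult_ac)
qed

text \<open>By antisymmetry it suffices to evaluate at a closed word beginning with the letter \<open>i\<close> of the edge.  The first
  face is then diagonal, and the line of \<open>i\<close> passes all other letters one after the other.\<close>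

lemma detf_transfer:
 assumes m: "m : V" "i : I" "st m i : V" and q: "i # w : closed_words m"
 shows "detf (transfer_form (sw \<zeta>) (m, i) (m, i)) (st m i) m (i # w) =
 inverse \<zeta> ^ N * t * sg (w @ [i]) * prod_list (map (qm m i) w)"
proof -
 let ?r = "(m, i)" and ?l = "st m i" and ?Q = "wpath m (i # w)"
 note cl = closed_wordsD[OF q]
 have rA: "?r : arcs G" using m by simp
 have vw: "valid ?l w" "wend ?l w = m" "length (i # w) = N" using cl by simp_all
 have n: "N = Suc (length w)" using vw(3) by simp
 have pn: "paths G N = paths G (Suc (length w))" by (rule arg_cong[where f = "paths G", OF n])
 define \<Phi> where "\<Phi> x P = (if x = ?r then sg (map snd (snd P)) else 0)" for x :: sos_arc and P :: "(weight, sos_arc) path"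
 define \<Phi>' where "\<Phi>' u P = (SUM x:arcs G. SUM c:arcs G. sw \<zeta> x ?r c u * \<Phi> x (path_concat (edge_path G c) P))" for u P
 have "detf (transfer_form (sw \<zeta>) ?r ?r) ?l m (i # w) = (SUM p:closed_words ?l. sg p * transfer (sw \<zeta>) (wpath ?l p) ?Q ?r ?r)"
 unfolding detf_def transfer_form_basis ..
 also have "... = (SUM p:{p. valid ?l p & length p = N}. sg p * transfer (sw \<zeta>) (wpath ?l p) ?Q ?r ?r)"
 by (rule sum_closed[symmetric])
 also have "... = (SUM n:V. SUM p:{p. valid n p & length p = N}. sg p * transfer (sw \<zeta>) (wpath n p) ?Q ?r ?r)"
 by (rule sum_single[OF finite_V m(3), symmetric]) (auto simp: transfer_def intro!: sum.neutral)
 also have "... = (SUM P:paths G N. sg (map snd (snd P)) * transfer (sw \<zeta>) P ?Q ?r ?r)"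
 unfolding sum_paths_words wpath_simps ..
 also have "... = (SUM x:arcs G. SUM P:paths G N. \<Phi> x P * transfer (sw \<zeta>) P ?Q x ?r)"
 by (rule sum_single[OF finite_arcs_G rA, symmetric, THEN trans[rotated]]) (simp_all add: \<Phi>_def)
 also have "... = (SUM u:arcs G. SUM P:paths G (length w). \<Phi>' u P * transfer (sw \<zeta>) P (wpath ?l w) u ?r)"
 unfolding pn wpath_Cons \<Phi>'_def
 by (rule transfer_step[OF sw_supported rA wpath_in[OF vw(1)] _ rA]) simp
 also have "... = (SUM u:arcs G. SUM P:paths G (length w). \<Phi>' u P * transfer (sw \<zeta>) P (wpath (wend ?l []) w) u (wend (wend ?l []) w, i))"
 by (simp only: wend.simps vw(2))
 also have "... = inverse \<zeta> ^ length w * inverse \<zeta> * prod_list (map (qm m i) w) * wa m i i * sg ([] @ w @ [i])"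
 proof (rule det_pass[OF m])
 show "valid (wend ?l []) (w @ [i])" using vw m by (simp add: valid_append)
 show "distinct ([] @ w)" "i \<notin> set ([] @ w)" "set [] \<subseteq> I" using cl(2) by simp_all
 fix u p assume "valid (wend ?l []) (u # p)" "length p = length w"
 then have vu: "valid m [i, u]" using m valid_V by auto
 have "\<Phi>' (?l, u) (wpath (st ?l u) p) = fop (sw \<zeta>) m (%a d. \<Phi> (m, a) (path_concat (edge_path G (st m a, d)) (wpath (st ?l u) p))) i u"
  unfolding \<Phi>'_def by (rule face_sum[OF sw_supported vu])
 also have "... = inverse \<zeta> * W m (%a d. \<Phi> (m, a) (path_concat (edge_path G (st m a, d)) (wpath (st ?l u) p))) i u"
  by (rule fop_sw[OF vu])
 also have "W m (%a d. \<Phi> (m, a) (path_concat (edge_path G (st m a, d)) (wpath (st ?l u) p))) i u = wa m i u * sg (u # p)"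
  by (cases "u = i") (simp_all add: W_def wb_def \<Phi>_def path_concat_def edge_path_def)
 finally show "\<Phi>' (wend ?l [], u) (wpath (st (wend ?l []) u) p) = inverse \<zeta> * wa m i u * sg ([] @ u # p)" by simp
 qed
 finally show ?thesis by (simp add: n wa_def mult_ac)
qed

lemma D_step:
 assumes m: "m : V" "i : I"
 shows "D (st m i) = D m * (PROD x:I - {i}. - qm m i x)"
proof -
 let ?P = "{(a, b). 1 <= a & a < b & b <= N}"
 let ?g = "%x. - qm m i x" and ?f = "%y. if fst y = i then - qm m i (snd y) else if snd y = i then - qm m i (fst y) else 1"
 have fin: "finite ?P" by (rule finite_subset[of _ "{..N} \<times> {..N}"]) auto
 have "D (st m i) = (PROD y:?P. (\<lbrakk>sos_d m (fst y) (snd y)\<rbrakk> / \<lbrakk>sos_d (%_. 0) (fst y) (snd y)\<rbrakk>) * ?f y)"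
 unfolding sos_D_def case_prod_unfold
 proof (rule prod.cong[OF refl])
 fix y assume "y : {p. 1 <= fst p & fst p < snd p & snd p <= N}"
 then obtain a b where y: "y = (a, b)" "a : I" "b : I" "a < b" by (cases y) auto
 have d: "sos_d (st m i) a b = sos_d m a b + (if i = a then 1 else 0) - (if i = b then 1 else 0)"
  by (rule d_step[OF m(2) y(2,3)])
 have nz: "\<lbrakk>sos_d m a b\<rbrakk> ~= 0" using qn_d_nz[OF m(1) y(2,3)] y(4) by simp
 consider "a = i" | "b = i" "a ~= i" | "a ~= i" "b ~= i" by blast
 then show "\<lbrakk>sos_d (st m i) (fst y) (snd y)\<rbrakk> / \<lbrakk>sos_d (%_. 0) (fst y) (snd y)\<rbrakk> =
  \<lbrakk>sos_d m (fst y) (snd y)\<rbrakk> / \<lbrakk>sos_d (%_. 0) (fst y) (snd y)\<rbrakk> * ?f y"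
 proof cases
  case 1
  then show ?thesis using d nz y(4) by (simp add: y(1) qm_def)
 next
  case 2
  have "sos_d m i a = - sos_d m a b" using 2 by (simp add: d_swap[of m i a])
  then have "\<lbrakk>sos_d m i a + 1\<rbrakk> = - \<lbrakk>sos_d m a b - 1\<rbrakk>" "\<lbrakk>sos_d m i a\<rbrakk> = - \<lbrakk>sos_d m a b\<rbrakk>"
  using q_int_minus[of t "sos_d m a b - 1"] q_int_minus[of t "sos_d m a b"] by simp_all
  then have "- qm m i a = \<lbrakk>sos_d m a b - 1\<rbrakk> / \<lbrakk>sos_d m a b\<rbrakk>" by (simp add: qm_def)
  then show ?thesis using d nz 2 by (simp add: y(1))
 qed (use d in \<open>simp add: y(1)\<close>)
 qed
 also have "... = D m * (PROD y:?P. ?f y)" unfolding prod.distrib sos_D_def case_prod_unfold ..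
 also have "(PROD y:?P. ?f y) = (PROD y:{y : ?P. fst y = i \<or> snd y = i}. ?f y)"
 by (rule prod.mono_neutral_right[OF fin]) auto
 also have "... = (PROD x:I - {i}. ?g x)"
 by (rule prod.reindex_bij_witness[of _ "%x. if x < i then (x, i) else (i, x)" "%y. if fst y = i then snd y else fst y"])
  (use m(2) in auto)
 finally show ?thesis .
qed

lemma step_inject:
 assumes e: "st m a = st m b" and ab: "a : I" "b : I"
 shows "a = b"
proof (rule ccontr)
 assume ne: "a ~= b"
 have "sos_d (st m a) a b = sos_d m a b + 1" using d_step[OF ab(1) ab(1) ab(2), of m] ne by simp
 moreover have "sos_d (st m b) a b = sos_d m a b - 1" using d_step[OF ab(2) ab(1) ab(2), of m] ne by simp
 ultimately show False unfolding e by linarith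
qed

lemma transfer_J: "z : J ==> r : arcs G ==> s : arcs G ==> transfer_form (sw \<zeta>) r s z = 0"
 using path_quotient.transfer_vanish[OF path_quotient_H sw_supported[of \<zeta>], where T = "transfer_form (sw \<zeta>)" and S = "face_relations G (sw 1)"]
 transfer_sw_kills face_relations_in unfolding face_ideal_def by blast

lemma transfer_det:
 assumes r: "r : arcs G" "s : arcs G"
 shows "transfer_form (sw \<zeta>) r s det = (if r = s then inverse \<zeta> ^ N * t * \<epsilon> ^ (N - 1) else 0)"
proof -
 let ?T = "transfer_form (sw \<zeta>) r s"
 obtain m i where ri: "r = (m, i)" by (cases r)
 have m: "m : V" "i : I" "st m i : V" using r(1) by (auto simp: ri)
 have zero: "?T (sos_det_comp N L t \<epsilon> l n) = 0" if ln: "l : V" "n : V" and no: "~ (st m i = l & m = n & s = r)" for l n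
 proof -
 have "transfer (sw \<zeta>) (wpath l p) (wpath n (qw n)) r s = 0" if p: "p : closed_words l" for p
 proof (rule ccontr)
  assume "transfer (sw \<zeta>) (wpath l p) (wpath n (qw n)) r s ~= 0"
  then have e: "st m i = l" "m = n" and tr: "tr (sw \<zeta>) (warcs l p) (warcs n (qw n)) r s ~= 0"
  by (auto simp: transfer_def ri split: if_splits)
  note q = qw(1)[OF ln(2)]
  have "(l, warcs l p) : paths G N" "(n, warcs n (qw n)) : paths G N"
  using wpath_in[OF closed_wordsD(1)[OF p]] wpath_in[OF closed_wordsD(1)[OF q]]
  unfolding closed_wordsD(4)[OF p] closed_wordsD(4)[OF q] wpath_def .
  from tr_support[OF sw_supported this _ _ tr] have "head G s = path_end G (wpath l p)" "tail G s = path_end G (wpath n (qw n))"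
  using e by (auto simp: ri wpath_def)
  then have "head G s = l" "tail G s = n" unfolding wpath_end closed_wordsD(5)[OF p] closed_wordsD(5)[OF q] .
  moreover obtain m' j where sj: "s = (m', j)" by (cases s)
  ultimately have "m' = m" "st m j = st m i" "j : I" using e r(2) by auto
  then have "s = r" using step_inject[OF _ _ m(2)] by (auto simp: sj ri)
  then show False using no e by blast
 qed
 then show ?thesis unfolding form_det_comp[OF transfer_form_linear ln] detf_def transfer_form_basis by simp
 qed
 have "?T det = (SUM l:V. SUM n:V. if st m i = l & m = n then ?T (sos_det_comp N L t \<epsilon> l n) else 0)"
 unfolding form_det[OF transfer_form_linear]
 proof (rule sum.cong[OF refl], rule sum.cong[OF refl])
 fix l n assume ln: "l : V" "n : V"
 show "?T (sos_det_comp N L t \<epsilon> l n) = (if st m i = l & m = n then ?T (sos_det_comp N L t \<epsilon> l n) else 0)"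
 proof (cases "st m i = l & m = n")
  case False
  then have "~ (st m i = l & m = n & s = r)" by blast
  from zero[OF ln this] show ?thesis unfolding if_not_P[OF False] .
 next
  case True
  show ?thesis unfolding if_P[OF True] ..
 qed
 qed
 also have "... = ?T (sos_det_comp N L t \<epsilon> (st m i) m)" by (rule sum2_delta[OF finite_V m(3,1)])
 finally have A: "?T det = ?T (sos_det_comp N L t \<epsilon> (st m i) m)" .
 show ?thesis
 proof (cases "r = s")
 case False
 then show ?thesis unfolding A using zero[OF m(3,1)] by auto
 next
 case True
 obtain w where w: "i # w : closed_words m" using closed_word_exists[of m "[i]"] m by auto
 note cl = closed_wordsD[OF w] and qc = closed_wordsD[OF qw(1)[OF m(1)]]
 let ?d = "detf ?T (st m i) m"
 have "?d (i # w) = sg (i # w) * (sg (qw m) * ?d (qw m))"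
  by (rule detf_value[OF transfer_form_linear transfer_J[OF _ r] cl(1,4) qw(1)[OF m(1)]])
 then have d: "sg (qw m) * ?d (qw m) = sg (i # w) * ?d (i # w)" using sg_square[OF cl(2)] by (simp add: mult.assoc[symmetric])
 have len: "length w = N - 1" using cl(4) by simp
 have s: "sg (i # w) * sg (w @ [i]) = (- \<epsilon>) ^ (N - 1)"
  using sg_last[of i w "[]"] cl(2) sg_square[OF cl(2)] by (simp add: len)
 have "set w = I - {i}" using cl(2,3) by auto
 then have "prod_list (map (qm m i) w) = (PROD x:I - {i}. qm m i x)"
  using prod.distinct_set_conv_list[of w "qm m i"] cl(2) by simp
 also have "... = (PROD x:I - {i}. (- 1) * (- qm m i x))" by simp
 also have "... = (- 1) ^ (N - 1) * (PROD x:I - {i}. - qm m i x)" unfolding prod.distrib using m(2) by simp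
 finally have p: "prod_list (map (qm m i) w) * D m = (- 1) ^ (N - 1) * D (st m i)" unfolding D_step[OF m(1,2)] by simp
 have "?T det = D m / D (st m i) * (sg (i # w) * (inverse \<zeta> ^ N * t * sg (w @ [i]) * prod_list (map (qm m i) w)))"
  unfolding A form_det_comp[OF transfer_form_linear m(3,1)] d using detf_transfer[OF m w, of \<zeta>] True by (simp only: ri)
 also have "... = inverse \<zeta> ^ N * t * (sg (i # w) * sg (w @ [i])) * (prod_list (map (qm m i) w) * D m) / D (st m i)" by simp
 also have "... = inverse \<zeta> ^ N * t * ((- \<epsilon>) ^ (N - 1) * (- 1) ^ (N - 1))" unfolding s p using D_nz[OF m(3)] by simp
 also have "(- \<epsilon>) ^ (N - 1) * (- 1) ^ (N - 1) = \<epsilon> ^ (N - 1)" by (simp add: power_mult_distrib[symmetric])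
 finally show ?thesis using True by simp
 qed
qed

lemma transfer_one:
 assumes r: "r : arcs G"
 shows "transfer_form X r s \<one>\<^bsub>H\<^esub> = (if r = s then 1 else 0)"
proof -
 have "head G r : V" "tail G r : V" using r by (cases r; auto)+
 moreover have "transfer X (i, []) (j, []) r s = (if head G r = i & tail G r = j then if r = s then 1 else 0 else 0)" for i j
 unfolding transfer_def fst_conv snd_conv tr.simps ..
 ultimately show ?thesis unfolding form_one[OF transfer_form_linear] transfer_form_basis
 by (simp only: sum2_delta[OF finite_V])
qed

lemma S_biideal_quotient: "biideal_quotient (verts G) AA SI"
 unfolding biideal_quotient_def biideal_quotient_axioms_def using A.face_algebra_axioms S_biideal by blast

text \<open>This is where the condition on \<open>\<zeta>\<close> enters: it makes the transfer matrix of the determinant the identity.\<close>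

theorem S_functional:
 assumes \<zeta>: "\<zeta> ^ N = \<epsilon> ^ (N - 1) * t" and xy: "x : arcs G" "y : arcs G"
 obtains F where "linear_form SS F" "!!f. f : carrier H ==> F (pS f) = transfer_form (sw \<zeta>) x y f"
proof -
 define P where "P r s F \<longleftrightarrow> linear_form AA F & (ALL f:carrier H. F (pA f) = transfer_form (sw \<zeta>) r s f)" for r s F
 have ex: "EX F. P r s F" if rs: "r : arcs G" "s : arcs G" for r s
 proof -
 obtain F where "linear_form (quotient_face_alg H J) F" "!!f. f : carrier H ==> F (J +>\<^bsub>H\<^esub> f) = transfer_form (sw \<zeta>) r s f"
  using biideal_quotient.form_descends[OF H_biideal_quotient transfer_form_linear[of "sw \<zeta>" r s] transfer_J[OF _ rs]] by metis
 then show ?thesis unfolding P_def sos_weight_alg_def weight_face_alg_def weight_proj_def by blast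
 qed
 define T where "T r s = (SOME F. P r s F)" for r s
 have T: "linear_form AA (T r s)" "!!f. f : carrier H ==> T r s (pA f) = transfer_form (sw \<zeta>) r s f" if "r : arcs G" "s : arcs G" for r s
 using someI_ex[OF ex[OF that]] unfolding T_def P_def by blast+
 have "\<zeta> ^ N ~= 0" using \<zeta> t_nz eps by auto
 then have "inverse \<zeta> ^ N * \<zeta> ^ N = 1" by (simp add: power_inverse)
 then have one: "inverse \<zeta> ^ N * t * \<epsilon> ^ (N - 1) = 1" unfolding \<zeta> by (simp only: mult_ac)
 have g: "T r s gS = 0" if rs: "r : arcs G" "s : arcs G" for r s
 unfolding form_gS[OF T(1)[OF rs]] T(2)[OF rs det_in] T(2)[OF rs one_in] transfer_det[OF rs] transfer_one[OF rs(1)] one by simp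
 have "T x y a = 0" if a: "a : SI" for a
 using A.transfer_vanish[OF sw_supported T(2) _ _ _ xy, of "{gS}" a] g gS_in a unfolding sos_ideal_eq by blast
 then obtain F where F: "linear_form (quotient_face_alg AA SI) F" "!!a. a : carrier AA ==> F (SI +>\<^bsub>AA\<^esub> a) = T x y a"
 using biideal_quotient.form_descends[OF S_biideal_quotient T(1)[OF xy]] by metis
 have "F (pS f) = transfer_form (sw \<zeta>) x y f" if f: "f : carrier H" for f
 using F(2)[OF A.pi_in[OF f]] T(2)[OF xy f] by simp
 then show ?thesis using F(1) that unfolding sos_algebra_def by blast
qed

section \<open>Braidings of the SOS algebra\<close>

lemma W1_lin: "W1 l (%i j k. f i j k - (a * g i j k + b * e i j k)) = (%i j k. W1 l f i j k - (a * W1 l g i j k + b * W1 l e i j k))"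
 by (intro ext) (simp add: W1_def W_def algebra_simps)

lemma W2_lin: "W2 l (%i j k. f i j k - (a * g i j k + b * e i j k)) = (%i j k. W2 l f i j k - (a * W2 l g i j k + b * W2 l e i j k))"
 by (intro ext) (simp add: W2_def W_def algebra_simps)

lemma W1_hecke: "valid l [i, j, k] ==> W1 l (W1 l d) i j k = d i j k + h * W1 l d i j k"
 unfolding W1_def by (rule W_hecke) (auto dest: valid_V)

lemma W2_hecke: "valid l [i, j, k] ==> W2 l (W2 l d) i j k = d i j k + h * W2 l d i j k"
 unfolding W2_def by (rule W_hecke) auto

lemma W1_cancel:
 assumes z: "!!i j k. valid l [i, j, k] ==> W1 l d i j k = 0" and v: "valid l [i, j, k]"
 shows "d i j k = 0"
proof -
 have "W1 l (W1 l d) i j k = W1 l (%i j k. 0) i j k" by (rule W1_cong[OF v z])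
 also have "... = 0" by (simp add: W1_def W_def)
 finally show ?thesis using W1_hecke[OF v, of d] z[OF v] by simp
qed

lemma W2_cancel:
 assumes z: "!!i j k. valid l [i, j, k] ==> W2 l d i j k = 0" and v: "valid l [i, j, k]"
 shows "d i j k = 0"
proof -
 have "W2 l (W2 l d) i j k = W2 l (%i j k. 0) i j k" by (rule W2_cong[OF v z])
 also have "... = 0" by (simp add: W2_def W_def)
 finally show ?thesis using W2_hecke[OF v, of d] z[OF v] by simp
qed

lemma O21_sw:
 assumes v: "valid l [i, j, k]"
 shows "O2 (sw \<zeta>) l (O1 (sw \<zeta>) l g) i j k = inverse \<zeta> * (inverse \<zeta> * W2 l (W1 l g) i j k)"
proof -
 have "O2 (sw \<zeta>) l (O1 (sw \<zeta>) l g) i j k = inverse \<zeta> * W2 l (O1 (sw \<zeta>) l g) i j k" by (rule fop_W'[OF v])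
 also have "W2 l (O1 (sw \<zeta>) l g) i j k = W2 l (%i j k. inverse \<zeta> * W1 l g i j k) i j k"
 by (rule W2_cong[OF v]) (rule fop_W)
 also have "... = inverse \<zeta> * W2 l (W1 l g) i j k" by (rule W2_scale)
 finally show ?thesis .
qed

lemma concat_edges: "path_concat (edge_path G a) (edge_path G b) = edge_pair_path G a b"
 by (simp add: path_concat_def edge_path_def edge_pair_path_def)

lemma edge_weight_eq:
 "r : arcs G ==> q : arcs G ==> p : arcs G ==> s : arcs G ==>
 edge_weight rho r q p s = rho (edge_path G p) (edge_path G q) (edge_path G r) (edge_path G s)"
 unfolding edge_weight_def by (simp del: G_simps)

text \<open>The intertwining relation of \<open>R\<close> on edges, evaluated by the functionals that \<open>S\<close> inherits from the transfer
  matrices of \<open>w\<^sub>\<zeta>\<close>.\<close>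

theorem braiding_relation:
 assumes rm: "rmatrix_pair rho rho'" and com: "S.commutes rho" and \<zeta>: "\<zeta> ^ N = \<epsilon> ^ (N - 1) * t" and v: "valid l [i, j, k]"
 shows "O2 (sw \<zeta>) l (O1 (sw \<zeta>) l (O2 (edge_weight rho) l (words3 l F))) i j k =
 O1 (edge_weight rho) l (O2 (sw \<zeta>) l (O1 (sw \<zeta>) l (words3 l F))) i j k"
proof -
 let ?X = "edge_weight rho" and ?q = "(l, i)" and ?s = "(st l i, j)" and ?y = "(st (st l i) j, k)"
 have X: "face_supported G ?X" by (rule edge_weight_face_supported[OF rm])
 have Xf: "?X a b c d ~= 0 ==> is_face G a b c d" and wf: "sw \<zeta> a b c d ~= 0 ==> is_face G a b c d" for a b c d
 using X sw_supported[of \<zeta>] unfolding face_supported_def by blast+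
 have ar: "?q : arcs G" "?s : arcs G" "?y : arcs G" using v by auto
 have hq: "head G ?q = tail G ?s" by simp
 show ?thesis
 unfolding strip_left[OF sw_supported sw_supported X v, symmetric] strip_right[OF sw_supported sw_supported X v, symmetric]
 proof (rule sum.cong[OF refl], rule sum.cong[OF refl], rule sum.cong[OF refl])
 fix x r p assume a: "x : arcs G" "r : arcs G" "p : arcs G"
 obtain f where f: "linear_form SS f" "!!g. g : carrier H ==> f (pS g) = transfer_form (sw \<zeta>) x ?y g"
  by (rule S_functional[OF \<zeta> a(1) ar(3)]) blast
 have val: "f (S.E (edge_path G b) (edge_path G c) \<otimes>\<^bsub>SS\<^esub> S.E (edge_path G d) (edge_path G e)) =
  (if head G b = tail G d & head G c = tail G e then SUM z:arcs G. sw \<zeta> x c b z * sw \<zeta> z e d ?y else 0)"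
  if bc: "b : arcs G" "c : arcs G" "d : arcs G" "e : arcs G" for b c d e
 proof (cases "head G b = tail G d & head G c = tail G e")
  case True
  have cp: "(b, d) : composable_pairs G" "(c, e) : composable_pairs G"
  using True bc unfolding composable_pairs_iff by blast+
  have in': "e_basis (edge_pair_path G b d) (edge_pair_path G c e) : carrier H"
  by (rule e_basis_carrier[OF path_pairsI[OF edge_pair_in[OF cp(1)] edge_pair_in[OF cp(2)]]])
  show ?thesis
  unfolding S.E_mult[OF edge_path_in[OF bc(1)] edge_path_in[OF bc(2)] edge_path_in[OF bc(3)] edge_path_in[OF bc(4)]]
   edge_path_simps concat_edges if_P[OF True] f(2)[OF in'] transfer_form_basis
  by (rule transfer_pair[OF sw_supported bc(1,3,2,4) ar(3)])
 next
  case False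
  show ?thesis
  unfolding S.E_mult[OF edge_path_in[OF bc(1)] edge_path_in[OF bc(2)] edge_path_in[OF bc(3)] edge_path_in[OF bc(4)]]
   edge_path_simps if_not_P[OF False] by (rule S.linear_form_Q_zero[OF f(1)])
 qed
 have c: "S.com rho 1 1" using com unfolding S.commutes_com by blast
 note main = S.comD[OF c f(1) edge_path_in[OF a(3)] edge_path_in[OF ar(1)] edge_path_in[OF a(2)] edge_path_in[OF ar(2)], unfolded sum_paths_1]
 have L: "(SUM u:arcs G. SUM v:arcs G. ?X r u p v * (SUM z:arcs G. sw \<zeta> x ?q u z * sw \<zeta> z ?s v ?y)) =
  (SUM u:arcs G. SUM v:arcs G. rho (edge_path G p) (edge_path G u) (edge_path G r) (edge_path G v) *
   f (S.E (edge_path G u) (edge_path G ?q) \<otimes>\<^bsub>SS\<^esub> S.E (edge_path G v) (edge_path G ?s)))"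
 proof (rule sum.cong[OF refl], rule sum.cong[OF refl])
  fix u v assume uv: "u : arcs G" "v : arcs G"
  have "?X r u p v = 0" if "~ head G u = tail G v" using Xf[of r u p v] that unfolding is_face_def by blast
  then show "?X r u p v * (SUM z:arcs G. sw \<zeta> x ?q u z * sw \<zeta> z ?s v ?y) =
   rho (edge_path G p) (edge_path G u) (edge_path G r) (edge_path G v) *
   f (S.E (edge_path G u) (edge_path G ?q) \<otimes>\<^bsub>SS\<^esub> S.E (edge_path G v) (edge_path G ?s))"
  unfolding val[OF uv(1) ar(1) uv(2) ar(2)] edge_weight_eq[OF a(2) uv(1) a(3) uv(2)]
  using hq by (cases "head G u = tail G v") (simp_all only: simp_thms if_True if_False mult_zero_left mult_zero_right)
 qed
 have Rr: "(SUM v:arcs G. SUM u:arcs G. ?X v ?q u ?s * (SUM z:arcs G. sw \<zeta> x v r z * sw \<zeta> z u p ?y)) =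
  (SUM u:arcs G. SUM v:arcs G. f (S.E (edge_path G r) (edge_path G v) \<otimes>\<^bsub>SS\<^esub> S.E (edge_path G p) (edge_path G u)) *
   rho (edge_path G u) (edge_path G ?q) (edge_path G v) (edge_path G ?s))"
 proof (subst sum.swap, rule sum.cong[OF refl], rule sum.cong[OF refl])
  fix u v assume uv: "u : arcs G" "v : arcs G"
  have 1: "?X v ?q u ?s = 0" if "~ head G v = tail G u" using Xf[of v ?q u ?s] that unfolding is_face_def by blast
  have 2: "(SUM z:arcs G. sw \<zeta> x v r z * sw \<zeta> z u p ?y) = 0" if "~ head G r = tail G p"
  proof (rule sum.neutral, rule ballI)
  fix z
  show "sw \<zeta> x v r z * sw \<zeta> z u p ?y = 0"
  proof (rule ccontr)
   assume "sw \<zeta> x v r z * sw \<zeta> z u p ?y ~= 0"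
   then have "is_face G x v r z" "is_face G z u p ?y" using wf by (metis mult_eq_0_iff)+
   then have "head G r = tail G p" unfolding is_face_def by metis
   then show False using that by blast
  qed
  qed
  show "?X v ?q u ?s * (SUM z:arcs G. sw \<zeta> x v r z * sw \<zeta> z u p ?y) =
   f (S.E (edge_path G r) (edge_path G v) \<otimes>\<^bsub>SS\<^esub> S.E (edge_path G p) (edge_path G u)) *
   rho (edge_path G u) (edge_path G ?q) (edge_path G v) (edge_path G ?s)"
  unfolding val[OF a(2) uv(2) a(3) uv(1)] edge_weight_eq[OF uv(2) ar(1) uv(1) ar(2), symmetric]
  using 1 2 by (cases "head G v = tail G u"; cases "head G r = tail G p") (simp_all only: simp_thms if_True if_False mult_zero_left mult_zero_right mult.commute)
 qed
 show "(SUM u:arcs G. SUM v:arcs G. ?X r u p v * (SUM z:arcs G. sw \<zeta> x ?q u z * sw \<zeta> z ?s v ?y)) * F x r p =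
  (SUM v:arcs G. SUM u:arcs G. ?X v ?q u ?s * (SUM z:arcs G. sw \<zeta> x v r z * sw \<zeta> z u p ?y)) * F x r p"
  unfolding L Rr main ..
 qed
qed

definition acts where
 "acts X \<alpha> \<beta> l \<longleftrightarrow> (ALL i j f. valid l [i, j] --> fop X l f i j = \<alpha> * f i j + \<beta> * W l f i j)"

lemma actsD: "acts X \<alpha> \<beta> l ==> valid l [i, j] ==> fop X l f i j = \<alpha> * f i j + \<beta> * W l f i j"
 unfolding acts_def by blast

text \<open>By the Yang-Baxter equation the relation says that \<open>w\<^sub>1\<close> and \<open>w\<^sub>2\<close> annihilate the difference of \<open>X\<^sub>2\<close> and \<open>\<alpha> + \<beta> w\<^sub>2\<close>;
  they are invertible by the Hecke relation.\<close>

lemma acts_step: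
 assumes \<zeta>: "\<zeta> ~= 0"
 and rel: "!!F i j k. valid l [i, j, k] ==>
  O2 (sw \<zeta>) l (O1 (sw \<zeta>) l (O2 X l (words3 l F))) i j k = O1 X l (O2 (sw \<zeta>) l (O1 (sw \<zeta>) l (words3 l F))) i j k"
 and act: "acts X \<alpha> \<beta> l" and a: "l : V" "a : I"
 shows "acts X \<alpha> \<beta> (st l a)"
 unfolding acts_def
proof (intro allI impI)
 fix j k f assume vj: "valid (st l a) [j, k]"
 have v: "valid l [a, j, k]" using vj a by simp
 define F where "F x y z = (if snd x = a then f (snd y) (snd z) else 0 :: complex)" for x y z :: sos_arc
 define g where "g = words3 l F"
 have ga: "g a = f" by (intro ext) (simp add: g_def words3_def F_def)
 have eq: "W2 l (W1 l (O2 X l g)) i j k = \<alpha> * W2 l (W1 l g) i j k + \<beta> * W2 l (W1 l (W2 l g)) i j k" if v: "valid l [i, j, k]" for i j k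
 proof -
 have vij: "valid l [i, j]" using v valid_V by auto
 let ?z = "inverse \<zeta>"
 let ?G = "O2 (sw \<zeta>) l (O1 (sw \<zeta>) l g)"
 have "?z * (?z * W2 l (W1 l (O2 X l g)) i j k) = O1 X l ?G i j k"
  unfolding O21_sw[OF v, symmetric] g_def by (rule rel[OF v])
 also have "... = \<alpha> * ?G i j k + \<beta> * W1 l ?G i j k"
  unfolding O1_def W1_def by (rule actsD[OF act vij])
 also have "W1 l ?G i j k = W1 l (%i j k. ?z * (?z * W2 l (W1 l g) i j k)) i j k"
  by (rule W1_cong[OF v]) (rule O21_sw)
 also have "... = ?z * (?z * W1 l (W2 l (W1 l g)) i j k)" unfolding W1_scale ..
 also have "?G i j k = ?z * (?z * W2 l (W1 l g) i j k)" by (rule O21_sw[OF v])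
 finally have "?z * (?z * W2 l (W1 l (O2 X l g)) i j k) =
  ?z * (?z * (\<alpha> * W2 l (W1 l g) i j k + \<beta> * W2 l (W1 l (W2 l g)) i j k))"
  unfolding yang_baxter[OF v] by (simp only: algebra_simps)
 then show ?thesis using \<zeta> by (simp only: mult_left_cancel nonzero_imp_inverse_nonzero not_False_eq_True)
 qed
 define d where "d = (%i j k. O2 X l g i j k - (\<alpha> * g i j k + \<beta> * W2 l g i j k))"
 have "W2 l (W1 l d) i j k = 0" if v: "valid l [i, j, k]" for i j k
 unfolding d_def W1_lin W2_lin eq[OF v] by simp
 then have "W1 l d i j k = 0" if "valid l [i, j, k]" for i j k using W2_cancel[of l "W1 l d"] that by blast
 then have "d a j k = 0" using W1_cancel[of l d] v by blast
 then show "fop X (st l a) f j k = \<alpha> * f j k + \<beta> * W (st l a) f j k"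
 unfolding d_def O2_def W2_def ga by simp
qed


lemma origin_steps:
 shows "st (%_. 0) (Suc 0) = (%x. if x = 1 then 1 else 0)" "st (st (%_. 0) (Suc 0)) (Suc 0) = (%x. if x = 1 then 2 else 0)"
 "valid (%_. 0) [1, 1, 2]" "valid (%_. 0) [1, 2]"
proof -
 show 1: "st (%_. 0) (Suc 0) = (%x. if x = 1 then 1 else 0)" using N2 by (auto simp: sos_step_def normalise_def)
 show 2: "st (st (%_. 0) (Suc 0)) (Suc 0) = (%x. if x = 1 then 2 else 0)" unfolding 1 using N2 by (auto simp: sos_step_def normalise_def)
 have "(%x. if x = 1 then 1 else 0) : V" "(%x. if x = 1 then 2 else 0) : V" using N2 L2 by (auto simp: sos_verts_def)
 moreover have "st (%x. if x = 1 then 2 else 0) 2 : V" "st (%x. if x = 1 then 1 else 0) 2 : V"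
 using N2 L2 by (auto simp: sos_verts_def sos_step_def normalise_def)
 moreover have "1 : I" "2 : I" using N2 by auto
 ultimately show "valid (%_. 0) [1, 1, 2]" "valid (%_. 0) [1, 2]"
 using zero_V unfolding valid.simps One_nat_def 1[unfolded One_nat_def] 2[unfolded 1, unfolded One_nat_def]
 by (simp_all only: One_nat_def simp_thms)
qed

lemma origin_words:
 assumes v: "valid (%_. 0) [i, j]"
 shows "i = 1" "j = 1 \<or> j = 2"
proof -
 have I: "i : I" "j : I" "st (%_. 0) i : V" "st (st (%_. 0) i) j : V" using v by auto
 have K1: "K > 1" using N2 by simp
 show i: "i = 1"
 proof (rule ccontr)
 assume "i ~= 1"
 then have b: "i - 1 : I" "i - 1 ~= i" "sos_d (%_. 0) (i - 1) i = 1" using I(1) by (auto simp: sos_d_def)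
 then have "sos_d (%_. 0) (i - 1) i mod K = 1" using K1 by simp
 then show False using step_valid_iff[OF zero_V I(1)] I(3) b by blast
 qed
 show "j = 1 \<or> j = 2"
 proof (rule ccontr)
 assume no: "~ (j = 1 \<or> j = 2)"
 then have b: "j - 1 : I" "j - 1 ~= j" "sos_d (%_. 0) (j - 1) j = 1" "i ~= j - 1" "i ~= j" using I(2) i by (auto simp: sos_d_def)
 have "sos_d (st (%_. 0) i) (j - 1) j = 1" using d_step[OF I(1) b(1) I(2), of "%_. 0"] b(3-5) by simp
 then have "sos_d (st (%_. 0) i) (j - 1) j mod K = 1" using K1 by simp
 then show False using step_valid_iff[OF I(3,2)] I(4) b by blast
 qed
qed

lemma q_int_1: "\<lbrakk>1\<rbrakk> = 1"
 unfolding q_int_def using t_diff_nz by (simp add: power_int_minus)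

lemma W_origin: "W (%_. 0) f 1 1 = t * f 1 1" "W (%_. 0) f 1 2 = - inverse t * f 1 2"
proof -
 show "W (%_. 0) f 1 1 = t * f 1 1" by (simp add: W_def wa_def wb_def)
 have d: "sos_d (%_. 0) 1 2 = 1" by (simp add: sos_d_def)
 have "wa (%_. 0) 1 2 = - inverse t" "wb (%_. 0) 1 2 = 0"
 unfolding wa_def wb_def d q_int_1 by (simp_all add: power_int_minus q_int_def)
 then show "W (%_. 0) f 1 2 = - inverse t * f 1 2" by (simp add: W_def)
qed

lemma fop_origin:
 assumes X: "face_supported G X" and j: "j = 1 \<or> j = 2"
 shows "fop X (%_. 0) f 1 j = X (%_. 0, 1) (%_. 0, 1) (st (%_. 0) 1, j) (st (%_. 0) 1, j) * f 1 j"
proof (cases "j = 1")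
 case False
 have "X (%_. 0, j) (%_. 0, 1) (st (%_. 0) j, 1) (st (%_. 0) 1, j) = 0"
 proof (rule ccontr)
 assume "X (%_. 0, j) (%_. 0, 1) (st (%_. 0) j, 1) (st (%_. 0) 1, j) ~= 0"
 then have "is_face G (%_. 0, j) (%_. 0, 1) (st (%_. 0) j, 1) (st (%_. 0) 1, j)" using X unfolding face_supported_def by blast
 then have "valid (%_. 0) [j, 1]" by (auto simp: is_face_def)
 then show False using origin_words(1) False by blast
 qed
 then show ?thesis using False unfolding fop_def by (simp only: if_False mult_zero_left add_0_right) auto
qed (simp add: fop_def)

text \<open>The two paths of length two from the origin, with letters 1,1 and 1,2, have different ends, so a face operator is diagonal there; two
  numbers can be interpolated since the eigenvalues \<open>t\<close> and \<open>-1/t\<close> differ.\<close>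

lemma acts_origin:
 assumes X: "face_supported G X"
 shows "\<exists>\<alpha> \<beta>. acts X \<alpha> \<beta> (%_. 0)"
proof -
 define x where "x j = X (%_. 0, 1) (%_. 0, 1) (st (%_. 0) 1, j) (st (%_. 0) 1, j)" for j
 define \<beta> where "\<beta> = (x 1 - x 2) / (t + inverse t)"
 define \<alpha> where "\<alpha> = x 1 - \<beta> * t"
 have b: "\<beta> * (t + inverse t) = x 1 - x 2" unfolding \<beta>_def using sum_t_nz by simp
 have a: "x 1 = \<alpha> + \<beta> * t" "x 2 = \<alpha> - \<beta> * inverse t" using b by (simp_all add: \<alpha>_def algebra_simps)
 have "fop X (%_. 0) f i j = \<alpha> * f i j + \<beta> * W (%_. 0) f i j" if v: "valid (%_. 0) [i, j]" for i j f
 using origin_words(2)[OF v]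
 proof
 assume j: "j = 1"
 show ?thesis unfolding origin_words(1)[OF v] j W_origin fop_origin[OF X disjI1[OF refl]] x_def[symmetric] a by (simp add: algebra_simps)
 next
 assume j: "j = 2"
 show ?thesis unfolding origin_words(1)[OF v] j W_origin fop_origin[OF X disjI2[OF refl]] x_def[symmetric] a by (simp add: algebra_simps)
 qed
 then show ?thesis unfolding acts_def by blast
qed

text \<open>A box can be removed from the last nonzero row of a partition.\<close>

lemma origin_reaches:
 assumes P0: "P (%_. 0)" and step: "!!l a. l : V ==> a : I ==> st l a : V ==> P l ==> P (st l a)" and l: "l : V"
 shows "P l"
 using l
proof (induction "nat (SUM k:I. l k)" arbitrary: l rule: less_induct)
 case less
 have pos: "l x \<ge> 0" if "x : I" for x using V_antimono[OF less.prems, of x N] that less.prems N2 by (auto simp: sos_verts_def)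
 have out: "l x = 0" if "x \<notin> I" for x using less.prems that by (auto simp: sos_verts_def)
 show ?case
 proof (cases "EX x:I. l x ~= 0")
 case False
 then have "l x = 0" for x using out[of x] by (cases "x : I") blast+
 then have "l = (%_. 0)" by (rule ext)
 then show ?thesis using P0 by simp
 next
 case True
 define k where "k = Max {x : I. l x ~= 0}"
 have "k : {x : I. l x ~= 0}" unfolding k_def by (rule Max_in) (use True in auto)
 then have k: "k : I" "l k ~= 0" by auto
 have big: "l x = 0" if "x > k" for x
 proof (rule ccontr)
  assume "l x ~= 0"
  then have "x : {x : I. l x ~= 0}" using out by blast
  then have "x <= k" unfolding k_def by (intro Max_ge) auto
  then show False using that by simp
 qed
 have lN: "l N = 0" using less.prems by (simp add: sos_verts_def)
 have kN: "k < N" using k lN by (cases "k = N") auto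
 have lk: "l k \<ge> 1" using pos[OF k(1)] k(2) by simp
 let ?l = "l(k := l k - 1)"
 have V': "?l : V" using less.prems big[of "k + 1"] lk kN k(1) unfolding sos_verts_def by auto
 have s: "st ?l k = l"
 proof
  fix x show "st ?l k x = l x" using out[of x] kN lN by (auto simp: sos_step_def normalise_def)
 qed
 have "(SUM x:I. ?l x) = (SUM x:I. l x - (if x = k then 1 else 0))" by (intro sum.cong) auto
 also have "... = (SUM x:I. l x) - 1" using k(1) by (simp add: sum_subtractf)
 finally have e: "(SUM x:I. ?l x) = (SUM x:I. l x) - 1" .
 have "(SUM x:I. l x) \<ge> l k" using k(1) pos by (intro member_le_sum) auto
 then have "nat (SUM x:I. ?l x) < nat (SUM x:I. l x)" using e lk by simp
 then have "P ?l" using less.hyps V' by blast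
 then have "P (st ?l k)" by (intro step V' k(1)) (use s less.prems in simp_all)
 then show ?thesis unfolding s .
 qed
qed

lemma zeta_exists: "\<exists>\<zeta>::complex. \<zeta> ^ N = c"
proof -
 have "(rcis (root N (cmod c)) (Arg c / N)) ^ N = rcis (cmod c) (Arg c)"
 unfolding DeMoivre2 using N2 by simp
 then show ?thesis by (metis rcis_cmod_Arg)
qed

lemma edge_form:
 assumes rm: "rmatrix_pair (%p q r s. Rp (S.E p q) (S.E r s)) rho'" and B: "bilinear_form SS Rp"
 and xy: "x : arcs G" "y : arcs G" and f: "f : carrier H"
 shows "Rp (pS f) (S.E (edge_path G x) (edge_path G y)) = transfer_form (edge_weight (%p q r s. Rp (S.E p q) (S.E r s))) x y f"
proof (rule linear_form_H_eqI[where X = "%f. Rp (pS f) (S.E (edge_path G x) (edge_path G y))", OF _ transfer_form_linear _ f])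
 have "linear_form SS (%a. Rp a (S.E (edge_path G x) (edge_path G y)))"
 by (rule bilinear_form_left[OF B S.E_in[OF edge_path_in[OF xy(1)] edge_path_in[OF xy(2)]]])
 then show "linear_form H (%f. Rp (pS f) (S.E (edge_path G x) (edge_path G y)))" by (rule iffD1[OF S.linear_form_pi])
next
 fix m p q assume "p : paths G m" "q : paths G m"
 from rmatrix_transfer[OF rm xy this]
 show "Rp (S.E p q) (S.E (edge_path G x) (edge_path G y)) = transfer_form (edge_weight (%p q r s. Rp (S.E p q) (S.E r s))) x y (e_basis p q)"
 unfolding transfer_form_basis .
qed

lemma pS_J: "z : J ==> pS z = \<zero>\<^bsub>SS\<^esub>"
 using pA_J[of z] A.pi_zero S.pi_zero by simp

lemma pS_det: "pS det = pS \<one>\<^bsub>H\<^esub>"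
proof -
 have "gS : SI" unfolding sos_ideal_eq using ring.genideal_self[OF A.A_ring, of "{gS}"] gS_in by simp
 then show ?thesis
 using biideal_quotient.pr_eq_iff[OF S_biideal_quotient A.pi_in[OF det_in] A.pi_in[OF one_in]] unfolding one_A by blast
qed

theorem edge_operator:
 assumes R: "S.braiding_pair Rp Rm"
 obtains \<alpha> \<beta> where "!!l. l : V ==> acts (edge_weight (%p q r s. Rp (S.E p q) (S.E r s))) \<alpha> \<beta> l"
 and "\<alpha> = 0 \<or> \<alpha> = - \<beta> * h"
proof -
 let ?rho = "%p q r s. Rp (S.E p q) (S.E r s)"
 let ?X = "edge_weight ?rho"
 note R' = R[unfolded S.braiding_pair_iff]
 have B: "bilinear_form SS Rp" and rm: "rmatrix_pair ?rho (%p q r s. Rm (S.E p q) (S.E r s))" and com: "S.commutes ?rho"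
 using R' by blast+
 have X: "face_supported G ?X" by (rule edge_weight_face_supported[OF rm])
 obtain \<alpha> \<beta> where o: "acts ?X \<alpha> \<beta> (%_. 0)" using acts_origin[OF X] by blast
 obtain \<zeta> where \<zeta>: "\<zeta> ^ N = \<epsilon> ^ (N - 1) * t" using zeta_exists by blast
 have "\<epsilon> ^ (N - 1) * t ~= 0" using eps t_nz by auto
 then have \<zeta>0: "\<zeta> ~= 0" using \<zeta> N2 by (auto simp: power_0_left)
 have act: "acts ?X \<alpha> \<beta> l" if "l : V" for l
 proof (rule origin_reaches[where P = "acts ?X \<alpha> \<beta>", OF o _ that])
 fix l a assume a: "l : V" "a : I" "acts ?X \<alpha> \<beta> l"
 show "acts ?X \<alpha> \<beta> (st l a)"
  by (rule acts_step[OF \<zeta>0 _ a(3,1,2)]) (rule braiding_relation[OF rm com \<zeta>])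
 qed
 let ?o = "%_. 0 :: int"
 define F where "F x y z = (if snd x = 1 & snd y = 2 & snd z = 1 then 1 else 0 :: complex)" for x y z :: sos_arc
 define g where "g = words3 ?o F"
 have kill: "transfer_form ?X x y z = 0" if z: "z : face_relations G (sw 1)" and xy: "x : arcs G" "y : arcs G" for x y z
 proof -
 have zz: "z : J" "z : carrier H" using z face_relation_in_ideal face_relations_in by blast+
 have "transfer_form ?X x y z = Rp (pS z) (S.E (edge_path G x) (edge_path G y))" by (rule edge_form[OF rm B xy zz(2), symmetric])
 also have "... = 0" unfolding pS_J[OF zz(1)]
  by (rule S.linear_form_Q_zero[OF bilinear_form_left[OF B S.E_in[OF edge_path_in[OF xy(1)] edge_path_in[OF xy(2)]]]])
 finally show ?thesis .
 qed
 have v: "valid ?o [1, 1, 2]" by (rule origin_steps(3))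
 have x1: "O1 ?X ?o f i j k = \<alpha> * f i j k + \<beta> * W1 ?o f i j k" if v: "valid ?o [i, j, k]" for i j k f
 unfolding O1_def W1_def by (rule actsD[OF o]) (use v valid_V in auto)
 have x2: "O2 ?X ?o f i j k = \<alpha> * f i j k + \<beta> * W2 ?o f i j k" if v: "valid ?o [i, j, k]" for i j k f
 unfolding O2_def W2_def by (rule actsD[OF act]) (use v valid_V in auto)
 have "O2 ?X ?o (O1 ?X ?o (O2 (sw 1) ?o g)) 1 1 2 = O1 (sw 1) ?o (O2 ?X ?o (O1 ?X ?o g)) 1 1 2"
 unfolding g_def by (rule transfer_relations_yb[OF X sw_supported kill v])
 moreover have "O2 ?X ?o (O1 ?X ?o (O2 (sw 1) ?o g)) 1 1 2 =
  \<alpha> * (\<alpha> * W2 ?o g 1 1 2 + \<beta> * W1 ?o (W2 ?o g) 1 1 2) + \<beta> * (\<alpha> * W2 ?o (W2 ?o g) 1 1 2 + \<beta> * W2 ?o (W1 ?o (W2 ?o g)) 1 1 2)"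
 proof -
 have a: "O1 ?X ?o (O2 (sw 1) ?o g) i j k = \<alpha> * W2 ?o g i j k + \<beta> * W1 ?o (W2 ?o g) i j k" if v: "valid ?o [i, j, k]" for i j k
 proof -
  have "W1 ?o (O2 (sw 1) ?o g) i j k = W1 ?o (W2 ?o g) i j k" by (rule W1_cong[OF v]) (simp only: fop_W' inverse_1 mult_1)
  then show ?thesis unfolding x1[OF v] fop_W'[OF v] by simp
 qed
 have "W2 ?o (O1 ?X ?o (O2 (sw 1) ?o g)) 1 1 2 = W2 ?o (%i j k. \<alpha> * W2 ?o g i j k + \<beta> * W1 ?o (W2 ?o g) i j k) 1 1 2"
  by (rule W2_cong[OF v a])
 also have "... = \<alpha> * W2 ?o (W2 ?o g) 1 1 2 + \<beta> * W2 ?o (W1 ?o (W2 ?o g)) 1 1 2"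
  unfolding W2_def[of _ "%i j k. \<alpha> * W2 ?o g i j k + \<beta> * W1 ?o (W2 ?o g) i j k"] W2_def[of _ "W2 ?o g"] W2_def[of _ "W1 ?o (W2 ?o g)"] W_def
  by (simp only: algebra_simps)
 finally show ?thesis unfolding x2[OF v] a[OF v] by simp
 qed
 moreover have "O1 (sw 1) ?o (O2 ?X ?o (O1 ?X ?o g)) 1 1 2 =
  \<alpha> * (\<alpha> * W1 ?o g 1 1 2 + \<beta> * W1 ?o (W1 ?o g) 1 1 2) + \<beta> * (\<alpha> * W1 ?o (W2 ?o g) 1 1 2 + \<beta> * W1 ?o (W2 ?o (W1 ?o g)) 1 1 2)"
 proof -
 have a: "O2 ?X ?o (O1 ?X ?o g) i j k = \<alpha> * (\<alpha> * g i j k + \<beta> * W1 ?o g i j k) + \<beta> * (\<alpha> * W2 ?o g i j k + \<beta> * W2 ?o (W1 ?o g) i j k)"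
  if v: "valid ?o [i, j, k]" for i j k
 proof -
  have "W2 ?o (O1 ?X ?o g) i j k = W2 ?o (%i j k. \<alpha> * g i j k + \<beta> * W1 ?o g i j k) i j k" by (rule W2_cong[OF v x1])
  also have "... = \<alpha> * W2 ?o g i j k + \<beta> * W2 ?o (W1 ?o g) i j k"
  unfolding W2_def W_def by (simp only: algebra_simps)
  finally show ?thesis unfolding x2[OF v] x1[OF v] by simp
 qed
 have "O1 (sw 1) ?o (O2 ?X ?o (O1 ?X ?o g)) 1 1 2 = W1 ?o (O2 ?X ?o (O1 ?X ?o g)) 1 1 2"
  unfolding fop_W[OF v] by simp
 also have "... = W1 ?o (%i j k. \<alpha> * (\<alpha> * g i j k + \<beta> * W1 ?o g i j k) + \<beta> * (\<alpha> * W2 ?o g i j k + \<beta> * W2 ?o (W1 ?o g) i j k)) 1 1 2"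
  by (rule W1_cong[OF v a])
 also have "... = \<alpha> * (\<alpha> * W1 ?o g 1 1 2 + \<beta> * W1 ?o (W1 ?o g) 1 1 2) + \<beta> * (\<alpha> * W1 ?o (W2 ?o g) 1 1 2 + \<beta> * W1 ?o (W2 ?o (W1 ?o g)) 1 1 2)"
 proof -
  have lin: "W1 ?o (%i j k. \<alpha> * (\<alpha> * f i j k + \<beta> * f' i j k) + \<beta> * (\<alpha> * f'' i j k + \<beta> * f3 i j k)) 1 1 2 =
  \<alpha> * (\<alpha> * W1 ?o f 1 1 2 + \<beta> * W1 ?o f' 1 1 2) + \<beta> * (\<alpha> * W1 ?o f'' 1 1 2 + \<beta> * W1 ?o f3 1 1 2)" for f f' f'' f3
  unfolding W1_def W_def by (simp only: algebra_simps)
  show ?thesis by (rule lin)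
 qed
 finally show ?thesis .
 qed
 ultimately have E: "\<alpha> * (\<alpha> * W2 ?o g 1 1 2 + \<beta> * W1 ?o (W2 ?o g) 1 1 2) + \<beta> * (\<alpha> * W2 ?o (W2 ?o g) 1 1 2 + \<beta> * W2 ?o (W1 ?o (W2 ?o g)) 1 1 2) =
  \<alpha> * (\<alpha> * W1 ?o g 1 1 2 + \<beta> * W1 ?o (W1 ?o g) 1 1 2) + \<beta> * (\<alpha> * W1 ?o (W2 ?o g) 1 1 2 + \<beta> * W1 ?o (W2 ?o (W1 ?o g)) 1 1 2)"
 by (simp only:)
 define a b c d where "a = W2 ?o g 1 1 2" and "b = W1 ?o g 1 1 2" and "c = W1 ?o (W2 ?o g) 1 1 2" and "d = W2 ?o (W1 ?o (W2 ?o g)) 1 1 2"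
 have "\<alpha> * (\<alpha> * a + \<beta> * c) + \<beta> * (\<alpha> * (g 1 1 2 + h * a) + \<beta> * d) = \<alpha> * (\<alpha> * b + \<beta> * (g 1 1 2 + h * b)) + \<beta> * (\<alpha> * c + \<beta> * d)"
 using E unfolding yang_baxter[OF v] W1_hecke[OF v] W2_hecke[OF v] a_def b_def c_def d_def .
 then have "\<alpha> * (\<alpha> + \<beta> * h) * (a - b) = 0" by (simp add: algebra_simps)
 moreover have "a - b ~= 0"
 proof -
 have g: "g 1 1 2 = 0" "g 1 2 1 = 1" by (simp_all add: g_def words3_def F_def)
 have b: "b = 0" unfolding b_def W1_def W_def by (simp add: g(1)[simplified] wb_def)
 have dd: "sos_d (st ?o 1) 1 2 = 2" using d_step[of 1 1 2 ?o] N2 by (simp add: sos_d_def)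
 have n2: "\<lbrakk>2\<rbrakk> ~= 0" unfolding qn_zero_iff using N2 L2 by (auto dest: zdvd_imp_le)
 have "a = wb (st ?o 1) 1 2" unfolding a_def W2_def W_def g by (simp only: mult_zero_right add_0_left mult_1_right)
 also have "... = \<epsilon> * (\<lbrakk>1\<rbrakk> / \<lbrakk>2\<rbrakk>)" unfolding wb_def dd by simp
 finally have "a ~= 0" using n2 eps by (auto simp: q_int_1)
 then show ?thesis using b by simp
 qed
 ultimately have "\<alpha> * (\<alpha> + \<beta> * h) = 0" by simp
 then have "\<alpha> = 0 \<or> \<alpha> = - \<beta> * h"
 unfolding mult_minus_left eq_neg_iff_add_eq_0 by (simp only: mult_eq_0_iff)
 then show ?thesis using that act by blast
qed

theorem canonical_case:
 assumes R: "S.braiding_pair Rp Rm" and act: "!!l. l : V ==> acts (edge_weight (%p q r s. Rp (S.E p q) (S.E r s))) 0 \<beta> l"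
 and \<beta>: "\<beta> ~= 0"
 shows "\<exists>\<zeta>. \<zeta> ^ N = \<epsilon> ^ (N - 1) * t & sos_braiding_pair N L t \<epsilon> \<zeta> Rp Rm"
proof -
 define \<zeta> where "\<zeta> = inverse \<beta>"
 have \<zeta>0: "\<zeta> ~= 0" using \<beta> by (simp add: \<zeta>_def)
 let ?rho = "%p q r s. Rp (S.E p q) (S.E r s)"
 let ?rho' = "%p q r s. Rm (S.E p q) (S.E r s)"
 let ?X = "edge_weight ?rho"
 note R' = R[unfolded S.braiding_pair_iff]
 have B: "bilinear_form SS Rp" "bilinear_form SS Rm" and rm: "rmatrix_pair ?rho ?rho'" and com: "S.commutes ?rho"
 using R' by blast+
 have Xs: "face_supported G ?X" by (rule edge_weight_face_supported[OF rm])
 have X: "?X = sw \<zeta>"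
 proof (intro ext, rule face_ext[OF Xs sw_supported])
 fix l i j f assume v: "valid l [i, j]"
 show "fop ?X l f i j = fop (sw \<zeta>) l f i j"
  unfolding fop_sw[OF v] actsD[OF act[OF valid_V(1)[OF v]] v] by (simp add: \<zeta>_def)
 qed
 define x where "x = ((%_. 0, 1) :: sos_arc)"
 have x: "x : arcs G" using origin_steps(3) unfolding x_def by auto
 have "transfer_form (sw \<zeta>) x x det = transfer_form (sw \<zeta>) x x \<one>\<^bsub>H\<^esub>"
 using edge_form[OF rm B(1) x x det_in] edge_form[OF rm B(1) x x one_in] unfolding pS_det X by simp
 then have "inverse \<zeta> ^ N * t * \<epsilon> ^ (N - 1) = 1" unfolding transfer_det[OF x x] transfer_one[OF x] by simp
 then have \<zeta>: "\<zeta> ^ N = \<epsilon> ^ (N - 1) * t" using \<zeta>0 by (simp add: power_inverse field_simps)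
 define C where "C a b = Rp (SI +>\<^bsub>AA\<^esub> a) (SI +>\<^bsub>AA\<^esub> b)" for a b
 define C' where "C' a b = Rm (SI +>\<^bsub>AA\<^esub> a) (SI +>\<^bsub>AA\<^esub> b)" for a b
 have "A.braiding_pair C C'" unfolding A.braiding_pair_iff
 proof (intro conjI)
 show "bilinear_form AA C" "bilinear_form AA C'"
  using B unfolding sos_algebra_def biideal_quotient.bilinear_form_pr[OF S_biideal_quotient] C_def C'_def by blast+
 show "rmatrix_pair (%p q r s. C (A.E p q) (A.E r s)) (%p q r s. C' (A.E p q) (A.E r s))"
  unfolding C_def C'_def by (rule rm)
 show "A.commutes (%p q r s. C (A.E p q) (A.E r s))" unfolding C_def
 proof (rule A.commutes_generators[OF rm], unfold A.com_def, intro allI impI ballI)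
  fix Y p' q' r' s' assume Y: "linear_form AA Y" and paths: "p' : paths G 1" "q' : paths G 1" "r' : paths G 1" "s' : paths G 1"
  obtain p q r s where e: "p' = edge_path G p" "q' = edge_path G q" "r' = edge_path G r" "s' = edge_path G s"
  and a: "p : arcs G" "q : arcs G" "r : arcs G" "s : arcs G"
  using paths unfolding paths_1 by blast
  have f: "sw \<zeta> b c d k ~= 0 ==> is_face G b c d k" for b c d k using sw_supported unfolding face_supported_def by blast
  have rho: "?rho (edge_path G d) (edge_path G c) (edge_path G b) (edge_path G k) = sw \<zeta> b c d k"
  if "b : arcs G" "c : arcs G" "d : arcs G" "k : arcs G" for b c d k
  using edge_weight_eq[OF that, of ?rho] unfolding X by simp
  have E: "Y (A.E (edge_path G b) (edge_path G c) \<otimes>\<^bsub>AA\<^esub> A.E (edge_path G d) (edge_path G k)) =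
   (if head G b = tail G d & head G c = tail G k then Y (pA (e_basis (edge_pair_path G b d) (edge_pair_path G c k))) else 0)"
  if bc: "b : arcs G" "c : arcs G" "d : arcs G" "k : arcs G" for b c d k
  unfolding A.E_mult[OF edge_path_in[OF bc(1)] edge_path_in[OF bc(2)] edge_path_in[OF bc(3)] edge_path_in[OF bc(4)]]
   edge_path_simps concat_edges
  by (cases "head G b = tail G d & head G c = tail G k") (simp_all only: if_True if_False simp_thms A.linear_form_Q_zero[OF Y])
  have L: "(SUM u:paths G 1. SUM v:paths G 1. ?rho p' u r' v * Y (A.E u q' \<otimes>\<^bsub>AA\<^esub> A.E v s')) =
   (SUM u:arcs G. SUM v:arcs G. sw \<zeta> r u p v * (if head G u = tail G v & head G q = tail G s then Y (pA (e_basis (edge_pair_path G u v) (edge_pair_path G q s))) else 0))"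
  unfolding sum_paths_1 e
  proof (rule sum.cong[OF refl], rule sum.cong[OF refl])
  fix u v assume uv: "u : arcs G" "v : arcs G"
  show "?rho (edge_path G p) (edge_path G u) (edge_path G r) (edge_path G v) * Y (A.E (edge_path G u) (edge_path G q) \<otimes>\<^bsub>AA\<^esub> A.E (edge_path G v) (edge_path G s)) =
   sw \<zeta> r u p v * (if head G u = tail G v & head G q = tail G s then Y (pA (e_basis (edge_pair_path G u v) (edge_pair_path G q s))) else 0)"
   unfolding rho[OF a(3) uv(1) a(1) uv(2)] E[OF uv(1) a(2) uv(2) a(4)] ..
  qed
  have Rr: "(SUM u:paths G 1. SUM v:paths G 1. Y (A.E r' v \<otimes>\<^bsub>AA\<^esub> A.E p' u) * ?rho u q' v s') =
   (SUM v:arcs G. SUM u:arcs G. sw \<zeta> v q u s * (if head G r = tail G p & head G v = tail G u then Y (pA (e_basis (edge_pair_path G r p) (edge_pair_path G v u))) else 0))"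
  unfolding sum_paths_1 e
  proof (subst sum.swap, rule sum.cong[OF refl], rule sum.cong[OF refl])
  fix u v assume uv: "v : arcs G" "u : arcs G"
  show "Y (A.E (edge_path G r) (edge_path G v) \<otimes>\<^bsub>AA\<^esub> A.E (edge_path G p) (edge_path G u)) * ?rho (edge_path G u) (edge_path G q) (edge_path G v) (edge_path G s) =
   sw \<zeta> v q u s * (if head G r = tail G p & head G v = tail G u then Y (pA (e_basis (edge_pair_path G r p) (edge_pair_path G v u))) else 0)"
   unfolding rho[OF uv(1) a(2) uv(2) a(4)] E[OF a(3) uv(1) a(1) uv(2)] by (rule mult.commute)
  qed
  show "(SUM u:paths G 1. SUM v:paths G 1. ?rho p' u r' v * Y (A.E u q' \<otimes>\<^bsub>AA\<^esub> A.E v s')) =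
   (SUM u:paths G 1. SUM v:paths G 1. Y (A.E r' v \<otimes>\<^bsub>AA\<^esub> A.E p' u) * ?rho u q' v s')"
  proof (cases "head G q = tail G s & head G r = tail G p")
  case True
  then have qs: "(q, s) : composable_pairs G" and rp: "(r, p) : composable_pairs G" using a by (auto simp only: composable_pairs_iff)
  have Yl: "linear_form H (%f. Y (pA f))" by (rule form_A(1)[OF Y])
  let ?col = "face_col (sw \<zeta>) r p (edge_pair_path G q s)" and ?row = "face_row (sw \<zeta>) (edge_pair_path G r p) q s"
  have "?col - ?row : face_relations G (sw \<zeta>)" unfolding face_relations_alt using qs rp by blast
  then have "?col - ?row : J" using face_relation_in_ideal[of "sw \<zeta>"] unfolding face_ideal_sw[OF \<zeta>0] by blast
  from form_A(2)[OF Y this] have eq: "Y (pA ?col) = Y (pA ?row)"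
   unfolding linear_form_H_diff[OF Yl face_col_in[OF edge_pair_in[OF qs]] face_row_in[OF edge_pair_in[OF rp]]] by (simp only: right_minus_eq)
  have col: "Y (pA ?col) = (SUM u:arcs G. SUM v:arcs G. sw \<zeta> r u p v * Y (pA (e_basis (edge_pair_path G u v) (edge_pair_path G q s))))"
   unfolding linear_form_face_col[OF Yl edge_pair_in[OF qs]]
  proof (rule sum_composable)
   fix c d assume "sw \<zeta> r c p d * Y (pA (e_basis (edge_pair_path G c d) (edge_pair_path G q s))) ~= 0"
   then have "sw \<zeta> r c p d ~= 0" by (metis mult_zero_left)
   from f[OF this] show "head G c = tail G d" unfolding is_face_def by blast
  qed
  have row: "Y (pA ?row) = (SUM v:arcs G. SUM u:arcs G. sw \<zeta> v q u s * Y (pA (e_basis (edge_pair_path G r p) (edge_pair_path G v u))))"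
   unfolding linear_form_face_row[OF Yl edge_pair_in[OF rp]]
  proof (rule sum_composable)
   fix c d assume "sw \<zeta> c q d s * Y (pA (e_basis (edge_pair_path G r p) (edge_pair_path G c d))) ~= 0"
   then have "sw \<zeta> c q d s ~= 0" by (metis mult_zero_left)
   from f[OF this] show "head G c = tail G d" unfolding is_face_def by blast
  qed
  have z1: "sw \<zeta> r u p v * (if head G u = tail G v & head G q = tail G s then c else 0) = sw \<zeta> r u p v * c" for u v c
  proof (cases "head G u = tail G v")
   case c: True
   show ?thesis by (simp only: c True simp_thms if_True)
  next
   case c: False
   have "sw \<zeta> r u p v = 0" using f[of r u p v] c unfolding is_face_def by blast
   then show ?thesis by (simp only: mult_zero_left)
  qed
  have z2: "sw \<zeta> v q u s * (if head G r = tail G p & head G v = tail G u then c else 0) = sw \<zeta> v q u s * c" for u v c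
  proof (cases "head G v = tail G u")
   case c: True
   show ?thesis by (simp only: c True simp_thms if_True)
  next
   case c: False
   have "sw \<zeta> v q u s = 0" using f[of v q u s] c unfolding is_face_def by blast
   then show ?thesis by (simp only: mult_zero_left)
  qed
  show ?thesis unfolding L Rr z1 z2 using eq unfolding col row .
  next
  case False
  have z1: "sw \<zeta> r u p v * (if head G u = tail G v & head G q = tail G s then c else 0) = 0" for u v c
  proof (cases "head G q = tail G s")
   case True
   have "sw \<zeta> r u p v = 0" using f[of r u p v] True False unfolding is_face_def by blast
   then show ?thesis by (simp only: mult_zero_left)
  qed (simp only: simp_thms if_False mult_zero_right)
  have z2: "sw \<zeta> v q u s * (if head G r = tail G p & head G v = tail G u then c else 0) = 0" for u v c
  proof (cases "head G r = tail G p")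
   case True
   have "sw \<zeta> v q u s = 0" using f[of v q u s] True False unfolding is_face_def by blast
   then show ?thesis by (simp only: mult_zero_left)
  qed (simp only: simp_thms if_False mult_zero_right)
  show ?thesis unfolding L Rr z1 z2 by (simp only: sum.neutral_const)
  qed
 qed
 qed
 then have br: "A.braiding C" unfolding A.braiding_def by blast
 have w: "weight_face_alg G (sw \<zeta>) = AA" "weight_proj G (sw \<zeta>) = pA"
 unfolding sos_weight_alg_def weight_face_alg_def weight_proj_def[abs_def] face_ideal_sw[OF \<zeta>0] by (rule refl)+
 have "canonical_braiding G (sw \<zeta>) C" unfolding canonical_braiding_def w
 proof (intro conjI ballI br)
 fix p q r s assume a: "p : arcs G" "q : arcs G" "r : arcs G" "s : arcs G"
 show "C (A.E (edge_path G p) (edge_path G q)) (A.E (edge_path G r) (edge_path G s)) = sw \<zeta> r q p s"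
  unfolding C_def using edge_weight_eq[OF a(3,2,1,4), of ?rho] unfolding X by simp
 qed
 moreover have "ALL a:carrier AA. ALL b:carrier AA. Rp (SI +>\<^bsub>AA\<^esub> a) (SI +>\<^bsub>AA\<^esub> b) = C a b"
 by (intro ballI) (rule C_def[symmetric])
 ultimately have "sos_braiding_pair N L t \<epsilon> \<zeta> Rp Rm"
 unfolding sos_braiding_pair_def Let_def by (intro conjI[OF R] exI[of _ C] conjI)
 then show ?thesis using \<zeta> by blast
qed

text \<open>The edge weight of the flipped inverse is the inverse operator; at the origin both are diagonal.\<close>

lemma inverse_at_origin:
 assumes rm: "rmatrix_pair rho rho'" and act: "acts (edge_weight rho) \<alpha> \<beta> (%_. 0)"
 and act': "acts (edge_weight (%p q r s. rho' r s p q)) \<alpha>' \<beta>' (%_. 0)"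
 shows "(\<alpha> + \<beta> * t) * (\<alpha>' + \<beta>' * t) = 1" "(\<alpha> - \<beta> * inverse t) * (\<alpha>' - \<beta>' * inverse t) = 1"
proof -
 let ?o = "%_. 0 :: int"
 let ?X = "edge_weight rho" and ?X' = "edge_weight (%p q r s. rho' r s p q)"
 have Xs: "face_supported G ?X" "face_supported G ?X'"
 by (rule edge_weight_face_supported[OF rm], rule edge_weight_face_supported[OF rmatrix_pair_swap[OF rm]])
 let ?a = "(?o, 1) :: sos_arc" and ?b = "%j. (st ?o 1, j) :: sos_arc"
 have one: "?X ?a ?a (?b j) (?b j) * ?X' ?a ?a (?b j) (?b j) = 1" if j: "j = 1 \<or> j = 2" for j
 proof -
 have v: "valid ?o [1, j]" using j origin_steps(3,4) valid_append[of ?o "[1, 1]" "[2]"] by auto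
 have ar: "?a : arcs G" "?b j : arcs G" using v by auto
 have "(SUM v:arcs G. SUM u:arcs G. ?X v ?a u (?b j) * rho' (edge_path G ?a) (edge_path G u) (edge_path G (?b j)) (edge_path G v)) =
  mp 1 1 rho' rho (edge_path G ?a) (edge_path G ?a) (edge_path G (?b j)) (edge_path G (?b j))"
  unfolding mp_nested sum_paths_1
 proof (subst sum.swap, rule sum.cong[OF refl], rule sum.cong[OF refl])
  fix u v assume "u : arcs G" "v : arcs G"
  then show "?X v ?a u (?b j) * rho' (edge_path G ?a) (edge_path G u) (edge_path G (?b j)) (edge_path G v) =
  rho' (edge_path G ?a) (edge_path G u) (edge_path G (?b j)) (edge_path G v) * rho (edge_path G u) (edge_path G ?a) (edge_path G v) (edge_path G (?b j))"
  using edge_weight_eq[OF _ ar(1) _ ar(2), of v u rho] by (simp only: mult.commute)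
 qed
 also have "... = 1"
  unfolding rmatrix_pairD(1)[OF rm edge_path_in[OF ar(1)] edge_path_in[OF ar(1)] edge_path_in[OF ar(2)] edge_path_in[OF ar(2)]] delta_mat_def
  by simp
 finally have "fop ?X ?o (%x y. rho' (edge_path G ?a) (edge_path G (st ?o x, y)) (edge_path G (?b j)) (edge_path G (?o, x))) 1 j = 1"
  unfolding face_sum[OF Xs(1) v, of "%v u. rho' (edge_path G ?a) (edge_path G u) (edge_path G (?b j)) (edge_path G v)"] .
 then show ?thesis unfolding fop_origin[OF Xs(1) j] edge_weight_eq[OF ar(1) ar(1) ar(2) ar(2), of "%p q r s. rho' r s p q"] .
 qed
 have val: "Y ?a ?a (?b 1) (?b 1) = \<alpha> + \<beta> * t" "Y ?a ?a (?b 2) (?b 2) = \<alpha> - \<beta> * inverse t"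
 if Y: "face_supported G Y" "acts Y \<alpha> \<beta> ?o" for Y \<alpha> \<beta>
 proof -
 have v: "valid ?o [1, 1]" "valid ?o [1, 2]" using origin_steps(3,4) valid_append[of ?o "[1, 1]" "[2]"] by auto
 show "Y ?a ?a (?b 1) (?b 1) = \<alpha> + \<beta> * t"
  using actsD[OF Y(2) v(1), of "%_ _. 1"] unfolding fop_origin[OF Y(1) disjI1[OF refl]] W_origin(1) by simp
 show "Y ?a ?a (?b 2) (?b 2) = \<alpha> - \<beta> * inverse t"
  using actsD[OF Y(2) v(2), of "%_ _. 1"] unfolding fop_origin[OF Y(1) disjI2[OF refl]] W_origin(2) by simp
 qed
 show "(\<alpha> + \<beta> * t) * (\<alpha>' + \<beta>' * t) = 1" "(\<alpha> - \<beta> * inverse t) * (\<alpha>' - \<beta>' * inverse t) = 1"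
 using one[of 1] one[of 2] unfolding val[OF Xs(1) act] val[OF Xs(2) act'] by simp_all
qed

theorem braiding_classification:
 assumes "S.braiding R"
 shows "\<exists>\<zeta> Rp Rm. \<zeta> ^ N = \<epsilon> ^ (N - 1) * t & sos_braiding_pair N L t \<epsilon> \<zeta> Rp Rm \<and>
 (S.form_eq R Rp \<or> S.form_eq R (%a b. Rm b a))"
proof -
 obtain Rm where R: "S.braiding_pair R Rm" using assms unfolding S.braiding_def by blast
 let ?rho = "%p q r s. R (S.E p q) (S.E r s)" and ?rho' = "%p q r s. Rm (S.E p q) (S.E r s)"
 note R' = R[unfolded S.braiding_pair_iff]
 have B: "bilinear_form SS R" "bilinear_form SS Rm" and rm: "rmatrix_pair ?rho ?rho'" and com: "S.commutes ?rho"
 using R' by blast+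
 define P where "P a b = Rm b a" for a b
 define M where "M a b = R b a" for a b
 have PM: "S.braiding_pair P M" unfolding S.braiding_pair_iff P_def M_def
 using bilinear_form_swap[OF B(1)] bilinear_form_swap[OF B(2)] rmatrix_pair_swap[OF rm] S.commutes_swap[OF rm com] by blast
 obtain \<alpha> \<beta> where ab: "!!l. l : V ==> acts (edge_weight ?rho) \<alpha> \<beta> l" "\<alpha> = 0 \<or> \<alpha> = - \<beta> * h"
 using edge_operator[OF R] by blast
 obtain \<alpha>' \<beta>' where ab': "!!l. l : V ==> acts (edge_weight (%p q r s. P (S.E p q) (S.E r s))) \<alpha>' \<beta>' l" "\<alpha>' = 0 \<or> \<alpha>' = - \<beta>' * h"
 using edge_operator[OF PM] by blast
 have act': "acts (edge_weight (%p q r s. ?rho' r s p q)) \<alpha>' \<beta>' (%_. 0)" using ab'(1)[OF zero_V] unfolding P_def .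
 note inv = inverse_at_origin[OF rm ab(1)[OF zero_V] act']
 show ?thesis
 proof (cases "\<alpha> = 0")
 case True
 then have "\<beta> ~= 0" using inv(1) by auto
 then obtain \<zeta> where "\<zeta> ^ N = \<epsilon> ^ (N - 1) * t" "sos_braiding_pair N L t \<epsilon> \<zeta> R Rm"
  using canonical_case[OF R] ab(1) True by blast
 moreover have "S.form_eq R R" by (simp add: S.form_eq_def)
 ultimately show ?thesis by blast
 next
 case False
 then have a: "\<alpha> = - \<beta> * h" using ab(2) by blast
 have "\<alpha>' = 0"
 proof (rule ccontr)
  assume "\<alpha>' ~= 0"
  then have a': "\<alpha>' = - \<beta>' * h" using ab'(2) by blast
  have e: "- x * h + x * t = x * inverse t" "- x * h - x * inverse t = - x * t" for x by (simp_all add: h_def algebra_simps)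
  have 1: "(\<beta> * inverse t) * (\<beta>' * inverse t) = 1" "(- \<beta> * t) * (- \<beta>' * t) = 1" using inv unfolding a a' e by simp_all
  then have bb: "\<beta> * \<beta>' = t * t" using t_nz by (simp add: field_simps)
  have "\<beta> * \<beta>' * (t * t) = 1" using 1(2) by (simp add: mult_ac)
  then have "t powi 4 = 1" unfolding bb by (metis power4_eq_xxxx power_int_numeral mult.assoc)
  then have "2 * K dvd 4" by (rule iffD1[OF t_powi_eq_1])
  then show False using N2 L2 by (auto dest: zdvd_imp_le)
 qed
 moreover from this have "\<beta>' ~= 0" using inv(1) by auto
 ultimately obtain \<zeta> where "\<zeta> ^ N = \<epsilon> ^ (N - 1) * t" "sos_braiding_pair N L t \<epsilon> \<zeta> P M"
  using canonical_case[OF PM] ab'(1) by blast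
 moreover have "S.form_eq R (%a b. M b a)" by (simp add: S.form_eq_def M_def)
 ultimately show ?thesis by blast
 qed
qed

end

theorem theorem8p1:
  fixes N L :: nat and t \<epsilon> :: complex
    and R :: "(weight, sos_arc) path_comb set set \<Rightarrow> (weight, sos_arc) path_comb set set \<Rightarrow> complex"
  assumes "N \<ge> 2" and "L \<ge> 2"
    and "t ^ (2 * (N + L)) = 1" and "\<forall>k. 0 < k \<and> k < 2 * (N + L) \<longrightarrow> t ^ k \<noteq> 1"
    and "\<epsilon> \<in> {1, -1}"
    and "face_algebra.braiding (sos_algebra N L t \<epsilon>) R"
  shows "\<exists>\<zeta> Rp Rm. \<zeta> ^ N = \<epsilon> ^ (N - 1) * t \<and> sos_braiding_pair N L t \<epsilon> \<zeta> Rp Rm \<and>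
           (face_algebra.form_eq (sos_algebra N L t \<epsilon>) R Rp \<or>
            face_algebra.form_eq (sos_algebra N L t \<epsilon>) R (\<lambda>a b. Rm b a))"
proof -
  interpret sos N L t \<epsilon> by unfold_locales (use assms in auto)
  show ?thesis by (rule braiding_classification[OF assms(6)])
qed

end
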